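(* For all $\delta\in(1,2)$ and for all $\delta'<\delta$, if Euclidean TSP in $\mathbb R^2$ on all point sets of size $n$ and fractal dimension at most $\delta$ can be solved in time $2^{O(n^{1-1/\delta'})}$, then the Exponential Time Hypothesis (ETH) fails.
   Context: Euclidean TSP in $\mathbb R^2$: given a finite set of $n$ points in $\mathbb R^2$, find a traveling salesperson tour visiting all the points of minimum total Euclidean length. Nets: for $P\subseteq\mathbb R^2$ and $\rho>0$, a $\rho$-net of $P$ is a set $N\subseteq P$ such that distinct points of $N$ are at Euclidean distance greater than $\rho$ and every point of $P$ is within distance $\rho$ of $N$. $\mathsf{ball}(x,r)$ is the Euclidean ball of center $x$ and radius $r$. Fractal dimension: the fractal dimension of a set $P\subseteq\mathbb R^2$ is the infimum of the $s$ such that for any $\rho>0$ and $r\ge 2\rho$, for any $\rho$-net $N$ of $P$, and for any $x\in\mathbb R^2$, one has $|N\cap\mathsf{ball}(x,r)|=O((r/\rho)^s)$. ETH: there is a constant $\sigma>0$ such that no algorithm solves 3-SAT on $N$ variables in time $O(2^{\sigma N})$.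
   Formalization: δ' is taken positive (at 0 the exponent is undefined; below 0 brute force meets the bound); the O-constant in the fractal dimension is uniform over a family of point sets; inputs are rational points, and the assumed time may have an extra factor polynomial in the input length. *)

theory Defs
  imports "HOL-Analysis.Analysis" "HOL-Library.Landau_Symbols"
begin

section \<open>Nets and fractal dimension\<close>

definition is_net :: "real \<Rightarrow> (real \<times> real) set \<Rightarrow> (real \<times> real) set \<Rightarrow> bool" where
  "is_net \<rho> N P \<longleftrightarrow> N \<subseteq> P
     \<and> (\<forall>x\<in>N. \<forall>y\<in>N. x \<noteq> y \<longrightarrow> dist x y > \<rho>)
     \<and> (\<forall>p\<in>P. \<exists>q\<in>N. dist p q \<le> \<rho>)"

text \<open>
  For a single finite set \<open>P\<close> the bound \<open>|N \<inter> ball(x,r)| = O((r/\<rho>)^s)\<close> holds with the constant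
  \<open>|P|\<close> for every \<open>s \<ge> 0\<close>, so the notion only has content for finite sets if the
  constant is uniform over the class of instances considered. The dimension is therefore
  attached to a family of point sets; the dimension of one set \<open>P\<close> is that of \<open>{P}\<close>.
  The intersections below are finite, being \<open>\<rho>\<close>-separated and bounded, so \<open>card\<close> is meaningful.
\<close>

definition growth_bound :: "(real \<times> real) set set \<Rightarrow> real \<Rightarrow> bool" where
  "growth_bound F s \<longleftrightarrow> (\<exists>C. \<forall>P\<in>F. \<forall>\<rho>>0. \<forall>r\<ge>2 * \<rho>. \<forall>N. is_net \<rho> N P \<longrightarrow>
     (\<forall>x. real (card (N \<inter> cball x r)) \<le> C * (r / \<rho>) powr s))"

definition fractal_dim :: "(real \<times> real) set set \<Rightarrow> ereal" where
  "fractal_dim F = (INF s \<in> {s. growth_bound F s}. ereal s)"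


section \<open>Algorithms and running time\<close>

text \<open>
  The machine model is Jones' WHILE language over binary trees (Computability and Complexity
  from a Programming Perspective, 1997): variables hold binary trees, and the operations are
  building a node, taking a subtree, and testing for a leaf. A tree is a pointer, so each
  operation is of constant cost, and running time is polynomially equivalent to that of
  deterministic Turing machines. Expressions in a program have fixed size; charging one unit
  for a whole expression changes running times only by a factor depending on the program.
\<close>

datatype tree = Leaf | Node tree tree

datatype expr = Var nat | LeafE | NodeE expr expr | Left expr | Right expr

datatype com = Assign nat expr | Seq com com | IfNode expr com com | WhileNode expr com

type_synonym store = "nat \<Rightarrow> tree"

fun left :: "tree \<Rightarrow> tree" where
  "left Leaf = Leaf"
| "left (Node a b) = a"

fun right :: "tree \<Rightarrow> tree" where
  "right Leaf = Leaf"
| "right (Node a b) = b"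

fun eval_expr :: "expr \<Rightarrow> store \<Rightarrow> tree" where
  "eval_expr (Var x) s = s x"
| "eval_expr LeafE s = Leaf"
| "eval_expr (NodeE a b) s = Node (eval_expr a s) (eval_expr b s)"
| "eval_expr (Left a) s = left (eval_expr a s)"
| "eval_expr (Right a) s = right (eval_expr a s)"

text \<open>\<open>exec c s t s'\<close>: started in store \<open>s\<close>, program \<open>c\<close> halts after \<open>t\<close> steps in store \<open>s'\<close>.\<close>

inductive exec :: "com \<Rightarrow> store \<Rightarrow> nat \<Rightarrow> store \<Rightarrow> bool" where
  Assign: "exec (Assign x e) s 1 (s(x := eval_expr e s))"
| Seq: "exec c1 s1 t1 s2 \<Longrightarrow> exec c2 s2 t2 s3 \<Longrightarrow> exec (Seq c1 c2) s1 (t1 + t2) s3"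
| IfTrue: "eval_expr e s \<noteq> Leaf \<Longrightarrow> exec c1 s t s' \<Longrightarrow> exec (IfNode e c1 c2) s (1 + t) s'"
| IfFalse: "eval_expr e s = Leaf \<Longrightarrow> exec c2 s t s' \<Longrightarrow> exec (IfNode e c1 c2) s (1 + t) s'"
| WhileFalse: "eval_expr e s = Leaf \<Longrightarrow> exec (WhileNode e c) s 1 s"
| WhileTrue: "eval_expr e s1 \<noteq> Leaf \<Longrightarrow> exec c s1 t1 s2 \<Longrightarrow> exec (WhileNode e c) s2 t2 s3
    \<Longrightarrow> exec (WhileNode e c) s1 (1 + t1 + t2) s3"

lemma exec_deterministic:
  "exec c s t s' \<Longrightarrow> exec c s u s'' \<Longrightarrow> t = u \<and> s' = s''"
proof (induction arbitrary: u s'' rule: exec.induct)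
  case (Assign x e s)
  from Assign.prems show ?case by cases auto
next
  case (Seq c1 s1 t1 s2 c2 t2 s3)
  from Seq.prems show ?case by cases (use Seq.IH in blast)
next
  case (IfTrue e s c1 t s' c2)
  from IfTrue.prems show ?case by cases (use IfTrue.IH IfTrue.hyps in blast)+
next
  case (IfFalse e s c2 t s' c1)
  from IfFalse.prems show ?case by cases (use IfFalse.IH IfFalse.hyps in blast)+
next
  case (WhileFalse e s c)
  from WhileFalse.prems show ?case by cases (use WhileFalse.hyps in blast)+
next
  case (WhileTrue e s1 c t1 s2 t2 s3)
  from WhileTrue.prems show ?case by cases (use WhileTrue.IH WhileTrue.hyps in blast)+
qed

text \<open>Input and output are passed in variable \<open>0\<close>; all other variables are initially leaves.\<close>

definition outputs_within :: "com \<Rightarrow> tree \<Rightarrow> real \<Rightarrow> tree \<Rightarrow> bool" where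
  "outputs_within c x T y \<longleftrightarrow>
     (\<exists>t s. exec c ((\<lambda>_. Leaf)(0 := x)) t s \<and> s 0 = y \<and> real t \<le> T)"


section \<open>Encodings\<close>

definition enc_bool :: "bool \<Rightarrow> tree" where
  "enc_bool b = (if b then Node Leaf Leaf else Leaf)"

definition enc_list :: "('a \<Rightarrow> tree) \<Rightarrow> 'a list \<Rightarrow> tree" where
  "enc_list f xs = foldr (\<lambda>x t. Node (f x) t) xs Leaf"

text \<open>Numbers are written in binary, least significant bit first.\<close>

fun bits :: "nat \<Rightarrow> bool list" where
  "bits n = (if n = 0 then [] else odd n # bits (n div 2))"

declare bits.simps [simp del]

definition enc_nat :: "nat \<Rightarrow> tree" where
  "enc_nat n = enc_list enc_bool (bits n)"

definition enc_int :: "int \<Rightarrow> tree" where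
  "enc_int i = Node (enc_bool (i < 0)) (enc_nat (nat \<bar>i\<bar>))"

definition enc_rat :: "rat \<Rightarrow> tree" where
  "enc_rat q = Node (enc_int (fst (quotient_of q))) (enc_int (snd (quotient_of q)))"

definition enc_points :: "(rat \<times> rat) list \<Rightarrow> tree" where
  "enc_points = enc_list (\<lambda>(x, y). Node (enc_rat x) (enc_rat y))"


section \<open>Euclidean TSP\<close>

definition tour_length :: "(real \<times> real) list \<Rightarrow> real" where
  "tour_length ps = (\<Sum>i<length ps. dist (ps ! i) (ps ! (Suc i mod length ps)))"

definition is_tour :: "(real \<times> real) set \<Rightarrow> (real \<times> real) list \<Rightarrow> bool" where
  "is_tour P ps \<longleftrightarrow> distinct ps \<and> set ps = P"

definition optimal_tour :: "(real \<times> real) set \<Rightarrow> (real \<times> real) list \<Rightarrow> bool" where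
  "optimal_tour P ps \<longleftrightarrow>
     is_tour P ps \<and> (\<forall>qs. is_tour P qs \<longrightarrow> tour_length ps \<le> tour_length qs)"

definition real_point :: "rat \<times> rat \<Rightarrow> real \<times> real" where
  "real_point = map_prod of_rat of_rat"

text \<open>
  Inputs are the members of \<open>F\<close> with rational coordinates, listed in any order. The time bound \<open>T\<close>
  is a function of the number of points and of the length of the binary encoding of the
  input. The second argument is needed because no bound in the number of points alone
  leaves time to read coordinates of arbitrary length.
\<close>

definition solves_TSP :: "com \<Rightarrow> (real \<times> real) set set \<Rightarrow> (nat \<Rightarrow> nat \<Rightarrow> real) \<Rightarrow> bool" where
  "solves_TSP c F T \<longleftrightarrow>
     (\<forall>ps. distinct ps \<and> real_point ` set ps \<in> F \<longrightarrow>
        (\<exists>qs. optimal_tour (real_point ` set ps) (map real_point qs) \<and>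
           outputs_within c (enc_points ps) (T (length ps) (size (enc_points ps)))
             (enc_points qs)))"


section \<open>3-SAT and the Exponential Time Hypothesis\<close>

text \<open>A literal is a variable with the truth value that satisfies it.\<close>

type_synonym literal = "nat \<times> bool"
type_synonym cnf = "literal list list"

text \<open>
  Clauses are not repeated, so that the size of a formula is polynomial in the number \<open>N\<close> of
  variables and a time bound in \<open>N\<close> alone makes sense.
\<close>

definition is_3cnf :: "nat \<Rightarrow> cnf \<Rightarrow> bool" where
  "is_3cnf N \<phi> \<longleftrightarrow> distinct \<phi> \<and> (\<forall>C\<in>set \<phi>. length C \<le> 3 \<and> (\<forall>(v, b)\<in>set C. v < N))"

definition satisfiable :: "cnf \<Rightarrow> bool" where
  "satisfiable \<phi> \<longleftrightarrow> (\<exists>\<alpha>. \<forall>C\<in>set \<phi>. \<exists>(v, b)\<in>set C. \<alpha> v = b)"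

definition enc_3sat :: "nat \<Rightarrow> cnf \<Rightarrow> tree" where
  "enc_3sat N \<phi> =
     Node (enc_nat N) (enc_list (enc_list (\<lambda>(v, b). Node (enc_nat v) (enc_bool b))) \<phi>)"

definition solves_3SAT :: "com \<Rightarrow> (nat \<Rightarrow> real) \<Rightarrow> bool" where
  "solves_3SAT c T \<longleftrightarrow>
     (\<forall>N \<phi>. is_3cnf N \<phi> \<longrightarrow>
        outputs_within c (enc_3sat N \<phi>) (T N) (enc_bool (satisfiable \<phi>)))"

definition ETH :: bool where
  "ETH \<longleftrightarrow> (\<exists>\<sigma>>0. \<not> (\<exists>c T. T \<in> O(\<lambda>N. 2 powr (\<sigma> * real N)) \<and> solves_3SAT c T))"

end

theory Submission
 imports Defs "HOL-Real_Asymp.Real_Asymp"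
begin

text \<open>Branching on frequent symbols (sparsification) reduces a 3-SAT instance on \<open>N\<close> variables to
 \<open>2 powr (\<epsilon> * N)\<close> monotone formulas with \<open>O(N)\<close> clauses over the \<open>2 * N\<close> literal symbols; consistency of
 a symbol with its negation is expressed by \<open>N\<close> additional negative clauses. Such a formula, with one
 row per symbol and one column per clause, is drawn as a system of closed tracks that meet only in
 contacts between thick cells. Replacing the drawing by the centres of discs with disjoint interiors
 gives a TSP instance: a tour has length at least twice the sum of the radii, with equality iff
 consecutive discs touch. A tour of touching discs must leave every track through one of its
 contacts, and the contacts are placed so that this is possible iff the formula is satisfiable.

 Rows and columns sit at coordinates obtained by reading their indices in base \<open>2 ^ p\<close> as numerals in
 base \<open>2 ^ q\<close>, and are joined by straight wires. The coordinates form a Cantor-like set of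
 dimension \<open>p / q\<close>, so all the instances lie in one family of fractal dimension at most
 \<open>1 + p / q \<le> \<delta>\<close>, although each consists of only \<open>O(N powr (1 + q / p))\<close> points. If \<open>\<delta>' < 1 + p / q\<close>, then
 \<open>(1 + q / p) * (1 - 1 / \<delta>') < 1\<close>, so that a TSP query takes time \<open>2 powr o(N)\<close>.\<close>

section \<open>Cycles\<close>

text \<open>A thick cell is one disc of radius 3/2 that may touch up to four neighbours; a wire cell
  is a chain of three discs of radius 1/2 and leaves no choice. So the freedom of a tour of touching
  discs lies in the contacts alone. At a contact the tour either stays on both tracks or crosses
  over twice, and contacts that share a thick cell exclude each other. In the column of a clause, L
  blocks face the L + 1 vertical tracks below, between and above them. A block whose innermost ring
  \<open>4\<close> is left vertically can serve only one of its two vertical tracks, so some ring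
  \<open>4\<close> must be left sideways, through a thick cell that exists only at an occurrence of
  the symbol. Along a row, the choice between a left and a right exit transports one bit, and only
  one way: a positive exit forbids negative exits of the same row further left. Hence the negative
  columns come first, and consistency is expressed by negative clauses on pairs of symbols. This
  one-sidedness suits sparsification, which treats the two literals of a variable as unrelated
  symbols.\<close>

fun pedges :: "'a list \<Rightarrow> 'a set set" where
 "pedges [] = {}"
| "pedges [x] = {}"
| "pedges (x # y # zs) = insert {x, y} (pedges (y # zs))"

text \<open>Edges are unordered pairs, so rotating or reversing a cyclic list does not change its
  edge set. For lists with fewer than three entries the set degenerates, which is why statements
  about degrees assume length at least 3.\<close>

definition cedges :: "'a list \<Rightarrow> 'a set set" where
 "cedges xs = (if xs = [] then {} else insert {last xs, hd xs} (pedges xs))"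

lemma pedges_append:
 "xs \<noteq> [] \<Longrightarrow> ys \<noteq> [] \<Longrightarrow> pedges (xs @ ys) = pedges xs \<union> {{last xs, hd ys}} \<union> pedges ys"
proof (induction xs rule: pedges.induct)
 case (2 x)
 then obtain y zs where "ys = y # zs" by (cases ys) auto
 then show ?case by simp
qed auto

lemma pedges_rev: "pedges (rev xs) = pedges xs"
proof (induction xs rule: pedges.induct)
 case (3 x y zs)
 have "pedges (rev (x # y # zs)) = pedges (rev (y # zs) @ [x])" by simp
 also have "\<dots> = pedges (rev (y # zs)) \<union> {{y, x}}"
  by (subst pedges_append) (auto simp: last_rev)
 finally show ?case using 3 by (auto simp: insert_commute)
qed auto

lemma cedges_swap: "cedges (xs @ ys) = cedges (ys @ xs)"
proof (cases "xs = [] \<or> ys = []")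
 case False
 then show ?thesis by (auto simp: cedges_def pedges_append)
qed auto

lemma cedges_rev: "cedges (rev xs) = cedges xs"
 by (auto simp: cedges_def pedges_rev hd_rev last_rev insert_commute)

lemma pedges_split:
 "e \<in> pedges xs \<Longrightarrow> \<exists>as bs x y. xs = as @ x # y # bs \<and> e = {x, y}"
proof (induction xs rule: pedges.induct)
 case (3 x y zs)
 show ?case
 proof (cases "e = {x, y}")
  case True
  then show ?thesis by (metis append_Nil)
 next
  case False
  with 3 obtain as bs u v where "y # zs = as @ u # v # bs" "e = {u, v}" by auto
  then have "x # y # zs = (x # as) @ u # v # bs" by simp
  then show ?thesis using \<open>e = {u, v}\<close> by blast
 qed
qed auto

lemma pedges_closed:
 "\<lbrakk>xs \<noteq> []; hd xs \<in> S; \<And>x y. {x, y} \<in> pedges xs \<Longrightarrow> x \<in> S \<Longrightarrow> y \<in> S\<rbrakk> \<Longrightarrow> set xs \<subseteq> S"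
proof (induction xs rule: pedges.induct)
 case (3 x y zs)
 have "y \<in> S" using 3(4)[of x y] 3(3) by simp
 moreover have "set (y # zs) \<subseteq> S"
 proof (rule 3(1))
  show "v \<in> S" if "{u, v} \<in> pedges (y # zs)" "u \<in> S" for u v
   using 3(4)[of u v] that by auto
 qed (use \<open>y \<in> S\<close> in auto)
 ultimately show ?case using 3(3) by simp
qed auto

lemma pedges_set: "e \<in> pedges xs \<Longrightarrow> e \<subseteq> set xs"
 by (induction xs rule: pedges.induct) auto

lemma cedges_set: "e \<in> cedges xs \<Longrightarrow> e \<subseteq> set xs"
 using pedges_set[of e xs] by (auto simp: cedges_def split: if_splits)

lemma rotate_to:
 assumes "v \<in> set xs" "distinct xs"
 obtains ys where "set (v # ys) = set xs" "distinct (v # ys)" "length (v # ys) = length xs"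
  "cedges (v # ys) = cedges xs"
proof -
 obtain as bs where xs: "xs = as @ v # bs" using assms(1) by (meson split_list)
 have "cedges (v # (bs @ as)) = cedges xs" using cedges_swap[of as "v # bs"] xs by simp
 moreover have "distinct (v # (bs @ as))" using assms(2) xs by auto
 ultimately show ?thesis using that[of "bs @ as"] xs by auto
qed

lemma rotate_edge:
 assumes e: "{p, q} \<in> cedges xs" and "distinct xs"
 obtains ys where "set ys = set xs" "distinct ys" "length ys = length xs"
  "cedges ys = cedges xs" "hd ys = p" "last ys = q" "ys \<noteq> []"
proof -
 have ne: "xs \<noteq> []" using e by (auto simp: cedges_def)
 have "\<exists>ys. set ys = set xs \<and> distinct ys \<and> length ys = length xs \<and> cedges ys = cedges xs
   \<and> {last ys, hd ys} = {p, q} \<and> ys \<noteq> []"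
 proof (cases "{p, q} = {last xs, hd xs}")
  case True
  then show ?thesis using assms ne by auto
 next
  case False
  then have "{p, q} \<in> pedges xs" using e ne by (simp add: cedges_def)
  then obtain as bs x y where xs: "xs = as @ x # y # bs" and pq: "{p, q} = {x, y}"
   using pedges_split by blast
  have "cedges ((y # bs) @ (as @ [x])) = cedges xs"
   using cedges_swap[of "as @ [x]" "y # bs"] xs by simp
  then show ?thesis
   by (intro exI[of _ "(y # bs) @ (as @ [x])"]) (use assms xs pq in auto)
 qed
 then obtain ys where ys: "set ys = set xs" "distinct ys" "length ys = length xs"
   "cedges ys = cedges xs" "{last ys, hd ys} = {p, q}" "ys \<noteq> []" by blast
 then consider "last ys = q" "hd ys = p" | "last ys = p" "hd ys = q"
  by (metis doubleton_eq_iff)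
 then show ?thesis
 proof cases
  case 1
  then show ?thesis using that ys by blast
 next
  case 2
  show ?thesis by (rule that[of "rev ys"]) (use ys 2 in \<open>auto simp: cedges_rev hd_rev last_rev\<close>)
 qed
qed

section \<open>Merging disjoint cycles along a tree\<close>

text \<open>Both cycles are cut open at the given edge and glued with the second one reversed, so
  that \<open>q\<close> meets \<open>q'\<close> and, across the ends, \<open>p\<close> meets
  \<open>p'\<close>. The last inclusion says that no other edge is lost; further merges rely on it,
  because their edges must still be there.\<close>

lemma cycle_merge:
 assumes "distinct xs" "distinct ys" "set xs \<inter> set ys = {}"
  and "{p, q} \<in> cedges xs" "{p', q'} \<in> cedges ys"
 obtains zs where "distinct zs" "set zs = set xs \<union> set ys"
  "cedges zs \<subseteq> cedges xs \<union> cedges ys \<union> {{p, p'}, {q, q'}}"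
  "(cedges xs \<union> cedges ys) - {{p, q}, {p', q'}} \<subseteq> cedges zs"
proof -
 obtain us where us: "set us = set xs" "distinct us" "cedges us = cedges xs"
   "hd us = p" "last us = q" "us \<noteq> []" using rotate_edge assms by metis
 obtain vs where vs: "set vs = set ys" "distinct vs" "cedges vs = cedges ys"
   "hd vs = p'" "last vs = q'" "vs \<noteq> []" using rotate_edge assms by metis
 have c: "cedges (us @ rev vs) = insert {p', p} (pedges us \<union> {{q, q'}} \<union> pedges vs)"
  using us vs by (simp add: cedges_def pedges_append pedges_rev hd_rev last_rev)
 have u: "cedges xs = insert {q, p} (pedges us)"
  using us(3-6) by (metis cedges_def)
 have v: "cedges ys = insert {q', p'} (pedges vs)"
  using vs(3-6) by (metis cedges_def)
 show ?thesis
  by (rule that[of "us @ rev vs"]) (use c u v us vs assms in \<open>auto simp: insert_commute\<close>)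
qed

text \<open>A track of largest rank is nobody's parent, so it can be set aside, the rest merged, and
  its cycle spliced in last. The edge of the parent that is needed for this is still present: by the
  last two hypotheses it was consumed neither for another child nor for attaching a track to its own
  parent.\<close>

lemma forest_merge:
 fixes cyc :: "'t \<Rightarrow> 'a list"
 assumes "finite T" "r \<in> T"
  and "\<And>t. t \<in> T \<Longrightarrow> distinct (cyc t)"
  and "\<And>t t'. t \<in> T \<Longrightarrow> t' \<in> T \<Longrightarrow> t \<noteq> t' \<Longrightarrow> set (cyc t) \<inter> set (cyc t') = {}"
  and "\<And>t. t \<in> T \<Longrightarrow> t \<noteq> r \<Longrightarrow> par t \<in> T \<and> rk (par t) < (rk t :: nat)
    \<and> {cp t, cq t} \<in> cedges (cyc t) \<and> {pp t, pq t} \<in> cedges (cyc (par t))"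
  and "\<And>t t'. t \<in> T - {r} \<Longrightarrow> t' \<in> T - {r} \<Longrightarrow> t \<noteq> t' \<Longrightarrow> {pp t, pq t} \<noteq> {pp t', pq t'}"
  and "\<And>t t'. t \<in> T - {r} \<Longrightarrow> t' \<in> T - {r} \<Longrightarrow> {cp t, cq t} \<noteq> {pp t', pq t'}"
 shows "\<exists>zs. distinct zs \<and> set zs = (\<Union>t\<in>T. set (cyc t))
  \<and> cedges zs \<subseteq> (\<Union>t\<in>T. cedges (cyc t)) \<union> (\<Union>t\<in>T - {r}. {{cp t, pp t}, {cq t, pq t}})
  \<and> (\<Union>t\<in>T. cedges (cyc t)) - (\<Union>t\<in>T - {r}. {{cp t, cq t}, {pp t, pq t}}) \<subseteq> cedges zs"
 using assms
proof (induction "card T" arbitrary: T)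
 case 0
 then show ?case by auto
next
 case (Suc n T)
 show ?case
 proof (cases "T = {r}")
  case True
  then show ?thesis using Suc.prems(3)[of r] by (intro exI[of _ "cyc r"]) auto
 next
  case False
  let ?R = "rk ` (T - {r})"
  have fin: "finite ?R" "?R \<noteq> {}" using Suc.prems(1,2) False by auto
  from Max_in[OF fin] obtain t where t: "t \<in> T - {r}" "Max ?R = rk t" by (rule imageE) blast
  have tmax: "\<And>t'. t' \<in> T - {r} \<Longrightarrow> rk t' \<le> rk t"
   unfolding t(2)[symmetric] by (intro Max_ge fin(1) imageI)
  let ?S = "T - {t}"
  have card: "n = card ?S" using Suc.hyps(2) Suc.prems(1) t by simp
  have parS: "\<And>t'. t' \<in> ?S \<Longrightarrow> t' \<noteq> r \<Longrightarrow> par t' \<in> ?S"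
  proof -
   fix t' assume "t' \<in> ?S" "t' \<noteq> r"
   then have "par t' \<in> T" "rk (par t') < rk t'" "rk t' \<le> rk t"
    using Suc.prems(5) tmax by auto
   then show "par t' \<in> ?S" by auto
  qed
  have "\<exists>zs. distinct zs \<and> set zs = (\<Union>t\<in>?S. set (cyc t))
   \<and> cedges zs \<subseteq> (\<Union>t\<in>?S. cedges (cyc t)) \<union> (\<Union>t\<in>?S - {r}. {{cp t, pp t}, {cq t, pq t}})
   \<and> (\<Union>t\<in>?S. cedges (cyc t)) - (\<Union>t\<in>?S - {r}. {{cp t, cq t}, {pp t, pq t}}) \<subseteq> cedges zs"
  proof (rule Suc.hyps(1)[OF card])
   show "finite ?S" using Suc.prems(1) by simp
   show "r \<in> ?S" using Suc.prems(2) t by auto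
   show "distinct (cyc t)" if "t \<in> ?S" for t using Suc.prems(3) that by blast
   show "set (cyc t) \<inter> set (cyc t') = {}" if "t \<in> ?S" "t' \<in> ?S" "t \<noteq> t'" for t t'
    using Suc.prems(4) that by blast
   show "par t \<in> ?S \<and> rk (par t) < rk t
    \<and> {cp t, cq t} \<in> cedges (cyc t) \<and> {pp t, pq t} \<in> cedges (cyc (par t))"
    if "t \<in> ?S" "t \<noteq> r" for t using Suc.prems(5) that parS by blast
   show "{pp t, pq t} \<noteq> {pp t', pq t'}" if "t \<in> ?S - {r}" "t' \<in> ?S - {r}" "t \<noteq> t'" for t t'
    using Suc.prems(6) that by blast
   show "{cp t, cq t} \<noteq> {pp t', pq t'}" if "t \<in> ?S - {r}" "t' \<in> ?S - {r}" for t t'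
    using Suc.prems(7) that by blast
  qed
  then obtain zs where zs: "distinct zs" "set zs = (\<Union>t\<in>?S. set (cyc t))"
   "cedges zs \<subseteq> (\<Union>t\<in>?S. cedges (cyc t)) \<union> (\<Union>t\<in>?S - {r}. {{cp t, pp t}, {cq t, pq t}})"
   "(\<Union>t\<in>?S. cedges (cyc t)) - (\<Union>t\<in>?S - {r}. {{cp t, cq t}, {pp t, pq t}}) \<subseteq> cedges zs"
   by blast
  have tT: "t \<in> T" "t \<noteq> r" using t by auto
  note pt = Suc.prems(5)[OF tT]
  have "par t \<in> ?S" using pt by auto
  have e1: "{pp t, pq t} \<in> cedges zs"
  proof -
   have "{pp t, pq t} \<in> (\<Union>t\<in>?S. cedges (cyc t))" using pt \<open>par t \<in> ?S\<close> by blast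
   moreover have "{pp t, pq t} \<notin> (\<Union>t\<in>?S - {r}. {{cp t, cq t}, {pp t, pq t}})"
    using Suc.prems(6)[of t] Suc.prems(7)[of _ t] t by blast
   ultimately show ?thesis using zs(4) by blast
  qed
  have dis: "set (cyc t) \<inter> set zs = {}" using zs(2) Suc.prems(4) tT by fastforce
  obtain ws where ws: "distinct ws" "set ws = set (cyc t) \<union> set zs"
   "cedges ws \<subseteq> cedges (cyc t) \<union> cedges zs \<union> {{cp t, pp t}, {cq t, pq t}}"
   "(cedges (cyc t) \<union> cedges zs) - {{cp t, cq t}, {pp t, pq t}} \<subseteq> cedges ws"
   using cycle_merge[OF Suc.prems(3)[OF tT(1)] zs(1) dis, of "cp t" "cq t" "pp t" "pq t"] pt e1
   by metis
  have U: "(\<Union>u\<in>T. f u) = f t \<union> (\<Union>u\<in>?S. f u)" for f :: "'t \<Rightarrow> 'b set"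
   using tT by blast
  have V: "(\<Union>u\<in>T - {r}. f u) = f t \<union> (\<Union>u\<in>?S - {r}. f u)" for f :: "'t \<Rightarrow> 'b set"
   using tT by blast
  have s: "set ws = (\<Union>t\<in>T. set (cyc t))" unfolding U using ws(2) zs(2) by blast
  have c1: "cedges ws \<subseteq> (\<Union>t\<in>T. cedges (cyc t)) \<union> (\<Union>t\<in>T - {r}. {{cp t, pp t}, {cq t, pq t}})"
   unfolding U V using ws(3) zs(3) by blast
  have c2: "(\<Union>t\<in>T. cedges (cyc t)) - (\<Union>t\<in>T - {r}. {{cp t, cq t}, {pp t, pq t}}) \<subseteq> cedges ws"
   unfolding U V using ws(4) zs(4) by blast
  show ?thesis using ws(1) s c1 c2 by blast
 qed
qed

section \<open>Degree and connectivity of a cycle\<close>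

lemma cycle_degree:
 assumes "distinct xs" "length xs \<ge> 3" "v \<in> set xs"
 obtains a b where "a \<noteq> b" "a \<noteq> v" "b \<noteq> v" "{w. {v, w} \<in> cedges xs} = {a, b}"
proof -
 obtain ys where ys: "set (v # ys) = set xs" "distinct (v # ys)" "length (v # ys) = length xs"
  "cedges (v # ys) = cedges xs" using rotate_to assms by metis
 obtain y1 y2 zs where y: "ys = y1 # y2 # zs"
  using ys(3) assms(2) by (cases ys; cases "tl ys") auto
 have c: "cedges xs = insert {last ys, v} (insert {v, y1} (pedges ys))"
  using ys(4) y by (simp add: cedges_def)
 have "{v, w} \<in> cedges xs \<longleftrightarrow> w = last ys \<or> w = y1" for w
 proof -
  have "{v, w} \<notin> pedges ys" using pedges_set[of "{v, w}" ys] ys(2) by auto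
  then show ?thesis unfolding c by (auto simp: doubleton_eq_iff)
 qed
 then have "{w. {v, w} \<in> cedges xs} = {last ys, y1}" by auto
 moreover have "last ys \<noteq> y1" "last ys \<noteq> v" "y1 \<noteq> v"
  using ys(2) y by (auto split: if_splits)
 ultimately show ?thesis using that by blast
qed

lemma cycle_closed:
 assumes "distinct xs" "v \<in> set xs" "v \<in> S"
  and "\<And>x y. {x, y} \<in> cedges xs \<Longrightarrow> x \<in> S \<Longrightarrow> y \<in> S"
 shows "set xs \<subseteq> S"
proof -
 obtain ys where ys: "set (v # ys) = set xs" "cedges (v # ys) = cedges xs"
  using rotate_to assms by metis
 have "set (v # ys) \<subseteq> S"
  by (rule pedges_closed) (use assms ys in \<open>auto simp: cedges_def\<close>)
 then show ?thesis using ys(1) by blast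
qed

lemma pedges_conv_nth: "pedges xs = {{xs ! i, xs ! Suc i} |i. Suc i < length xs}"
proof (induction xs rule: pedges.induct)
 case (3 x y zs)
 have "{{(x # y # zs) ! i, (x # y # zs) ! Suc i} |i. Suc i < length (x # y # zs)}
   = insert {x, y} {{(y # zs) ! i, (y # zs) ! Suc i} |i. Suc i < length (y # zs)}" (is "?A = ?B")
 proof
  show "?A \<subseteq> ?B"
  proof
   fix e assume "e \<in> ?A"
   then obtain i where i: "e = {(x # y # zs) ! i, (x # y # zs) ! Suc i}" "Suc i < length (x # y # zs)"
    by blast
   then show "e \<in> ?B" by (cases i) auto
  qed
  show "?B \<subseteq> ?A"
  proof
   fix e assume "e \<in> ?B"
   then consider "e = {x, y}" | i where "e = {(y # zs) ! i, (y # zs) ! Suc i}" "Suc i < length (y # zs)"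
    by blast
   then show "e \<in> ?A"
   proof cases
    case 1
    then have "e = {(x # y # zs) ! 0, (x # y # zs) ! Suc 0}" by simp
    then show ?thesis by (metis (mono_tags, lifting) CollectI length_Cons Suc_less_eq zero_less_Suc)
   next
    case (2 i)
    then have "e = {(x # y # zs) ! Suc i, (x # y # zs) ! Suc (Suc i)}" by simp
    then show ?thesis using 2(2) by (metis (mono_tags, lifting) CollectI length_Cons Suc_less_eq)
   qed
  qed
 qed
 then show ?case using 3 by simp
qed auto

lemma cedges_conv_nth:
 assumes "xs \<noteq> []"
 shows "cedges xs = (\<lambda>i. {xs ! i, xs ! (Suc i mod length xs)}) ` {..<length xs}"
proof
 let ?f = "\<lambda>i. {xs ! i, xs ! (Suc i mod length xs)}"
 show "cedges xs \<subseteq> ?f ` {..<length xs}"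
 proof
  fix e assume "e \<in> cedges xs"
  then consider "e = {last xs, hd xs}" | i where "e = {xs ! i, xs ! Suc i}" "Suc i < length xs"
   using assms by (auto simp: cedges_def pedges_conv_nth)
  then show "e \<in> ?f ` {..<length xs}"
  proof cases
   case 1
   then have "e = ?f (length xs - 1)" using assms by (simp add: last_conv_nth hd_conv_nth)
   then show ?thesis using assms by (intro image_eqI[where x="length xs - 1"]) auto
  next
   case (2 i)
   then show ?thesis by (intro image_eqI[where x=i]) auto
  qed
 qed
 show "?f ` {..<length xs} \<subseteq> cedges xs"
 proof
  fix e assume "e \<in> ?f ` {..<length xs}"
  then obtain i where i: "i < length xs" "e = ?f i" by auto
  show "e \<in> cedges xs"
  proof (cases "Suc i < length xs")
   case True
   then show ?thesis using i by (auto simp: cedges_def pedges_conv_nth)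
  next
   case False
   then have "i = length xs - 1" "Suc i = length xs" using i by auto
   then show ?thesis using i assms by (simp add: cedges_def last_conv_nth hd_conv_nth)
  qed
 qed
qed

section \<open>The drawing of a formula\<close>

text \<open>Entry \<open>k\<close> of row \<open>l\<close> is the shape of the cell in column \<open>k\<close>, row \<open>l\<close>: empty (0), a vertical (2) or
 horizontal (10) wire, a corner (3 to 6), a thick cell (9), or a vertical wire that is replaced by a thick
 cell iff the symbol of the row occurs positively (7) or negatively (8) in the clause of the column.
 Columns 2, 3 and rows 2, 24 occur once, at the border; column 13 and row 23 are repeated to
 stretch the gaps between blocks; everything else is repeated for each clause and symbol.\<close>

definition shtab :: "nat list list" where
 "shtab =
  [[0,0,0,0,0,0,0,0,0,0,0,0,0,0,0],
  [0,0,0,0,0,0,0,0,0,0,0,0,0,0,0],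
  [0,0,3,4,0,0,0,3,4,0,0,0,0,0,0],
  [0,0,2,2,0,0,0,9,9,0,0,0,0,0,0],
  [0,0,2,2,3,10,10,9,9,10,10,4,0,0,0],
  [0,0,2,2,2,0,3,9,9,4,0,2,0,0,0],
  [0,0,2,2,2,0,2,9,9,2,0,2,0,0,0],
  [0,0,2,9,9,0,2,2,2,2,0,9,9,10,9],
  [0,0,2,9,9,0,2,9,9,2,0,9,9,10,9],
  [0,0,2,2,2,0,5,9,9,6,0,2,0,0,0],
  [0,0,2,2,2,3,10,9,9,10,4,2,0,0,0],
  [0,0,2,2,2,2,3,9,9,4,2,2,0,0,0],
  [0,0,2,2,9,9,8,0,0,7,9,9,9,10,9],
  [0,0,2,2,9,9,8,0,0,7,9,9,9,10,9],
  [0,0,2,2,2,2,5,9,9,6,2,2,0,0,0],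
  [0,0,2,2,2,5,10,9,9,10,6,2,0,0,0],
  [0,0,2,2,2,0,3,9,9,4,0,2,0,0,0],
  [0,0,2,2,2,0,2,9,9,2,0,2,0,0,0],
  [0,0,2,2,2,0,2,2,2,2,0,2,0,0,0],
  [0,0,2,2,2,0,2,9,9,2,0,2,0,0,0],
  [0,0,2,2,2,0,5,9,9,6,0,2,0,0,0],
  [0,0,2,2,5,10,10,9,9,10,10,6,0,0,0],
  [0,0,2,2,0,0,0,9,9,0,0,0,0,0,0],
  [0,0,2,2,0,0,0,2,2,0,0,0,0,0,0],
  [0,0,5,6,0,0,0,5,6,0,0,0,0,0,0]]"

text \<open>The track to which the cell belongs; 0 for empty cells.\<close>

definition tktab :: "nat list list" where
 "tktab =
  [[0,0,0,0,0,0,0,0,0,0,0,0,0,0,0],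
  [0,0,0,0,0,0,0,0,0,0,0,0,0,0,0],
  [0,0,12,12,0,0,0,11,11,0,0,0,0,0,0],
  [0,0,12,12,0,0,0,11,11,0,0,0,0,0,0],
  [0,0,12,12,2,2,2,2,2,2,2,2,0,0,0],
  [0,0,12,12,2,0,7,7,7,7,0,2,0,0,0],
  [0,0,12,12,2,0,7,8,8,7,0,2,0,0,0],
  [0,0,12,12,2,0,7,8,8,7,0,2,10,10,10],
  [0,0,12,12,2,0,7,8,8,7,0,2,10,10,10],
  [0,0,12,12,2,0,7,7,7,7,0,2,0,0,0],
  [0,0,12,12,2,3,3,3,3,3,3,2,0,0,0],
  [0,0,12,12,2,3,4,4,4,4,3,2,0,0,0],
  [0,0,12,12,2,3,4,0,0,4,3,2,9,9,9],
  [0,0,12,12,2,3,4,0,0,4,3,2,9,9,9],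
  [0,0,12,12,2,3,4,4,4,4,3,2,0,0,0],
  [0,0,12,12,2,3,3,3,3,3,3,2,0,0,0],
  [0,0,12,12,2,0,5,5,5,5,0,2,0,0,0],
  [0,0,12,12,2,0,5,6,6,5,0,2,0,0,0],
  [0,0,12,12,2,0,5,6,6,5,0,2,0,0,0],
  [0,0,12,12,2,0,5,6,6,5,0,2,0,0,0],
  [0,0,12,12,2,0,5,5,5,5,0,2,0,0,0],
  [0,0,12,12,2,2,2,2,2,2,2,2,0,0,0],
  [0,0,12,12,0,0,0,11,11,0,0,0,0,0,0],
  [0,0,12,12,0,0,0,11,11,0,0,0,0,0,0],
  [0,0,12,12,0,0,0,11,11,0,0,0,0,0,0]]"

definition sh :: "nat \<Rightarrow> nat \<Rightarrow> nat" where "sh k l = shtab ! l ! k"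

definition tk :: "nat \<Rightarrow> nat \<Rightarrow> nat" where "tk k l = tktab ! l ! k"

lemma set_2_25: "set [2..<25] = {2,3,4,5,6,7,8,9,10,11,12,13,14,15,16,17,18,19,20,21,22,23,24}"
 by (simp add: upt_rec_numeral)

lemma set_2_15: "set [2..<15] = {2,3,4,5,6,7,8,9,10,11,12,13,14}"
 by (simp add: upt_rec_numeral)

text \<open>Expanding the bounded quantifiers turns each table entry into a ground rewrite rule,
  collected in \<open>sh_simps\<close> and \<open>tk_simps\<close>. The ranges start at 2 because
  the first two rows and columns of the tables are empty and carry no addresses.\<close>

lemma sh_tk: "\<forall>l\<in>set [2..<25]. \<forall>k\<in>set [2..<15]. sh k l = shtab ! l ! k"
 "\<forall>l\<in>set [2..<25]. \<forall>k\<in>set [2..<15]. tk k l = tktab ! l ! k"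
 by (simp_all add: sh_def tk_def)

lemmas sh_simps = sh_tk(1)[unfolded set_2_25 set_2_15 ball_simps, simplified shtab_def, simplified]
lemmas tk_simps = sh_tk(2)[unfolded set_2_25 set_2_15 ball_simps, simplified tktab_def, simplified]

type_synonym addr = "nat \<times> nat \<times> nat"
type_synonym cell = "addr \<times> addr"

text \<open>A shape is known to the proof only through the sides on which it is open. Row numbers
  grow upwards, against the order in which the tables are printed.\<close>

fun opR :: "nat \<Rightarrow> bool" where "opR s = (s = 3 \<or> s = 5 \<or> s = 9 \<or> s = 10)"
fun opL :: "nat \<Rightarrow> bool" where "opL s = (s = 4 \<or> s = 6 \<or> s = 9 \<or> s = 10)"
fun opU :: "nat \<Rightarrow> bool" where "opU s = (s = 2 \<or> s = 3 \<or> s = 4 \<or> s = 9)"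
fun opD :: "nat \<Rightarrow> bool" where "opD s = (s = 2 \<or> s = 5 \<or> s = 6 \<or> s = 9)"

lemmas op_simps = opR.simps opL.simps opU.simps opD.simps

section \<open>Addresses of cells and their neighbours\<close>

text \<open>There are \<open>L\<close> symbols (rows of blocks) and \<open>M\<close> clauses
  (columns of blocks). \<open>gx j\<close> counts the copies of column 13 between the clauses
  \<open>j\<close> and \<open>j + 1\<close>, and \<open>gy i\<close> the copies of row 23 between
  the symbols \<open>i - 1\<close> and \<open>i\<close>.\<close>

locale layout =
 fixes L M :: nat and gx gy :: "nat \<Rightarrow> nat" and occP occN :: "nat \<Rightarrow> nat \<Rightarrow> bool"
 assumes L: "0 < L" and M: "0 < M" and gx: "\<And>j. 0 < gx j" and gy: "\<And>i. 0 < gy i"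
begin

text \<open>An address consists of the kind of the column, the index of the block, and a copy number
  that is nonzero only in the stretched column. The columns between the clauses \<open>j\<close> and
  \<open>j + 1\<close> carry the index \<open>j\<close>.\<close>

fun vx :: "addr \<Rightarrow> bool" where
 "vx (k, j, g) \<longleftrightarrow> ((k = 2 \<or> k = 3) \<and> j = 0 \<and> g = 0) \<or> (4 \<le> k \<and> k \<le> 11 \<and> j < M \<and> g = 0)
   \<or> ((k = 12 \<or> k = 14) \<and> Suc j < M \<and> g = 0) \<or> (k = 13 \<and> Suc j < M \<and> g < gx j)"

fun nx :: "addr \<Rightarrow> addr" where
 "nx (k, j, g) = (if k = 13 then (if Suc g < gx j then (13, j, Suc g) else (14, j, 0))
   else if k = 14 then (4, Suc j, 0) else (Suc k, j, 0))"

fun px :: "addr \<Rightarrow> addr" where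
 "px (k, j, g) = (if k = 4 then (if j = 0 then (3, 0, 0) else (14, j - 1, 0))
   else if k = 13 then (if g = 0 then (12, j, 0) else (13, j, g - 1))
   else if k = 14 then (13, j, gx j - 1) else (k - 1, j, 0))"

text \<open>Rows 22 and 23 carry the index of the block above them, up to \<open>L\<close> above the
  last block. In this way all cells of the vertical track between the blocks \<open>i - 1\<close>
  and \<open>i\<close> have the same index \<open>i\<close>.\<close>

fun vy :: "addr \<Rightarrow> bool" where
 "vy (k, i, g) \<longleftrightarrow> (k = 2 \<and> i = 0 \<and> g = 0) \<or> (3 \<le> k \<and> k \<le> 21 \<and> i < L \<and> g = 0)
   \<or> (k = 22 \<and> 1 \<le> i \<and> i \<le> L \<and> g = 0) \<or> (k = 23 \<and> 1 \<le> i \<and> i < L \<and> g < gy i)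
   \<or> (k = 24 \<and> i = L \<and> g = 0)"

fun ny :: "addr \<Rightarrow> addr" where
 "ny (k, i, g) = (if k = 21 then (22, Suc i, 0)
   else if k = 22 then (if i < L then (23, i, 0) else (24, i, 0))
   else if k = 23 then (if Suc g < gy i then (23, i, Suc g) else (3, i, 0))
   else (Suc k, i, 0))"

fun py :: "addr \<Rightarrow> addr" where
 "py (k, i, g) = (if k = 3 then (if i = 0 then (2, 0, 0) else (23, i, gy i - 1))
   else if k = 22 then (21, i - 1, 0)
   else if k = 23 then (if g = 0 then (22, i, 0) else (23, i, g - 1))
   else if k = 24 then (22, i, 0) else (k - 1, i, 0))"

lemma px_nx: "vx \<alpha> \<Longrightarrow> vx (nx \<alpha>) \<Longrightarrow> px (nx \<alpha>) = \<alpha>"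
 apply (cases \<alpha>)
 subgoal for k j g by (cases "k = 13"; cases "k = 14"; simp; linarith?)
 done

lemma nx_px: "vx \<alpha> \<Longrightarrow> vx (px \<alpha>) \<Longrightarrow> nx (px \<alpha>) = \<alpha>"
 apply (cases \<alpha>)
 subgoal for k j g by (cases "k = 13"; cases "k = 14"; cases "k = 4"; cases "j = 0"; cases "g = 0"; simp; linarith?)
 done

lemma py_ny: "vy \<alpha> \<Longrightarrow> vy (ny \<alpha>) \<Longrightarrow> py (ny \<alpha>) = \<alpha>"
 apply (cases \<alpha>)
 subgoal for k j g by (cases "k = 21"; cases "k = 22"; cases "k = 23"; simp; linarith?)
 done

lemma ny_py: "vy \<alpha> \<Longrightarrow> vy (py \<alpha>) \<Longrightarrow> ny (py \<alpha>) = \<alpha>"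
 using L apply (cases \<alpha>)
 subgoal for k j g by (cases "k = 3"; cases "k = 22"; cases "k = 23"; cases "k = 24"; cases "j = 0"; cases "g = 0"; simp; linarith?)
 done

definition rs :: "cell \<Rightarrow> nat" where
 "rs c = (case c of ((k, j, g), (l, i, h)) \<Rightarrow>
   (if sh k l = 7 then (if occP i j then 9 else 2)
   else if sh k l = 8 then (if occN i j then 9 else 2) else sh k l))"

definition cell :: "cell \<Rightarrow> bool" where
 "cell c \<longleftrightarrow> vx (fst c) \<and> vy (snd c) \<and> rs c \<noteq> 0"

definition trk :: "cell \<Rightarrow> nat \<times> nat \<times> nat" where
 "trk c = (case c of ((k, j, g), (l, i, h)) \<Rightarrow>
   (if tk k l = 12 then (12, 0, 0) else (tk k l, i, j)))"

definition hpot :: "cell \<Rightarrow> cell \<Rightarrow> bool" where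
 "hpot c c' \<longleftrightarrow> fst c' = nx (fst c) \<and> snd c' = snd c \<and> opR (rs c) \<and> opL (rs c')"

definition vpot :: "cell \<Rightarrow> cell \<Rightarrow> bool" where
 "vpot c c' \<longleftrightarrow> snd c' = ny (snd c) \<and> fst c' = fst c \<and> opU (rs c) \<and> opD (rs c')"

text \<open>The graph on cells in which tours are sought: adjacent cells that are open towards each
  other. It contains the steps along a track as well as the contacts between tracks.\<close>

definition pot :: "cell \<Rightarrow> cell \<Rightarrow> bool" where
 "pot c c' \<longleftrightarrow> cell c \<and> cell c' \<and> (hpot c c' \<or> hpot c' c \<or> vpot c c' \<or> vpot c' c)"

lemma pot_sym: "pot c c' \<Longrightarrow> pot c' c" unfolding pot_def by blast

lemma pot_iff:
 "pot (\<alpha>, \<beta>) c' \<longleftrightarrow> cell (\<alpha>, \<beta>) \<and> cell c' \<and>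
  (c' = (nx \<alpha>, \<beta>) \<and> opR (rs (\<alpha>, \<beta>)) \<and> opL (rs c')
  \<or> c' = (px \<alpha>, \<beta>) \<and> opL (rs (\<alpha>, \<beta>)) \<and> opR (rs c')
  \<or> c' = (\<alpha>, ny \<beta>) \<and> opU (rs (\<alpha>, \<beta>)) \<and> opD (rs c')
  \<or> c' = (\<alpha>, py \<beta>) \<and> opD (rs (\<alpha>, \<beta>)) \<and> opU (rs c'))"
proof -
 obtain \<alpha>' \<beta>' where c': "c' = (\<alpha>', \<beta>')" by (cases c')
 show ?thesis
  unfolding pot_def hpot_def vpot_def cell_def c'
  by (smt (verit) fst_conv snd_conv prod.inject px_nx nx_px py_ny ny_py)
qed

end

text \<open>The places where thick cells of different tracks are adjacent: columns \<open>k\<close>, \<open>k'\<close> in row \<open>l\<close>, and rows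
 \<open>l\<close>, \<open>l'\<close> in column \<open>k\<close>.\<close>

definition CH :: "(nat \<times> nat \<times> nat) list" where
 "CH = [(3, 4, 7),(3, 4, 8),(4, 5, 12),(4, 5, 13),(5, 6, 12),(5, 6, 13),(9, 10, 12),(9, 10, 13),(10, 11, 12),(10, 11, 13),(11, 12, 7),(11, 12, 8),(11, 12, 12),(11, 12, 13),(14, 4, 7),(14, 4, 8),(14, 4, 12),(14, 4, 13)]"

definition CV :: "(nat \<times> nat \<times> nat) list" where
 "CV = [(3, 4, 7),(3, 4, 8),(4, 5, 7),(4, 5, 8),(5, 6, 7),(5, 6, 8),(8, 9, 7),(8, 9, 8),(9, 10, 7),(9, 10, 8),(10, 11, 7),(10, 11, 8),(14, 15, 7),(14, 15, 8),(15, 16, 7),(15, 16, 8),(16, 17, 7),(16, 17, 8),(19, 20, 7),(19, 20, 8),(20, 21, 7),(20, 21, 8),(21, 22, 7),(21, 22, 8)]"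

text \<open>Shapes 7 and 8 are read as thick, their most permissive reading, so that one check of
  the table covers all formulas.\<close>

definition tog :: "nat \<Rightarrow> nat" where "tog s = (if s = 7 \<or> s = 8 then 9 else s)"

definition nxk :: "nat \<Rightarrow> nat list" where
 "nxk k = (if k = 13 then [13, 14] else if k = 14 then [4] else [Suc k])"

definition nyk :: "nat \<Rightarrow> nat list" where
 "nyk k = (if k = 22 then [23, 24] else if k = 23 then [23, 3] else [Suc k])"

text \<open>Two facing openings either continue one track or form a listed contact. A step from
  column 14 to column 4 changes the clause index, and in \<open>vok\<close> a step from row 21 to
  row 22 changes the symbol index, so there equality of track kinds would not mean equality of
  tracks.\<close>

definition hok :: "nat \<Rightarrow> nat \<Rightarrow> nat \<Rightarrow> bool" where
 "hok k k' l \<longleftrightarrow> (opR (tog (sh k l)) \<longrightarrow> opL (tog (sh k' l)) \<longrightarrow>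
   (tk k l = tk k' l \<and> tk k l \<noteq> 0 \<and> k \<noteq> 14 \<and> (tk k l = 12 \<or> k \<noteq> 3))
   \<or> ((k, k', l) \<in> set CH \<and> sh k l \<in> {7,8,9} \<and> sh k' l \<in> {7,8,9}))"

definition vok :: "nat \<Rightarrow> nat \<Rightarrow> nat \<Rightarrow> bool" where
 "vok l l' k \<longleftrightarrow> (opU (tog (sh k l)) \<longrightarrow> opD (tog (sh k l')) \<longrightarrow>
   (tk k l = tk k l' \<and> tk k l \<noteq> 0 \<and> (tk k l = 12 \<or> l \<noteq> 21))
   \<or> ((l, l', k) \<in> set CV \<and> sh k l = 9 \<and> sh k l' = 9))"

lemmas hok_simps = hok_def vok_def sh_simps tk_simps tog_def CH_def CV_def op_simps

lemma hcheck: "\<forall>k\<in>set [2..<15]. \<forall>k'\<in>set (nxk k). k' < 15 \<longrightarrow> (\<forall>l\<in>set [2..<25]. hok k k' l)"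
 unfolding set_2_25 set_2_15 ball_simps by (intro conjI TrueI) (simp add: nxk_def hok_simps)+

lemma vcheck: "\<forall>l\<in>set [2..<25]. \<forall>l'\<in>set (nyk l). l' < 25 \<longrightarrow> (\<forall>k\<in>set [2..<15]. vok l l' k)"
 unfolding set_2_25 set_2_15 ball_simps by (intro conjI TrueI) (simp add: nyk_def hok_simps)+

context layout begin

lemma vxD: "vx (k, j, g) \<Longrightarrow> k \<in> set [2..<15]" unfolding set_upt atLeastLessThan_iff by auto
lemma vyD: "vy (l, i, h) \<Longrightarrow> l \<in> set [2..<25]" unfolding set_upt atLeastLessThan_iff by auto

lemma nx_nxk: "nx (k, j, g) = (k', j', g') \<Longrightarrow> k' \<in> set (nxk k)"
 by (auto simp: nxk_def split: if_splits)

lemma ny_nyk: "ny (k, j, g) = (k', j', g') \<Longrightarrow> k' \<in> set (nyk k)"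
 by (auto simp: nyk_def split: if_splits)

lemma op_rs:
 "opR (rs ((k, j, g), (l, i, h))) \<Longrightarrow> opR (tog (sh k l))"
 "opL (rs ((k, j, g), (l, i, h))) \<Longrightarrow> opL (tog (sh k l))"
 "opU (rs ((k, j, g), (l, i, h))) \<Longrightarrow> opU (tog (sh k l))"
 "opD (rs ((k, j, g), (l, i, h))) \<Longrightarrow> opD (tog (sh k l))"
 by (auto simp: rs_def tog_def split: if_splits)

text \<open>The finite check of the table carries over to the drawing of any size, because every
  step between addresses projects to a step between kinds that \<open>nxk\<close> lists.\<close>

lemma hpot_trk:
 assumes "vx (k, j, g)" "vx (k', j', g')" "vy (l, i, h)"
  "hpot ((k, j, g), (l, i, h)) ((k', j', g'), (l, i, h))"
 shows "trk ((k, j, g), (l, i, h)) = trk ((k', j', g'), (l, i, h))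
  \<or> (k, k', l) \<in> set CH \<and> rs ((k, j, g), (l, i, h)) = 9 \<and> rs ((k', j', g'), (l, i, h)) = 9"
proof -
 have nx: "nx (k, j, g) = (k', j', g')" and o: "opR (rs ((k, j, g), (l, i, h)))"
  "opL (rs ((k', j', g'), (l, i, h)))" using assms(4) by (auto simp: hpot_def)
 have "k' < 15" using vxD[OF assms(2)] unfolding set_upt atLeastLessThan_iff by blast
 then have "hok k k' l"
  using hcheck[rule_format, OF vxD[OF assms(1)] nx_nxk[OF nx] _ vyD[OF assms(3)]] by blast
 then consider "tk k l = tk k' l" "k \<noteq> 14" "tk k l = 12 \<or> k \<noteq> 3"
  | "(k, k', l) \<in> set CH" "sh k l \<in> {7,8,9}" "sh k' l \<in> {7,8,9}"
  using op_rs[of k j g l i h] op_rs[of k' j' g' l i h] o unfolding hok_def by blast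
 then show ?thesis
 proof cases
  case 1
  then have "tk k l = 12 \<or> j = j'" using nx by (auto split: if_splits)
  then show ?thesis using 1(1) by (auto simp: trk_def)
 next
  case 2
  have "rs ((k, j, g), (l, i, h)) = 9" "rs ((k', j', g'), (l, i, h)) = 9"
   using 2 o by (auto simp: rs_def split: if_splits)
  then show ?thesis using 2 by blast
 qed
qed

lemma vpot_trk:
 assumes "vx (k, j, g)" "vy (l, i, h)" "vy (l', i', h')"
  "vpot ((k, j, g), (l, i, h)) ((k, j, g), (l', i', h'))"
 shows "trk ((k, j, g), (l, i, h)) = trk ((k, j, g), (l', i', h'))
  \<or> (l, l', k) \<in> set CV \<and> rs ((k, j, g), (l, i, h)) = 9 \<and> rs ((k, j, g), (l', i', h')) = 9"
proof -
 have ny: "ny (l, i, h) = (l', i', h')" and o: "opU (rs ((k, j, g), (l, i, h)))"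
  "opD (rs ((k, j, g), (l', i', h')))" using assms(4) by (auto simp: vpot_def)
 have l': "l' < 25" using vyD[OF assms(3)] unfolding set_upt atLeastLessThan_iff by blast
 have "l \<noteq> 24" using ny l' by auto
 then have "vok l l' k"
  using vcheck[rule_format, OF vyD[OF assms(2)] ny_nyk[OF ny] l' vxD[OF assms(1)]] by blast
 then consider "tk k l = tk k l'" "tk k l = 12 \<or> l \<noteq> 21"
  | "(l, l', k) \<in> set CV" "sh k l = 9" "sh k l' = 9"
  using op_rs[of k j g l i h] op_rs[of k j g l' i' h'] o unfolding vok_def by blast
 then show ?thesis
 proof cases
  case 1
  then have "tk k l = 12 \<or> i = i'" using ny by (auto split: if_splits)
  then show ?thesis using 1(1) by (auto simp: trk_def)
 next
  case 2
  then show ?thesis by (simp add: rs_def)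
 qed
qed

abbreviation nd :: "nat \<Rightarrow> nat \<Rightarrow> nat \<Rightarrow> nat \<Rightarrow> cell" where
 "nd k l i j \<equiv> ((k, j, 0), (l, i, 0))"

end

section \<open>From tours to satisfying assignments\<close>

text \<open>\<open>H c c'\<close> means that the tour passes between the cells \<open>c\<close> and \<open>c'\<close>.\<close>

locale cell_tour = layout +
 fixes H :: "cell \<Rightarrow> cell \<Rightarrow> bool"
 assumes Hsym: "H c c' \<Longrightarrow> H c' c"
  and Hpot: "H c c' \<Longrightarrow> pot c c'"
  and Hwire: "pot c c' \<Longrightarrow> rs c \<noteq> 9 \<Longrightarrow> H c c'"
  and HT: "cell c \<Longrightarrow> rs c = 9 \<Longrightarrow> \<exists>a b. a \<noteq> b \<and> {c'. H c c'} = {a, b}"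
  and Hconn: "cell c \<Longrightarrow> c \<in> S \<Longrightarrow> (\<And>x y. H x y \<Longrightarrow> x \<in> S \<Longrightarrow> y \<in> S) \<Longrightarrow> cell c' \<Longrightarrow> c' \<in> S"
begin

lemma Hcomm: "H c c' = H c' c" by (blast intro: Hsym)

text \<open>The contacts of a block form six stacks. A to D run downwards in the columns 7 and 8 and
  join the tracks 11-2-5-6, 6-5-3-4, 4-3-7-8 and 8-7-2-11. L runs inwards from the left through
  9-2-3-4 (with the border track 12 in place of 9 for the first clause), and R outwards to the right
  through 4-3-2-9. The digits tell which consecutive members meet. Every contact has two parallel
  edges; the abbreviation names one of them.\<close>

abbreviation "A12 i j \<equiv> H (nd 7 22 (Suc i) j) (nd 7 21 i j)"
abbreviation "A23 i j \<equiv> H (nd 7 21 i j) (nd 7 20 i j)"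
abbreviation "A34 i j \<equiv> H (nd 7 20 i j) (nd 7 19 i j)"
abbreviation "B12 i j \<equiv> H (nd 7 17 i j) (nd 7 16 i j)"
abbreviation "B23 i j \<equiv> H (nd 7 16 i j) (nd 7 15 i j)"
abbreviation "B34 i j \<equiv> H (nd 7 15 i j) (nd 7 14 i j)"
abbreviation "C12 i j \<equiv> H (nd 7 11 i j) (nd 7 10 i j)"
abbreviation "C23 i j \<equiv> H (nd 7 10 i j) (nd 7 9 i j)"
abbreviation "C34 i j \<equiv> H (nd 7 9 i j) (nd 7 8 i j)"
abbreviation "D12 i j \<equiv> H (nd 7 6 i j) (nd 7 5 i j)"
abbreviation "D23 i j \<equiv> H (nd 7 5 i j) (nd 7 4 i j)"
abbreviation "D34 i j \<equiv> H (nd 7 4 i j) (nd 7 3 i j)"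
abbreviation "L12 i j \<equiv> H (nd 4 13 i j) (px (4, j, 0), (13, i, 0))"
abbreviation "L23 i j \<equiv> H (nd 4 13 i j) (nd 5 13 i j)"
abbreviation "L34 i j \<equiv> H (nd 5 13 i j) (nd 6 13 i j)"
abbreviation "R12 i j \<equiv> H (nd 10 13 i j) (nd 9 13 i j)"
abbreviation "R23 i j \<equiv> H (nd 10 13 i j) (nd 11 13 i j)"
abbreviation "R34 i j \<equiv> H (nd 11 13 i j) (nd 12 13 i j)"

section \<open>Ladders of thick cells\<close>

text \<open>A wire uses all its openings, so it takes up one of the two tour edges of the thick cell
  at its end. A single edge of the thick cell remains free.\<close>

lemma tour_nbrs:
 assumes "rs c = 9" "pot c l" "rs l \<noteq> 9"
 obtains w where "{c'. H c c'} = {l, w}" "w \<noteq> l" "pot c w"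
proof -
 have "cell c" using assms(2) by (simp add: pot_def)
 then obtain u v where uv: "u \<noteq> v" "{c'. H c c'} = {u, v}" using HT assms(1) by blast
 have "H c l" using Hwire[of l c] assms(2,3) pot_sym Hsym by blast
 then have "l \<in> {u, v}" using uv(2) by blast
 then obtain w where "{c'. H c c'} = {l, w}" "w \<noteq> l" using uv by blast
 then show ?thesis using that[of w] Hpot by blast
qed

definition "one3 p q r \<longleftrightarrow> p \<and> \<not> q \<and> \<not> r \<or> \<not> p \<and> q \<and> \<not> r \<or> \<not> p \<and> \<not> q \<and> r"

lemma ex3:
 assumes "rs c = 9" "pot c l" "rs l \<noteq> 9"
  "\<And>x. pot c x \<Longrightarrow> x = l \<or> x = q \<or> x = a \<or> x = b" "l \<noteq> q" "l \<noteq> a" "l \<noteq> b" "q \<noteq> a" "q \<noteq> b" "a \<noteq> b"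
 shows "one3 (H c q) (H c a) (H c b)"
proof -
 obtain w where w: "{c'. H c c'} = {l, w}" "w \<noteq> l" "pot c w" using tour_nbrs assms(1-3) by blast
 moreover have "H c x \<longleftrightarrow> x = l \<or> x = w" for x using w(1) by blast
 ultimately show ?thesis using assms(4-) unfolding one3_def by metis
qed

lemma ex2:
 assumes "rs c = 9" "pot c l" "rs l \<noteq> 9"
  "\<And>x. pot c x \<Longrightarrow> x = l \<or> x = q \<or> x = a" "l \<noteq> q" "l \<noteq> a" "q \<noteq> a"
 shows "H c q \<longleftrightarrow> \<not> H c a"
proof -
 obtain w where w: "{c'. H c c'} = {l, w}" "w \<noteq> l" "pot c w" using tour_nbrs assms(1-3) by blast
 moreover have "H c x \<longleftrightarrow> x = l \<or> x = w" for x using w(1) by blast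
 ultimately show ?thesis using assms(4-) by metis
qed

lemma potE:
 assumes "pot (\<alpha>, \<beta>) x"
 shows "x = (nx \<alpha>, \<beta>) \<and> opL (rs (nx \<alpha>, \<beta>)) \<or> x = (px \<alpha>, \<beta>) \<and> opR (rs (px \<alpha>, \<beta>))
  \<or> x = (\<alpha>, ny \<beta>) \<and> opD (rs (\<alpha>, ny \<beta>)) \<or> x = (\<alpha>, py \<beta>) \<and> opU (rs (\<alpha>, py \<beta>))"
 using assms unfolding pot_iff by blast

abbreviation "ladder a b r0 r1 r2 r3 \<equiv>
 (H (a r0) (a r1) \<longleftrightarrow> H (b r0) (b r1)) \<and> (H (a r1) (a r2) \<longleftrightarrow> H (b r1) (b r2)) \<and> (H (a r2) (a r3) \<longleftrightarrow> H (b r2) (b r3))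
 \<and> \<not> (H (a r0) (a r1) \<and> H (a r1) (a r2)) \<and> \<not> (H (a r1) (a r2) \<and> H (a r2) (a r3))"

text \<open>Each inner cell has one free edge: across to its partner, back, or onward. If the two
  rails agree at the first contact, the partners make the same choice in each further row, and no
  inner cell can take part in two contacts.\<close>

lemma ladderI:
 assumes "H (a r0) (a r1) \<longleftrightarrow> H (b r0) (b r1)"
  "\<And>c d. c = a \<and> d = b \<or> c = b \<and> d = a \<Longrightarrow> one3 (H (c r1) (d r1)) (H (c r1) (c r0)) (H (c r1) (c r2))
   \<and> one3 (H (c r2) (d r2)) (H (c r2) (c r1)) (H (c r2) (c r3))"
 shows "ladder a b r0 r1 r2 r3"
proof -
 have s: "H (b r) (a r) = H (a r) (b r)" "H (a r1) (a r0) = H (a r0) (a r1)" "H (a r2) (a r1) = H (a r1) (a r2)"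
  "H (b r1) (b r0) = H (b r0) (b r1)" "H (b r2) (b r1) = H (b r1) (b r2)" for r
  by (rule Hcomm)+
 show ?thesis using assms(1) assms(2)[of a b] assms(2)[of b a] unfolding s one3_def by argo
qed

lemma stack:
 assumes "i < L" "j < M"
  and r: "r0 = (22, Suc i, 0) \<and> r1 = (21, i, 0) \<and> r2 = (20, i, 0) \<and> r3 = (19, i, 0)
   \<or> r0 = (17, i, 0) \<and> r1 = (16, i, 0) \<and> r2 = (15, i, 0) \<and> r3 = (14, i, 0)
   \<or> r0 = (11, i, 0) \<and> r1 = (10, i, 0) \<and> r2 = (9, i, 0) \<and> r3 = (8, i, 0)
   \<or> r0 = (6, i, 0) \<and> r1 = (5, i, 0) \<and> r2 = (4, i, 0) \<and> r3 = (3, i, 0)"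
 shows "ladder (Pair (7, j, 0)) (Pair (8, j, 0)) r0 r1 r2 r3"
proof -
 \<comment> \<open>The forced edge of the top cell leads up into a wire, except in row 11, where the
   cell above is empty and the wire lies beside it.\<close>
 have 1: "H ((m, j, 0), r0) ((m', j, 0), r0) \<longleftrightarrow> \<not> H ((m, j, 0), r0) ((m, j, 0), r1)"
  if "m = 7 \<and> m' = 8 \<and> k = 6 \<or> m = 8 \<and> m' = 7 \<and> k = 9" for m m' k :: nat
  using r that
  by - (elim disjE conjE; rule ex2[of _ "if r0 = (11, i, 0) then ((k, j, 0), r0) else ((m, j, 0), ny r0)"];
    (((drule potE)?, auto simp: rs_def sh_simps split: if_splits; fail)
     | use assms(1,2) L M gx gy in \<open>auto simp: pot_iff cell_def rs_def sh_simps split: if_splits\<close>))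
 have 2: "one3 (H ((m, j, 0), r1) ((m', j, 0), r1)) (H ((m, j, 0), r1) ((m, j, 0), r0)) (H ((m, j, 0), r1) ((m, j, 0), r2))"
  if "m = 7 \<and> m' = 8 \<and> k = 6 \<or> m = 8 \<and> m' = 7 \<and> k = 9" for m m' k :: nat
  using r that
  by - (elim disjE conjE; rule ex3[of _ "((k, j, 0), r1)"];
    (((drule potE)?, auto simp: rs_def sh_simps split: if_splits; fail)
     | use assms(1,2) L M gx gy in \<open>auto simp: pot_iff cell_def rs_def sh_simps split: if_splits\<close>))
 have 3: "one3 (H ((m, j, 0), r2) ((m', j, 0), r2)) (H ((m, j, 0), r2) ((m, j, 0), r1)) (H ((m, j, 0), r2) ((m, j, 0), r3))"
  if "m = 7 \<and> m' = 8 \<and> k = 6 \<or> m = 8 \<and> m' = 7 \<and> k = 9" for m m' k :: nat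
  using r that
  by - (elim disjE conjE; rule ex3[of _ "((k, j, 0), r2)"];
    (((drule potE)?, auto simp: rs_def sh_simps split: if_splits; fail)
     | use assms(1,2) L M gx gy in \<open>auto simp: pot_iff cell_def rs_def sh_simps split: if_splits\<close>))
 show ?thesis
 proof (rule ladderI)
  show "H ((7, j, 0), r0) ((7, j, 0), r1) \<longleftrightarrow> H ((8, j, 0), r0) ((8, j, 0), r1)"
   using 1[of 7 8 6] 1[of 8 7 9] Hcomm by blast
  fix c d :: "nat \<times> nat \<times> nat \<Rightarrow> cell"
  assume "c = Pair (7, j, 0) \<and> d = Pair (8, j, 0) \<or> c = Pair (8, j, 0) \<and> d = Pair (7::nat, j, 0::nat)"
  then show "one3 (H (c r1) (d r1)) (H (c r1) (c r0)) (H (c r1) (c r2)) \<and> one3 (H (c r2) (d r2)) (H (c r2) (c r1)) (H (c r2) (c r3))"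
   using 2[of 7 8 6] 2[of 8 7 9] 3[of 7 8 6] 3[of 8 7 9] by auto
 qed
qed

lemmas stackA = stack[of i j "(22, Suc i, 0)" "(21, i, 0)" "(20, i, 0)" "(19, i, 0)" for i j, simplified]
lemmas stackB = stack[of i j "(17, i, 0)" "(16, i, 0)" "(15, i, 0)" "(14, i, 0)" for i j, simplified]
lemmas stackC = stack[of i j "(11, i, 0)" "(10, i, 0)" "(9, i, 0)" "(8, i, 0)" for i j, simplified]
lemmas stackD = stack[of i j "(6, i, 0)" "(5, i, 0)" "(4, i, 0)" "(3, i, 0)" for i j, simplified]

text \<open>Without an occurrence the switchable cell is a vertical wire and is not open
  sideways.\<close>

lemma n6: "\<not> occN i j \<Longrightarrow> l = 12 \<or> l = 13 \<Longrightarrow> \<not> H (nd 5 l i j) (nd 6 l i j)"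
 by (rule notI, drule Hpot, drule potE) (auto simp: rs_def sh_simps)

lemma n9: "\<not> occP i j \<Longrightarrow> l = 12 \<or> l = 13 \<Longrightarrow> \<not> H (nd 10 l i j) (nd 9 l i j)"
 by (rule notI, drule Hpot, drule potE) (auto simp: rs_def sh_simps)

text \<open>The difference to \<open>stack\<close> is that the innermost cells are thick only at an
  occurrence. Elsewhere the innermost contact is absent on both rails, so the agreement from which
  \<open>ladderI\<close> starts holds all the same.\<close>

lemma side:
 assumes "i < L" "j < M"
  and k: "k0 = (6, j, 0) \<and> k1 = (5, j, 0) \<and> k2 = (4, j, 0) \<and> k3 = px (4, j, 0) \<and> oc = occN i j
   \<or> k0 = (9, j, 0) \<and> k1 = (10, j, 0) \<and> k2 = (11, j, 0) \<and> k3 = (12, j, 0) \<and> oc = occP i j"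
 shows "ladder (\<lambda>k. (k, (13, i, 0))) (\<lambda>k. (k, (12, i, 0))) k0 k1 k2 k3"
proof -
 have 1: "H (k0, m, i, 0) (k0, m', i, 0) \<longleftrightarrow> \<not> H (k0, m, i, 0) (k1, m, i, 0)"
  if oc "m = 13 \<and> m' = 12 \<and> l = 14 \<or> m = 12 \<and> m' = 13 \<and> l = 11" for m m' l :: nat
  using k that
  by - (elim disjE conjE; rule ex2[of _ "(k0, l, i, 0)"];
    (((drule potE)?, auto simp: rs_def sh_simps split: if_splits; fail)
     | use assms(1,2) L M gx gy in \<open>auto simp: pot_iff cell_def rs_def sh_simps split: if_splits\<close>))
 have 2: "one3 (H (k1, m, i, 0) (k1, m', i, 0)) (H (k1, m, i, 0) (k0, m, i, 0)) (H (k1, m, i, 0) (k2, m, i, 0))"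
  if "m = 13 \<and> m' = 12 \<and> l = 14 \<or> m = 12 \<and> m' = 13 \<and> l = 11" for m m' l :: nat
  using k that
  by - (elim disjE conjE; rule ex3[of _ "(k1, l, i, 0)"];
    (((drule potE)?, auto simp: rs_def sh_simps split: if_splits; fail)
     | use assms(1,2) L M gx gy in \<open>auto simp: pot_iff cell_def rs_def sh_simps split: if_splits\<close>))
 have 3: "one3 (H (k2, m, i, 0) (k2, m', i, 0)) (H (k2, m, i, 0) (k1, m, i, 0)) (H (k2, m, i, 0) (k3, m, i, 0))"
  if "m = 13 \<and> m' = 12 \<and> l = 14 \<or> m = 12 \<and> m' = 13 \<and> l = 11" for m m' l :: nat
  using k that
  by - (elim disjE conjE; rule ex3[of _ "(k2, l, i, 0)"];
    (((drule potE)?, auto simp: rs_def sh_simps split: if_splits; fail)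
     | use assms(1,2) L M gx gy in \<open>auto simp: pot_iff cell_def rs_def sh_simps split: if_splits\<close>))
 show ?thesis
 proof (rule ladderI)
  show "H (k0, 13, i, 0) (k1, 13, i, 0) \<longleftrightarrow> H (k0, 12, i, 0) (k1, 12, i, 0)"
  proof (cases oc)
   case True
   then show ?thesis using 1[OF True, of 13 12 14] 1[OF True, of 12 13 11] Hcomm by blast
  next
   case False
   have "\<not> H (k0, l, i, 0) (k1, l, i, 0)" if "l = 12 \<or> l = 13" for l
    using k False n6[of i j l] n9[of i j l] that Hcomm by metis
   then show ?thesis by blast
  qed
  fix c d :: "nat \<times> nat \<times> nat \<Rightarrow> cell"
  assume "c = (\<lambda>k. (k, 13, i, 0)) \<and> d = (\<lambda>k. (k, 12, i, 0)) \<or> c = (\<lambda>k. (k, 12, i, 0)) \<and> d = (\<lambda>k. (k, 13::nat, i, 0::nat))"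
  then show "one3 (H (c k1) (d k1)) (H (c k1) (c k0)) (H (c k1) (c k2)) \<and> one3 (H (c k2) (d k2)) (H (c k2) (c k1)) (H (c k2) (c k3))"
   using 2[of 13 12 14] 2[of 12 13 11] 3[of 13 12 14] 3[of 12 13 11] by auto
 qed
qed

lemma leftS:
 assumes "i < L" "j < M"
 shows "(L34 i j \<longleftrightarrow> H (nd 5 12 i j) (nd 6 12 i j)) \<and> (L23 i j \<longleftrightarrow> H (nd 4 12 i j) (nd 5 12 i j))
  \<and> (L12 i j \<longleftrightarrow> H (nd 4 12 i j) (px (4, j, 0), (12, i, 0))) \<and> \<not> (L34 i j \<and> L23 i j) \<and> \<not> (L12 i j \<and> L23 i j)"
 using side[OF assms, of "(6, j, 0)" "(5, j, 0)" "(4, j, 0)" "px (4, j, 0)"]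
 unfolding Hcomm[of "nd 6 _ i j"] Hcomm[of "nd 5 _ i j" "nd 4 _ i j"] by blast

lemma rightS:
 assumes "i < L" "j < M"
 shows "(R12 i j \<longleftrightarrow> H (nd 10 12 i j) (nd 9 12 i j)) \<and> (R23 i j \<longleftrightarrow> H (nd 10 12 i j) (nd 11 12 i j))
  \<and> (R34 i j \<longleftrightarrow> H (nd 11 12 i j) (nd 12 12 i j)) \<and> \<not> (R12 i j \<and> R23 i j) \<and> \<not> (R34 i j \<and> R23 i j)"
 using side[OF assms, of "(9, j, 0)" "(10, j, 0)" "(11, j, 0)" "(12, j, 0)"]
 unfolding Hcomm[of "nd 9 _ i j"] by blast

section \<open>Crossings from one track to another\<close>

lemma crossing:
 assumes "H ((k, j, g), (l, i, h)) ((k', j', g'), (l', i', h'))"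
  "trk ((k, j, g), (l, i, h)) \<noteq> trk ((k', j', g'), (l', i', h'))"
 shows "(l', i', h') = (l, i, h) \<and> nx (k, j, g) = (k', j', g') \<and> (k, k', l) \<in> set CH
  \<or> (l', i', h') = (l, i, h) \<and> nx (k', j', g') = (k, j, g) \<and> (k', k, l) \<in> set CH
  \<or> (k', j', g') = (k, j, g) \<and> ny (l, i, h) = (l', i', h') \<and> (l, l', k) \<in> set CV
  \<or> (k', j', g') = (k, j, g) \<and> ny (l', i', h') = (l, i, h) \<and> (l', l, k) \<in> set CV"
proof -
 let ?c = "((k, j, g), (l, i, h))" and ?c' = "((k', j', g'), (l', i', h'))"
 have p: "pot ?c ?c'" using Hpot assms(1) by blast
 then have v: "vx (k, j, g)" "vx (k', j', g')" "vy (l, i, h)" "vy (l', i', h')"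
  by (simp_all add: pot_def cell_def del: vx.simps vy.simps)
 from p consider "hpot ?c ?c'" | "hpot ?c' ?c" | "vpot ?c ?c'" | "vpot ?c' ?c"
  unfolding pot_def by blast
 then show ?thesis
 proof cases
  case 1
  then have e: "(l', i', h') = (l, i, h)" "nx (k, j, g) = (k', j', g')" by (auto simp: hpot_def)
  then show ?thesis using hpot_trk[of k j g k' j' g' l i h] v 1 assms(2) by metis
 next
  case 2
  then have e: "(l', i', h') = (l, i, h)" "nx (k', j', g') = (k, j, g)" by (auto simp: hpot_def)
  then show ?thesis using hpot_trk[of k' j' g' k j g l i h] v 2 assms(2) by metis
 next
  case 3
  then have e: "(k', j', g') = (k, j, g)" "ny (l, i, h) = (l', i', h')" by (auto simp: vpot_def)
  then show ?thesis using vpot_trk[of k j g l i h l' i' h'] v 3 assms(2) by metis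
 next
  case 4
  then have e: "(k', j', g') = (k, j, g)" "ny (l', i', h') = (l, i, h)" by (auto simp: vpot_def)
  then show ?thesis using vpot_trk[of k j g l' i' h' l i h] v 4 assms(2) by metis
 qed
qed

text \<open>Connectedness of the tour in the form used below: a set of tracks that does not contain
  all cells is left by some edge of the tour.\<close>

lemma leave:
 assumes "cell c0" "trk c0 \<in> TT" "cell c1" "trk c1 \<notin> TT"
 obtains c c' where "H c c'" "trk c \<in> TT" "trk c' \<notin> TT"
proof (rule ccontr)
 assume "\<not> thesis"
 then have "\<And>x y. H x y \<Longrightarrow> x \<in> {c. trk c \<in> TT} \<Longrightarrow> y \<in> {c. trk c \<in> TT}" using that by blast
 then have "c1 \<in> {c. trk c \<in> TT}" using Hconn[of c0 "{c. trk c \<in> TT}" c1] assms by blast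
 then show False using assms(4) by simp
qed

text \<open>A normal form that locates both cells in the table, so that the finite lists
  \<open>CH\<close> and \<open>CV\<close> can be run through. The border track is excluded because
  its value of \<open>trk\<close> forgets the row.\<close>

lemma cross_cases:
 assumes "H c c'" "trk c = (t, i, j)" "trk c' \<noteq> trk c" "t \<noteq> 12"
 obtains k g l h k' j' g' where "(k, k', l) \<in> set CH" "tk k l = t" "nx (k, j, g) = (k', j', g')"
   "c = ((k, j, g), (l, i, h))" "c' = ((k', j', g'), (l, i, h))" "vx (k, j, g)" "vx (k', j', g')" "vy (l, i, h)" "H c c'" "H c' c"
 | k g l h k' j' g' where "(k', k, l) \<in> set CH" "tk k l = t" "nx (k', j', g') = (k, j, g)"
   "c = ((k, j, g), (l, i, h))" "c' = ((k', j', g'), (l, i, h))" "vx (k, j, g)" "vx (k', j', g')" "vy (l, i, h)" "H c c'" "H c' c"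
 | k g l h l' i' h' where "(l, l', k) \<in> set CV" "tk k l = t" "ny (l, i, h) = (l', i', h')"
   "c = ((k, j, g), (l, i, h))" "c' = ((k, j, g), (l', i', h'))" "vx (k, j, g)" "vy (l, i, h)" "vy (l', i', h')" "H c c'" "H c' c"
 | k g l h l' i' h' where "(l', l, k) \<in> set CV" "tk k l = t" "ny (l', i', h') = (l, i, h)"
   "c = ((k, j, g), (l, i, h))" "c' = ((k, j, g), (l', i', h'))" "vx (k, j, g)" "vy (l, i, h)" "vy (l', i', h')" "H c c'" "H c' c"
proof -
 obtain k j1 g l i1 h where c0: "c = ((k, j1, g), (l, i1, h))" by (cases c) auto
 then have tk: "tk k l = t" "i1 = i" "j1 = j" using assms(2,4) by (auto simp: trk_def split: if_splits)
 note c = c0[unfolded tk]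
 obtain k' j' g' l' i' h' where c': "c' = ((k', j', g'), (l', i', h'))" by (cases c') auto
 have v: "vx (k, j, g)" "vx (k', j', g')" "vy (l, i, h)" "vy (l', i', h')"
  using Hpot[OF assms(1)] by (simp_all add: c c' pot_def cell_def del: vx.simps vy.simps)
 note rest = v assms(1) Hsym[OF assms(1)]
 show thesis
  using crossing[OF assms(1)[unfolded c c'] assms(3)[symmetric, unfolded c c']]
 proof (elim disjE conjE)
  assume a: "(l', i', h') = (l, i, h)" "nx (k, j, g) = (k', j', g')" "(k, k', l) \<in> set CH"
  show thesis by (rule that(1)[OF a(3) tk(1) a(2) c c'[unfolded a(1)] v(1-3) rest(5,6)])
 next
  assume a: "(l', i', h') = (l, i, h)" "nx (k', j', g') = (k, j, g)" "(k', k, l) \<in> set CH"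
  show thesis by (rule that(2)[OF a(3) tk(1) a(2) c c'[unfolded a(1)] v(1-3) rest(5,6)])
 next
  assume a: "(k', j', g') = (k, j, g)" "ny (l, i, h) = (l', i', h')" "(l, l', k) \<in> set CV"
  show thesis by (rule that(3)[OF a(3) tk(1) a(2) c c'[unfolded a(1)] v(1,3,4) rest(5,6)])
 next
  assume a: "(k', j', g') = (k, j, g)" "ny (l', i', h') = (l, i, h)" "(l', l, k) \<in> set CV"
  show thesis by (rule that(4)[OF a(3) tk(1) a(2) c c'[unfolded a(1)] v(1,3,4) rest(5,6)])
 qed
qed

lemmas CHV = CH_def CV_def list.set insert_iff empty_iff prod.inject simp_thms

text \<open>For each kind of track, this and the following lemmas list the ways out. The contact is
  named only where a later argument draws on it; otherwise the track that is entered is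
  enough.\<close>

lemma cross_6:
 assumes "H c c'" "trk c = (6, i, j)" "trk c' \<noteq> trk c"
 shows "(trk c' = (5, i, j) \<and> (\<exists>k\<in>{7,8}. H (nd k 20 i j) (nd k 19 i j)))
  \<or> (trk c' = (5, i, j) \<and> (\<exists>k\<in>{7,8}. H (nd k 17 i j) (nd k 16 i j)))"
 by ((rule cross_cases[OF assms], simp); simp only: CHV; elim FalseE disjE conjE;
  (simp add: trk_def tk_simps split: if_splits)?; force?)

lemma cross_5:
 assumes "H c c'" "trk c = (5, i, j)" "trk c' \<noteq> trk c"
 shows "(trk c' = (6, i, j))
  \<or> (trk c' = (2, i, j) \<and> (\<exists>k\<in>{7,8}. H (nd k 21 i j) (nd k 20 i j)))
  \<or> (trk c' = (3, i, j) \<and> (\<exists>k\<in>{7,8}. H (nd k 16 i j) (nd k 15 i j)))"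
 by ((rule cross_cases[OF assms], simp); simp only: CHV; elim FalseE disjE conjE;
  (simp add: trk_def tk_simps split: if_splits)?; force?)

lemma cross_8:
 assumes "H c c'" "trk c = (8, i, j)" "trk c' \<noteq> trk c"
 shows "(trk c' = (7, i, j) \<and> (\<exists>k\<in>{7,8}. H (nd k 9 i j) (nd k 8 i j)))
  \<or> (trk c' = (7, i, j) \<and> (\<exists>k\<in>{7,8}. H (nd k 6 i j) (nd k 5 i j)))"
 by ((rule cross_cases[OF assms], simp); simp only: CHV; elim FalseE disjE conjE;
  (simp add: trk_def tk_simps split: if_splits)?; force?)

lemma cross_7:
 assumes "H c c'" "trk c = (7, i, j)" "trk c' \<noteq> trk c"
 shows "(trk c' = (8, i, j))
  \<or> (trk c' = (3, i, j) \<and> (\<exists>k\<in>{7,8}. H (nd k 10 i j) (nd k 9 i j)))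
  \<or> (trk c' = (2, i, j) \<and> (\<exists>k\<in>{7,8}. H (nd k 5 i j) (nd k 4 i j)))"
 by ((rule cross_cases[OF assms], simp); simp only: CHV; elim FalseE disjE conjE;
  (simp add: trk_def tk_simps split: if_splits)?; force?)

lemma cross_4:
 assumes "H c c'" "trk c = (4, i, j)" "trk c' \<noteq> trk c"
 shows "(trk c' = (3, i, j) \<and> (\<exists>k\<in>{7,8}. H (nd k 15 i j) (nd k 14 i j)))
  \<or> (trk c' = (3, i, j) \<and> (\<exists>k\<in>{7,8}. H (nd k 11 i j) (nd k 10 i j)))
  \<or> (trk c' = (3, i, j) \<and> (\<exists>l\<in>{12,13}. H (nd 5 l i j) (nd 6 l i j)))
  \<or> (trk c' = (3, i, j) \<and> (\<exists>l\<in>{12,13}. H (nd 10 l i j) (nd 9 l i j)))"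
 by ((rule cross_cases[OF assms], simp); simp only: CHV; elim FalseE disjE conjE;
  (simp add: trk_def tk_simps split: if_splits)?; force?)

lemma cross_3:
 assumes "H c c'" "trk c = (3, i, j)" "trk c' \<noteq> trk c"
 shows "(trk c' = (4, i, j))
  \<or> (trk c' = (5, i, j) \<and> (\<exists>k\<in>{7,8}. H (nd k 16 i j) (nd k 15 i j)))
  \<or> (trk c' = (7, i, j) \<and> (\<exists>k\<in>{7,8}. H (nd k 10 i j) (nd k 9 i j)))
  \<or> (trk c' = (2, i, j) \<and> (\<exists>l\<in>{12,13}. H (nd 4 l i j) (nd 5 l i j)))
  \<or> (trk c' = (2, i, j) \<and> (\<exists>l\<in>{12,13}. H (nd 10 l i j) (nd 11 l i j)))"
 by ((rule cross_cases[OF assms], simp); simp only: CHV; elim FalseE disjE conjE;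
  (simp add: trk_def tk_simps split: if_splits)?; force?)

lemma cross_11:
 assumes "H c c'" "trk c = (11, i, j)" "trk c' \<noteq> trk c"
 shows "(i < L \<and> j < M \<and> (\<exists>k\<in>{7,8}. H (nd k 4 i j) (nd k 3 i j)))
  \<or> (\<exists>i'. i = Suc i' \<and> i' < L \<and> j < M \<and> (\<exists>k\<in>{7,8}. H (nd k 22 (Suc i') j) (nd k 21 i' j)))"
 by ((rule cross_cases[OF assms], simp); simp only: CHV; elim FalseE disjE conjE;
  (simp add: trk_def tk_simps split: if_splits)?; force?)

lemma cross_9:
 assumes "H c c'" "trk c = (9, i, j)" "trk c' \<noteq> trk c"
 shows "(Suc j < M \<and> (\<exists>l\<in>{12,13}. H (nd 11 l i j) (nd 12 l i j)))
  \<or> (Suc j < M \<and> (\<exists>l\<in>{12,13}. H (nd 4 l i (Suc j)) (nd 14 l i j)))"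
 by ((rule cross_cases[OF assms], simp); simp only: CHV; elim FalseE disjE conjE;
  (simp add: trk_def tk_simps split: if_splits)?; force?)

lemma cell_node: "i < L \<Longrightarrow> j < M \<Longrightarrow> k \<in> {4,7} \<Longrightarrow> cell (nd k 4 i j) \<and> trk (nd k 4 i j) = (2, i, j)"
 by (auto simp: cell_def rs_def trk_def sh_simps tk_simps)

lemma iso_node:
 assumes "i < L" "j < M" "cell c0" "trk c0 \<in> TT" "(2, i, j) \<notin> TT"
 shows "\<exists>c c'. H c c' \<and> trk c \<in> TT \<and> trk c' \<notin> TT"
 using leave[of c0 TT "nd 4 4 i j"] assms cell_node[OF assms(1,2), of 4] by (metis insertI1)

lemma bex2: "(\<exists>k\<in>{a, b}. P k) \<longleftrightarrow> P a \<or> P b" by simp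

section \<open>Exits forced by connectedness\<close>

text \<open>Ring \<open>6\<close> touches nothing but the surrounding ring \<open>5\<close>, once
  above and once below, and a connected tour has to leave it.\<close>

lemma iso_Y1:
 assumes "i < L" "j < M" shows "A34 i j \<or> B12 i j"
proof -
 let ?T = "{(6, i, j)}"
 have c: "cell (nd 7 19 i j)" "trk (nd 7 19 i j) = (6, i, j)"
  using assms by (auto simp: cell_def rs_def trk_def sh_simps tk_simps)
 have m: "trk (nd 7 19 i j) \<in> ?T" "(2::nat, i, j) \<notin> ?T" unfolding c(2) by auto
 obtain c c' where *: "H c c'" "trk c \<in> ?T" "trk c' \<notin> ?T"
  using iso_node[OF assms c(1) m] by blast
 then have t: "trk c = (6, i, j)" "trk c' \<noteq> trk c" by auto
 show ?thesis
  using cross_6[OF *(1) t, unfolded bex2] stackA[OF assms] stackB[OF assms] by metis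
qed

lemma iso_Y3:
 assumes "i < L" "j < M" shows "C34 i j \<or> D12 i j"
proof -
 let ?T = "{(8, i, j)}"
 have c: "cell (nd 7 8 i j)" "trk (nd 7 8 i j) = (8, i, j)"
  using assms by (auto simp: cell_def rs_def trk_def sh_simps tk_simps)
 have m: "trk (nd 7 8 i j) \<in> ?T" "(2::nat, i, j) \<notin> ?T" unfolding c(2) by auto
 obtain c c' where *: "H c c'" "trk c \<in> ?T" "trk c' \<notin> ?T"
  using iso_node[OF assms c(1) m] by blast
 then have t: "trk c = (8, i, j)" "trk c' \<noteq> trk c" by auto
 show ?thesis
  using cross_8[OF *(1) t, unfolded bex2] stackC[OF assms] stackD[OF assms] by metis
qed

text \<open>Taken together, the rings \<open>5\<close> and \<open>6\<close> can be left only upwards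
  to ring \<open>2\<close> or downwards to ring \<open>3\<close>.\<close>

lemma iso_Z1:
 assumes "i < L" "j < M" shows "A23 i j \<or> B23 i j"
proof -
 let ?T = "{(5, i, j), (6, i, j)}"
 have c: "cell (nd 7 19 i j)" "trk (nd 7 19 i j) = (6, i, j)"
  using assms by (auto simp: cell_def rs_def trk_def sh_simps tk_simps)
 have m: "trk (nd 7 19 i j) \<in> ?T" "(2::nat, i, j) \<notin> ?T" unfolding c(2) by auto
 obtain c c' where *: "H c c'" "trk c \<in> ?T" "trk c' \<notin> ?T"
  using iso_node[OF assms c(1) m] by blast
 then consider "trk c = (5, i, j)" | "trk c = (6, i, j)" by blast
 then show ?thesis
 proof cases
  case 1
  then have n: "trk c' \<noteq> trk c" "trk c' \<noteq> (6, i, j)" using *(3) by auto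
  show ?thesis using cross_5[OF *(1) 1 n(1), unfolded bex2] n(2) stackA[OF assms] stackB[OF assms] by metis
 next
  case 2
  then have n: "trk c' \<noteq> trk c" "trk c' \<noteq> (5, i, j)" using *(3) by auto
  show ?thesis using cross_6[OF *(1) 2 n(1)] n(2) by blast
 qed
qed

lemma iso_Z3:
 assumes "i < L" "j < M" shows "C23 i j \<or> D23 i j"
proof -
 let ?T = "{(7, i, j), (8, i, j)}"
 have c: "cell (nd 7 8 i j)" "trk (nd 7 8 i j) = (8, i, j)"
  using assms by (auto simp: cell_def rs_def trk_def sh_simps tk_simps)
 have m: "trk (nd 7 8 i j) \<in> ?T" "(2::nat, i, j) \<notin> ?T" unfolding c(2) by auto
 obtain c c' where *: "H c c'" "trk c \<in> ?T" "trk c' \<notin> ?T"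
  using iso_node[OF assms c(1) m] by blast
 then consider "trk c = (7, i, j)" | "trk c = (8, i, j)" by blast
 then show ?thesis
 proof cases
  case 1
  then have n: "trk c' \<noteq> trk c" "trk c' \<noteq> (8, i, j)" using *(3) by auto
  show ?thesis using cross_7[OF *(1) 1 n(1), unfolded bex2] n(2) stackC[OF assms] stackD[OF assms] by metis
 next
  case 2
  then have n: "trk c' \<noteq> trk c" "trk c' \<noteq> (7, i, j)" using *(3) by auto
  show ?thesis using cross_8[OF *(1) 2 n(1)] n(2) by blast
 qed
qed

text \<open>Using both outer contacts of ring \<open>5\<close> would block both of its inner
  contacts by the exclusions in the ladders, and ring \<open>6\<close> would be cut off. This is
  what rings \<open>6\<close> and \<open>8\<close> are for: they turn "at least one" into "exactly
  one".\<close>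

lemma strict_Z1: "i < L \<Longrightarrow> j < M \<Longrightarrow> \<not> (A23 i j \<and> B23 i j)"
 using iso_Y1[of i j] stackA[of i j] stackB[of i j] by blast

lemma strict_Z3: "i < L \<Longrightarrow> j < M \<Longrightarrow> \<not> (C23 i j \<and> D23 i j)"
 using iso_Y3[of i j] stackC[of i j] stackD[of i j] by blast

lemma iso_S2:
 assumes "i < L" "j < M" shows "B34 i j \<or> C12 i j \<or> L34 i j \<or> R12 i j"
proof -
 let ?T = "{(4, i, j)}"
 have c: "cell (nd 7 14 i j)" "trk (nd 7 14 i j) = (4, i, j)"
  using assms by (auto simp: cell_def rs_def trk_def sh_simps tk_simps)
 have m: "trk (nd 7 14 i j) \<in> ?T" "(2::nat, i, j) \<notin> ?T" unfolding c(2) by auto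
 obtain c c' where *: "H c c'" "trk c \<in> ?T" "trk c' \<notin> ?T"
  using iso_node[OF assms c(1) m] by blast
 then have t: "trk c = (4, i, j)" "trk c' \<noteq> trk c" by auto
 show ?thesis
  using cross_4[OF *(1) t, unfolded bex2] stackB[OF assms] stackC[OF assms] leftS[OF assms] rightS[OF assms] by metis
qed

text \<open>A vertical track touches only the block above it and the block below it. At the two ends
  of a column one of these is missing, which anchors the counting argument in
  \<open>column_extra\<close>.\<close>

lemma iso_S4:
 assumes "i \<le> L" "j < M" shows "(i < L \<and> D34 i j) \<or> (\<exists>i'. i = Suc i' \<and> i' < L \<and> A12 i' j)"
proof -
 let ?T = "{(11, i, j)}"
 define c0 where "c0 = (if i < L then nd 7 3 i j else nd 7 22 i j)"
 have c: "cell c0" "trk c0 = (11, i, j)"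
  using assms L by (auto simp: c0_def cell_def rs_def trk_def sh_simps tk_simps)
 have m: "trk c0 \<in> ?T" "(2::nat, 0::nat, j) \<notin> ?T" unfolding c(2) by auto
 obtain c c' where *: "H c c'" "trk c \<in> ?T" "trk c' \<notin> ?T"
  using iso_node[OF L assms(2) c(1) m] by blast
 then have t: "trk c = (11, i, j)" "trk c' \<noteq> trk c" by auto
 from cross_11[OF *(1) t, unfolded bex2] show ?thesis
 proof (elim disjE[where P="i < L \<and> _"] exE conjE)
  assume a: "i < L" "H (nd 7 4 i j) (nd 7 3 i j) \<or> H (nd 8 4 i j) (nd 8 3 i j)"
  then show ?thesis using stackD[OF a(1) assms(2)] by blast
 next
  fix i' assume a: "i = Suc i'" "i' < L"
   "H (nd 7 22 (Suc i') j) (nd 7 21 i' j) \<or> H (nd 8 22 (Suc i') j) (nd 8 21 i' j)"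
  then show ?thesis using stackA[OF a(2) assms(2)] by blast
 qed
qed

text \<open>The horizontal track \<open>9\<close> touches only the outer rings of the two blocks
  that it joins.\<close>

lemma iso_W:
 assumes "i < L" "Suc j < M" shows "R34 i j \<or> L12 i (Suc j)"
proof -
 have jM: "j < M" using assms by simp
 have px: "px (4, Suc j, 0) = (14, j, 0)" by simp
 let ?T = "{(9, i, j)}"
 have c: "cell (nd 12 12 i j)" "trk (nd 12 12 i j) = (9, i, j)"
  using assms by (auto simp: cell_def rs_def trk_def sh_simps tk_simps)
 have m: "trk (nd 12 12 i j) \<in> ?T" "(2::nat, i, j) \<notin> ?T" unfolding c(2) by auto
 obtain c c' where *: "H c c'" "trk c \<in> ?T" "trk c' \<notin> ?T"
  using iso_node[OF assms(1) jM c(1) m] by blast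
 then have t: "trk c = (9, i, j)" "trk c' \<noteq> trk c" by auto
 show ?thesis
  using cross_9[OF *(1) t, unfolded bex2] leftS[OF assms] rightS[OF assms(1) jM] px by metis
qed

text \<open>The pairs of rings \<open>5\<close>, \<open>6\<close> and \<open>7\<close>,
  \<open>8\<close> are added to the set when they are tied to ring \<open>3\<close>. By the
  strictness lemmas they then have no contact with ring \<open>2\<close>, so the only ways out of
  the set are the sideways contacts of ring \<open>3\<close>.\<close>

lemma iso_R:
 assumes "i < L" "j < M" shows "L23 i j \<or> R23 i j"
proof -
 let ?T = "{(3, i, j), (4, i, j)} \<union> {t. B23 i j \<and> (t = (5, i, j) \<or> t = (6, i, j))}
   \<union> {t. C23 i j \<and> (t = (7, i, j) \<or> t = (8, i, j))}"
 have c: "cell (nd 7 14 i j)" "trk (nd 7 14 i j) = (4, i, j)"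
  using assms by (auto simp: cell_def rs_def trk_def sh_simps tk_simps)
 have m: "trk (nd 7 14 i j) \<in> ?T" "(2::nat, i, j) \<notin> ?T" unfolding c(2) by auto
 obtain c c' where *: "H c c'" "trk c \<in> ?T" "trk c' \<notin> ?T"
  using iso_node[OF assms c(1) m] by blast
 have e: "H (nd 8 16 i j) (nd 8 15 i j) = B23 i j" "H (nd 8 10 i j) (nd 8 9 i j) = C23 i j"
  "H (nd 4 12 i j) (nd 5 12 i j) = L23 i j" "H (nd 10 12 i j) (nd 11 12 i j) = R23 i j"
  "H (nd 8 21 i j) (nd 8 20 i j) = A23 i j" "H (nd 8 5 i j) (nd 8 4 i j) = D23 i j"
  using stackA[OF assms] stackB[OF assms] stackC[OF assms] stackD[OF assms] leftS[OF assms] rightS[OF assms]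
  by simp_all
 have n: "trk c' \<noteq> (3, i, j)" "trk c' \<noteq> (4, i, j)" "B23 i j \<Longrightarrow> trk c' \<noteq> (5, i, j)" "B23 i j \<Longrightarrow> trk c' \<noteq> (6, i, j)"
  "C23 i j \<Longrightarrow> trk c' \<noteq> (7, i, j)" "C23 i j \<Longrightarrow> trk c' \<noteq> (8, i, j)" "trk c' \<noteq> trk c"
  using *(2,3) by auto
 from *(2) consider "trk c = (3, i, j)" | "trk c = (4, i, j)" | "trk c = (5, i, j)" "B23 i j"
  | "trk c = (6, i, j)" "B23 i j" | "trk c = (7, i, j)" "C23 i j" | "trk c = (8, i, j)" "C23 i j"
  by auto
 then show ?thesis
 proof cases
  case 1
  show ?thesis using cross_3[OF *(1) 1 n(7), unfolded bex2 e] n by argo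
 next
  case 2
  show ?thesis using cross_4[OF *(1) 2 n(7)] n by argo
 next
  case 3
  show ?thesis using cross_5[OF *(1) 3(1) n(7), unfolded bex2 e] 3(2) n strict_Z1[OF assms] by argo
 next
  case 4
  show ?thesis using cross_6[OF *(1) 4(1) n(7)] 4(2) n by argo
 next
  case 5
  show ?thesis using cross_7[OF *(1) 5(1) n(7), unfolded bex2 e] 5(2) n strict_Z3[OF assms] by argo
 next
  case 6
  show ?thesis using cross_8[OF *(1) 6(1) n(7)] 6(2) n by argo
 qed
qed

section \<open>Signals along columns and rows\<close>

text \<open>A pigeonhole argument run as an induction up the column. If no ring \<open>4\<close> has
  a sideways exit, a block that serves the vertical track below it cannot serve the one above. The
  lowest track depends on the lowest block, so every block serves the track below it, and nothing is
  left for the topmost track.\<close>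

lemma column_extra:
 assumes "j < M" shows "\<exists>i<L. L34 i j \<or> R12 i j"
proof (rule ccontr)
 assume no: "\<not> ?thesis"
 have "i < L \<Longrightarrow> D34 i j" for i
 proof (induction i)
  case 0
  then show ?case using iso_S4[of 0 j] assms by auto
 next
  case (Suc i)
  then have i: "i < L" by simp
  \<comment> \<open>The signal climbs the block: \<open>D34\<close> excludes \<open>D23\<close>,
    which forces \<open>C23\<close>, which excludes \<open>C12\<close>; ring \<open>4\<close> then
    needs \<open>B34\<close>, which excludes \<open>B23\<close>, forces \<open>A23\<close> and
    excludes \<open>A12\<close>.\<close>
  have "\<not> A12 i j"
   using Suc.IH[OF i] i stackA[OF i assms] stackB[OF i assms] stackC[OF i assms] stackD[OF i assms]
    iso_Z1[OF i assms] iso_Z3[OF i assms] iso_S2[OF i assms] no by blast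
  then show ?case using iso_S4[of "Suc i" j] Suc.prems assms by auto
 qed
 moreover obtain i where i: "L = Suc i" using L by (cases L) auto
 ultimately have d: "D34 i j" and iL: "i < L" by auto
 have "\<not> A12 i j"
  using d stackA[OF iL assms] stackB[OF iL assms] stackC[OF iL assms] stackD[OF iL assms]
   iso_Z1[OF iL assms] iso_Z3[OF iL assms] iso_S2[OF iL assms] no iL by blast
 then show False using iso_S4[of L j] assms i by auto
qed

text \<open>\<open>L23\<close> excludes \<open>L12\<close>, so the horizontal track on the left must
  be left through \<open>R34\<close> of the preceding block. This excludes \<open>R23\<close> there,
  and \<open>iso_R\<close> leaves \<open>L23\<close> as the only possibility.\<close>

lemma row_signal:
 assumes "i < L" "j \<le> j'" "j' < M" "L23 i j'"
 shows "L23 i j"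
 using assms(2-)
proof (induction j' rule: dec_induct)
 case (step n)
 then have n: "n < M" by simp
 have "\<not> L12 i (Suc n)" using leftS[OF assms(1) step(4)] step(5) by blast
 then have "R34 i n" using iso_W[OF assms(1) step(4)] by blast
 then have "\<not> R23 i n" using rightS[OF assms(1) n] by blast
 then have "L23 i n" using iso_R[OF assms(1) n] by blast
 then show ?case using step.IH n by blast
qed auto

theorem tour_sat:
 assumes neg_first: "\<And>i i' j j'. occP i j \<Longrightarrow> occN i' j' \<Longrightarrow> j' < j"
 shows "\<exists>\<tau>. \<forall>j<M. \<exists>i<L. (occP i j \<and> \<tau> i) \<or> (occN i j \<and> \<not> \<tau> i)"
proof (rule exI[of _ "\<lambda>i. \<exists>j<M. occP i j \<and> R12 i j"], intro allI impI)
 fix j assume j: "j < M"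
 let ?t = "\<lambda>i. \<exists>j<M. occP i j \<and> R12 i j"
 obtain i where i: "i < L" "L34 i j \<or> R12 i j" using column_extra[OF j] by blast
 show "\<exists>i<L. (occP i j \<and> ?t i) \<or> (occN i j \<and> \<not> ?t i)"
 proof (cases "R12 i j")
  case True
  then have "occP i j" using n9[of i j 13] by blast
  then show ?thesis using True i j by blast
 next
  case False
  then have l: "L34 i j" using i by blast
  then have n: "occN i j" using n6[of i j 13] by blast
  have "\<not> ?t i"
  proof
   assume "?t i"
   then obtain j' where j': "j' < M" "occP i j'" "R12 i j'" by blast
   then have "L23 i j'" using rightS[OF i(1) j'(1)] iso_R[OF i(1) j'(1)] by blast
   then have "L23 i j" using row_signal[OF i(1) _ j'(1)] neg_first[OF j'(2) n] by simp
   then show False using l leftS[OF i(1) j] by blast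
  qed
  then show ?thesis using n i by blast
 qed
qed

end

section \<open>From satisfying assignments to tours\<close>

text \<open>The seven rings inside a block, listed counterclockwise as closed walks; they are
  certificates to be checked against the tables. The remaining tracks have variable length and are
  generated from lists of addresses.\<close>

definition ringl :: "nat \<Rightarrow> (nat \<times> nat) list" where
 "ringl t = (if t = 2 then [(4,4),(5,4),(6,4),(7,4),(8,4),(9,4),(10,4),(11,4),(11,5),(11,6),(11,7),(11,8),(11,9),(11,10),(11,11),(11,12),(11,13),(11,14),(11,15),(11,16),(11,17),(11,18),(11,19),(11,20),(11,21),(10,21),(9,21),(8,21),(7,21),(6,21),(5,21),(4,21),(4,20),(4,19),(4,18),(4,17),(4,16),(4,15),(4,14),(4,13),(4,12),(4,11),(4,10),(4,9),(4,8),(4,7),(4,6),(4,5)]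
  else if t = 3 then [(5,10),(6,10),(7,10),(8,10),(9,10),(10,10),(10,11),(10,12),(10,13),(10,14),(10,15),(9,15),(8,15),(7,15),(6,15),(5,15),(5,14),(5,13),(5,12),(5,11)]
  else if t = 4 then [(6,11),(7,11),(8,11),(9,11),(9,12),(9,13),(9,14),(8,14),(7,14),(6,14),(6,13),(6,12)]
  else if t = 5 then [(6,16),(7,16),(8,16),(9,16),(9,17),(9,18),(9,19),(9,20),(8,20),(7,20),(6,20),(6,19),(6,18),(6,17)]
  else if t = 6 then [(7,17),(8,17),(8,18),(8,19),(7,19),(7,18)]
  else if t = 7 then [(6,5),(7,5),(8,5),(9,5),(9,6),(9,7),(9,8),(9,9),(8,9),(7,9),(6,9),(6,8),(6,7),(6,6)]
  else if t = 8 then [(7,6),(8,6),(8,7),(8,8),(7,8),(7,7)] else [])"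

lemmas ringl_simps = ringl_def[of 2, simplified] ringl_def[of 3, simplified] ringl_def[of 4, simplified] ringl_def[of 5, simplified] ringl_def[of 6, simplified] ringl_def[of 7, simplified] ringl_def[of 8, simplified]

text \<open>The converse of the check in \<open>ring_all\<close>: every nonempty cell of the table
  lies on the walk, or in the rows and columns, of the track that \<open>tk\<close> names.\<close>

definition okc :: "nat \<Rightarrow> nat \<Rightarrow> bool" where
 "okc k l \<longleftrightarrow> (tk k l = 0 \<longleftrightarrow> sh k l = 0) \<and> tk k l \<noteq> 1 \<and> tk k l \<le> 12
   \<and> (2 \<le> tk k l \<and> tk k l \<le> 8 \<longrightarrow> (k, l) \<in> set (ringl (tk k l)))
   \<and> (tk k l = 9 \<longrightarrow> (k = 12 \<or> k = 13 \<or> k = 14) \<and> (l = 12 \<or> l = 13))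
   \<and> (tk k l = 10 \<longrightarrow> (k = 12 \<or> k = 13 \<or> k = 14) \<and> (l = 7 \<or> l = 8))
   \<and> (tk k l = 11 \<longrightarrow> (k = 7 \<or> k = 8) \<and> (l = 2 \<or> l = 3 \<or> l = 22 \<or> l = 23 \<or> l = 24))
   \<and> (tk k l = 12 \<longrightarrow> k = 2 \<or> k = 3)"

lemma okc_all: "\<forall>k\<in>set [2..<15]. \<forall>l\<in>set [2..<25]. okc k l"
 unfolding set_2_25 set_2_15 ball_simps by (intro conjI TrueI) (simp add: okc_def ringl_simps sh_simps tk_simps)+

lemmas okc = okc_all[rule_format]

text \<open>Vertical steps accept the shapes 7 and 8, which are open above and below in both
  readings. Horizontal steps avoid them by using the shapes as they stand.\<close>

fun stepok :: "nat \<times> nat \<Rightarrow> nat \<times> nat \<Rightarrow> bool" where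
 "stepok (k, l) (k', l') \<longleftrightarrow> 4 \<le> k \<and> k \<le> 11 \<and> 4 \<le> l \<and> l \<le> 21 \<and> 4 \<le> k' \<and> k' \<le> 11 \<and> 4 \<le> l' \<and> l' \<le> 21 \<and>
  (k' = Suc k \<and> l' = l \<and> opR (sh k l) \<and> opL (sh k' l')
   \<or> k = Suc k' \<and> l' = l \<and> opL (sh k l) \<and> opR (sh k' l')
   \<or> k' = k \<and> l' = Suc l \<and> opU (tog (sh k l)) \<and> opD (tog (sh k' l'))
   \<or> k' = k \<and> l = Suc l' \<and> opD (tog (sh k l)) \<and> opU (tog (sh k' l')))"

fun chain :: "(nat \<times> nat) list \<Rightarrow> bool" where
 "chain (x # y # zs) \<longleftrightarrow> stepok x y \<and> chain (y # zs)"
| "chain _ \<longleftrightarrow> True"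

fun adjin :: "'a list \<Rightarrow> 'a \<Rightarrow> 'a \<Rightarrow> bool" where
 "adjin (x # y # zs) a b \<longleftrightarrow> (x = a \<and> y = b) \<or> (x = b \<and> y = a) \<or> adjin (y # zs) a b"
| "adjin _ a b \<longleftrightarrow> False"

lemma adjin_pedges: "adjin xs a b \<Longrightarrow> {a, b} \<in> pedges xs"
 by (induction xs a b rule: adjin.induct) auto

lemma chain_pedges: "chain xs \<Longrightarrow> {a, b} \<in> pedges xs \<Longrightarrow> stepok a b \<or> stepok b a"
 by (induction xs rule: chain.induct) (auto simp: doubleton_eq_iff)

lemma ring_all:
 assumes "2 \<le> t" "t \<le> 8"
 shows "chain (ringl t)" "stepok (last (ringl t)) (hd (ringl t))" "distinct (ringl t)"
  "list_all (\<lambda>(k, l). tk k l = t \<and> sh k l \<noteq> 0 \<and> 4 \<le> k \<and> k \<le> 11 \<and> 4 \<le> l \<and> l \<le> 21) (ringl t)" "ringl t \<noteq> []"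
proof -
 have "t = 2 \<or> t = 3 \<or> t = 4 \<or> t = 5 \<or> t = 6 \<or> t = 7 \<or> t = 8" using assms by arith
 then show "chain (ringl t)" "stepok (last (ringl t)) (hd (ringl t))" "distinct (ringl t)"
  "list_all (\<lambda>(k, l). tk k l = t \<and> sh k l \<noteq> 0 \<and> 4 \<le> k \<and> k \<le> 11 \<and> 4 \<le> l \<and> l \<le> 21) (ringl t)" "ringl t \<noteq> []"
  by (elim disjE; simp add: ringl_simps sh_simps tk_simps tog_def)+
qed

lemma pedges_map: "pedges (map f xs) = (`) f ` pedges xs"
 by (induction xs rule: pedges.induct) auto

lemma cedges_map: "cedges (map f xs) = (`) f ` cedges xs"
 by (auto simp: cedges_def pedges_map last_map hd_map)

text \<open>The tracks \<open>9\<close> to \<open>12\<close> are racetracks: two parallel copies of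
  one path, joined at both ends.\<close>

lemma cedges_race:
 assumes "xs \<noteq> []"
 shows "cedges (map f xs @ rev (map g xs)) = (`) f ` pedges xs \<union> (`) g ` pedges xs
  \<union> {{f (last xs), g (last xs)}, {f (hd xs), g (hd xs)}}"
 using assms by (auto simp: cedges_def pedges_append pedges_map pedges_rev last_map hd_map hd_rev last_rev insert_commute)

lemma pedges_succ:
 "successively (\<lambda>a b. b = f a) xs \<Longrightarrow> e \<in> pedges xs \<Longrightarrow> \<exists>a. a \<in> set xs \<and> f a \<in> set xs \<and> e = {a, f a}"
 by (induction xs rule: pedges.induct) auto

lemma successively_concat_upt:
 assumes "\<And>i. i < n \<Longrightarrow> f i \<noteq> [] \<and> successively R (f i)"
  and "\<And>i. Suc i < n \<Longrightarrow> R (last (f i)) (hd (f (Suc i)))"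
 shows "successively R (concat (map f [0..<n])) \<and>
  (0 < n \<longrightarrow> concat (map f [0..<n]) \<noteq> [] \<and> last (concat (map f [0..<n])) = last (f (n - 1))
   \<and> hd (concat (map f [0..<n])) = hd (f 0))"
 using assms
proof (induction n)
 case (Suc n)
 have IH: "successively R (concat (map f [0..<n])) \<and>
  (0 < n \<longrightarrow> concat (map f [0..<n]) \<noteq> [] \<and> last (concat (map f [0..<n])) = last (f (n - 1))
   \<and> hd (concat (map f [0..<n])) = hd (f 0))"
  using Suc by simp
 show ?case
 proof (cases "n = 0")
  case False
  then have "R (last (f (n - 1))) (hd (f n))" using Suc.prems(2)[of "n - 1"] by simp
  then show ?thesis using IH False Suc.prems(1)[of n] by (simp add: successively_append_iff)
 qed (use Suc.prems(1)[of 0] in auto)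
qed simp

lemma distinct_concat_upt:
 assumes "\<And>i. i < n \<Longrightarrow> distinct (f i)"
  and "\<And>i j. i < j \<Longrightarrow> j < n \<Longrightarrow> set (f i) \<inter> set (f j) = {}"
 shows "distinct (concat (map f [0..<n]))"
 using assms by (induction n) fastforce+

lemma successively_map_upt:
 "successively R (map f [a..<b]) \<longleftrightarrow> (\<forall>i. a \<le> i \<and> Suc i < b \<longrightarrow> R (f i) (f (Suc i)))"
proof -
 have "(\<forall>i. a \<le> i \<and> Suc i < b \<longrightarrow> R (f i) (f (Suc i))) \<longleftrightarrow> (\<forall>n. Suc n < b - a \<longrightarrow> R (f (a + n)) (f (Suc (a + n))))"
 proof (intro iffI allI impI)
  fix i assume h: "\<forall>n. Suc n < b - a \<longrightarrow> R (f (a + n)) (f (Suc (a + n)))" and i: "a \<le> i \<and> Suc i < b"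
  show "R (f i) (f (Suc i))" using h[rule_format, of "i - a"] i by auto
 qed auto
 then show ?thesis by (simp add: successively_conv_nth)
qed

context layout begin

definition hl :: "nat \<Rightarrow> addr list" where
 "hl j = (12, j, 0) # map (\<lambda>g. (13, j, g)) [0..<gx j] @ [(14, j, 0)]"

definition vl :: "nat \<Rightarrow> addr list" where
 "vl i = (if i = 0 then [(2, 0, 0), (3, 0, 0)]
   else if i < L then (22, i, 0) # map (\<lambda>g. (23, i, g)) [0..<gy i] @ [(3, i, 0)]
   else [(22, i, 0), (24, i, 0)])"

definition nodex :: "nat \<Rightarrow> addr list" where "nodex j = map (\<lambda>k. (k, j, 0)) [4..<12]"
definition nodey :: "nat \<Rightarrow> addr list" where "nodey i = map (\<lambda>l. (l, i, 0)) [4..<22]"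

text \<open>The addresses of the columns from left to right. Positions in \<open>xl\<close> and
  \<open>yl\<close> become the coordinates of the cells; \<open>yl\<close> is moreover the path of
  the border track.\<close>

definition xl :: "addr list" where
 "xl = [(2, 0, 0), (3, 0, 0)] @ nodex 0 @ concat (map (\<lambda>j. hl j @ nodex (Suc j)) [0..<M - 1])"

definition yl :: "addr list" where
 "yl = concat (map (\<lambda>i. vl i @ nodey i) [0..<L]) @ vl L"

lemma hl: "hl j \<noteq> []" "hd (hl j) = (12, j, 0)" "last (hl j) = (14, j, 0)" "distinct (hl j)"
 "successively (\<lambda>a b. b = nx a) (hl j)"
 using gx[of j]
 by (auto simp: hl_def distinct_map inj_on_def successively_append_iff successively_Cons
   successively_map_upt hd_append hd_map last_map)

lemma vl: "vl i \<noteq> []" "distinct (vl i)" "hd (vl i) = (if i = 0 then (2, 0, 0) else (22, i, 0))"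
 "last (vl i) = (if i < L then (3, i, 0) else (24, i, 0))"
 "i \<le> L \<Longrightarrow> successively (\<lambda>a b. b = ny a) (vl i)"
 using gy[of i] L
 by (auto simp: vl_def distinct_map inj_on_def successively_append_iff successively_Cons
   successively_map_upt hd_append hd_map last_map)

lemma nodex: "nodex j \<noteq> []" "distinct (nodex j)" "hd (nodex j) = (4, j, 0)" "last (nodex j) = (11, j, 0)"
 "successively (\<lambda>a b. b = nx a) (nodex j)"
 by (auto simp: nodex_def distinct_map inj_on_def successively_map_upt hd_map last_map)

lemma nodey: "nodey i \<noteq> []" "distinct (nodey i)" "hd (nodey i) = (4, i, 0)" "last (nodey i) = (21, i, 0)"
 "successively (\<lambda>a b. b = ny a) (nodey i)"
 by (auto simp: nodey_def distinct_map inj_on_def successively_map_upt hd_map last_map)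

lemma set_hl: "set (hl j) = {\<alpha>. \<exists>k g. \<alpha> = (k, j, g) \<and> ((k = 12 \<or> k = 14) \<and> g = 0 \<or> k = 13 \<and> g < gx j)}"
 by (auto simp: hl_def)

lemma set_vl: "set (vl i) = {\<beta>. \<exists>k g. \<beta> = (k, i, g) \<and> (if i = 0 then (k = 2 \<or> k = 3) \<and> g = 0
  else if i < L then (k = 22 \<or> k = 3) \<and> g = 0 \<or> k = 23 \<and> g < gy i else (k = 22 \<or> k = 24) \<and> g = 0)}"
 by (auto simp: vl_def)

lemma set_nodex: "set (nodex j) = {\<alpha>. \<exists>k. \<alpha> = (k, j, 0) \<and> 4 \<le> k \<and> k \<le> 11}"
 unfolding nodex_def set_map set_upt by auto

lemma set_nodey: "set (nodey i) = {\<beta>. \<exists>k. \<beta> = (k, i, 0) \<and> 4 \<le> k \<and> k \<le> 21}"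
 unfolding nodey_def set_map set_upt by auto

lemma ge3: "(3 \<le> k \<and> k \<le> 21 \<and> X) \<longleftrightarrow> (k = 3 \<and> X) \<or> (4 \<le> k \<and> k \<le> (21::nat) \<and> X)"
 by (cases "k = 3") auto

lemma set_yl: "set yl = {\<beta>. vy \<beta>}"
proof -
 have "\<beta> \<in> set yl \<longleftrightarrow> vy \<beta>" for \<beta>
 proof -
  obtain k i g where b: "\<beta> = (k, i, g)" by (cases \<beta>)
  have "\<beta> \<in> set yl \<longleftrightarrow> (i < L \<and> (\<beta> \<in> set (vl i) \<or> \<beta> \<in> set (nodey i))) \<or> i = L \<and> \<beta> \<in> set (vl L)"
  proof -
   have 1: "\<beta> \<in> set yl \<longleftrightarrow> (\<exists>i'<L. \<beta> \<in> set (vl i') \<or> \<beta> \<in> set (nodey i')) \<or> \<beta> \<in> set (vl L)"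
    by (auto simp: yl_def)
   have 2: "i' = i" if "\<beta> \<in> set (vl i')" for i' using that unfolding set_vl b by blast
   have 3: "i' = i" if "\<beta> \<in> set (nodey i')" for i' using that unfolding set_nodey b by blast
   show ?thesis using 1 2 3 by blast
  qed
  also have "\<dots> \<longleftrightarrow> vy \<beta>"
  proof -
   consider "i = 0" | "0 < i" "i < L" | "i = L" | "L < i" by linarith
   then show ?thesis
   proof cases
    case 1
    then show ?thesis using L unfolding b set_vl set_nodey vy.simps ge3 by (simp; blast?)
   next
    case 2
    then show ?thesis unfolding b set_vl set_nodey vy.simps ge3 by (simp; blast?)
   next
    case 3
    then show ?thesis using L unfolding b set_vl set_nodey vy.simps ge3 by (simp; blast?)
   next
    case 4
    then show ?thesis unfolding b by simp
   qed
  qed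
  finally show ?thesis .
 qed
 then show ?thesis by blast
qed

lemma set_xl: "set xl = {\<alpha>. vx \<alpha>}"
proof -
 have "\<alpha> \<in> set xl \<longleftrightarrow> vx \<alpha>" for \<alpha>
 proof -
  obtain k j g where b: "\<alpha> = (k, j, g)" by (cases \<alpha>)
  have "\<alpha> \<in> set xl \<longleftrightarrow> \<alpha> = (2, 0, 0) \<or> \<alpha> = (3, 0, 0) \<or> (j < M \<and> \<alpha> \<in> set (nodex j)) \<or> (Suc j < M \<and> \<alpha> \<in> set (hl j))"
  proof -
   have "(\<exists>j'<M - 1. \<alpha> \<in> set (nodex (Suc j'))) \<or> \<alpha> \<in> set (nodex 0) \<longleftrightarrow> j < M \<and> \<alpha> \<in> set (nodex j)"
    using M by (cases j) (auto simp: b set_nodex)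
   moreover have "(\<exists>j'<M - 1. \<alpha> \<in> set (hl j')) \<longleftrightarrow> Suc j < M \<and> \<alpha> \<in> set (hl j)"
    by (auto simp: b set_hl)
   ultimately show ?thesis by (auto simp: xl_def)
  qed
  also have "\<dots> \<longleftrightarrow> vx \<alpha>"
  proof -
   consider "Suc j < M" | "Suc j = M" | "M \<le> j" by linarith
   then show ?thesis
   proof cases
    case 1
    then show ?thesis unfolding b set_hl set_nodex by (simp; blast?)
   next
    case 2
    then show ?thesis using M unfolding b set_hl set_nodex by (simp; blast?)
   next
    case 3
    then show ?thesis using M unfolding b set_hl set_nodex by (simp; blast?)
   qed
  qed
  finally show ?thesis .
 qed
 then show ?thesis by blast
qed

lemma distinct_yl: "distinct yl"
proof -
 have "distinct (concat (map (\<lambda>i. vl i @ nodey i) [0..<L]))"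
  by (rule distinct_concat_upt) (auto simp: vl nodey set_vl set_nodey split: if_splits)
 then show ?thesis unfolding yl_def distinct_append
  by (auto simp: vl set_vl set_nodey split: if_splits)
qed

lemma distinct_xl: "distinct xl"
proof -
 have "distinct (concat (map (\<lambda>j. hl j @ nodex (Suc j)) [0..<M - 1]))"
  by (rule distinct_concat_upt) (auto simp: hl nodex set_hl set_nodex)
 then show ?thesis unfolding xl_def distinct_append
  by (auto simp: hl nodex set_hl set_nodex)
qed

lemma yl_succ: "successively (\<lambda>a b. b = ny a) yl"
 and yl_ends: "yl \<noteq> []" "hd yl = (2, 0, 0)" "last yl = (24, L, 0)"
proof -
 have "successively (\<lambda>a b. b = ny a) (concat (map (\<lambda>i. vl i @ nodey i) [0..<L])) \<and>
  (0 < L \<longrightarrow> concat (map (\<lambda>i. vl i @ nodey i) [0..<L]) \<noteq> []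
   \<and> last (concat (map (\<lambda>i. vl i @ nodey i) [0..<L])) = last (vl (L - 1) @ nodey (L - 1))
   \<and> hd (concat (map (\<lambda>i. vl i @ nodey i) [0..<L])) = hd (vl 0 @ nodey 0))"
  by (rule successively_concat_upt) (auto simp: successively_append_iff vl nodey)
 then show "successively (\<lambda>a b. b = ny a) yl" "yl \<noteq> []" "hd yl = (2, 0, 0)" "last yl = (24, L, 0)"
  using L by (auto simp: yl_def successively_append_iff vl nodey hd_append)
qed

lemma xl_succ: "successively (\<lambda>a b. b = nx a) xl"
 and xl_ends: "xl \<noteq> []" "hd xl = (2, 0, 0)" "last xl = (11, M - 1, 0)"
proof -
 let ?c = "concat (map (\<lambda>j. hl j @ nodex (Suc j)) [0..<M - 1])"
 have c: "successively (\<lambda>a b. b = nx a) ?c \<and> (0 < M - 1 \<longrightarrow> ?c \<noteq> []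
   \<and> last ?c = last (hl (M - 1 - 1) @ nodex (Suc (M - 1 - 1))) \<and> hd ?c = hd (hl 0 @ nodex (Suc 0)))"
  by (rule successively_concat_upt) (auto simp: successively_append_iff hl nodex)
 show "xl \<noteq> []" "hd xl = (2, 0, 0)" by (simp_all add: xl_def)
 show "successively (\<lambda>a b. b = nx a) xl" "last xl = (11, M - 1, 0)"
 proof -
  have "successively (\<lambda>a b. b = nx a) xl \<and> last xl = (11, M - 1, 0)"
  proof (cases "M - 1 = 0")
   case True
   then show ?thesis using M by (auto simp: xl_def successively_append_iff successively_Cons hl nodex hd_append)
  next
   case False
   then have "Suc (M - 1 - 1) = M - 1" by simp
   then show ?thesis using c False
    by (auto simp: xl_def successively_append_iff successively_Cons hl nodex hd_append)
  qed
  then show "successively (\<lambda>a b. b = nx a) xl" "last xl = (11, M - 1, 0)" by blast+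
 qed
qed

end

lemma lb_check:
 "\<forall>l\<in>set [2..<25]. tk 2 l = 12 \<and> tk 3 l = 12 \<and> sh 2 l \<noteq> 0 \<and> sh 3 l \<noteq> 0 \<and> sh 2 l \<noteq> 7 \<and> sh 2 l \<noteq> 8
   \<and> sh 3 l \<noteq> 7 \<and> sh 3 l \<noteq> 8 \<and> (l \<noteq> 24 \<longrightarrow> opU (sh 2 l) \<and> opU (sh 3 l)) \<and> (l \<noteq> 2 \<longrightarrow> opD (sh 2 l) \<and> opD (sh 3 l))"
 unfolding set_2_25 ball_simps by (intro conjI TrueI) (simp_all add: sh_simps tk_simps)

context layout begin

section \<open>The tracks partition the cells\<close>

definition tracks :: "(nat \<times> nat \<times> nat) set" where
 "tracks = {(t, i, j). t = 12 \<and> i = 0 \<and> j = 0 \<or> 2 \<le> t \<and> t \<le> 8 \<and> i < L \<and> j < M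
   \<or> (t = 9 \<or> t = 10) \<and> i < L \<and> Suc j < M \<or> t = 11 \<and> i \<le> L \<and> j < M}"

definition cyc :: "nat \<times> nat \<times> nat \<Rightarrow> cell list" where
 "cyc = (\<lambda>(t, i, j).
   if t = 12 then map (Pair (3, 0, 0)) yl @ rev (map (Pair (2, 0, 0)) yl)

  else if t = 11 then map (Pair (8, j, 0)) (vl i) @ rev (map (Pair (7, j, 0)) (vl i))

  else if t = 10 then map (\<lambda>\<alpha>. (\<alpha>, (7, i, 0))) (hl j) @ rev (map (\<lambda>\<alpha>. (\<alpha>, (8, i, 0))) (hl j))

  else if t = 9 then map (\<lambda>\<alpha>. (\<alpha>, (12, i, 0))) (hl j) @ rev (map (\<lambda>\<alpha>. (\<alpha>, (13, i, 0))) (hl j))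
   else map (\<lambda>(k, l). nd k l i j) (ringl t))"

lemma cyc_simps:
 "cyc (12, i, j) = map (Pair (3, 0, 0)) yl @ rev (map (Pair (2, 0, 0)) yl)"
 "cyc (11, i, j) = map (Pair (8, j, 0)) (vl i) @ rev (map (Pair (7, j, 0)) (vl i))"
 "cyc (10, i, j) = map (\<lambda>\<alpha>. (\<alpha>, (7, i, 0))) (hl j) @ rev (map (\<lambda>\<alpha>. (\<alpha>, (8, i, 0))) (hl j))"
 "cyc (9, i, j) = map (\<lambda>\<alpha>. (\<alpha>, (12, i, 0))) (hl j) @ rev (map (\<lambda>\<alpha>. (\<alpha>, (13, i, 0))) (hl j))"
 "t \<le> 8 \<Longrightarrow> cyc (t, i, j) = map (\<lambda>(k, l). nd k l i j) (ringl t)"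
 by (simp_all add: cyc_def)

lemma tracks_cases:
 assumes "t \<in> tracks"
 obtains "t = (12, 0, 0)" | s i j where "t = (s, i, j)" "2 \<le> s" "s \<le> 8" "i < L" "j < M"
  | s i j and l l' :: nat where "t = (s, i, j)" "i < L" "Suc j < M" "s = 9 \<and> l = 12 \<and> l' = 13 \<or> s = 10 \<and> l = 7 \<and> l' = 8"
  | i j where "t = (11, i, j)" "i \<le> L" "j < M"
 using assms that(1,2,4) that(3)[of _ _ _ 12 13] that(3)[of _ _ _ 7 8] unfolding tracks_def by (cases t) blast

lemma cyc_distinct: assumes "t \<in> tracks" shows "distinct (cyc t)"
 using assms
proof (cases rule: tracks_cases)
 case 1
 then show ?thesis by (auto simp: cyc_simps distinct_map distinct_yl inj_on_def)
next
 case (2 s i j)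
 then show ?thesis
  using ring_all(3)[of s] by (auto simp: cyc_simps distinct_map inj_on_def)
next
 case (3 s i j l l')
 then show ?thesis by (auto simp: cyc_simps distinct_map hl inj_on_def)
next
 case (4 i j)
 then show ?thesis by (auto simp: cyc_simps distinct_map vl inj_on_def)
qed

lemma ring_mem:
 assumes "(k, l) \<in> set (ringl t)" "2 \<le> t" "t \<le> 8"
 shows "tk k l = t" "sh k l \<noteq> 0" "4 \<le> k" "k \<le> 11" "4 \<le> l" "l \<le> 21"
 using ring_all(4)[OF assms(2,3)] assms(1) by (auto simp: list_all_iff)

lemma rs_sh: "rs ((k, j, g), (l, i, h)) = 0 \<longleftrightarrow> sh k l = 0"
 by (simp add: rs_def)

lemma vy_vl: "i \<le> L \<Longrightarrow> (l, i, h) \<in> set (vl i) \<longleftrightarrow> vy (l, i, h) \<and> (l = 2 \<or> l = 3 \<or> l = 22 \<or> l = 23 \<or> l = 24)"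
proof -
 assume "i \<le> L"
 then consider "i = 0" | "0 < i" "i < L" | "0 < i" "i = L" by linarith
 then show ?thesis
  using L unfolding set_vl by cases auto
qed

lemma vx_hl: "(k, j, g) \<in> set (hl j) \<and> Suc j < M \<longleftrightarrow> vx (k, j, g) \<and> (k = 12 \<or> k = 13 \<or> k = 14)"
 unfolding set_hl by auto

lemma cell_okc:
 assumes "cell ((k, j, g), (l, i, h))"
 shows "vx (k, j, g)" "vy (l, i, h)" "okc k l" "tk k l \<noteq> 0"
proof -
 show v: "vx (k, j, g)" "vy (l, i, h)" using assms by (simp_all add: cell_def del: vx.simps vy.simps)
 show o: "okc k l" using okc[OF vxD[OF v(1)] vyD[OF v(2)]] .
 have "sh k l \<noteq> 0" using assms rs_sh[of k j g l i h] by (simp add: cell_def)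
 then show "tk k l \<noteq> 0" using o unfolding okc_def by metis
qed

text \<open>Together with \<open>cyc_cell\<close> this shows that every cell lies on the walk of
  exactly one track, so that merging the walks will visit each cell once.\<close>

lemma cell_trk: assumes "cell c" shows "trk c \<in> tracks \<and> c \<in> set (cyc (trk c))"
proof -
 obtain k j g l i h where c: "c = ((k, j, g), (l, i, h))" by (cases c) auto
 note o = cell_okc[OF assms[unfolded c]]
 have "tk k l = 12 \<or> tk k l = 11 \<or> tk k l = 10 \<or> tk k l = 9 \<or> 2 \<le> tk k l \<and> tk k l \<le> 8"
 proof -
  have "tk k l \<noteq> 1" "tk k l \<le> 12" using o(3) unfolding okc_def by blast+
  then show ?thesis using o(4) by arith
 qed
 then consider "tk k l = 12" | "tk k l = 11" | "tk k l = 10 \<or> tk k l = 9" | "2 \<le> tk k l" "tk k l \<le> 8"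
  by blast
 then show ?thesis
 proof cases
  case 1
  then have k: "k = 2 \<or> k = 3" using o(3) unfolding okc_def by blast
  then have "j = 0" "g = 0" using o(1) by auto
  moreover have "(l, i, h) \<in> set yl" using o(2) set_yl by blast
  ultimately show ?thesis using 1 k by (auto simp: c trk_def cyc_simps tracks_def)
 next
  case 2
  then have k: "k = 7 \<or> k = 8" and l: "l = 2 \<or> l = 3 \<or> l = 22 \<or> l = 23 \<or> l = 24"
   using o(3) unfolding okc_def by blast+
  have g: "j < M" "g = 0" using o(1) k by auto
  have i: "i \<le> L" using o(2) l by auto
  have "(l, i, h) \<in> set (vl i)" using vy_vl[OF i] o(2) l by blast
  then show ?thesis using 2 k g i by (auto simp: c trk_def cyc_simps tracks_def)
 next
  case 3
  then have k: "k = 12 \<or> k = 13 \<or> k = 14" and l: "tk k l = 10 \<and> (l = 7 \<or> l = 8) \<or> tk k l = 9 \<and> (l = 12 \<or> l = 13)"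
   using o(3) unfolding okc_def by blast+
  have "(k, j, g) \<in> set (hl j)" "Suc j < M" using vx_hl o(1) k by blast+
  moreover have "h = 0" "i < L" using o(2) l by auto
  ultimately show ?thesis using l by (auto simp: c trk_def cyc_simps tracks_def)
 next
  case 4
  then have m: "(k, l) \<in> set (ringl (tk k l))" using o(3) unfolding okc_def by blast
  note r = ring_mem[OF m 4]
  have "j < M" "g = 0" using o(1) r(3,4) by auto
  moreover have "i < L" "h = 0" using o(2) r(5,6) by auto
  ultimately show ?thesis using 4 m by (auto simp: c trk_def cyc_simps tracks_def image_iff intro!: bexI[of _ "(k, l)"])
 qed
qed

lemma cyc_cell: assumes "t \<in> tracks" "c \<in> set (cyc t)" shows "cell c \<and> trk c = t"
 using assms(1)
proof (cases rule: tracks_cases)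
 case 1
 then obtain k \<beta> where c: "c = ((k, 0, 0), \<beta>)" "k = 2 \<or> k = 3" "\<beta> \<in> set yl"
  using assms(2) by (auto simp: cyc_simps)
 obtain l i h where b: "\<beta> = (l, i, h)" by (cases \<beta>)
 have v: "vy (l, i, h)" using c(3) set_yl b by blast
 have "vx (k, 0, 0)" using c(2) by auto
 then show ?thesis using lb_check[rule_format, OF vyD[OF v]] v c(1,2) 1 rs_sh[of k 0 0 l i h]
  by (auto simp: cell_def b trk_def simp del: vx.simps vy.simps)
next
 case (2 s i j)
 then obtain k l where c: "c = nd k l i j" "(k, l) \<in> set (ringl s)"
  using assms(2) by (auto simp: cyc_simps)
 note r = ring_mem[OF c(2) 2(2,3)]
 have "vx (k, j, 0)" "vy (l, i, 0)" using r 2 by auto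
 then show ?thesis using r 2 rs_sh[of k j 0 l i 0] by (auto simp: cell_def c trk_def simp del: vx.simps vy.simps)
next
 case (3 s i j l0 l1)
 then obtain \<alpha> l where c: "c = (\<alpha>, (l, i, 0))" "l = l0 \<or> l = l1" "\<alpha> \<in> set (hl j)"
  using assms(2) by (auto simp: cyc_simps)
 obtain k g where a: "\<alpha> = (k, j, g)" using c(3) set_hl by blast
 have v: "vx (k, j, g)" "k = 12 \<or> k = 13 \<or> k = 14" using vx_hl[of k j g] c(3) a 3 by blast+
 have "vy (l, i, 0)" using c(2) 3 by auto
 then show ?thesis using v c 3 a by (auto simp: cell_def rs_def trk_def sh_simps tk_simps simp del: vx.simps vy.simps)
next
 case (4 i j)
 then obtain k \<beta> where c: "c = ((k, j, 0), \<beta>)" "k = 7 \<or> k = 8" "\<beta> \<in> set (vl i)"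
  using assms(2) by (auto simp: cyc_simps)
 obtain l h where b: "\<beta> = (l, i, h)" using c(3) set_vl by blast
 have v: "vy (l, i, h)" "l = 2 \<or> l = 3 \<or> l = 22 \<or> l = 23 \<or> l = 24"
  using vy_vl[OF 4(2), of l h] c(3) b by blast+
 have "vx (k, j, 0)" using c(2) 4 by auto
 then show ?thesis using v c 4 b by (auto simp: cell_def rs_def trk_def sh_simps tk_simps simp del: vx.simps vy.simps)
qed

lemma vstep_pot:
 assumes "vx (k, j, g)" "vy (l, i, h)" "vy (ny (l, i, h))" "sh k l \<noteq> 7" "sh k l \<noteq> 8"
  "sh k (fst (ny (l, i, h))) \<noteq> 7" "sh k (fst (ny (l, i, h))) \<noteq> 8"
  "opU (sh k l)" "opD (sh k (fst (ny (l, i, h))))"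
 shows "pot ((k, j, g), (l, i, h)) ((k, j, g), ny (l, i, h))"
proof -
 obtain l' i' h' where n: "ny (l, i, h) = (l', i', h')" by (cases "ny (l, i, h)")
 have "rs ((k, j, g), (l, i, h)) = sh k l" "rs ((k, j, g), (l', i', h')) = sh k l'"
  using assms n by (auto simp: rs_def)
 then show ?thesis using assms n by (auto simp: pot_def cell_def vpot_def simp del: vx.simps vy.simps ny.simps)
qed

lemma hstep_pot:
 assumes "vy (l, i, h)" "vx (k, j, g)" "vx (nx (k, j, g))" "sh k l \<noteq> 7" "sh k l \<noteq> 8"
  "sh (fst (nx (k, j, g))) l \<noteq> 7" "sh (fst (nx (k, j, g))) l \<noteq> 8"
  "opR (sh k l)" "opL (sh (fst (nx (k, j, g))) l)"
 shows "pot ((k, j, g), (l, i, h)) (nx (k, j, g), (l, i, h))"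
proof -
 obtain k' j' g' where n: "nx (k, j, g) = (k', j', g')" by (cases "nx (k, j, g)")
 have "rs ((k, j, g), (l, i, h)) = sh k l" "rs ((k', j', g'), (l, i, h)) = sh k' l"
  using assms n by (auto simp: rs_def)
 then show ?thesis using assms n by (auto simp: pot_def cell_def hpot_def simp del: vx.simps vy.simps nx.simps)
qed

lemma stepok_pot:
 assumes "stepok (k, l) (k', l')" "i < L" "j < M"
 shows "pot (nd k l i j) (nd k' l' i j)"
proof -
 have rU: "opU (tog (sh k l)) \<Longrightarrow> opU (rs (nd k l i j))" "opD (tog (sh k l)) \<Longrightarrow> opD (rs (nd k l i j))"
  "opR (sh k l) \<Longrightarrow> rs (nd k l i j) = sh k l" "opL (sh k l) \<Longrightarrow> rs (nd k l i j) = sh k l" for k l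
  by (auto simp: rs_def tog_def)
 have v: "vx (k, j, 0)" "vx (k', j, 0)" "vy (l, i, 0)" "vy (l', i, 0)" using assms by auto
 have nz: "opU s \<Longrightarrow> s \<noteq> 0" "opD s \<Longrightarrow> s \<noteq> 0" "opL s \<Longrightarrow> s \<noteq> 0" "opR s \<Longrightarrow> s \<noteq> 0" for s by auto
 from assms(1) consider "k' = Suc k" "l' = l" "opR (sh k l)" "opL (sh k' l')" "k' \<le> 11"
  | "k = Suc k'" "l' = l" "opL (sh k l)" "opR (sh k' l')" "k \<le> 11"
  | "k' = k" "l' = Suc l" "opU (tog (sh k l))" "opD (tog (sh k' l'))" "l' \<le> 21"
  | "k' = k" "l = Suc l'" "opD (tog (sh k l))" "opU (tog (sh k' l'))" "l \<le> 21"
  unfolding stepok.simps by blast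
 then show ?thesis
 proof cases
  case 1
  have "(k', j, 0) = nx (k, j, 0)" using 1 by simp
  then show ?thesis using 1 v rU(3)[of k l] rU(4)[of k' l'] nz(4)[of "sh k l"] nz(3)[of "sh k' l'"]
   by (simp add: pot_def cell_def hpot_def del: vx.simps vy.simps nx.simps op_simps)
 next
  case 2
  have "(k, j, 0) = nx (k', j, 0)" using 2 by simp
  then show ?thesis using 2 v rU(4)[of k l] rU(3)[of k' l'] nz(3)[of "sh k l"] nz(4)[of "sh k' l'"]
   by (simp add: pot_def cell_def hpot_def del: vx.simps vy.simps nx.simps op_simps)
 next
  case 3
  have "(l', i, 0) = ny (l, i, 0)" using 3 by simp
  then show ?thesis using 3 v rU(1)[of k l] rU(2)[of k' l'] nz(1)[of "rs (nd k l i j)"] nz(2)[of "rs (nd k' l' i j)"]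
   by (simp add: pot_def cell_def vpot_def del: vx.simps vy.simps ny.simps op_simps)
 next
  case 4
  have "(l, i, 0) = ny (l', i, 0)" using 4 by simp
  then show ?thesis using 4 v rU(2)[of k l] rU(1)[of k' l'] nz(2)[of "rs (nd k l i j)"] nz(1)[of "rs (nd k' l' i j)"]
   by (simp add: pot_def cell_def vpot_def del: vx.simps vy.simps ny.simps op_simps)
 qed
qed

lemma yl_step: assumes "vy \<beta>" "vy (ny \<beta>)" shows "{\<beta>, ny \<beta>} \<in> pedges yl"
proof -
 have "\<beta> \<in> set yl" using assms(1) set_yl by blast
 then obtain a where a: "a < length yl" "yl ! a = \<beta>" unfolding in_set_conv_nth by blast
 have "Suc a < length yl"
 proof (rule ccontr)
  assume "\<not> Suc a < length yl"
  then have "a = length yl - 1" using a by linarith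
  then have "\<beta> = last yl" using a(2) yl_ends(1) by (simp add: last_conv_nth)
  then show False using assms(2) unfolding yl_ends(3) by simp
 qed
 moreover have "\<forall>n. Suc n < length yl \<longrightarrow> yl ! Suc n = ny (yl ! n)"
  using yl_succ unfolding successively_conv_nth by blast
 ultimately have "yl ! Suc a = ny \<beta>" using a(2) by blast
 then show ?thesis unfolding pedges_conv_nth using a(2) \<open>Suc a < length yl\<close>
  by (intro CollectI exI[of _ a] conjI) simp_all
qed

lemma race:
 assumes "{c, c'} \<in> cedges (map f bs @ rev (map g bs))" "bs \<noteq> []" "successively (\<lambda>a b. b = s a) bs"
 shows "(\<exists>x\<in>{f, g}. \<exists>b\<in>set bs. s b \<in> set bs \<and> {c, c'} = {x b, x (s b)}) \<or> (\<exists>b\<in>{hd bs, last bs}. {c, c'} = {f b, g b})"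
proof -
 have "\<exists>b\<in>set bs. s b \<in> set bs \<and> {c, c'} = {x b, x (s b)}" if x: "{c, c'} \<in> (`) x ` pedges bs" for x
 proof -
  obtain e where e: "e \<in> pedges bs" "{c, c'} = x ` e" using x by blast
  obtain b where b: "b \<in> set bs" "s b \<in> set bs" "e = {b, s b}" using pedges_succ[OF assms(3) e(1)] by blast
  have "{c, c'} = {x b, x (s b)}" unfolding e(2) b(3) by simp
  then show ?thesis using b(1,2) by blast
 qed
 note k = this
 from assms(1) show ?thesis
  unfolding cedges_race[OF assms(2)]
 proof (elim UnE)
  assume "{c, c'} \<in> (`) f ` pedges bs"
  then show ?thesis using k[of f] by blast
 next
  assume "{c, c'} \<in> (`) g ` pedges bs"
  then show ?thesis using k[of g] by blast
 qed blast
qed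

lemma pot_eq: "{c, c'} = {d, d'} \<Longrightarrow> pot d d' \<Longrightarrow> pot c c'"
 using pot_sym by (metis doubleton_eq_iff)

lemma cyc_pot:
 assumes "t \<in> tracks" "{c, c'} \<in> cedges (cyc t)" shows "pot c c'"
 using assms(1)
proof (cases rule: tracks_cases)
 case 1
 from assms(2) have e: "{c, c'} \<in> cedges (map (Pair (3, 0, 0)) yl @ rev (map (Pair (2, 0, 0)) yl))"
  unfolding 1 cyc_simps .
 from race[OF e yl_ends(1) yl_succ] show ?thesis
 proof (elim disjE bexE conjE)
  fix x \<beta> assume 1: "x \<in> {Pair (3, 0, 0), Pair (2, 0, 0)}" "\<beta> \<in> set yl" "ny \<beta> \<in> set yl" "{c, c'} = {x \<beta>, x (ny \<beta>)}"
  obtain k where k: "x = Pair (k, 0, 0)" "k = 2 \<or> k = 3" using 1(1) by blast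
  obtain l i h where b: "\<beta> = (l, i, h)" by (cases \<beta>)
  obtain l' i' h' where b': "ny (l, i, h) = (l', i', h')" by (cases "ny (l, i, h)")
  have "\<beta> \<in> {\<beta>. vy \<beta>}" "ny \<beta> \<in> {\<beta>. vy \<beta>}" using 1(2,3) set_yl by blast+
  then have v: "vy (l, i, h)" "vy (l', i', h')" unfolding b b' by blast+
  have l: "l \<noteq> 24" "l' \<noteq> 2" using v b' by (auto split: if_splits)
  have vk: "vx (k, 0, 0)" using k(2) by auto
  have "pot ((k, 0, 0), (l, i, h)) ((k, 0, 0), ny (l, i, h))"
  proof (rule vstep_pot)
   note c1 = lb_check[rule_format, OF vyD[OF v(1)]] and c2 = lb_check[rule_format, OF vyD[OF v(2)]]
   have f: "fst (ny (l, i, h)) = l'" unfolding b' by simp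
   show "vx (k, 0, 0)" "vy (l, i, h)" "vy (ny (l, i, h))" using vk v unfolding b' .
   show "sh k l \<noteq> 7" "sh k l \<noteq> 8" "sh k (fst (ny (l, i, h))) \<noteq> 7" "sh k (fst (ny (l, i, h))) \<noteq> 8"
    "opU (sh k l)" "opD (sh k (fst (ny (l, i, h))))"
    using k(2) c1 c2 l unfolding f by metis+
  qed
  then show ?thesis using pot_eq[OF 1(4)] unfolding b k(1) by blast
 next
  fix \<beta> assume 2: "\<beta> \<in> {hd yl, last yl}" "{c, c'} = {((3, 0, 0), \<beta>), ((2, 0, 0), \<beta>)}"
  have "pot ((2, 0, 0), \<beta>) ((3, 0, 0), \<beta>)"
   using 2(1) L unfolding yl_ends by (auto simp: pot_def cell_def hpot_def rs_def sh_simps)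
  then show ?thesis using pot_eq[OF 2(2)] pot_sym by blast
 qed
next
 case (2 s i j)
 have "cyc t = map (\<lambda>(k, l). nd k l i j) (ringl s)" using 2(3) by (simp add: 2(1) cyc_simps)
 then have "{c, c'} \<in> cedges (map (\<lambda>(k, l). nd k l i j) (ringl s))" using assms(2) by simp
 then obtain e where e: "e \<in> cedges (ringl s)" "{c, c'} = (\<lambda>(k, l). nd k l i j) ` e"
  unfolding cedges_map by blast
 have "\<exists>x y. e = {x, y} \<and> stepok x y"
 proof (cases "e \<in> pedges (ringl s)")
  case True
  obtain x y where xy: "e = {x, y}" using pedges_split[OF True] by blast
  have "stepok x y \<or> stepok y x" using chain_pedges[OF ring_all(1)[OF 2(2,3)]] True unfolding xy by blast
  then show ?thesis unfolding xy by (metis insert_commute)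
 next
  case False
  then have "e = {last (ringl s), hd (ringl s)}" using e(1) ring_all(5)[OF 2(2,3)] by (simp add: cedges_def)
  then show ?thesis using ring_all(2)[OF 2(2,3)] by blast
 qed
 then obtain x y where xy: "e = {x, y}" "stepok x y" by blast
 obtain k l where x: "x = (k, l)" by (cases x)
 obtain k' l' where y: "y = (k', l')" by (cases y)
 have "{c, c'} = {nd k l i j, nd k' l' i j}" unfolding e(2) xy(1) x y by simp
 then show ?thesis using pot_eq stepok_pot[OF xy(2)[unfolded x y] 2(4,5)] by blast
next
 case (3 s i j l0 l1)
 from assms(2) have e: "{c, c'} \<in> cedges (map (\<lambda>\<alpha>. (\<alpha>, (l0, i, 0))) (hl j) @ rev (map (\<lambda>\<alpha>. (\<alpha>, (l1, i, 0))) (hl j)))"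
  using 3(4) by (auto simp: 3(1) cyc_simps)
 from race[OF e hl(1) hl(5)] show ?thesis
 proof (elim disjE bexE conjE)
  fix x \<alpha> assume 1: "x \<in> {\<lambda>\<alpha>. (\<alpha>, (l0, i, 0)), \<lambda>\<alpha>. (\<alpha>, (l1, i, 0))}" "\<alpha> \<in> set (hl j)" "nx \<alpha> \<in> set (hl j)"
   "{c, c'} = {x \<alpha>, x (nx \<alpha>)}"
  obtain l where l: "x = (\<lambda>\<alpha>. (\<alpha>, (l, i, 0)))" "l = 7 \<or> l = 8 \<or> l = 12 \<or> l = 13" using 1(1) 3(4) by blast
  obtain k g where a: "\<alpha> = (k, j, g)" using 1(2) set_hl by blast
  obtain k' g' where a': "nx (k, j, g) = (k', j, g')" using 1(3) set_hl a by blast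
  have v: "vx (k, j, g)" "k = 12 \<or> k = 13 \<or> k = 14" "vx (k', j, g')" "k' = 12 \<or> k' = 13 \<or> k' = 14"
   using vx_hl[of k j g] vx_hl[of k' j g'] 1(2,3) a a' 3(3) by simp_all
  have k: "k \<noteq> 14" "k' \<noteq> 12" using a' v(2) by (auto split: if_splits)
  have "vy (l, i, 0)" using l(2) 3(2) by auto
  then have "pot ((k, j, g), (l, i, 0)) (nx (k, j, g), (l, i, 0))"
   using v k l(2) a' by (intro hstep_pot) (auto simp: sh_simps simp del: vy.simps vx.simps nx.simps)
  then show ?thesis using pot_eq[OF 1(4)] unfolding a l(1) by blast
 next
  fix \<alpha> assume 2: "\<alpha> \<in> {hd (hl j), last (hl j)}" "{c, c'} = {(\<alpha>, (l0, i, 0)), (\<alpha>, (l1, i, 0))}"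
  have "pot (\<alpha>, (l0, i, 0)) (\<alpha>, (l1, i, 0))"
   using 3(4) 2(1) 3(2,3) unfolding hl by (elim disjE conjE; auto simp: pot_def cell_def vpot_def rs_def sh_simps)
  then show ?thesis using pot_eq[OF 2(2)] by blast
 qed
next
 case (4 i j)
 from assms(2) have e: "{c, c'} \<in> cedges (map (Pair (8, j, 0)) (vl i) @ rev (map (Pair (7, j, 0)) (vl i)))"
  unfolding 4 cyc_simps .
 from race[OF e vl(1) vl(5)[OF 4(2)]] show ?thesis
 proof (elim disjE bexE conjE)
  fix x \<beta> assume 1: "x \<in> {Pair (8, j, 0), Pair (7, j, 0)}" "\<beta> \<in> set (vl i)" "ny \<beta> \<in> set (vl i)" "{c, c'} = {x \<beta>, x (ny \<beta>)}"
  obtain k where kk: "x = Pair (k, j, 0)" "k = 7 \<or> k = 8" using 1(1) by blast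
  obtain l h where b: "\<beta> = (l, i, h)" using 1(2) set_vl by blast
  obtain l' h' where b': "ny (l, i, h) = (l', i, h')" using 1(3) set_vl b by blast
  have v: "vy (l, i, h)" "l = 2 \<or> l = 3 \<or> l = 22 \<or> l = 23 \<or> l = 24"
   "vy (l', i, h')" "l' = 2 \<or> l' = 3 \<or> l' = 22 \<or> l' = 23 \<or> l' = 24"
   using vy_vl[OF 4(2)] 1(2,3) unfolding b b' by blast+
  have k: "l \<noteq> 3" "l \<noteq> 24" "l' \<noteq> 22" "l' \<noteq> 2" using b' v by (auto split: if_splits)
  have "vx (k, j, 0)" using kk(2) 4 by auto
  then have "pot ((k, j, 0), (l, i, h)) ((k, j, 0), ny (l, i, h))"
   using v k kk(2) b' by (intro vstep_pot) (auto simp: sh_simps simp del: vy.simps vx.simps ny.simps)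
  then show ?thesis using pot_eq[OF 1(4)] unfolding b kk(1) by blast
 next
  fix \<beta> assume 2: "\<beta> \<in> {hd (vl i), last (vl i)}" "{c, c'} = {((8, j, 0), \<beta>), ((7, j, 0), \<beta>)}"
  have "\<beta> = (2, i, 0) \<and> i = 0 \<or> \<beta> = (22, i, 0) \<and> 0 < i \<or> \<beta> = (3, i, 0) \<and> i < L \<or> \<beta> = (24, i, 0) \<and> i = L"
   using 2(1) 4(2) unfolding vl by (auto split: if_splits)
  then have "pot ((7, j, 0), \<beta>) ((8, j, 0), \<beta>)"
   using 4(2,3) L by (elim disjE) (simp_all add: pot_def cell_def hpot_def rs_def sh_simps)
  then show ?thesis using pot_eq[OF 2(2)] pot_sym by blast
 qed
qed

end

section \<open>A spanning tree of tracks for a satisfying assignment\<close>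

text \<open>\<open>e j\<close> selects one symbol that satisfies clause \<open>j\<close>; a single
  sideways exit per clause is enough for the tour.\<close>

locale sat_layout = layout +
 fixes \<tau> :: "nat \<Rightarrow> bool" and e :: "nat \<Rightarrow> nat"
 assumes e_less: "j < M \<Longrightarrow> e j < L"
  and e_sat: "j < M \<Longrightarrow> if \<tau> (e j) then occP (e j) j else occN (e j) j"
begin

text \<open>Parent of a track, the edge of the track that is opened, and the edge of the parent that
  is opened. Rings \<open>2\<close> and tracks \<open>10\<close> tie each row to the border whatever
  the assignment is. Ring \<open>3\<close> and track \<open>9\<close> follow the truth value of the
  row: both use the contact on their left if it is true, both the one on their right if it is false.
  In a column, the blocks below row \<open>e j\<close> serve the vertical track beneath them and the
  blocks above it the track over them. The block in row \<open>e j\<close> serves both, and its ring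
  \<open>4\<close> leaves sideways.\<close>

definition att :: "nat \<times> nat \<times> nat \<Rightarrow> (nat \<times> nat \<times> nat) \<times> (cell \<times> cell) \<times> (cell \<times> cell)" where
 "att = (\<lambda>(t, i, j).
  let H = (\<lambda>l i. (nd 7 l i j, nd 8 l i j)); V = (\<lambda>k l. (nd k (Suc l) i j, nd k l i j)) in
  if t = 2 then (if j = 0 then ((12, 0, 0), V 4 7, (((3, 0, 0), (8, i, 0)), ((3, 0, 0), (7, i, 0))))
          else ((10, i, j - 1), V 4 7, (nd 14 8 i (j - 1), nd 14 7 i (j - 1))))

  else if t = 3 then (if \<tau> i then ((2, i, j), V 5 12, V 4 12) else ((2, i, j), V 10 12, V 11 12))

  else if t = 4 then (if i < e j then ((3, i, j), H 14 i, H 15 i) else if e j < i then ((3, i, j), H 11 i, H 10 i)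
          else if \<tau> i then ((3, i, j), V 9 12, V 10 12) else ((3, i, j), V 6 12, V 5 12))

  else if t = 5 then (if i < e j then ((2, i, j), H 20 i, H 21 i) else ((3, i, j), H 16 i, H 15 i))

  else if t = 6 then (if i < e j then ((5, i, j), H 17 i, H 16 i) else ((5, i, j), H 19 i, H 20 i))

  else if t = 7 then (if i \<le> e j then ((3, i, j), H 9 i, H 10 i) else ((2, i, j), H 5 i, H 4 i))

  else if t = 8 then (if i \<le> e j then ((7, i, j), H 6 i, H 5 i) else ((7, i, j), H 8 i, H 9 i))

  else if t = 9 then (if \<tau> i then ((2, i, j), V 12 12, V 11 12)
          else ((2, i, Suc j), V 14 12, (nd 4 13 i (Suc j), nd 4 12 i (Suc j))))

  else if t = 10 then ((2, i, j), V 12 7, V 11 7)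
  else (if i \<le> e j then ((2, i, j), H 3 i, H 4 i) else ((2, i - 1, j), H 22 i, H 21 (i - 1))))"

definition "par t = fst (att t)"
definition "cp t = fst (fst (snd (att t)))"
definition "cq t = snd (fst (snd (att t)))"
definition "pp t = fst (snd (snd (att t)))"
definition "pq t = snd (snd (snd (att t)))"

lemmas att_defs = par_def cp_def cq_def pp_def pq_def att_def Let_def

text \<open>Along a row, rings \<open>2\<close> and tracks \<open>10\<close> alternate and receive
  odd and even ranks; all other tracks hang on these at depth at most three, hence the offsets above
  \<open>2 * M\<close>.\<close>

definition rk :: "nat \<times> nat \<times> nat \<Rightarrow> nat" where
 "rk = (\<lambda>(t, i, j). if t = 12 then 0
  else if t = 2 then 2 * j + 1
  else if t = 10 then 2 * j + 2

  else if t = 3 \<or> t = 9 \<or> t = 11 then 2 * M + 3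
  else if t = 6 \<or> t = 8 then 2 * M + 5 else 2 * M + 4)"

lemma tracks_cases2:
 assumes "t \<in> tracks" "t \<noteq> (12, 0, 0)"
 obtains i j where "t = (2, i, j)" "i < L" "j < M" | i j where "t = (3, i, j)" "i < L" "j < M"
  | i j where "t = (4, i, j)" "i < L" "j < M" | i j where "t = (5, i, j)" "i < L" "j < M"
  | i j where "t = (6, i, j)" "i < L" "j < M" | i j where "t = (7, i, j)" "i < L" "j < M"
  | i j where "t = (8, i, j)" "i < L" "j < M"
  | i j where "t = (9, i, j)" "i < L" "Suc j < M" | i j where "t = (10, i, j)" "i < L" "Suc j < M"
  | i j where "t = (11, i, j)" "i \<le> L" "j < M"
 using assms(1)
proof (cases rule: tracks_cases)
 case (2 s i j)
 then have "s = 2 \<or> s = 3 \<or> s = 4 \<or> s = 5 \<or> s = 6 \<or> s = 7 \<or> s = 8" by arith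
 then show ?thesis using that(1-7) 2 by blast
qed (use assms(2) that(8-10) in blast)+

lemma e_lt: "j < M \<Longrightarrow> i \<le> e j \<Longrightarrow> i < L"
 using e_less by (meson le_less_trans)

lemma par_rk: assumes "t \<in> tracks" "t \<noteq> (12, 0, 0)" shows "par t \<in> tracks \<and> rk (par t) < rk t"
 using assms by (cases rule: tracks_cases2) (auto simp: att_defs rk_def tracks_def dest: e_lt)

lemma ring_edge:
 "2 \<le> t \<Longrightarrow> t \<le> 8 \<Longrightarrow> adjin (ringl t) (k, l) (k', l') \<Longrightarrow> {nd k l i j, nd k' l' i j} \<in> cedges (cyc (t, i, j))"
proof -
 assume t: "2 \<le> t" "t \<le> 8" and a: "adjin (ringl t) (k, l) (k', l')"
 have "{(k, l), (k', l')} \<in> cedges (ringl t)"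
  using adjin_pedges[OF a] ring_all(5)[OF t] by (simp add: cedges_def)
 then have "(\<lambda>(k, l). nd k l i j) ` {(k, l), (k', l')} \<in> cedges (map (\<lambda>(k, l). nd k l i j) (ringl t))"
  unfolding cedges_map by blast
 then show ?thesis using t by (simp add: cyc_simps)
qed

lemma ring_edges:
 "{nd 4 8 i j, nd 4 7 i j} \<in> cedges (cyc (2, i, j))" "{nd 4 13 i j, nd 4 12 i j} \<in> cedges (cyc (2, i, j))"
 "{nd 11 8 i j, nd 11 7 i j} \<in> cedges (cyc (2, i, j))" "{nd 11 13 i j, nd 11 12 i j} \<in> cedges (cyc (2, i, j))"
 "{nd 7 4 i j, nd 8 4 i j} \<in> cedges (cyc (2, i, j))" "{nd 7 21 i j, nd 8 21 i j} \<in> cedges (cyc (2, i, j))"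
 "{nd 5 13 i j, nd 5 12 i j} \<in> cedges (cyc (3, i, j))" "{nd 10 13 i j, nd 10 12 i j} \<in> cedges (cyc (3, i, j))"
 "{nd 7 10 i j, nd 8 10 i j} \<in> cedges (cyc (3, i, j))" "{nd 7 15 i j, nd 8 15 i j} \<in> cedges (cyc (3, i, j))"
 "{nd 6 13 i j, nd 6 12 i j} \<in> cedges (cyc (4, i, j))" "{nd 9 13 i j, nd 9 12 i j} \<in> cedges (cyc (4, i, j))"
 "{nd 7 11 i j, nd 8 11 i j} \<in> cedges (cyc (4, i, j))" "{nd 7 14 i j, nd 8 14 i j} \<in> cedges (cyc (4, i, j))"
 "{nd 7 16 i j, nd 8 16 i j} \<in> cedges (cyc (5, i, j))" "{nd 7 20 i j, nd 8 20 i j} \<in> cedges (cyc (5, i, j))"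
 "{nd 7 17 i j, nd 8 17 i j} \<in> cedges (cyc (6, i, j))" "{nd 7 19 i j, nd 8 19 i j} \<in> cedges (cyc (6, i, j))"
 "{nd 7 5 i j, nd 8 5 i j} \<in> cedges (cyc (7, i, j))" "{nd 7 9 i j, nd 8 9 i j} \<in> cedges (cyc (7, i, j))"
 "{nd 7 6 i j, nd 8 6 i j} \<in> cedges (cyc (8, i, j))" "{nd 7 8 i j, nd 8 8 i j} \<in> cedges (cyc (8, i, j))"
 by (rule ring_edge; simp add: ringl_simps)+

lemma seg_edges:
 "{nd 12 13 i j, nd 12 12 i j} \<in> cedges (cyc (9, i, j))" "{nd 14 13 i j, nd 14 12 i j} \<in> cedges (cyc (9, i, j))"
 "{nd 12 8 i j, nd 12 7 i j} \<in> cedges (cyc (10, i, j))" "{nd 14 8 i j, nd 14 7 i j} \<in> cedges (cyc (10, i, j))"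
 unfolding cyc_simps cedges_race[OF hl(1)] hl by (simp_all add: insert_commute)

lemma s4_edges:
 "i < L \<Longrightarrow> {nd 7 3 i j, nd 8 3 i j} \<in> cedges (cyc (11, i, j))"
 "0 < i \<Longrightarrow> {nd 7 22 i j, nd 8 22 i j} \<in> cedges (cyc (11, i, j))"
 unfolding cyc_simps cedges_race[OF vl(1)] vl by (simp_all add: insert_commute)

lemma lb_edge:
 assumes "i < L" shows "{((3, 0, 0), (8, i, 0)), ((3, 0, 0), (7, i, 0))} \<in> cedges (cyc (12, 0, 0))"
proof -
 have "{(7, i, 0), ny (7, i, 0)} \<in> pedges yl" by (rule yl_step) (use assms in auto)
 moreover have "ny (7, i, 0) = (8, i, 0)" by simp
 ultimately have "{(7, i, 0), (8, i, 0)} \<in> pedges yl" by metis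
 from imageI[OF this, of "(`) (Pair (3, 0, 0))"]
 have "{((3, 0, 0), (8, i, 0)), ((3, 0, 0), (7, i, 0))} \<in> (`) (Pair (3, 0, 0)) ` pedges yl"
  unfolding image_insert image_empty by (subst insert_commute)
 then show ?thesis unfolding cyc_simps cedges_race[OF yl_ends(1)] by (intro UnI1)
qed

lemma child_edge: assumes "t \<in> tracks" "t \<noteq> (12, 0, 0)" shows "{cp t, cq t} \<in> cedges (cyc t)"
 using assms by (cases rule: tracks_cases2) (auto simp: att_defs ring_edges seg_edges intro: s4_edges e_lt)

lemma parent_edge: assumes "t \<in> tracks" "t \<noteq> (12, 0, 0)" shows "{pp t, pq t} \<in> cedges (cyc (par t))"
 using assms by (cases rule: tracks_cases2) (auto simp: att_defs ring_edges seg_edges lb_edge)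

text \<open>Tells the two rails of a contact apart. Every opened edge has one end on each rail, so
  two such unordered edges are equal only if their first ends are equal.\<close>

fun isq :: "cell \<Rightarrow> bool" where "isq ((k, j, g), (l, i, h)) \<longleftrightarrow> k = 8 \<or> l = 7 \<or> l = 12"

lemma isq: assumes "t \<in> tracks" "t \<noteq> (12, 0, 0)"
 shows "\<not> isq (cp t)" "isq (cq t)" "\<not> isq (pp t)" "isq (pq t)"
 using assms by (cases rule: tracks_cases2; simp add: att_defs)+

lemma doubleton_isq: "\<not> isq a \<Longrightarrow> isq b \<Longrightarrow> \<not> isq c \<Longrightarrow> isq d \<Longrightarrow> {a, b} = {c, d} \<Longrightarrow> a = c"
 by (metis doubleton_eq_iff)

lemma trk_cp: assumes "t \<in> tracks" "t \<noteq> (12, 0, 0)" shows "trk (cp t) = t"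
 using assms by (cases rule: tracks_cases2) (auto simp: att_defs trk_def tk_simps)

lemma trk_pp: assumes "t \<in> tracks" "t \<noteq> (12, 0, 0)" shows "trk (pp t) = par t"
 using assms by (cases rule: tracks_cases2) (auto simp: att_defs trk_def tk_simps)

lemma cp_par: assumes "t \<in> tracks" "t \<noteq> (12, 0, 0)" shows "cp (par t) \<noteq> pp t"
 using assms by (cases rule: tracks_cases2) (auto simp: att_defs)

text \<open>A left inverse of \<open>pp\<close>: it recovers the child from the cell where the child
  is attached to its parent. That such a function exists shows that no edge of a parent is opened
  twice. The case distinctions reflect contacts that share an edge and are used
  alternatively.\<close>

fun chi :: "cell \<Rightarrow> nat \<times> nat \<times> nat" where
 "chi ((k, j, g), (l, i, h)) =
  (if k = 3 then (2, i, 0) else if k = 14 then (2, i, Suc j)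
   else if l = 8 \<and> k = 11 then (10, i, j)
   else if l = 13 \<and> k = 4 then (if \<tau> i then (3, i, j) else (9, i, j - 1))
   else if l = 13 \<and> k = 11 then (if \<tau> i then (9, i, j) else (3, i, j))
   else if l = 13 then (4, i, j)
   else if l = 15 then (if i < e j then (4, i, j) else (5, i, j))
   else if l = 10 then (if e j < i then (4, i, j) else (7, i, j))
   else if l = 21 then (if i < e j then (5, i, j) else (11, Suc i, j))
   else if l = 16 \<or> l = 20 then (6, i, j)
   else if l = 4 then (if i \<le> e j then (11, i, j) else (7, i, j))
   else (8, i, j))"

lemma chi: assumes "t \<in> tracks" "t \<noteq> (12, 0, 0)" shows "chi (pp t) = t"
 using assms by (cases rule: tracks_cases2) (auto simp: att_defs)

lemma att_pot:
 assumes "t \<in> tracks" "t \<noteq> (12, 0, 0)" shows "pot (cp t) (pp t)" "pot (cq t) (pq t)"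
proof -
 \<comment> \<open>\<open>e_sat\<close> is needed for ring \<open>4\<close> in row
   \<open>e j\<close>: the switchable cell at its sideways exit is thick because the symbol occurs
   in the clause with the right sign.\<close>
 have a: "rs (cp t) = 9 \<and> rs (cq t) = 9 \<and> rs (pp t) = 9 \<and> rs (pq t) = 9"
  using assms e_sat by (cases rule: tracks_cases2) (auto simp: att_defs rs_def sh_simps)
 have c: "cell (cp t)" "cell (cq t)" "cell (pp t)" "cell (pq t)"
 proof -
  have "cp t \<in> set (cyc t)" "cq t \<in> set (cyc t)" using cedges_set[OF child_edge[OF assms]] by blast+
  then show "cell (cp t)" "cell (cq t)" using cyc_cell[OF assms(1)] by blast+
  have p: "par t \<in> tracks" using par_rk[OF assms] by blast
  have "pp t \<in> set (cyc (par t))" "pq t \<in> set (cyc (par t))" using cedges_set[OF parent_edge[OF assms]] by blast+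
  then show "cell (pp t)" "cell (pq t)" using cyc_cell[OF p] by blast+
 qed
 have "fst (pp t) = nx (fst (cp t)) \<and> snd (pp t) = snd (cp t) \<and> fst (pq t) = nx (fst (cq t)) \<and> snd (pq t) = snd (cq t)
   \<or> fst (cp t) = nx (fst (pp t)) \<and> snd (pp t) = snd (cp t) \<and> fst (cq t) = nx (fst (pq t)) \<and> snd (pq t) = snd (cq t)
   \<or> snd (pp t) = ny (snd (cp t)) \<and> fst (pp t) = fst (cp t) \<and> snd (pq t) = ny (snd (cq t)) \<and> fst (pq t) = fst (cq t)
   \<or> snd (cp t) = ny (snd (pp t)) \<and> fst (pp t) = fst (cp t) \<and> snd (cq t) = ny (snd (pq t)) \<and> fst (pq t) = fst (cq t)"
  using assms by (cases rule: tracks_cases2) (auto simp: att_defs)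
 then have "pot (cp t) (pp t) \<and> pot (cq t) (pq t)"
  unfolding pot_def hpot_def vpot_def
  by (elim disjE conjE; (simp add: a c del: nx.simps ny.simps)?)
 then show "pot (cp t) (pp t)" "pot (cq t) (pq t)" by blast+
qed

theorem cell_cycle:
 "\<exists>zs. distinct zs \<and> set zs = {c. cell c} \<and> (\<forall>c c'. {c, c'} \<in> cedges zs \<longrightarrow> pot c c')"
proof -
 have fin: "finite tracks"
 proof -
  have "tracks \<subseteq> {..12} \<times> {..L} \<times> {..M}" by (auto simp: tracks_def)
  then show ?thesis using finite_subset by blast
 qed
 have "\<exists>zs. distinct zs \<and> set zs = (\<Union>t\<in>tracks. set (cyc t))
  \<and> cedges zs \<subseteq> (\<Union>t\<in>tracks. cedges (cyc t)) \<union> (\<Union>t\<in>tracks - {(12, 0, 0)}. {{cp t, pp t}, {cq t, pq t}})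
  \<and> (\<Union>t\<in>tracks. cedges (cyc t)) - (\<Union>t\<in>tracks - {(12, 0, 0)}. {{cp t, cq t}, {pp t, pq t}}) \<subseteq> cedges zs"
 proof (rule forest_merge[where par = par and rk = rk and cyc = cyc and cp = cp and cq = cq and pp = pp and pq = pq])
  show "(12, 0, 0) \<in> tracks" by (simp add: tracks_def)
  show "set (cyc t) \<inter> set (cyc t') = {}" if "t \<in> tracks" "t' \<in> tracks" "t \<noteq> t'" for t t'
  proof (rule equals0I)
   fix c assume "c \<in> set (cyc t) \<inter> set (cyc t')"
   then have "trk c = t" "trk c = t'" using cyc_cell that(1,2) by blast+
   then show False using that(3) by simp
  qed
  show "par t \<in> tracks \<and> rk (par t) < rk t \<and> {cp t, cq t} \<in> cedges (cyc t) \<and> {pp t, pq t} \<in> cedges (cyc (par t))"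
   if "t \<in> tracks" "t \<noteq> (12, 0, 0)" for t
   using par_rk[OF that] child_edge[OF that] parent_edge[OF that] by simp
  show "{pp t, pq t} \<noteq> {pp t', pq t'}"
   if "t \<in> tracks - {(12, 0, 0)}" "t' \<in> tracks - {(12, 0, 0)}" "t \<noteq> t'" for t t'
  proof
   have m: "t \<in> tracks" "t \<noteq> (12, 0, 0)" and m': "t' \<in> tracks" "t' \<noteq> (12, 0, 0)" using that(1,2) by blast+
   assume "{pp t, pq t} = {pp t', pq t'}"
   then have "pp t = pp t'" using doubleton_isq[OF isq(3)[OF m] isq(4)[OF m] isq(3)[OF m'] isq(4)[OF m']] by blast
   then have "chi (pp t) = chi (pp t')" by (rule arg_cong)
   then show False unfolding chi[OF m] chi[OF m'] using that(3) by contradiction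
  qed
  show "{cp t, cq t} \<noteq> {pp t', pq t'}"
   if "t \<in> tracks - {(12, 0, 0)}" "t' \<in> tracks - {(12, 0, 0)}" for t t'
  proof
   have m: "t \<in> tracks" "t \<noteq> (12, 0, 0)" and m': "t' \<in> tracks" "t' \<noteq> (12, 0, 0)" using that(1,2) by blast+
   assume "{cp t, cq t} = {pp t', pq t'}"
   then have eq: "cp t = pp t'" using doubleton_isq[OF isq(1)[OF m] isq(2)[OF m] isq(3)[OF m'] isq(4)[OF m']] by blast
   then have "trk (cp t) = trk (pp t')" by (rule arg_cong)
   then have "t = par t'" unfolding trk_cp[OF m] trk_pp[OF m'] .
   then show False using cp_par[OF m'] eq by blast
  qed
 qed (rule fin cyc_distinct; assumption?)+
 then obtain zs where zs: "distinct zs" "set zs = (\<Union>t\<in>tracks. set (cyc t))"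
  "cedges zs \<subseteq> (\<Union>t\<in>tracks. cedges (cyc t)) \<union> (\<Union>t\<in>tracks - {(12, 0, 0)}. {{cp t, pp t}, {cq t, pq t}})"
  by blast
 have "set zs = {c. cell c}"
 proof (intro set_eqI iffI)
  fix c assume "c \<in> set zs"
  then obtain t where "t \<in> tracks" "c \<in> set (cyc t)" unfolding zs(2) by blast
  then show "c \<in> {c. cell c}" using cyc_cell by blast
 next
  fix c assume "c \<in> {c. cell c}"
  then have "trk c \<in> tracks" "c \<in> set (cyc (trk c))" using cell_trk by blast+
  then show "c \<in> set zs" unfolding zs(2) by (rule UN_I)
 qed
 moreover have "pot c c'" if "{c, c'} \<in> cedges zs" for c c'
 proof -
  have "{c, c'} \<in> (\<Union>t\<in>tracks. cedges (cyc t)) \<union> (\<Union>t\<in>tracks - {(12, 0, 0)}. {{cp t, pp t}, {cq t, pq t}})"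
   by (rule subsetD[OF zs(3) that])
  then show ?thesis
  proof (elim UnE UN_E)
   fix t assume "t \<in> tracks" "{c, c'} \<in> cedges (cyc t)"
   then show ?thesis by (rule cyc_pot)
  next
   fix t assume t: "t \<in> tracks - {(12, 0, 0)}" "{c, c'} \<in> {{cp t, pp t}, {cq t, pq t}}"
   then have m: "t \<in> tracks" "t \<noteq> (12, 0, 0)" by blast+
   from t(2) have "{c, c'} = {cp t, pp t} \<or> {c, c'} = {cq t, pq t}" by simp
   then show ?thesis by (elim disjE) (erule pot_eq, rule att_pot[OF m])+
  qed
 qed
 ultimately show ?thesis using zs(1) by blast
qed

end

section \<open>Points and touching discs\<close>

definition ix :: "'a list \<Rightarrow> 'a \<Rightarrow> nat" where "ix xs a = length (takeWhile (\<lambda>z. z \<noteq> a) xs)"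

lemma ix: "a \<in> set xs \<Longrightarrow> ix xs a < length xs \<and> xs ! ix xs a = a"
 by (induction xs) (auto simp: ix_def)

lemma ix_nth: "distinct xs \<Longrightarrow> i < length xs \<Longrightarrow> ix xs (xs ! i) = i"
 using ix[of "xs ! i" xs] nth_eq_iff_index_eq by fastforce

lemma ix_inj: "a \<in> set xs \<Longrightarrow> b \<in> set xs \<Longrightarrow> ix xs a = ix xs b \<Longrightarrow> a = b"
 using ix by metis

lemma ix_succ:
 assumes "distinct xs" "successively (\<lambda>a b. b = f a) xs" "f (last xs) \<notin> set xs" "a \<in> set xs" "b \<in> set xs"
 shows "b = f a \<longleftrightarrow> ix xs b = Suc (ix xs a)"
proof -
 have s: "\<And>i. Suc i < length xs \<Longrightarrow> xs ! Suc i = f (xs ! i)"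
  using assms(2) unfolding successively_conv_nth by blast
 note ia = ix[OF assms(4)] and ib = ix[OF assms(5)]
 show ?thesis
 proof
  assume e: "b = f a"
  have "Suc (ix xs a) < length xs"
  proof (rule ccontr)
   assume "\<not> Suc (ix xs a) < length xs"
   then have "ix xs a = length xs - 1" "xs \<noteq> []" using ia by auto
   then have "a = last xs" using ia by (metis last_conv_nth)
   then show False using assms(3,5) e by simp
  qed
  then show "ix xs b = Suc (ix xs a)" using s[of "ix xs a"] ia e ix_nth[OF assms(1), of "Suc (ix xs a)"] by simp
 next
  assume e: "ix xs b = Suc (ix xs a)"
  then show "b = f a" using s[of "ix xs a"] ia ib by simp
 qed
qed

type_synonym vert = "cell \<times> nat \<times> nat"

text \<open>Positions of the discs on the 3 by 3 grid inside a cell: a wire has its centre and one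
  point at each of its two open sides, a thick cell only its centre.\<close>

definition offs :: "nat \<Rightarrow> (nat \<times> nat) list" where
 "offs s = (if s = 0 then [] else [(1, 1)]) @ (if s \<noteq> 9 \<and> opL s then [(0, 1)] else [])
   @ (if s \<noteq> 9 \<and> opR s then [(2, 1)] else []) @ (if s \<noteq> 9 \<and> opU s then [(1, 2)] else [])
   @ (if s \<noteq> 9 \<and> opD s then [(1, 0)] else [])"

lemma set_offs: "(u, v) \<in> set (offs s) \<longleftrightarrow> (u, v) = (1, 1) \<and> s \<noteq> 0 \<or> s \<noteq> 9 \<and>
  ((u, v) = (0, 1) \<and> opL s \<or> (u, v) = (2, 1) \<and> opR s \<or> (u, v) = (1, 2) \<and> opU s \<or> (u, v) = (1, 0) \<and> opD s)"
 by (auto simp: offs_def simp del: op_simps)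

lemma offs_lt: "(u, v) \<in> set (offs s) \<Longrightarrow> u < 3 \<and> v < 3 \<and> (u = 1 \<or> v = 1)"
 by (auto simp: set_offs simp del: op_simps)

lemma offs_thick: "(u, v) \<in> set (offs 9) \<Longrightarrow> u = 1 \<and> v = 1"
 by (simp add: set_offs)

lemma offs_op: "(u, v) \<in> set (offs s) \<Longrightarrow> (u = 0 \<longrightarrow> opL s) \<and> (u = 2 \<longrightarrow> opR s) \<and> (v = 2 \<longrightarrow> opU s) \<and> (v = 0 \<longrightarrow> opD s)"
 by (auto simp: set_offs simp del: op_simps)

lemma op0: "opR s \<Longrightarrow> s \<noteq> 0" "opL s \<Longrightarrow> s \<noteq> 0" "opU s \<Longrightarrow> s \<noteq> 0" "opD s \<Longrightarrow> s \<noteq> 0" by auto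

lemma op_thick: "opR 9" "opL 9" "opU 9" "opD 9" by simp_all

context layout begin

section \<open>Positions and tangency\<close>

definition cx :: "cell \<Rightarrow> nat" where "cx c = ix xl (fst c)"
definition cy :: "cell \<Rightarrow> nat" where "cy c = ix yl (snd c)"

definition pos :: "vert \<Rightarrow> nat \<times> nat" where
 "pos = (\<lambda>(c, u, v). (3 * cx c + u, 3 * cy c + v))"

definition V :: "vert set" where "V = {(c, w). cell c \<and> w \<in> set (offs (rs c))}"

definition th :: "vert \<Rightarrow> nat" where "th v = (if rs (fst v) = 9 then 1 else 0)"

text \<open>The sum of two radii, where the radius is 1/2 for a point of a wire and 3/2 for a thick
  cell. The sum is a natural number, so tangency can be decided on integer coordinates.\<close>

definition wt :: "vert \<Rightarrow> vert \<Rightarrow> nat" where "wt v v' = 1 + th v + th v'"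

text \<open>Only distances parallel to the axes are considered. That no other pair of points
  realises the touching distance is part of \<open>separation\<close>.\<close>

definition apart :: "nat \<Rightarrow> nat \<times> nat \<Rightarrow> nat \<times> nat \<Rightarrow> bool" where
 "apart w p q \<longleftrightarrow> (snd p = snd q \<and> (fst q = fst p + w \<or> fst p = fst q + w))
   \<or> (fst p = fst q \<and> (snd q = snd p + w \<or> snd p = snd q + w))"

definition tang :: "vert \<Rightarrow> vert \<Rightarrow> bool" where "tang v v' \<longleftrightarrow> apart (wt v v') (pos v) (pos v')"

lemma tang_sym: "tang v v' \<Longrightarrow> tang v' v"
 by (auto simp: tang_def apart_def wt_def)

lemma cell_v: "cell c \<Longrightarrow> vx (fst c) \<and> vy (snd c)" by (simp add: cell_def)

lemma cx_step: "cell c \<Longrightarrow> cell c' \<Longrightarrow> fst c' = nx (fst c) \<longleftrightarrow> cx c' = Suc (cx c)"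
proof -
 assume c: "cell c" "cell c'"
 have "\<not> vx (nx (11, M - 1, 0))" using M by simp
 then have "nx (last xl) \<notin> set xl" unfolding xl_ends set_xl by blast
 moreover have "fst c \<in> set xl" "fst c' \<in> set xl" using cell_v c set_xl by blast+
 ultimately show ?thesis unfolding cx_def using ix_succ[OF distinct_xl xl_succ] by blast
qed

lemma cy_step: "cell c \<Longrightarrow> cell c' \<Longrightarrow> snd c' = ny (snd c) \<longleftrightarrow> cy c' = Suc (cy c)"
proof -
 assume c: "cell c" "cell c'"
 have "\<not> vy (ny (24, L, 0))" by simp
 then have "ny (last yl) \<notin> set yl" unfolding yl_ends set_yl by blast
 moreover have "snd c \<in> set yl" "snd c' \<in> set yl" using cell_v c set_yl by blast+
 ultimately show ?thesis unfolding cy_def using ix_succ[OF distinct_yl yl_succ] by blast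
qed

lemma cx_inj: "cell c \<Longrightarrow> cell c' \<Longrightarrow> fst c = fst c' \<longleftrightarrow> cx c = cx c'"
proof -
 assume c: "cell c" "cell c'"
 have "fst c \<in> set xl" "fst c' \<in> set xl" using cell_v c set_xl by blast+
 then show ?thesis unfolding cx_def using ix_inj[of "fst c" xl "fst c'"] by fastforce
qed

lemma cy_inj: "cell c \<Longrightarrow> cell c' \<Longrightarrow> snd c = snd c' \<longleftrightarrow> cy c = cy c'"
proof -
 assume c: "cell c" "cell c'"
 have "snd c \<in> set yl" "snd c' \<in> set yl" using cell_v c set_yl by blast+
 then show ?thesis unfolding cy_def using ix_inj[of "snd c" yl "snd c'"] by fastforce
qed

lemma hpot_conv: "cell c \<Longrightarrow> cell c' \<Longrightarrow> hpot c c' \<longleftrightarrow> cx c' = Suc (cx c) \<and> cy c' = cy c \<and> opR (rs c) \<and> opL (rs c')"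
 unfolding hpot_def using cx_step[of c c'] cy_inj[of c' c] by blast

lemma vpot_conv: "cell c \<Longrightarrow> cell c' \<Longrightarrow> vpot c c' \<longleftrightarrow> cy c' = Suc (cy c) \<and> cx c' = cx c \<and> opU (rs c) \<and> opD (rs c')"
 unfolding vpot_def using cy_step[of c c'] cx_inj[of c' c] by blast

lemma VD: "(c, u, v) \<in> V \<Longrightarrow> cell c \<and> (u, v) \<in> set (offs (rs c))" by (simp add: V_def)

lemma pos_inj: "inj_on pos V"
proof (rule inj_onI)
 fix x y assume xy: "x \<in> V" "y \<in> V" "pos x = pos y"
 obtain c u v where x: "x = (c, u, v)" by (cases x)
 obtain c' u' v' where y: "y = (c', u', v')" by (cases y)
 have u: "u < 3" "v < 3" "u' < 3" "v' < 3"
  using VD[of c u v] VD[of c' u' v'] xy(1,2) offs_lt unfolding x y by blast+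
 have "3 * cx c + u = 3 * cx c' + u'" "3 * cy c + v = 3 * cy c' + v'"
  using xy(3) by (simp_all add: x y pos_def)
 then have e: "cx c = cx c'" "u = u'" "cy c = cy c'" "v = v'" using u by presburger+
 have cc: "cell c" "cell c'" using VD xy(1,2) unfolding x y by blast+
 have "fst c = fst c'" "snd c = snd c'" using e cx_inj[OF cc] cy_inj[OF cc] by blast+
 then show "x = y" unfolding x y using e by (simp add: prod_eq_iff)
qed

definition rp :: "cell \<Rightarrow> vert" where "rp c = (c, if rs c = 9 then (1, 1) else (2, 1))"
definition lp :: "cell \<Rightarrow> vert" where "lp c = (c, if rs c = 9 then (1, 1) else (0, 1))"
definition upp :: "cell \<Rightarrow> vert" where "upp c = (c, if rs c = 9 then (1, 1) else (1, 2))"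
definition dp :: "cell \<Rightarrow> vert" where "dp c = (c, if rs c = 9 then (1, 1) else (1, 0))"
definition ctr :: "cell \<Rightarrow> vert" where "ctr c = (c, 1, 1)"

lemmas port_defs = rp_def lp_def upp_def dp_def ctr_def

lemma hpot_tang:
 assumes "cell c" "cell c'" "hpot c c'"
 shows "tang (rp c) (lp c')" "rp c \<in> V" "lp c' \<in> V"
proof -
 have "cx c' = Suc (cx c)" "cy c' = cy c" "opR (rs c)" "opL (rs c')" using assms hpot_conv by blast+
 moreover from this have "rs c \<noteq> 0" "rs c' \<noteq> 0" by (metis op0)+
 ultimately show "tang (rp c) (lp c')" "rp c \<in> V" "lp c' \<in> V"
  using assms(1,2) by (cases "rs c = 9"; cases "rs c' = 9"; simp add: tang_def apart_def wt_def th_def pos_def port_defs V_def set_offs del: op_simps)+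
qed

lemma vpot_tang:
 assumes "cell c" "cell c'" "vpot c c'"
 shows "tang (upp c) (dp c')" "upp c \<in> V" "dp c' \<in> V"
proof -
 have "cy c' = Suc (cy c)" "cx c' = cx c" "opU (rs c)" "opD (rs c')" using assms vpot_conv by blast+
 moreover from this have "rs c \<noteq> 0" "rs c' \<noteq> 0" by (metis op0)+
 ultimately show "tang (upp c) (dp c')" "upp c \<in> V" "dp c' \<in> V"
  using assms(1,2) by (cases "rs c = 9"; cases "rs c' = 9"; simp add: tang_def apart_def wt_def th_def pos_def port_defs V_def set_offs del: op_simps)+
qed

text \<open>Offsets are below 3, so the coordinates determine the cell indices and the offsets. With
  weight 1, 2 or 3 and offset 1 for thick cells, the only solutions in different cells are
  neighbouring cells touching at the points that face each other.\<close>

lemma tang_right: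
 assumes "x \<in> V" "y \<in> V" "fst x \<noteq> fst y" "snd (pos x) = snd (pos y)" "fst (pos y) = fst (pos x) + wt x y"
 shows "hpot (fst x) (fst y) \<and> x = rp (fst x) \<and> y = lp (fst y)"
proof -
 obtain c u v where x: "x = (c, u, v)" by (cases x)
 obtain c' u' v' where y: "y = (c', u', v')" by (cases y)
 have c: "cell c" "cell c'" "(u, v) \<in> set (offs (rs c))" "(u', v') \<in> set (offs (rs c'))"
  using VD assms(1,2) unfolding x y by blast+
 have uv: "u < 3" "v < 3" "u' < 3" "v' < 3" using offs_lt c(3,4) by blast+
 have p: "3 * cy c + v = 3 * cy c' + v'" "3 * cx c' + u' = 3 * cx c + u + wt x y"
  using assms(4,5) by (simp_all add: x y pos_def)
 have cy: "cy c = cy c'" "v = v'" using p(1) uv by presburger+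
 have ne: "cx c \<noteq> cx c'"
 proof
  assume "cx c = cx c'"
  then have "c = c'" using cx_inj[OF c(1,2)] cy_inj[OF c(1,2)] cy(1) by (simp add: prod_eq_iff)
  then show False using assms(3) by (simp add: x y)
 qed
 have w: "wt x y = 1 + (if rs c = 9 then 1 else 0) + (if rs c' = 9 then 1 else 0)" by (simp add: wt_def th_def x y)
 have t: "rs c = 9 \<Longrightarrow> u = 1 \<and> v = 1" "rs c' = 9 \<Longrightarrow> u' = 1 \<and> v' = 1"
  using offs_thick c(3,4) by metis+
 have cases: "cx c' = Suc (cx c) \<and> (if rs c = 9 then u = 1 else u = 2) \<and> (if rs c' = 9 then u' = 1 else u' = 0)"
  using p(2) w t ne uv by (auto split: if_splits) presburger+
 have "opR (rs c)" using cases offs_op[OF c(3)] op_thick by (cases "rs c = 9") simp_all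
 moreover have "opL (rs c')" using cases offs_op[OF c(4)] op_thick by (cases "rs c' = 9") simp_all
 moreover have "v = 1" using cases offs_lt[OF c(3)] t by (cases "rs c = 9") simp_all
 ultimately show ?thesis using cases cy hpot_conv[OF c(1,2)] by (cases "rs c = 9"; cases "rs c' = 9") (simp_all add: x y port_defs del: op_simps)
qed

lemma tang_up:
 assumes "x \<in> V" "y \<in> V" "fst x \<noteq> fst y" "fst (pos x) = fst (pos y)" "snd (pos y) = snd (pos x) + wt x y"
 shows "vpot (fst x) (fst y) \<and> x = upp (fst x) \<and> y = dp (fst y)"
proof -
 obtain c u v where x: "x = (c, u, v)" by (cases x)
 obtain c' u' v' where y: "y = (c', u', v')" by (cases y)
 have c: "cell c" "cell c'" "(u, v) \<in> set (offs (rs c))" "(u', v') \<in> set (offs (rs c'))"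
  using VD assms(1,2) unfolding x y by blast+
 have uv: "u < 3" "v < 3" "u' < 3" "v' < 3" using offs_lt c(3,4) by blast+
 have p: "3 * cx c + u = 3 * cx c' + u'" "3 * cy c' + v' = 3 * cy c + v + wt x y"
  using assms(4,5) by (simp_all add: x y pos_def)
 have cx: "cx c = cx c'" "u = u'" using p(1) uv by presburger+
 have ne: "cy c \<noteq> cy c'"
 proof
  assume "cy c = cy c'"
  then have "c = c'" using cx_inj[OF c(1,2)] cy_inj[OF c(1,2)] cx(1) by (simp add: prod_eq_iff)
  then show False using assms(3) by (simp add: x y)
 qed
 have w: "wt x y = 1 + (if rs c = 9 then 1 else 0) + (if rs c' = 9 then 1 else 0)" by (simp add: wt_def th_def x y)
 have t: "rs c = 9 \<Longrightarrow> u = 1 \<and> v = 1" "rs c' = 9 \<Longrightarrow> u' = 1 \<and> v' = 1"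
  using offs_thick c(3,4) by metis+
 have cases: "cy c' = Suc (cy c) \<and> (if rs c = 9 then v = 1 else v = 2) \<and> (if rs c' = 9 then v' = 1 else v' = 0)"
  using p(2) w t ne uv by (auto split: if_splits) presburger+
 have "opU (rs c)" using cases offs_op[OF c(3)] op_thick by (cases "rs c = 9") simp_all
 moreover have "opD (rs c')" using cases offs_op[OF c(4)] op_thick by (cases "rs c' = 9") simp_all
 moreover have "u = 1" using cases offs_lt[OF c(3)] t by (cases "rs c = 9") simp_all
 ultimately show ?thesis using cases cx vpot_conv[OF c(1,2)] by (cases "rs c = 9"; cases "rs c' = 9") (simp_all add: x y port_defs del: op_simps)
qed

lemma tang_cases:
 assumes "x \<in> V" "y \<in> V" "fst x \<noteq> fst y" "tang x y"
 shows "hpot (fst x) (fst y) \<and> x = rp (fst x) \<and> y = lp (fst y)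
  \<or> hpot (fst y) (fst x) \<and> x = lp (fst x) \<and> y = rp (fst y)
  \<or> vpot (fst x) (fst y) \<and> x = upp (fst x) \<and> y = dp (fst y)
  \<or> vpot (fst y) (fst x) \<and> x = dp (fst x) \<and> y = upp (fst y)"
proof -
 have w: "wt y x = wt x y" by (simp add: wt_def)
 show ?thesis
  using assms(4) tang_right[OF assms(1-3)] tang_right[OF assms(2,1) assms(3)[symmetric]]
   tang_up[OF assms(1-3)] tang_up[OF assms(2,1) assms(3)[symmetric]]
  unfolding tang_def apart_def w by metis
qed

lemma sq_ge: "(w::int) \<le> \<bar>a\<bar> \<Longrightarrow> 0 \<le> w \<Longrightarrow> w\<^sup>2 \<le> a\<^sup>2 \<and> (a\<^sup>2 = w\<^sup>2 \<longrightarrow> \<bar>a\<bar> = w)"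
 by (metis abs_le_square_iff abs_of_nonneg power2_eq_iff_nonneg power2_abs abs_ge_zero)

lemma far: "i \<noteq> j \<Longrightarrow> \<bar>d\<bar> \<le> 1 \<Longrightarrow> (2::int) \<le> \<bar>3 * (int i - int j) + d\<bar>"
 by (cases "i < j") (simp_all add: abs_if split: if_splits)

text \<open>It suffices that one coordinate difference reaches the sum of the radii; equality then
  makes the other difference vanish. Two thick centres differ by multiples of 3. A thick centre and
  a point of another cell differ by at least \<open>3 - 1 = 2\<close> in some coordinate. For two
  points of wires, distinctness on the integer grid is enough.\<close>

lemma separation:
 assumes "x \<in> V" "y \<in> V" "x \<noteq> y"
 defines "a \<equiv> int (fst (pos x)) - int (fst (pos y))" and "b \<equiv> int (snd (pos x)) - int (snd (pos y))"
 shows "(int (wt x y))\<^sup>2 \<le> a\<^sup>2 + b\<^sup>2 \<and> (a\<^sup>2 + b\<^sup>2 = (int (wt x y))\<^sup>2 \<longrightarrow> tang x y)"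
proof -
 obtain c u v where x: "x = (c, u, v)" by (cases x)
 obtain c' u' v' where y: "y = (c', u', v')" by (cases y)
 have c: "cell c" "cell c'" "(u, v) \<in> set (offs (rs c))" "(u', v') \<in> set (offs (rs c'))"
  using VD assms(1,2) unfolding x y by blast+
 have uv: "u < 3" "v < 3" "u' < 3" "v' < 3" "u = 1 \<or> v = 1" "u' = 1 \<or> v' = 1" using offs_lt c(3,4) by blast+
 have ab: "a = 3 * (int (cx c) - int (cx c')) + (int u - int u')" "b = 3 * (int (cy c) - int (cy c')) + (int v - int v')"
  by (simp_all add: a_def b_def x y pos_def)
 have w: "wt x y = 1 + (if rs c = 9 then 1 else 0) + (if rs c' = 9 then 1 else 0)" by (simp add: wt_def th_def x y)
 have t: "rs c = 9 \<Longrightarrow> u = 1 \<and> v = 1" "rs c' = 9 \<Longrightarrow> u' = 1 \<and> v' = 1"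
  using offs_thick c(3,4) by metis+
 have cc: "cx c = cx c' \<Longrightarrow> cy c = cy c' \<Longrightarrow> c = c'"
  using cx_inj[OF c(1,2)] cy_inj[OF c(1,2)] by (simp add: prod_eq_iff)
 have ne: "cx c \<noteq> cx c' \<or> cy c \<noteq> cy c' \<or> (rs c = rs c' \<and> rs c \<noteq> 9 \<and> (u \<noteq> u' \<or> v \<noteq> v'))"
  using cc t assms(3) unfolding x y by (cases "c = c'") auto
 have key: "int (wt x y) \<le> \<bar>a\<bar> \<or> int (wt x y) \<le> \<bar>b\<bar>"
 proof -
  consider "rs c = 9" "rs c' = 9" | "rs c = 9" "rs c' \<noteq> 9" | "rs c \<noteq> 9" "rs c' = 9" | "rs c \<noteq> 9" "rs c' \<noteq> 9" by blast
  then show ?thesis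
  proof cases
   case 1
   then have "u = 1" "v = 1" "u' = 1" "v' = 1" "wt x y = 3" using t w by auto
   then show ?thesis using ne 1 ab by (auto simp: abs_if split: if_splits)
  next
   case 2
   then have *: "u = 1" "v = 1" "wt x y = 2" "cx c \<noteq> cx c' \<or> cy c \<noteq> cy c'" using t w ne by auto
   have "\<bar>int u - int u'\<bar> \<le> 1" "\<bar>int v - int v'\<bar> \<le> 1" using * uv by linarith+
   then show ?thesis using *(4) far[of "cx c" "cx c'"] far[of "cy c" "cy c'"] unfolding *(3) ab by auto
  next
   case 3
   then have *: "u' = 1" "v' = 1" "wt x y = 2" "cx c \<noteq> cx c' \<or> cy c \<noteq> cy c'" using t w ne by auto
   have "\<bar>int u - int u'\<bar> \<le> 1" "\<bar>int v - int v'\<bar> \<le> 1" using * uv by linarith+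
   then show ?thesis using *(4) far[of "cx c" "cx c'"] far[of "cy c" "cy c'"] unfolding *(3) ab by auto
  next
   case 4
   then have *: "wt x y = 1" using w by simp
   have "a \<noteq> 0 \<or> b \<noteq> 0" using assms(1-3) pos_inj unfolding a_def b_def inj_on_def
    by (metis eq_iff_diff_eq_0 of_nat_eq_iff prod_eq_iff)
   then show ?thesis using * by linarith
  qed
 qed
 have tt: "tang x y" if "\<bar>a\<bar> = int (wt x y) \<and> b = 0 \<or> \<bar>b\<bar> = int (wt x y) \<and> a = 0"
  using that unfolding tang_def apart_def a_def b_def by (auto simp: abs_if split: if_splits)
 have z: "(0::int) \<le> int (wt x y)" by simp
 from key show ?thesis
 proof
  assume k: "int (wt x y) \<le> \<bar>a\<bar>"
  then have s: "(int (wt x y))\<^sup>2 \<le> a\<^sup>2" "a\<^sup>2 = (int (wt x y))\<^sup>2 \<longrightarrow> \<bar>a\<bar> = int (wt x y)"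
   using sq_ge[OF _ z] by blast+
  have "0 \<le> b\<^sup>2" by simp
  moreover have "b = 0" "a\<^sup>2 = (int (wt x y))\<^sup>2" if "a\<^sup>2 + b\<^sup>2 = (int (wt x y))\<^sup>2"
  proof -
   have "b\<^sup>2 = 0" using that s(1) \<open>0 \<le> b\<^sup>2\<close> by linarith
   then show "b = 0" by simp
   then show "a\<^sup>2 = (int (wt x y))\<^sup>2" using that by simp
  qed
  ultimately show ?thesis using s tt by (smt (verit))
 next
  assume k: "int (wt x y) \<le> \<bar>b\<bar>"
  then have s: "(int (wt x y))\<^sup>2 \<le> b\<^sup>2" "b\<^sup>2 = (int (wt x y))\<^sup>2 \<longrightarrow> \<bar>b\<bar> = int (wt x y)"
   using sq_ge[OF _ z] by blast+
  have "0 \<le> a\<^sup>2" by simp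
  moreover have "a = 0" "b\<^sup>2 = (int (wt x y))\<^sup>2" if "a\<^sup>2 + b\<^sup>2 = (int (wt x y))\<^sup>2"
  proof -
   have "a\<^sup>2 = 0" using that s(1) \<open>0 \<le> a\<^sup>2\<close> by linarith
   then show "a = 0" by simp
   then show "b\<^sup>2 = (int (wt x y))\<^sup>2" using that by simp
  qed
  ultimately show ?thesis using s tt by (smt (verit))
 qed
qed

end

section \<open>Tours of touching discs\<close>

lemma cyc_all_nth:
 assumes "xs \<noteq> []"
 shows "(\<forall>i<length xs. R (xs ! i) (xs ! (Suc i mod length xs))) \<longleftrightarrow> successively R xs \<and> R (last xs) (hd xs)"
proof -
 have "Suc i mod length xs = (if Suc i < length xs then Suc i else 0)" if "i < length xs" for i
  using that by (cases "Suc i = length xs") auto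
 moreover have "i < length xs \<longleftrightarrow> Suc i < length xs \<or> i = length xs - 1" for i
  using assms by (cases xs) auto
 ultimately have "(\<forall>i<length xs. R (xs ! i) (xs ! (Suc i mod length xs)))
   \<longleftrightarrow> (\<forall>i. Suc i < length xs \<longrightarrow> R (xs ! i) (xs ! Suc i)) \<and> R (xs ! (length xs - 1)) (xs ! 0)"
  using assms by (smt (verit) Suc_pred length_greater_0_conv lessI less_irrefl Suc_lessD)
 then show ?thesis using assms by (simp add: successively_conv_nth last_conv_nth hd_conv_nth)
qed

lemma cyc_all_cedges:
 assumes "xs \<noteq> []" "\<And>x y. R x y \<Longrightarrow> R y x"
 shows "(\<forall>i<length xs. R (xs ! i) (xs ! (Suc i mod length xs))) \<longleftrightarrow> (\<forall>x y. {x, y} \<in> cedges xs \<longrightarrow> R x y)"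
 unfolding cedges_conv_nth[OF assms(1)]
 by (auto simp: doubleton_eq_iff) (blast intro: assms(2))

lemma sum_cyc_Suc:
 fixes f :: "nat \<Rightarrow> 'b::comm_monoid_add"
 assumes "0 < n" shows "(\<Sum>i<n. f (Suc i mod n)) = (\<Sum>i<n. f i)"
proof -
 obtain m where m: "n = Suc m" using assms by (cases n) auto
 have "(\<Sum>i<n. f (Suc i mod n)) = (\<Sum>i<m. f (Suc i mod n)) + f (Suc m mod n)" unfolding m by simp
 also have "(\<Sum>i<m. f (Suc i mod n)) = (\<Sum>i<m. f (Suc i))" by (rule sum.cong) (auto simp: m)
 also have "f (Suc m mod n) = f 0" by (simp add: m)
 finally show ?thesis unfolding m sum.lessThan_Suc_shift by (simp add: add.commute)
qed

text \<open>Points are centres of non-overlapping discs, so every tour is at least twice the sum of the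
 radii, with equality iff consecutive discs touch.\<close>

lemma coins_optimal:
 fixes p :: "'a \<Rightarrow> real \<times> real" and r :: "'a \<Rightarrow> real"
 assumes inj: "inj_on p X"
  and sep: "\<And>x y. x \<in> X \<Longrightarrow> y \<in> X \<Longrightarrow> x \<noteq> y \<Longrightarrow> r x + r y \<le> dist (p x) (p y)"
  and vs: "distinct vs" "set vs = X" "2 \<le> length vs"
   "\<And>i. i < length vs \<Longrightarrow> dist (p (vs ! i)) (p (vs ! (Suc i mod length vs))) = r (vs ! i) + r (vs ! (Suc i mod length vs))"
  and opt: "optimal_tour (p ` X) (map p ws)" and ws: "set ws \<subseteq> X"
  and i: "i < length ws"
 shows "dist (p (ws ! i)) (p (ws ! (Suc i mod length ws))) = r (ws ! i) + r (ws ! (Suc i mod length ws))"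
proof -
 have dw: "distinct ws" "set ws = X"
 proof -
  have "distinct (map p ws)" "set (map p ws) = p ` X" using opt by (auto simp: optimal_tour_def is_tour_def)
  then show "distinct ws" "set ws = X" using ws inj by (auto simp: distinct_map inj_on_image_eq_iff)
 qed
 let ?n = "length ws"
 have len: "length vs = ?n" using dw vs by (metis distinct_card)
 have half: "(\<Sum>i<length us. r (us ! i) + r (us ! (Suc i mod length us))) = 2 * sum r X"
  if "distinct us" "set us = X" "0 < length us" for us
 proof -
  have "(\<Sum>i<length us. r (us ! i)) = sum r X"
   using sum.reindex_bij_betw[OF bij_betw_nth[OF that(1) refl refl], of r] that(2) by simp
  then show ?thesis using sum_cyc_Suc[OF that(3), of "\<lambda>i. r (us ! i)"] by (simp add: sum.distrib)
 qed
 have tl: "tour_length (map p us) = (\<Sum>i<length us. dist (p (us ! i)) (p (us ! (Suc i mod length us))))" for us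
  unfolding tour_length_def length_map
 proof (rule sum.cong)
  fix x assume "x \<in> {..<length us}"
  then have "x < length us" "Suc x mod length us < length us" by (cases us; simp)+
  then show "dist (map p us ! x) (map p us ! (Suc x mod length us)) = dist (p (us ! x)) (p (us ! (Suc x mod length us)))"
   by simp
 qed simp
 have "tour_length (map p ws) \<le> tour_length (map p vs)"
  using opt inj vs(1,2) by (auto simp: optimal_tour_def is_tour_def distinct_map)
 also have "tour_length (map p vs) = (\<Sum>i<length vs. r (vs ! i) + r (vs ! (Suc i mod length vs)))"
  unfolding tl using vs(4) by (intro sum.cong) auto
 also have "\<dots> = 2 * sum r X" using half[OF vs(1,2)] vs(3) by linarith
 also have "\<dots> = (\<Sum>i<?n. r (ws ! i) + r (ws ! (Suc i mod ?n)))" using half[OF dw] i by (cases ws) simp_all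
 finally have le: "(\<Sum>i<?n. dist (p (ws ! i)) (p (ws ! (Suc i mod ?n)))) \<le> (\<Sum>i<?n. r (ws ! i) + r (ws ! (Suc i mod ?n)))"
  unfolding tl .
 have ge: "r (ws ! j) + r (ws ! (Suc j mod ?n)) \<le> dist (p (ws ! j)) (p (ws ! (Suc j mod ?n)))" if "j < ?n" for j
 proof -
  have s: "Suc j mod ?n < ?n" using that by (cases ws; simp)
  have "Suc j mod ?n \<noteq> j" using that vs(3) len by (cases "Suc j = ?n") auto
  then have "ws ! j \<noteq> ws ! (Suc j mod ?n)" using dw(1) that s by (simp add: nth_eq_iff_index_eq)
  moreover have "ws ! j \<in> X" "ws ! (Suc j mod ?n) \<in> X" using dw(2) that s nth_mem by blast+
  ultimately show ?thesis using sep by blast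
 qed
 show ?thesis
 proof (rule ccontr)
  assume "\<not> ?thesis"
  then have "r (ws ! i) + r (ws ! (Suc i mod ?n)) < dist (p (ws ! i)) (p (ws ! (Suc i mod ?n)))"
   using ge[OF i] by simp
  then have "(\<Sum>i<?n. r (ws ! i) + r (ws ! (Suc i mod ?n))) < (\<Sum>i<?n. dist (p (ws ! i)) (p (ws ! (Suc i mod ?n))))"
   using ge i by (intro sum_strict_mono_ex1) (simp_all, blast)
  then show False using le by simp
 qed
qed

lemma shtab_vals: "s \<in> set ws \<Longrightarrow> ws \<in> set shtab \<Longrightarrow> s \<in> {0,2,3,4,5,6,7,8,9,10}"
proof -
 have "list_all (list_all (\<lambda>s. s \<in> {0,2,3,4,5,6,7,8,9,10})) shtab" by code_simp
 then show "s \<in> set ws \<Longrightarrow> ws \<in> set shtab \<Longrightarrow> s \<in> {0,2,3,4,5,6,7,8,9,10}" by (simp add: list_all_iff)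
qed

lemma shtab_len: "length shtab = 25" "ws \<in> set shtab \<Longrightarrow> length ws = 15"
proof -
 have "list_all (\<lambda>r. length r = 15) shtab \<and> length shtab = 25" by code_simp
 then show "length shtab = 25" "ws \<in> set shtab \<Longrightarrow> length ws = 15" by (auto simp: list_all_iff)
qed

context layout begin

lemma vx_le: "vx (k, j, g) \<Longrightarrow> k < 15" and vy_le: "vy (l, i, h) \<Longrightarrow> l < 25"
 by (simp_all; linarith)+

lemma rs_vals: "cell c \<Longrightarrow> rs c \<in> {2,3,4,5,6,9,10}"
proof -
 assume c: "cell c"
 obtain k j g l i h where e: "c = ((k, j, g), (l, i, h))" by (metis prod_cases3 prod.exhaust)
 have "k < 15" "l < 25" using c vx_le vy_le unfolding e cell_def fst_conv snd_conv by blast+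
 then have "shtab ! l \<in> set shtab" using shtab_len(1) by simp
 moreover from this have "sh k l \<in> set (shtab ! l)" unfolding sh_def using \<open>k < 15\<close> shtab_len(2) by simp
 ultimately have "sh k l \<in> {0,2,3,4,5,6,7,8,9,10}" using shtab_vals by blast
 moreover have "rs c \<noteq> 0" using c by (simp add: cell_def)
 ultimately show "rs c \<in> {2,3,4,5,6,9,10}" unfolding e rs_def prod.case by (auto split: if_splits)
qed

text \<open>The point of \<open>c\<close> at which it can touch \<open>c'\<close>. All ports of a
  thick cell coincide with its centre.\<close>

definition port :: "cell \<Rightarrow> cell \<Rightarrow> vert" where
 "port c c' = (if hpot c c' then rp c else if hpot c' c then lp c else if vpot c c' then upp c else dp c)"

lemma port_cases:
 assumes "pot c c'"
 obtains "hpot c c'" "port c c' = rp c" "port c' c = lp c'" "cx c' = Suc (cx c)" "cy c' = cy c" "opR (rs c)" "opL (rs c')"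
 | "hpot c' c" "port c c' = lp c" "port c' c = rp c'" "cx c = Suc (cx c')" "cy c' = cy c" "opL (rs c)" "opR (rs c')"
 | "vpot c c'" "port c c' = upp c" "port c' c = dp c'" "cy c' = Suc (cy c)" "cx c' = cx c" "opU (rs c)" "opD (rs c')"
 | "vpot c' c" "port c c' = dp c" "port c' c = upp c'" "cy c = Suc (cy c')" "cx c' = cx c" "opD (rs c)" "opU (rs c')"
proof -
 have c: "cell c" "cell c'" "hpot c c' \<or> hpot c' c \<or> vpot c c' \<or> vpot c' c" using assms by (auto simp: pot_def)
 note cv = hpot_conv[OF c(1,2)] hpot_conv[OF c(2,1)] vpot_conv[OF c(1,2)] vpot_conv[OF c(2,1)]
 from c(3) consider "hpot c c'" | "hpot c' c" | "vpot c c'" | "vpot c' c" by blast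
 then show thesis
 proof cases
  case 1
  have e: "cx c' = Suc (cx c)" "cy c' = cy c" "opR (rs c)" "opL (rs c')" using 1 cv(1) by blast+
  have "\<not> hpot c' c" unfolding cv(2) using e(1,2) by simp
  note n2 = this
  have "\<not> vpot c c'" unfolding cv(3) using e(1,2) by simp
  note n3 = this
  have "\<not> vpot c' c" unfolding cv(4) using e(1,2) by simp
  note n4 = this
  show thesis by (rule that(1)) (insert 1 n2 n3 n4 e, simp_all add: port_def del: op_simps)
 next
  case 2
  have e: "cx c = Suc (cx c')" "cy c' = cy c" "opL (rs c)" "opR (rs c')" using 2 cv(2) by metis+
  have "\<not> hpot c c'" unfolding cv(1) using e(1,2) by simp
  note n1 = this
  have "\<not> vpot c c'" unfolding cv(3) using e(1,2) by simp
  note n3 = this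
  have "\<not> vpot c' c" unfolding cv(4) using e(1,2) by simp
  note n4 = this
  show thesis by (rule that(2)) (insert 2 n1 n3 n4 e, simp_all add: port_def del: op_simps)
 next
  case 3
  have e: "cy c' = Suc (cy c)" "cx c' = cx c" "opU (rs c)" "opD (rs c')" using 3 cv(3) by blast+
  have "\<not> hpot c c'" unfolding cv(1) using e(1,2) by simp
  note n1 = this
  have "\<not> hpot c' c" unfolding cv(2) using e(1,2) by simp
  note n2 = this
  have "\<not> vpot c' c" unfolding cv(4) using e(1,2) by simp
  note n4 = this
  show thesis by (rule that(3)) (insert 3 n1 n2 n4 e, simp_all add: port_def del: op_simps)
 next
  case 4
  have e: "cy c = Suc (cy c')" "cx c' = cx c" "opD (rs c)" "opU (rs c')" using 4 cv(4) by metis+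
  have "\<not> hpot c c'" unfolding cv(1) using e(1,2) by simp
  note n1 = this
  have "\<not> hpot c' c" unfolding cv(2) using e(1,2) by simp
  note n2 = this
  have "\<not> vpot c c'" unfolding cv(3) using e(1,2) by simp
  note n3 = this
  show thesis by (rule that(4)) (insert 4 n1 n2 n3 e, simp_all add: port_def del: op_simps)
 qed
qed

lemma port_tang: "pot c c' \<Longrightarrow> tang (port c c') (port c' c) \<and> port c c' \<in> V \<and> fst (port c c') = c"
proof -
 assume p: "pot c c'"
 then have c: "cell c" "cell c'" by (auto simp: pot_def)
 have f: "fst (port c c') = c" by (simp add: port_def port_defs)
 from p show ?thesis
 proof (cases rule: port_cases)
  case 1 then show ?thesis using hpot_tang[OF c] f by simp
 next
  case 2 then show ?thesis using hpot_tang[OF c(2,1)] f by (simp add: tang_sym)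
 next
  case 3 then show ?thesis using vpot_tang[OF c] f by simp
 next
  case 4 then show ?thesis using vpot_tang[OF c(2,1)] f by (simp add: tang_sym)
 qed
qed

lemma cell_eq: "cell c \<Longrightarrow> cell c' \<Longrightarrow> cx c = cx c' \<Longrightarrow> cy c = cy c' \<Longrightarrow> c = c'"
 using cx_inj[of c c'] cy_inj[of c c'] by (simp add: prod_eq_iff)

lemma tang_port:
 assumes "x \<in> V" "y \<in> V" "fst x \<noteq> fst y" "tang x y"
 shows "pot (fst x) (fst y) \<and> x = port (fst x) (fst y) \<and> y = port (fst y) (fst x)"
proof -
 have c: "cell (fst x)" "cell (fst y)" using assms(1,2) by (auto simp: V_def)
 have p: "pot (fst x) (fst y)" using tang_cases[OF assms] c unfolding pot_def by blast
 note tc = tang_cases[OF assms]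
 have "x = port (fst x) (fst y) \<and> y = port (fst y) (fst x)"
  using tc
 proof (elim disjE conjE)
  assume h: "hpot (fst x) (fst y)" "x = rp (fst x)" "y = lp (fst y)"
  from p show ?thesis
  proof (cases rule: port_cases)
   case 1 then show ?thesis using h(2,3) by simp
  next
   case 2 then show ?thesis using h(1) unfolding hpot_conv[OF c] by simp
  next
   case 3 then show ?thesis using h(1) unfolding hpot_conv[OF c] by simp
  next
   case 4 then show ?thesis using h(1) unfolding hpot_conv[OF c] by simp
  qed
 next
  assume h: "hpot (fst y) (fst x)" "x = lp (fst x)" "y = rp (fst y)"
  from p show ?thesis
  proof (cases rule: port_cases)
   case 1 then show ?thesis using h(1) unfolding hpot_conv[OF c(2,1)] by simp
  next
   case 2 then show ?thesis using h(2,3) by simp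
  next
   case 3 then show ?thesis using h(1) unfolding hpot_conv[OF c(2,1)] by simp
  next
   case 4 then show ?thesis using h(1) unfolding hpot_conv[OF c(2,1)] by simp
  qed
 next
  assume h: "vpot (fst x) (fst y)" "x = upp (fst x)" "y = dp (fst y)"
  from p show ?thesis
  proof (cases rule: port_cases)
   case 1 then show ?thesis using h(1) unfolding vpot_conv[OF c] by simp
  next
   case 2 then show ?thesis using h(1) unfolding vpot_conv[OF c] by simp
  next
   case 3 then show ?thesis using h(2,3) by simp
  next
   case 4 then show ?thesis using h(1) unfolding vpot_conv[OF c] by simp
  qed
 next
  assume h: "vpot (fst y) (fst x)" "x = dp (fst x)" "y = upp (fst y)"
  from p show ?thesis
  proof (cases rule: port_cases)
   case 1 then show ?thesis using h(1) unfolding vpot_conv[OF c(2,1)] by simp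
  next
   case 2 then show ?thesis using h(1) unfolding vpot_conv[OF c(2,1)] by simp
  next
   case 3 then show ?thesis using h(1) unfolding vpot_conv[OF c(2,1)] by simp
  next
   case 4 then show ?thesis using h(2,3) by simp
  qed
 qed
 then show ?thesis using p by blast
qed

text \<open>This separates wires from thick cells: a wire meets each of its neighbours at a point of
  its own, so its neighbours do not compete.\<close>

lemma port_inj:
 assumes "pot c a" "pot c b" "a \<noteq> b"
 shows "rs c \<noteq> 9 \<Longrightarrow> port c a \<noteq> port c b"
proof
 assume w: "rs c \<noteq> 9" and e: "port c a = port c b"
 have ab: "cell a" "cell b" using assms by (auto simp: pot_def)
 have ne: "\<not> (cx a = cx b \<and> cy a = cy b)" using cell_eq[OF ab] assms(3) by blast
 have *: "port c a = port c b \<Longrightarrow> cx a = cx b \<and> cy a = cy b"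
  by (rule port_cases[OF assms(1)]; rule port_cases[OF assms(2)]; use w in \<open>simp add: port_defs del: op_simps\<close>)
 show False using * e ne by blast
qed

end

lemma cycle_of_tour:
 assumes "xs \<noteq> []" "successively R xs" "R (last xs) (hd xs)" "\<And>x y. R x y \<Longrightarrow> R y x" "{x, y} \<in> cedges xs"
 shows "R x y"
 using cyc_all_cedges[OF assms(1), of R] cyc_all_nth[OF assms(1), of R] assms(2-5) by blast

context layout begin

lemma ctr_V: "cell c \<Longrightarrow> ctr c \<in> V"
 by (simp add: V_def ctr_def set_offs cell_def)

lemma V_thick: "x \<in> V \<Longrightarrow> rs (fst x) = 9 \<Longrightarrow> x = ctr (fst x)"
 by (cases x) (auto simp: V_def ctr_def set_offs)

text \<open>Two ports of one wire never touch each other. A port therefore has only two possible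
  neighbours on a tour, the centre of its cell and the port facing it, and both are forced.\<close>

lemma tang_same:
 assumes "x \<in> V" "y \<in> V" "fst x = fst y" "tang x y"
 shows "x = ctr (fst x) \<or> y = ctr (fst y)"
proof -
 obtain c u v where x: "x = (c, u, v)" by (cases x)
 obtain c' u' v' where y: "y = (c', u', v')" by (cases y)
 have uv: "u = 1 \<or> v = 1" "u' = 1 \<or> v' = 1" "u < 3" "v < 3" "u' < 3" "v' < 3"
  using VD assms(1,2) offs_lt unfolding x y by blast+
 have c: "c' = c" using assms(3) x y by simp
 show ?thesis
 proof (cases "rs c = 9")
  case True then show ?thesis using V_thick[OF assms(1)] unfolding x fst_conv by blast
 next
  case False
  then have "wt x y = 1" by (simp add: wt_def th_def x y c)
  then have "(v = v' \<and> (u' = u + 1 \<or> u = u' + 1)) \<or> (u = u' \<and> (v' = v + 1 \<or> v = v' + 1))"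
   using assms(4) by (simp add: tang_def apart_def pos_def x y c)
  then show ?thesis using uv unfolding x y c by (auto simp: ctr_def)
 qed
qed

lemma V_len:
 assumes "distinct vs" "set vs = V" shows "3 \<le> length vs"
proof -
 let ?c = "((2::nat, 0::nat, 0::nat), (2::nat, 0::nat, 0::nat))"
 have r: "rs ?c = 3" by (simp add: rs_def sh_simps)
 then have c: "cell ?c" by (simp add: cell_def)
 have "{(?c, 1, 1), (?c, 2, 1), (?c, 1, 2)} \<subseteq> V"
  using c r by (auto simp: V_def set_offs)
 then have "card {(?c, 1::nat, 1::nat), (?c, 2, 1), (?c, 1, 2)} \<le> card (set vs)"
  unfolding assms(2)[symmetric] by (rule card_mono[OF finite_set])
 then show ?thesis using card_length[of vs] by simp
qed

text \<open>Contracting every cell to a point turns a tour of touching discs into the relation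
  \<open>H\<close> of \<open>cell_tour\<close>. Each port of a wire needs the port opposite as its
  second neighbour, so a wire uses all its openings. The disc of a thick cell has two neighbours,
  and these lie in different cells because each neighbouring cell has only one point facing
  it.\<close>

theorem perfect_sat:
 assumes vs: "distinct vs" "set vs = V" "successively tang vs" "tang (last vs) (hd vs)"
  and neg_first: "\<And>i i' j j'. occP i j \<Longrightarrow> occN i' j' \<Longrightarrow> j' < j"
 shows "\<exists>\<tau>. \<forall>j<M. \<exists>i<L. (occP i j \<and> \<tau> i) \<or> (occN i j \<and> \<not> \<tau> i)"
proof -
 define E where "E x y \<longleftrightarrow> {x, y} \<in> cedges vs" for x y
 define H where "H c c' \<longleftrightarrow> c \<noteq> c' \<and> (\<exists>x y. fst x = c \<and> fst y = c' \<and> E x y)" for c c'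
 have len: "3 \<le> length vs" using V_len vs by blast
 then have ne: "vs \<noteq> []" by auto
 have Es: "E x y \<Longrightarrow> E y x" for x y by (simp add: E_def insert_commute)
 have EV: "E x y \<Longrightarrow> x \<in> V \<and> y \<in> V" for x y using cedges_set[of "{x, y}" vs] vs(2) by (simp add: E_def)
 have Et: "E x y \<Longrightarrow> tang x y" for x y
  using cycle_of_tour[OF ne vs(3,4) tang_sym] unfolding E_def by blast
 have deg: "\<exists>a b. a \<noteq> b \<and> a \<noteq> x \<and> b \<noteq> x \<and> {w. E x w} = {a, b}" if "x \<in> V" for x
  using cycle_degree[OF vs(1) len] that vs(2) unfolding E_def by metis
 have Hport: "pot c c' \<and> E (port c c') (port c' c)" if h: "H c c'" for c c'
 proof -
  obtain x y where xy: "fst x = c" "fst y = c'" "E x y" "c \<noteq> c'" using h unfolding H_def by blast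
  then show ?thesis using tang_port[of x y] EV Et by auto
 qed
 have wire: "H c c'" if p: "pot c c'" and r: "rs c \<noteq> 9" for c c'
 proof -
  let ?q = "port c c'"
  have q: "?q \<in> V" "fst ?q = c" "c \<noteq> c'"
  proof -
   show "?q \<in> V" "fst ?q = c" using port_tang[OF p] by blast+
   show "c \<noteq> c'" using p by (rule port_cases) auto
  qed
  have nc: "?q \<noteq> ctr c" using r p by (auto simp: port_def port_defs)
  obtain a b where ab: "a \<noteq> b" "{w. E ?q w} = {a, b}" using deg[OF q(1)] by blast
  have step: "w = ctr c \<or> fst w = c'" if w: "E ?q w" for w
  proof (cases "fst w = c")
   case True
   then show ?thesis using tang_same[OF q(1) _ _ Et[OF w]] EV[OF w] q(2) nc by simp
  next
   case False
   then have "pot c (fst w) \<and> ?q = port c (fst w)"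
    using tang_port[of ?q w] EV[OF w] Et[OF w] q(2) by simp
   then show ?thesis using port_inj[OF p _ _ r] by blast
  qed
  have "E ?q a" "E ?q b" using ab(2) by blast+
  then have "fst a = c' \<or> fst b = c'" using step[of a] step[of b] ab(1) by argo
  then show "H c c'" unfolding H_def using q(2,3) \<open>E ?q a\<close> \<open>E ?q b\<close> by blast
 qed
 interpret cell_tour L M gx gy occP occN H
 proof
  show "H c c' \<Longrightarrow> H c' c" for c c' unfolding H_def using Es by metis
  show "H c c' \<Longrightarrow> pot c c'" for c c' using Hport by blast
  show "pot c c' \<Longrightarrow> rs c \<noteq> 9 \<Longrightarrow> H c c'" for c c' by (rule wire)
  show "\<exists>a b. a \<noteq> b \<and> {c'. H c c'} = {a, b}" if c: "cell c" "rs c = 9" for c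
  proof -
   obtain a b where ab: "a \<noteq> b" "a \<noteq> ctr c" "b \<noteq> ctr c" "{w. E (ctr c) w} = {a, b}"
    using deg[OF ctr_V[OF c(1)]] by blast
   have fc: "fst (ctr c) = c" by (simp add: ctr_def)
   have only: "x = ctr c" if "x \<in> V" "fst x = c" for x using V_thick[OF that(1)] that(2) c(2) by simp
   have E: "E (ctr c) a" "E (ctr c) b" using ab(4) by blast+
   have n: "fst a \<noteq> c" "fst b \<noteq> c" using only EV[OF E(1)] EV[OF E(2)] ab(2,3) by blast+
   have "a = port (fst a) c" "b = port (fst b) c"
    using tang_port[of "ctr c" a] tang_port[of "ctr c" b] E EV Et fc n by auto
   then have "fst a \<noteq> fst b" using ab(1) by metis
   moreover have "H c x \<longleftrightarrow> x = fst a \<or> x = fst b" for x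
   proof
    assume "H c x"
    then obtain u w where u: "fst u = c" "fst w = x" "E u w" unfolding H_def by metis
    then have "u = ctr c" using only EV by blast
    then have "w = a \<or> w = b" using u(3) ab(4) by blast
    then show "x = fst a \<or> x = fst b" using u(2) by blast
   next
    assume "x = fst a \<or> x = fst b"
    then show "H c x" unfolding H_def using E fc n by metis
   qed
   ultimately show ?thesis by (intro exI[of _ "fst a"] exI[of _ "fst b"]) blast
  qed
  show "c' \<in> S" if c: "cell c" "c \<in> S" "\<And>x y. H x y \<Longrightarrow> x \<in> S \<Longrightarrow> y \<in> S" "cell c'" for c c' S
  proof -
   have "set vs \<subseteq> {x. fst x \<in> S}"
   proof (rule cycle_closed[OF vs(1)])
    show "ctr c \<in> set vs" using ctr_V c(1) vs(2) by blast
    show "ctr c \<in> {x. fst x \<in> S}" using c(2) by (simp add: ctr_def)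
    fix x y assume xy: "{x, y} \<in> cedges vs" "x \<in> {x. fst x \<in> S}"
    show "y \<in> {x. fst x \<in> S}"
    proof (cases "fst x = fst y")
     case True then show ?thesis using xy(2) by simp
    next
     case False
     then have "H (fst x) (fst y)" unfolding H_def E_def using xy(1) by blast
     then show ?thesis using c(3) xy(2) by blast
    qed
   qed
   then have "fst (ctr c') \<in> S" using ctr_V[OF c(4)] vs(2) by blast
   then show ?thesis by (simp add: ctr_def)
  qed
 qed
 show ?thesis using tour_sat neg_first by blast
qed

lemma offs_set:
 "set (offs 2) = {(1,1), (1,2), (1,0)}" "set (offs 3) = {(1,1), (2,1), (1,2)}" "set (offs 4) = {(1,1), (0,1), (1,2)}"
 "set (offs 5) = {(1,1), (2,1), (1,0)}" "set (offs 6) = {(1,1), (0,1), (1,0)}" "set (offs 10) = {(1,1), (0,1), (2,1)}"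
 "set (offs 9) = {(1,1)}"
 by (simp_all add: offs_def)

lemma card_offs: "cell c \<Longrightarrow> rs c \<noteq> 9 \<Longrightarrow> card (set (offs (rs c))) = 3"
proof -
 assume c: "cell c" "rs c \<noteq> 9"
 from rs_vals[OF c(1)] c(2) consider "rs c = 2" | "rs c = 3" | "rs c = 4" | "rs c = 5" | "rs c = 6" | "rs c = 10" by auto
 then show ?thesis by cases (simp_all add: offs_set)
qed

text \<open>A wire has exactly three points, so entering at one port, passing the centre and leaving
  at the other port visits the whole cell.\<close>

lemma wire_block:
 assumes "pot c a" "pot c b" "a \<noteq> b" "rs c \<noteq> 9"
 shows "{port c a, ctr c, port c b} = {x \<in> V. fst x = c}" "distinct [port c a, ctr c, port c b]"
proof -
 have c: "cell c" using assms by (auto simp: pot_def)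
 have n: "port c a \<noteq> ctr c" "port c b \<noteq> ctr c" using assms(4) by (auto simp: port_def port_defs)
 then show d: "distinct [port c a, ctr c, port c b]" using port_inj[OF assms] by auto
 have e: "{x \<in> V. fst x = c} = Pair c ` set (offs (rs c))" using c by (auto simp: V_def)
 then have "card {x \<in> V. fst x = c} = 3" using card_offs[OF c assms(4)] by (simp add: card_image inj_on_def)
 moreover have "{port c a, ctr c, port c b} \<subseteq> {x \<in> V. fst x = c}"
  using port_tang[OF assms(1)] port_tang[OF assms(2)] ctr_V[OF c] by (auto simp: ctr_def)
 moreover have "card {port c a, ctr c, port c b} = 3" using d by auto
 ultimately show "{port c a, ctr c, port c b} = {x \<in> V. fst x = c}"
  using e by (intro card_subset_eq) auto
qed

lemma tang_ctr: "pot c c' \<Longrightarrow> rs c \<noteq> 9 \<Longrightarrow> tang (port c c') (ctr c)"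
 by (auto simp: port_def port_defs tang_def apart_def wt_def th_def pos_def)

end

context sat_layout begin

section \<open>Expanding a cycle of cells into a tour of points\<close>

theorem sat_perfect:
 obtains vs where "distinct vs" "set vs = V" "successively tang vs" "tang (last vs) (hd vs)"
proof -
 obtain zs where zs: "distinct zs" "set zs = {c. cell c}" "\<And>c c'. {c, c'} \<in> cedges zs \<Longrightarrow> pot c c'"
  using cell_cycle by blast
 let ?n = "length zs"
 \<comment> \<open>With at least three cells, the predecessor and the successor of a cell on the
   cycle are different, so a wire is entered and left at different ports.\<close>
 have n3: "3 \<le> ?n"
 proof -
  let ?f = "\<lambda>l. ((2::nat, 0::nat, 0::nat), (l::nat, 0::nat, 0::nat))"
  have "cell (?f 2)" "cell (?f 3)" "cell (?f 4)"
   using L by (simp_all add: cell_def rs_def sh_simps)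
  then have "{?f 2, ?f 3, ?f 4} \<subseteq> set zs" using zs(2) by blast
  then have "card {?f 2, ?f 3, ?f 4} \<le> card (set zs)" by (intro card_mono) auto
  then show ?thesis using card_length[of zs] by simp
 qed
 then have ne: "zs \<noteq> []" by auto
 define nxt where "nxt i = zs ! (Suc i mod ?n)" for i
 \<comment> \<open>Adding \<open>?n - 1\<close> is subtraction of 1 modulo the length, without
   truncation at index 0.\<close>
 define prv where "prv i = zs ! ((i + (?n - 1)) mod ?n)" for i
 have lt: "k mod ?n < ?n" for k using n3 by (intro mod_less_divisor) linarith
 have pot_next: "pot (zs ! i) (nxt i)" if "i < ?n" for i
 proof -
  have "{zs ! i, nxt i} \<in> cedges zs" unfolding cedges_conv_nth[OF ne] nxt_def using that by blast
  then show ?thesis using zs(3) by blast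
 qed
 have prv_nxt: "prv (Suc i mod ?n) = zs ! i" if "i < ?n" for i
 proof -
  have "(Suc i mod ?n + (?n - 1)) mod ?n = (Suc i + (?n - 1)) mod ?n" by (rule mod_add_left_eq)
  also have "Suc i + (?n - 1) = i + ?n" using n3 by linarith
  finally show ?thesis using that by (simp add: prv_def)
 qed
 have prv0: "\<exists>k<?n. prv i = zs ! k \<and> nxt k = zs ! i \<and> k \<noteq> Suc i mod ?n" if i: "i < ?n" for i
 proof (cases i)
  case 0
  show ?thesis
  proof (rule exI[of _ "?n - 1"])
   have "Suc (?n - 1) = ?n" "?n - 1 < ?n" "Suc 0 mod ?n = Suc 0" "?n - 1 \<noteq> Suc 0" using n3 by auto
   then show "?n - 1 < ?n \<and> prv i = zs ! (?n - 1) \<and> nxt (?n - 1) = zs ! i \<and> ?n - 1 \<noteq> Suc i mod ?n"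
    unfolding prv_def nxt_def 0 by simp
  qed
 next
  case (Suc m)
  have "i + (?n - 1) = m + ?n" using Suc n3 by linarith
  then have p: "prv i = zs ! m" using Suc i by (simp add: prv_def)
  have "m \<noteq> Suc i mod ?n"
  proof (cases "Suc i < ?n")
   case True then show ?thesis using Suc by simp
  next
   case False then have "Suc i = ?n" using i by simp
   then show ?thesis using Suc n3 by simp
  qed
  then show ?thesis using p Suc i by (intro exI[of _ m]) (simp add: nxt_def)
 qed
 have pp: "pot (zs ! i) (prv i) \<and> prv i \<noteq> nxt i" if i: "i < ?n" for i
 proof -
  obtain k where k: "k < ?n" "prv i = zs ! k" "nxt k = zs ! i" "k \<noteq> Suc i mod ?n" using prv0[OF i] by blast
  have "pot (zs ! i) (prv i)" using pot_next[OF k(1)] pot_sym k by simp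
  moreover have "zs ! k \<noteq> zs ! (Suc i mod ?n)" using k(1,4) lt zs(1) by (simp add: nth_eq_iff_index_eq)
  ultimately show ?thesis using k(2) by (simp add: nxt_def)
 qed
 define blk where "blk i = (if rs (zs ! i) = 9 then [ctr (zs ! i)]
   else [port (zs ! i) (prv i), ctr (zs ! i), port (zs ! i) (nxt i)])" for i
 have thick: "port c c' = ctr c" if "rs c = 9" for c c' using that by (simp add: port_def port_defs)
 have hdb: "hd (blk i) = port (zs ! i) (prv i)" "last (blk i) = port (zs ! i) (nxt i)" "blk i \<noteq> []" for i
  by (simp_all add: blk_def thick)
 have setb: "set (blk i) = {x \<in> V. fst x = zs ! i}" "distinct (blk i)" "successively tang (blk i)" if i: "i < ?n" for i
 proof -
  have c: "cell (zs ! i)" using i zs(2) nth_mem by blast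
  have "set (blk i) = {x \<in> V. fst x = zs ! i} \<and> distinct (blk i) \<and> successively tang (blk i)"
  proof (cases "rs (zs ! i) = 9")
   case True
   have "{x \<in> V. fst x = zs ! i} = {ctr (zs ! i)}"
   proof
    show "{ctr (zs ! i)} \<subseteq> {x \<in> V. fst x = zs ! i}" using ctr_V[OF c] by (simp add: ctr_def)
    show "{x \<in> V. fst x = zs ! i} \<subseteq> {ctr (zs ! i)}"
    proof
     fix x assume "x \<in> {x \<in> V. fst x = zs ! i}"
     then show "x \<in> {ctr (zs ! i)}" using V_thick[of x] True by simp
    qed
   qed
   then show ?thesis using True by (simp add: blk_def)
  next
   case False
   have p: "pot (zs ! i) (prv i)" "pot (zs ! i) (nxt i)" "prv i \<noteq> nxt i" using pp[OF i] pot_next[OF i] by blast+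
   have "set (blk i) = {port (zs ! i) (prv i), ctr (zs ! i), port (zs ! i) (nxt i)}" using False by (simp add: blk_def)
   then show ?thesis
    using wire_block[OF p False] tang_ctr[OF p(1) False] tang_ctr[OF p(2) False] tang_sym False by (simp add: blk_def)
  qed
  then show "set (blk i) = {x \<in> V. fst x = zs ! i}" "distinct (blk i)" "successively tang (blk i)" by blast+
 qed
 have link: "tang (last (blk i)) (hd (blk (Suc i mod ?n)))" if i: "i < ?n" for i
  using port_tang[OF pot_next[OF i]] prv_nxt[OF i] unfolding hdb by (simp add: nxt_def)
 let ?vs = "concat (map blk [0..<?n])"
 have s: "successively tang ?vs \<and> (0 < ?n \<longrightarrow> ?vs \<noteq> [] \<and> last ?vs = last (blk (?n - 1)) \<and> hd ?vs = hd (blk 0))"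
 proof -
  have a: "blk i \<noteq> [] \<and> successively tang (blk i)" if "i < ?n" for i using hdb(3) setb(3)[OF that] by blast
  have b: "tang (last (blk i)) (hd (blk (Suc i)))" if "Suc i < ?n" for i using link[of i] that by simp
  show ?thesis using successively_concat_upt[of ?n blk tang] a b by blast
 qed
 have d: "distinct ?vs"
 proof (rule distinct_concat_upt)
  show "distinct (blk i)" if "i < ?n" for i using setb(2) that by blast
  fix i j assume ij: "i < j" "j < ?n"
  then have "zs ! i \<noteq> zs ! j" using zs(1) by (simp add: nth_eq_iff_index_eq)
  then show "set (blk i) \<inter> set (blk j) = {}" using setb(1)[of i] setb(1)[of j] ij by auto
 qed
 have v: "set ?vs = V"
 proof
  show "set ?vs \<subseteq> V" using setb(1) by auto
  show "V \<subseteq> set ?vs"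
  proof
   fix x assume x: "x \<in> V"
   then have "fst x \<in> set zs" using zs(2) by (auto simp: V_def)
   then obtain i where i: "i < ?n" "zs ! i = fst x" by (auto simp: in_set_conv_nth)
   then have "x \<in> set (blk i)" using setb(1)[OF i(1)] x by simp
   then show "x \<in> set ?vs" using i(1) by auto
  qed
 qed
 have "tang (last ?vs) (hd ?vs)"
 proof -
  have "Suc (?n - 1) = ?n" "?n - 1 < ?n" using n3 by auto
  then have "?n - 1 < ?n" "Suc (?n - 1) mod ?n = 0" by simp_all
  then have "tang (last (blk (?n - 1))) (hd (blk 0))" using link[of "?n - 1"] by metis
  moreover have "0 < ?n" using n3 by linarith
  ultimately show ?thesis using s by metis
 qed
 then show thesis using that d v s by blast
qed

end

context layout begin

definition rpt :: "vert \<Rightarrow> real \<times> real" where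
 "rpt v = (real (fst (pos v)), real (snd (pos v)))"

lemma rpt_inj: "inj_on rpt V"
proof (rule inj_onI)
 fix x y assume "x \<in> V" "y \<in> V" "rpt x = rpt y"
 then show "x = y" using inj_onD[OF pos_inj, of x y] by (simp add: rpt_def prod_eq_iff)
qed

lemma rpt_dist:
 assumes "x \<in> V" "y \<in> V" "x \<noteq> y"
 shows "real (wt x y) \<le> dist (rpt x) (rpt y)" "dist (rpt x) (rpt y) = real (wt x y) \<longleftrightarrow> tang x y"
proof -
 define a b where ab: "a = int (fst (pos x)) - int (fst (pos y))" "b = int (snd (pos x)) - int (snd (pos y))"
 let ?w = "int (wt x y)"
 have sep: "?w\<^sup>2 \<le> a\<^sup>2 + b\<^sup>2" "a\<^sup>2 + b\<^sup>2 = ?w\<^sup>2 \<Longrightarrow> tang x y"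
  using separation[OF assms] unfolding ab by blast+
 have "dist (rpt x) (rpt y) = sqrt ((real_of_int a)\<^sup>2 + (real_of_int b)\<^sup>2)"
  by (simp add: rpt_def dist_prod_def dist_real_def ab)
 then have d: "dist (rpt x) (rpt y) = sqrt (real_of_int (a\<^sup>2 + b\<^sup>2))" by simp
 have w: "real (wt x y) = sqrt (real_of_int (?w\<^sup>2))" by simp
 have "sqrt (real_of_int (?w\<^sup>2)) \<le> sqrt (real_of_int (a\<^sup>2 + b\<^sup>2))"
  using sep(1) by (intro real_sqrt_le_mono) linarith
 then show "real (wt x y) \<le> dist (rpt x) (rpt y)" using d w by linarith
 have "sqrt (real_of_int (a\<^sup>2 + b\<^sup>2)) = sqrt (real_of_int (?w\<^sup>2)) \<longleftrightarrow> a\<^sup>2 + b\<^sup>2 = ?w\<^sup>2"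
  unfolding real_sqrt_eq_iff of_int_eq_iff ..
 then have "dist (rpt x) (rpt y) = real (wt x y) \<longleftrightarrow> a\<^sup>2 + b\<^sup>2 = ?w\<^sup>2"
  using d w by argo
 also have "\<dots> \<longleftrightarrow> tang x y"
 proof
  assume "tang x y"
  then have "(b = 0 \<and> \<bar>a\<bar> = ?w) \<or> (a = 0 \<and> \<bar>b\<bar> = ?w)"
   unfolding tang_def apart_def ab by auto
  then show "a\<^sup>2 + b\<^sup>2 = ?w\<^sup>2" using power2_abs[of a] power2_abs[of b] by (elim disjE conjE) simp_all
 qed (rule sep(2))
 finally show "dist (rpt x) (rpt y) = real (wt x y) \<longleftrightarrow> tang x y" .
qed

text \<open>If a perfect tour exists, then every optimal tour attains the lower bound and is perfect
  too. Satisfiability can therefore be read off from whichever optimal tour the solver returns, by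
  testing tangency; no sums of square roots have to be compared.\<close>

theorem optimal_tour_sat:
 assumes neg_first: "\<And>i i' j j'. occP i j \<Longrightarrow> occN i' j' \<Longrightarrow> j' < j"
  and opt: "optimal_tour (rpt ` V) (map rpt ws)" "set ws \<subseteq> V"
 shows "(\<exists>\<tau>. \<forall>j<M. \<exists>i<L. (occP i j \<and> \<tau> i) \<or> (occN i j \<and> \<not> \<tau> i))
  \<longleftrightarrow> (\<forall>i<length ws. tang (ws ! i) (ws ! (Suc i mod length ws)))"
proof
 have dw: "distinct ws" "set ws = V"
 proof -
  have "distinct (map rpt ws)" "set (map rpt ws) = rpt ` V" using opt by (auto simp: optimal_tour_def is_tour_def)
  then show "distinct ws" "set ws = V" using opt(2) rpt_inj by (auto simp: distinct_map inj_on_image_eq_iff)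
 qed
 have wl: "3 \<le> length ws" using V_len dw by blast
 then have wne: "ws \<noteq> []" by auto
 { assume "\<forall>i<length ws. tang (ws ! i) (ws ! (Suc i mod length ws))"
  then have "successively tang ws" "tang (last ws) (hd ws)" using cyc_all_nth[OF wne] by blast+
  then show "\<exists>\<tau>. \<forall>j<M. \<exists>i<L. (occP i j \<and> \<tau> i) \<or> (occN i j \<and> \<not> \<tau> i)"
   using perfect_sat[OF dw] neg_first by blast }
 assume "\<exists>\<tau>. \<forall>j<M. \<exists>i<L. (occP i j \<and> \<tau> i) \<or> (occN i j \<and> \<not> \<tau> i)"
 then obtain \<tau> where t: "\<And>j. j < M \<Longrightarrow> \<exists>i<L. (occP i j \<and> \<tau> i) \<or> (occN i j \<and> \<not> \<tau> i)" by blast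
 define e where "e j = (SOME i. i < L \<and> ((occP i j \<and> \<tau> i) \<or> (occN i j \<and> \<not> \<tau> i)))" for j
 have e: "e j < L \<and> ((occP (e j) j \<and> \<tau> (e j)) \<or> (occN (e j) j \<and> \<not> \<tau> (e j)))" if "j < M" for j
  unfolding e_def using someI_ex[of "\<lambda>i. i < L \<and> ((occP i j \<and> \<tau> i) \<or> (occN i j \<and> \<not> \<tau> i))"] t[OF that] by blast
 interpret sat_layout L M gx gy occP occN \<tau> e
  by unfold_locales (use e in auto)
 obtain vs where vs: "distinct vs" "set vs = V" "successively tang vs" "tang (last vs) (hd vs)"
  using sat_perfect by blast
 have vl: "3 \<le> length vs" using V_len vs by blast
 then have vne: "vs \<noteq> []" by auto
 define r where "r v = 1 / 2 + real (th v)" for v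
 have r: "r x + r y = real (wt x y)" for x y by (simp add: r_def wt_def)
 have ne: "us ! i \<noteq> us ! (Suc i mod length us) \<and> us ! i \<in> V \<and> us ! (Suc i mod length us) \<in> V"
  if us: "distinct us" "set us = V" "3 \<le> length us" "i < length us" for i us
 proof -
  have "Suc i mod length us < length us" by (rule mod_less_divisor) (use us(3) in linarith)
  moreover have "Suc i mod length us \<noteq> i"
  proof (cases "Suc i = length us")
   case True
   then have "Suc i mod length us = 0" by simp
   then show ?thesis using True us(3) by linarith
  next
   case False
   then have "Suc i mod length us = Suc i" using us(4) by simp
   then show ?thesis by linarith
  qed
  ultimately show ?thesis
   unfolding us(2)[symmetric] using us(4) nth_mem[of i us] nth_mem[of "Suc i mod length us" us]
   by (simp add: nth_eq_iff_index_eq[OF us(1)])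
 qed
 have vt: "tang (vs ! i) (vs ! (Suc i mod length vs))" if "i < length vs" for i
  using cyc_all_nth[OF vne, of tang] vs(3,4) that by blast
 show "\<forall>i<length ws. tang (ws ! i) (ws ! (Suc i mod length ws))"
 proof (intro allI impI)
  fix i assume i: "i < length ws"
  have "dist (rpt (ws ! i)) (rpt (ws ! (Suc i mod length ws))) = r (ws ! i) + r (ws ! (Suc i mod length ws))"
  proof (rule coins_optimal[OF rpt_inj _ vs(1,2) _ _ opt i])
   show "r x + r y \<le> dist (rpt x) (rpt y)" if "x \<in> V" "y \<in> V" "x \<noteq> y" for x y
    unfolding r using rpt_dist(1)[OF that] .
   show "2 \<le> length vs" using vl by simp
   show "dist (rpt (vs ! i)) (rpt (vs ! (Suc i mod length vs))) = r (vs ! i) + r (vs ! (Suc i mod length vs))"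
    if "i < length vs" for i
    unfolding r using rpt_dist(2) ne[OF vs(1,2) vl that] vt[OF that] by blast
  qed
  then show "tang (ws ! i) (ws ! (Suc i mod length ws))"
   unfolding r using rpt_dist(2) ne[OF dw wl i] by blast
 qed
qed

end

section \<open>Size and fractal dimension\<close>

text \<open>The guard \<open>p = 0\<close> is for termination, as division by \<open>2 ^ 0\<close>
  would not decrease \<open>j\<close>.\<close>

function can :: "nat \<Rightarrow> nat \<Rightarrow> nat \<Rightarrow> nat" where
 "can p q j = (if j = 0 \<or> p = 0 then 0 else 2 ^ q * can p q (j div 2 ^ p) + j mod 2 ^ p)"
 by auto
termination
proof (relation "Wellfounded.measure (\<lambda>(p, q, j). j)")
 fix p q j :: nat assume "\<not> (j = 0 \<or> p = 0)"
 then have "1 < (2::nat) ^ p" "0 < j" using one_less_power[of "2::nat" p] by simp_all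
 then show "((p, q, j div 2 ^ p), (p, q, j)) \<in> Wellfounded.measure (\<lambda>(p, q, j). j)" by simp
qed simp

declare can.simps [simp del]

lemma can_0 [simp]: "can p q 0 = 0" by (simp add: can.simps)

lemma can_rec: "0 < p \<Longrightarrow> can p q j = 2 ^ q * can p q (j div 2 ^ p) + j mod 2 ^ p"
 by (cases "j = 0") (simp, subst can.simps, simp)

lemma mod_power_less: "p \<le> q \<Longrightarrow> j mod 2 ^ p < (2::nat) ^ q"
 by (rule less_le_trans[OF mod_less_divisor power_increasing]) simp_all

text \<open>Without a carry the last digit grows. With a carry the leading part grows by induction,
  and since \<open>p \<le> q\<close> the weight \<open>2 ^ q\<close> of the leading part exceeds the
  last digit that is lost.\<close>

lemma can_Suc:
 assumes "0 < p" "p \<le> q" shows "can p q j < can p q (Suc j)"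
proof (induction j rule: less_induct)
 case (less j)
 let ?B = "2 ^ p :: nat" and ?Q = "2 ^ q :: nat" and ?c = "can p q"
 have B: "1 < ?B" "?B \<le> ?Q" using assms one_less_power[of "2::nat" p] by simp_all
 show ?case
 proof (cases "Suc (j mod ?B) = ?B")
  case False
  then have "Suc j div ?B = j div ?B" "Suc j mod ?B = Suc (j mod ?B)"
   by (simp_all add: div_Suc mod_Suc)
  then show ?thesis using can_rec[OF assms(1), of q j] can_rec[OF assms(1), of q "Suc j"] by simp
 next
  case True
  then have d: "Suc j div ?B = Suc (j div ?B)" "Suc j mod ?B = 0" by (simp_all add: div_Suc mod_Suc)
  have "j div ?B < j \<or> j = 0" using B by auto
  then have "?c (j div ?B) < ?c (Suc (j div ?B))"
  proof
   assume "j = 0"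
   then show ?thesis using True B by simp
  qed (rule less)
  then have "?Q * Suc (?c (j div ?B)) \<le> ?Q * ?c (Suc (j div ?B))" by (intro mult_left_mono) simp_all
  moreover have "?c j < ?Q * Suc (?c (j div ?B))"
   using can_rec[OF assms(1), of q j] mod_power_less[OF assms(2), of j] by simp
  ultimately show ?thesis using can_rec[OF assms(1), of q "Suc j"] d by simp
 qed
qed

lemma can_strict: "0 < p \<Longrightarrow> p \<le> q \<Longrightarrow> i < j \<Longrightarrow> can p q i < can p q j"
 using lift_Suc_mono_less[of "can p q"] can_Suc by blast

lemma can_mono: "0 < p \<Longrightarrow> p \<le> q \<Longrightarrow> i \<le> j \<Longrightarrow> can p q i \<le> can p q j"
 using can_strict[of p q i j] by (cases "i = j") (auto simp: less_imp_le)

text \<open>Self-similarity: indices that agree in all digits above position \<open>h\<close> have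
  values in one interval of length \<open>2 ^ (q * h)\<close>, whose left end is a scaled value of
  \<open>can\<close>.\<close>

lemma can_block:
 assumes "0 < p" "p \<le> q"
 shows "2 ^ (q * h) * can p q (j div 2 ^ (p * h)) \<le> can p q j \<and> can p q j < 2 ^ (q * h) * can p q (j div 2 ^ (p * h)) + 2 ^ (q * h)"
proof (induction h)
 case (Suc h)
 let ?m = "j div 2 ^ (p * h)"
 have d: "j div 2 ^ (p * Suc h) = ?m div 2 ^ p" by (simp only: mult_Suc_right add.commute[of p] power_add div_mult2_eq)
 have e: "can p q ?m = 2 ^ q * can p q (?m div 2 ^ p) + ?m mod 2 ^ p" using can_rec assms(1) by blast
 have l: "?m mod 2 ^ p + 1 \<le> 2 ^ q"
  using mod_power_less[OF assms(2), of ?m] by simp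
 have "2 ^ (q * h) * can p q ?m + 2 ^ (q * h) = 2 ^ (q * Suc h) * can p q (?m div 2 ^ p) + 2 ^ (q * h) * (?m mod 2 ^ p + 1)"
  unfolding e by (simp add: algebra_simps power_add)
 also have "\<dots> \<le> 2 ^ (q * Suc h) * can p q (?m div 2 ^ p) + 2 ^ (q * h) * 2 ^ q"
  using l by (intro add_left_mono mult_left_mono) simp_all
 finally have "2 ^ (q * h) * can p q ?m + 2 ^ (q * h) \<le> 2 ^ (q * Suc h) * can p q (?m div 2 ^ p) + 2 ^ (q * Suc h)"
  by (simp add: power_add mult.commute)
 moreover have "2 ^ (q * Suc h) * can p q (?m div 2 ^ p) \<le> 2 ^ (q * h) * can p q ?m"
  unfolding e by (simp add: algebra_simps power_add)
 ultimately show ?case unfolding d using Suc by linarith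
qed (simp add: can_0)

lemma can_upper:
 assumes "0 < p" "p \<le> q"
 shows "real (can p q j) \<le> 2 ^ q * real j powr (real q / real p)"
proof (cases "j = 0")
 case False
 have "j < 2 ^ j" by (rule less_exp)
 also have "\<dots> \<le> 2 ^ (p * j)" using assms(1) by (intro power_increasing) simp_all
 finally have ex: "\<exists>h. j < 2 ^ (p * h)" by blast
 \<comment> \<open>\<open>h\<close> is the number of digits of \<open>j\<close> in base
   \<open>2 ^ p\<close>; both sides are compared with the power of the base that has this
   exponent.\<close>
 define h where "h = (LEAST h. j < 2 ^ (p * h))"
 have h: "j < 2 ^ (p * h)" unfolding h_def using ex by (rule LeastI_ex)
 then have "h \<noteq> 0" using False by (cases h) auto
 then obtain g where g: "h = Suc g" by (cases h) auto
 then have "\<not> j < 2 ^ (p * g)" unfolding h_def using not_less_Least[of g "\<lambda>h. j < 2 ^ (p * h)"] h_def by auto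
 then have le: "2 ^ (p * g) \<le> real j" by (metis not_less of_nat_le_iff of_nat_numeral of_nat_power)
 have "can p q j < 2 ^ (q * h)" using can_block[OF assms, of h j] h by simp
 then have "real (can p q j) \<le> real (2 ^ (q * h))" by (simp only: of_nat_le_iff less_imp_le)
 also have "\<dots> = 2 ^ q * (2 powr (real p * real g)) powr (real q / real p)"
  using assms(1) by (simp add: powr_powr g power_add powr_realpow[symmetric] mult.commute)
 also have "\<dots> \<le> 2 ^ q * real j powr (real q / real p)"
  using le by (intro mult_left_mono powr_mono2) (simp_all add: powr_realpow[symmetric])
 finally show ?thesis .
qed simp

lemma ix_eq:
 assumes "distinct xs" "successively (\<lambda>a b. b = f a) xs" "g (hd xs) = 0"
  and "\<And>a. a \<in> set xs \<Longrightarrow> f a \<in> set xs \<Longrightarrow> g (f a) = Suc (g a)" and "a \<in> set xs"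
 shows "ix xs a = g a"
proof -
 have "i < length xs \<Longrightarrow> g (xs ! i) = i" for i
 proof (induction i)
  case 0 then show ?case using assms(3) by (simp add: hd_conv_nth)
 next
  case (Suc i)
  then have "xs ! Suc i = f (xs ! i)" using assms(2) by (simp add: successively_conv_nth)
  moreover have "xs ! i \<in> set xs" "xs ! Suc i \<in> set xs" using Suc.prems by simp_all
  ultimately show ?case using assms(4)[of "xs ! i"] Suc by simp
 qed
 from this[of "ix xs a"] show ?thesis using ix[OF assms(5)] by simp
qed

section \<open>The stretched layout and its number of points\<close>

locale cgrid =
 fixes p q L M :: nat and occP occN :: "nat \<Rightarrow> nat \<Rightarrow> bool"
 assumes p: "0 < p" and pq: "p \<le> q" and L0: "0 < L" and M0: "0 < M"
begin

abbreviation "ca \<equiv> can p q"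
text \<open>The gaps make the distance of consecutive blocks equal to 21 times the difference of
  their Cantor coordinates. The number 21 is the least period that fits vertically: 19 rows of a
  block, row 22 and at least one gap row. Horizontally 8 columns of a block and the columns 12 and
  14 are subtracted.\<close>

definition "gapx j = 21 * (ca (Suc j) - ca j) - 10"
definition "gapy i = 21 * (ca (Suc (i - 1)) - ca (i - 1)) - 20"

lemma gapx: "gapx j + 10 + 21 * ca j = 21 * ca (Suc j)" and gapy: "gapy i + 20 + 21 * ca (i - 1) = 21 * ca (Suc (i - 1))"
 using can_Suc[OF p pq, of j] can_Suc[OF p pq, of "i - 1"] unfolding gapx_def gapy_def by linarith+

sublocale layout L M gapx gapy occP occN
proof
 show "0 < L" "0 < M" by (rule L0 M0)+
 show "0 < gapx j" for j using can_Suc[OF p pq, of j] unfolding gapx_def by linarith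
 show "0 < gapy i" for i using can_Suc[OF p pq, of "i - 1"] unfolding gapy_def by linarith
qed

text \<open>Closed forms of the positions in \<open>xl\<close> and \<open>yl\<close>. The columns of
  block \<open>j\<close> start at \<open>21 * ca j + 2\<close>, after the two border columns in the
  case \<open>j = 0\<close>; in \<open>fy\<close> the index \<open>i - 1\<close> appears because
  rows 22 and 23 are labelled by the block above them.\<close>

definition fx :: "addr \<Rightarrow> nat" where
 "fx = (\<lambda>(k, j, g). if k \<le> 3 then k - 2 else if k \<le> 12 then 21 * ca j + (k - 2)
   else if k = 13 then 11 + 21 * ca j + g else 1 + 21 * ca (Suc j))"

definition fy :: "addr \<Rightarrow> nat" where
 "fy = (\<lambda>(k, i, g). if k = 2 then 0 else if k \<le> 21 then 21 * ca i + (k - 2)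
   else if k = 22 then 21 * ca (i - 1) + 20 else if k = 23 then 21 + 21 * ca (i - 1) + g
   else 21 + 21 * ca (i - 1))"

lemma fx_nx: "vx \<alpha> \<Longrightarrow> vx (nx \<alpha>) \<Longrightarrow> fx (nx \<alpha>) = Suc (fx \<alpha>)"
proof (cases \<alpha>)
 case (fields k j g)
 assume v: "vx \<alpha>" "vx (nx \<alpha>)"
 consider "k = 2" | "k = 3" | "4 \<le> k \<and> k \<le> 11" | "k = 12" | "k = 13" | "k = 14" using v unfolding fields by force
 then show ?thesis
 proof cases
  case 3
  then have "nx \<alpha> = (Suc k, j, 0)" by (simp add: fields)
  then show ?thesis using 3 by (auto simp: fx_def fields)
 next
  case 5
  then show ?thesis using v gapx[of j] by (cases "Suc g < gapx j") (simp_all add: fx_def fields)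
 qed (use v in \<open>simp_all add: fx_def fields\<close>)
qed

lemma fy_ny: "vy \<alpha> \<Longrightarrow> vy (ny \<alpha>) \<Longrightarrow> fy (ny \<alpha>) = Suc (fy \<alpha>)"
proof (cases \<alpha>)
 case (fields k i g)
 assume v: "vy \<alpha>" "vy (ny \<alpha>)"
 consider "k = 2" | "3 \<le> k \<and> k \<le> 20" | "k = 21" | "k = 22" | "k = 23" | "k = 24" using v unfolding fields by force
 then show ?thesis
 proof cases
  case 5
  then have "1 \<le> i" using v unfolding fields by simp
  then have "Suc (i - 1) = i" by simp
  then show ?thesis using v gapy[of i] 5 by (cases "Suc g < gapy i") (simp_all add: fy_def fields)
 next
  case 2
  then show ?thesis using v by (auto simp add: fy_def fields)
 next
  case 4
  then show ?thesis using v by (cases "i < L") (simp_all add: fy_def fields)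
 qed (use v in \<open>simp_all add: fy_def fields\<close>)
qed

lemma cx_eq: "cell c \<Longrightarrow> cx c = fx (fst c)"
proof -
 assume c: "cell c"
 show "cx c = fx (fst c)" unfolding cx_def
 proof (rule ix_eq[OF distinct_xl xl_succ])
  show "fx (hd xl) = 0" by (simp add: xl_ends fx_def)
  show "fst c \<in> set xl" using cell_v c set_xl by blast
  show "fx (nx a) = Suc (fx a)" if "a \<in> set xl" "nx a \<in> set xl" for a
   using fx_nx that set_xl by blast
 qed
qed

lemma cy_eq: "cell c \<Longrightarrow> cy c = fy (snd c)"
proof -
 assume c: "cell c"
 show "cy c = fy (snd c)" unfolding cy_def
 proof (rule ix_eq[OF distinct_yl yl_succ])
  show "fy (hd yl) = 0" by (simp add: yl_ends fy_def)
  show "snd c \<in> set yl" using cell_v c set_yl by blast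
  show "fy (ny a) = Suc (fy a)" if "a \<in> set yl" "ny a \<in> set yl" for a
   using fy_ny that set_yl by blast
 qed
qed

lemma fx_near: "vx (k, j, g) \<Longrightarrow> k \<noteq> 13 \<Longrightarrow> \<exists>i<M. \<exists>e\<le>10. fx (k, j, g) = 21 * ca i + e"
proof -
 assume v: "vx (k, j, g)" "k \<noteq> 13"
 then consider "k \<le> 3" "2 \<le> k" "j = 0" | "4 \<le> k \<and> k \<le> 12" "j < M" | "k = 14" "Suc j < M" by force
 then show ?thesis
 proof cases
  case 1 then show ?thesis using M0 by (intro exI[of _ 0] conjI exI[of _ "k - 2"]) (simp_all add: fx_def)
 next
  case 2 then show ?thesis by (intro exI[of _ j] conjI exI[of _ "k - 2"]) (auto simp add: fx_def)
 next
  case 3 then show ?thesis by (intro exI[of _ "Suc j"] conjI exI[of _ 1]) (simp_all add: fx_def)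
 qed
qed

lemma fy_near: "vy (k, j, g) \<Longrightarrow> k \<noteq> 23 \<Longrightarrow> \<exists>i<L. \<exists>e\<le>21. fy (k, j, g) = 21 * ca i + e"
proof -
 assume v: "vy (k, j, g)" "k \<noteq> 23"
 then consider "k = 2" | "3 \<le> k \<and> k \<le> 21" "j < L" | "k = 22" "1 \<le> j" "j \<le> L" | "k = 24" "j = L" by force
 then show ?thesis
 proof cases
  case 1 then show ?thesis using L0 by (intro exI[of _ 0] conjI exI[of _ 0]) (simp_all add: fy_def)
 next
  case 2 then show ?thesis by (intro exI[of _ j] conjI exI[of _ "k - 2"]) (auto simp add: fy_def)
 next
  case 3 then show ?thesis by (intro exI[of _ "j - 1"] conjI exI[of _ 20]) (auto simp add: fy_def)
 next
  case 4 then show ?thesis using L0 by (intro exI[of _ "j - 1"] conjI exI[of _ 21]) (auto simp add: fy_def)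
 qed
qed

lemma fx_le: "vx \<alpha> \<Longrightarrow> fx \<alpha> \<le> 21 * ca M + 10"
proof (cases \<alpha>)
 case (fields k j g)
 assume v: "vx \<alpha>"
 show ?thesis
 proof (cases "k = 13")
  case True
  then have "fx \<alpha> \<le> 11 + 21 * ca j + gapx j" "Suc j \<le> M" using v by (simp_all add: fields fx_def)
  then show ?thesis using gapx[of j] can_mono[OF p pq, of "Suc j" M] by linarith
 next
  case False
  then obtain i e where "i < M" "e \<le> 10" "fx \<alpha> = 21 * ca i + e" using fx_near v unfolding fields by blast
  then show ?thesis using can_mono[OF p pq, of i M] by linarith
 qed
qed

lemma fy_le: "vy \<alpha> \<Longrightarrow> fy \<alpha> \<le> 21 * ca L + 21"
proof (cases \<alpha>)
 case (fields k j g)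
 assume v: "vy \<alpha>"
 show ?thesis
 proof (cases "k = 23")
  case True
  then have "fy \<alpha> \<le> 21 + 21 * ca (j - 1) + gapy j" "Suc (j - 1) \<le> L" using v by (auto simp: fields fy_def)
  then show ?thesis using gapy[of j] can_mono[OF p pq, of "Suc (j - 1)" L] by linarith
 next
  case False
  then obtain i e where "i < L" "e \<le> 21" "fy \<alpha> = 21 * ca i + e" using fy_near v unfolding fields by blast
  then show ?thesis using can_mono[OF p pq, of i L] by linarith
 qed
qed

text \<open>A gap column and a gap row meet only in empty cells, so at least one coordinate of every
  point is close to a block. A cell has side 3, which gives the scale \<open>63 = 3 * 21\<close> and
  the largest offset \<open>65 = 3 * 21 + 2\<close>.\<close>

lemma V_near:
 assumes "x \<in> V"
 shows "(\<exists>i<M. \<exists>e\<le>65. fst (pos x) = 63 * ca i + e) \<or> (\<exists>i<L. \<exists>e\<le>65. snd (pos x) = 63 * ca i + e)"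
  and "fst (pos x) \<le> 63 * ca M + 65" "snd (pos x) \<le> 63 * ca L + 65"
proof -
 obtain k j g l i h u v where x: "x = (((k, j, g), (l, i, h)), u, v)" by (metis prod_cases3 prod.exhaust)
 let ?c = "((k, j, g), (l, i, h))"
 have c: "cell ?c" "u < 3" "v < 3" using VD[of ?c u v] offs_lt[of u v] assms unfolding x by blast+
 have vv: "vx (k, j, g)" "vy (l, i, h)" using c(1) by (simp_all add: cell_def)
 have pe: "fst (pos x) = 3 * fx (k, j, g) + u" "snd (pos x) = 3 * fy (l, i, h) + v"
  using cx_eq[OF c(1)] cy_eq[OF c(1)] by (simp_all add: x pos_def)
 show "fst (pos x) \<le> 63 * ca M + 65" "snd (pos x) \<le> 63 * ca L + 65"
  using fx_le[OF vv(1)] fy_le[OF vv(2)] c(2,3) pe by linarith+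
 have "k \<noteq> 13 \<or> l \<noteq> 23"
 proof (rule ccontr)
  assume "\<not> ?thesis"
  then have "rs ?c = 0" by (simp add: rs_def sh_simps)
  then show False using c(1) by (simp add: cell_def)
 qed
 then show "(\<exists>i<M. \<exists>e\<le>65. fst (pos x) = 63 * ca i + e) \<or> (\<exists>i<L. \<exists>e\<le>65. snd (pos x) = 63 * ca i + e)"
 proof
  assume "k \<noteq> 13"
  then obtain i' e where "i' < M" "e \<le> 10" "fx (k, j, g) = 21 * ca i' + e" using fx_near[OF vv(1)] by blast
  then have "fst (pos x) = 63 * ca i' + (3 * e + u)" "3 * e + u \<le> 65" "i' < M" using pe c(2) by linarith+
  then show ?thesis by blast
 next
  assume "l \<noteq> 23"
  then obtain i' e where "i' < L" "e \<le> 21" "fy (l, i, h) = 21 * ca i' + e" using fy_near[OF vv(2)] by blast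
  then have "snd (pos x) = 63 * ca i' + (3 * e + v)" "3 * e + v \<le> 65" "i' < L" using pe c(3) by linarith+
  then show ?thesis by blast
 qed
qed

text \<open>A point is determined by a block index and one of 66 offsets in its near coordinate,
  together with an arbitrary value of the other coordinate.\<close>

lemma card_V: "finite V" "card V \<le> 66 * M * (63 * ca L + 66) + 66 * L * (63 * ca M + 66)"
proof -
 let ?A = "(\<lambda>((i, e), y). (63 * ca i + e, y)) ` (({..<M} \<times> {..65}) \<times> {..63 * ca L + 65})"
 let ?B = "(\<lambda>((i, e), y). (y, 63 * ca i + e)) ` (({..<L} \<times> {..65}) \<times> {..63 * ca M + 65})"
 have sub: "pos ` V \<subseteq> ?A \<union> ?B"
 proof
  fix z assume "z \<in> pos ` V"
  then obtain x where x: "x \<in> V" "z = pos x" by blast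
  from V_near(1)[OF x(1)] show "z \<in> ?A \<union> ?B"
  proof
   assume "\<exists>i<M. \<exists>e\<le>65. fst (pos x) = 63 * ca i + e"
   then obtain i e where "i < M" "e \<le> 65" "fst (pos x) = 63 * ca i + e" by blast
   then have "z \<in> ?A" using V_near(3)[OF x(1)] x(2)
    by (intro image_eqI[of _ _ "((i, e), snd z)"]) (simp_all add: prod_eq_iff)
   then show ?thesis by blast
  next
   assume "\<exists>i<L. \<exists>e\<le>65. snd (pos x) = 63 * ca i + e"
   then obtain i e where "i < L" "e \<le> 65" "snd (pos x) = 63 * ca i + e" by blast
   then have "z \<in> ?B" using V_near(2)[OF x(1)] x(2)
    by (intro image_eqI[of _ _ "((i, e), fst z)"]) (simp_all add: prod_eq_iff)
   then show ?thesis by blast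
  qed
 qed
 have f: "finite (?A \<union> ?B)" by simp
 show "finite V" using finite_imageD[OF finite_subset[OF sub f] pos_inj] .
 have "card V = card (pos ` V)" using card_image[OF pos_inj] by simp
 also have "\<dots> \<le> card (?A \<union> ?B)" by (rule card_mono[OF f sub])
 also have "\<dots> \<le> card ?A + card ?B" by (rule card_Un_le)
 also have "\<dots> \<le> card (({..<M} \<times> {..65::nat}) \<times> {..63 * ca L + 65}) + card (({..<L} \<times> {..65::nat}) \<times> {..63 * ca M + 65})"
  by (intro add_mono card_image_le) simp_all
 also have "\<dots> = 66 * M * (63 * ca L + 66) + 66 * L * (63 * ca M + 66)" by (simp add: algebra_simps)
 finally show "card V \<le> 66 * M * (63 * ca L + 66) + 66 * L * (63 * ca M + 66)" .
qed

end

section \<open>The fractal dimension of the family\<close>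

lemma card_floor:
 fixes S :: "real set"
 assumes "S \<subseteq> {u..u + l}" "0 \<le> l"
 shows "finite (floor ` S) \<and> real (card ((floor ` S) :: int set)) \<le> l + 2"
proof -
 have s: "floor ` S \<subseteq> {\<lfloor>u\<rfloor>..\<lfloor>u + l\<rfloor>}" using assms(1) by (auto intro!: floor_mono)
 have "\<lfloor>u\<rfloor> \<le> \<lfloor>u + l\<rfloor>" using assms(2) by (intro floor_mono) simp
 then have "real (card {\<lfloor>u\<rfloor>..\<lfloor>u + l\<rfloor>}) = real_of_int \<lfloor>u + l\<rfloor> - \<lfloor>u\<rfloor> + 1" by simp
 also have "\<dots> \<le> l + 2" by linarith
 finally have "real (card {\<lfloor>u\<rfloor>..\<lfloor>u + l\<rfloor>}) \<le> l + 2" .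
 moreover have "card (floor ` S) \<le> card {\<lfloor>u\<rfloor>..\<lfloor>u + l\<rfloor>}" by (rule card_mono[OF _ s]) simp
 ultimately show ?thesis using finite_subset[OF s] by simp
qed

lemma power_between:
 fixes w b :: real
 assumes "1 < b" "1 \<le> w"
 obtains h where "b ^ h \<le> w" "w < b ^ Suc h"
proof -
 obtain n where n: "w < b ^ n" using real_arch_pow[OF assms(1)] by blast
 define m where "m = (LEAST n. w < b ^ n)"
 have m: "w < b ^ m" unfolding m_def using n by (rule LeastI)
 then obtain h where h: "m = Suc h" using assms(2) by (cases m) auto
 then have "\<not> w < b ^ h" using not_less_Least[of h "\<lambda>n. w < b ^ n"] unfolding m_def by simp
 then show thesis using that[of h] m unfolding h by linarith
qed

definition near_set :: "nat \<Rightarrow> nat \<Rightarrow> nat set" where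
 "near_set p q = {63 * can p q i + e |i e. e \<le> 65}"

text \<open>All finite sets of grid points with a near coordinate, whether or not they come from
  formulas. The family depends on \<open>p\<close> and \<open>q\<close> alone, so one solver has to
  handle formulas of every size.\<close>

definition fam :: "nat \<Rightarrow> nat \<Rightarrow> (real \<times> real) set set" where
 "fam p q = {P. finite P \<and> (\<forall>z\<in>P. \<exists>m n. z = (real m, real n) \<and> (m \<in> near_set p q \<or> n \<in> near_set p q))}"

text \<open>The scales of \<open>w\<close> and \<open>r\<close> are rounded to levels
  \<open>h \<le> k\<close> of the Cantor construction. A window of radius \<open>r\<close> meets
  boundedly many blocks of level \<open>k\<close>; each of these has
  \<open>2 ^ (p * (k - h))\<close> blocks of level \<open>h\<close>, and each of those is spread
  over boundedly many intervals of length \<open>w\<close>. The factor \<open>4224 = 66 * 64\<close>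
  counts the offsets \<open>e\<close> and the intervals per block.\<close>

lemma cantor_count:
 fixes w r x :: real
 assumes p: "0 < p" "p < q" and w: "1 \<le> w" "w \<le> r"
 shows "finite {\<lfloor>real m / w\<rfloor> |m. m \<in> near_set p q \<and> \<bar>real m - x\<bar> \<le> r}"
  and "real (card {\<lfloor>real m / w\<rfloor> |m. m \<in> near_set p q \<and> \<bar>real m - x\<bar> \<le> r})
   \<le> 4224 * (2 ^ q + 3) * 2 ^ p * (r / w) powr (real p / real q)"
proof -
 let ?c = "can p q"
 define Q B :: nat where "Q = 2 ^ q" and "B = 2 ^ p"
 have pq: "p \<le> q" using p by simp
 have Q1: "1 < real Q" using p one_less_power[of "2::real" q] by (simp add: Q_def)
 obtain h where h: "real Q ^ h \<le> w" "w < real Q ^ Suc h" using power_between[OF Q1 w(1)] .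
 obtain k where k: "real Q ^ k \<le> r" "r < real Q ^ Suc k" using power_between[OF Q1, of r] w by auto
 have "h \<le> k"
 proof (rule ccontr)
  assume "\<not> h \<le> k"
  then have "real Q ^ Suc k \<le> real Q ^ h" using Q1 by (intro power_increasing) auto
  then show False using h k w by linarith
 qed
 have blk: "Q ^ n * ?c (i div B ^ n) \<le> ?c i \<and> ?c i < Q ^ n * ?c (i div B ^ n) + Q ^ n" for n i
  using can_block[OF p(1) pq, of n i] by (simp add: Q_def B_def power_mult)
 define G where "G e = {i. \<bar>real (63 * ?c i + e) - x\<bar> \<le> r}" for e
 \<comment> \<open>The window has length \<open>2 * r / 63\<close>, at most \<open>Q\<close> blocks
   of length \<open>Q ^ k\<close>; partial blocks at the ends and the rounding in
   \<open>card_floor\<close> add 3.\<close>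
 have M': "finite ((\<lambda>i. i div B ^ k) ` G e) \<and> card ((\<lambda>i. i div B ^ k) ` G e) \<le> Q + 3" for e
 proof -
  let ?M = "(\<lambda>i. i div B ^ k) ` G e"
  let ?u = "(x - e - r) / 63 / real Q ^ k - 1"
  have inj: "inj_on (\<lambda>m. \<lfloor>real (?c m)\<rfloor>) ?M"
   using can_strict[OF p(1) pq] by (intro inj_onI) (metis linorder_neqE_nat less_irrefl floor_of_nat of_nat_eq_iff)
  have "(\<lambda>m. real (?c m)) ` ?M \<subseteq> {?u..?u + (real Q + 1)}"
  proof
   fix v assume "v \<in> (\<lambda>m. real (?c m)) ` ?M"
   then obtain i where i: "i \<in> G e" "v = real (?c (i div B ^ k))" by blast
   have b: "real Q ^ k * v \<le> real (?c i)" "real (?c i) < real Q ^ k * v + real Q ^ k"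
    using blk[of k i] unfolding i(2) of_nat_power[symmetric] of_nat_mult[symmetric] of_nat_add[symmetric] of_nat_le_iff of_nat_less_iff by blast+
   have g: "x - e - r \<le> 63 * real (?c i)" "63 * real (?c i) \<le> x - e + r" using i(1) by (auto simp: G_def abs_le_iff)
   have Qk: "0 < real Q ^ k" using Q1 by simp
   have "(x - e - r) / 63 \<le> (v + 1) * real Q ^ k" using b g by (simp add: algebra_simps)
   then have "(x - e - r) / 63 / real Q ^ k \<le> v + 1" using Qk by (simp only: pos_divide_le_eq)
   then have l: "?u \<le> v" by linarith
   have rk: "r \<le> real Q * real Q ^ k" using k by simp
   have "v * real Q ^ k \<le> real (?c i)" using b by (simp add: mult.commute)
   also have "\<dots> \<le> (x - e - r) / 63 + 2 * r / 63" using g by (simp add: field_simps)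
   also have "\<dots> \<le> (x - e - r) / 63 + real Q * real Q ^ k" using rk w by linarith
   also have "\<dots> = (?u + (real Q + 1)) * real Q ^ k" using Qk by (simp add: field_simps)
   finally have "v \<le> ?u + (real Q + 1)" using Qk by (rule mult_right_le_imp_le)
   then show "v \<in> {?u..?u + (real Q + 1)}" using l by simp
  qed
  then have f: "finite (floor ` (\<lambda>m. real (?c m)) ` ?M) \<and> real (card (floor ` (\<lambda>m. real (?c m)) ` ?M)) \<le> real Q + 1 + 2"
   by (rule card_floor) simp
  have e: "floor ` (\<lambda>m. real (?c m)) ` ?M = (\<lambda>m. \<lfloor>real (?c m)\<rfloor>) ` ?M" by (simp only: image_image)
  have "finite ?M" using f inj unfolding e by (blast dest: finite_imageD)
  moreover have "card ?M \<le> Q + 3" using f card_image[OF inj] unfolding e by linarith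
  ultimately show ?thesis by blast
 qed
 \<comment> \<open>A block of level \<open>h\<close> is given by the block of level \<open>k\<close>
   containing it and its remaining \<open>k - h\<close> digits in base \<open>B\<close>.\<close>
 have M: "finite ((\<lambda>i. i div B ^ h) ` G e) \<and> card ((\<lambda>i. i div B ^ h) ` G e) \<le> (Q + 3) * B ^ (k - h)" for e
 proof -
  let ?M = "(\<lambda>i. i div B ^ h) ` G e" and ?M' = "(\<lambda>i. i div B ^ k) ` G e" and ?T = "{..<B ^ (k - h)}"
  have Bk: "B ^ k = B ^ h * B ^ (k - h)" using \<open>h \<le> k\<close> by (simp flip: power_add)
  have sub: "?M \<subseteq> (\<lambda>(m, t). m * B ^ (k - h) + t) ` (?M' \<times> ?T)"
  proof
   fix m assume "m \<in> ?M"
   then obtain i where i: "i \<in> G e" "m = i div B ^ h" by blast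
   have "m div B ^ (k - h) = i div B ^ k" unfolding Bk i by (simp add: div_mult2_eq)
   then have "m = i div B ^ k * B ^ (k - h) + m mod B ^ (k - h)" using div_mult_mod_eq[of m "B ^ (k - h)"] by simp
   moreover have "m mod B ^ (k - h) \<in> ?T" by (simp add: B_def)
   ultimately show "m \<in> (\<lambda>(m, t). m * B ^ (k - h) + t) ` (?M' \<times> ?T)"
    using i(1) by (intro image_eqI[of _ _ "(i div B ^ k, m mod B ^ (k - h))"]) auto
  qed
  have fin: "finite (?M' \<times> ?T)" using M'[of e] by simp
  have "card ?M \<le> card (?M' \<times> ?T)" by (rule surj_card_le[OF fin sub])
  also have "\<dots> \<le> (Q + 3) * B ^ (k - h)" using M'[of e] by (simp add: card_cartesian_product)
  finally show ?thesis using finite_subset[OF sub] fin by blast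
 qed
 let ?F = "\<lambda>e. (\<lambda>i. \<lfloor>real (63 * ?c i + e) / w\<rfloor>) ` G e"
 \<comment> \<open>Within a block of level \<open>h\<close> the points vary by at most
   \<open>63 * Q ^ h \<le> 63 * w\<close>, so their cells follow the first one by at most
   63.\<close>
 have I: "finite (?F e) \<and> card (?F e) \<le> 64 * ((Q + 3) * B ^ (k - h))" for e
 proof -
  let ?M = "(\<lambda>i. i div B ^ h) ` G e"
  let ?b = "\<lambda>m. \<lfloor>real (63 * (Q ^ h * ?c m) + e) / w\<rfloor>"
  have sub: "?F e \<subseteq> (\<lambda>(m, t). ?b m + int t) ` (?M \<times> {..<64::nat})"
  proof
   fix v assume "v \<in> ?F e"
   then obtain i where i: "i \<in> G e" "v = \<lfloor>real (63 * ?c i + e) / w\<rfloor>" by blast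
   let ?m = "i div B ^ h"
   have b: "63 * (Q ^ h * ?c ?m) + e \<le> 63 * ?c i + e" "63 * ?c i + e \<le> 63 * (Q ^ h * ?c ?m) + e + 63 * Q ^ h"
    using blk[of h i] by simp_all
   have "real (63 * (Q ^ h * ?c ?m) + e) / w \<le> real (63 * ?c i + e) / w"
    using b(1) w by (intro divide_right_mono) linarith+
   then have lo: "?b ?m \<le> v" unfolding i(2) by (rule floor_mono)
   have "real (63 * ?c i + e) \<le> real (63 * (Q ^ h * ?c ?m) + e) + 63 * real Q ^ h"
    using b(2) by (simp only: of_nat_le_iff[symmetric, where 'a = real] of_nat_add of_nat_mult of_nat_power of_nat_numeral)
   also have "\<dots> \<le> real (63 * (Q ^ h * ?c ?m) + e) + 63 * w" using h by simp
   finally have "real (63 * ?c i + e) / w \<le> (real (63 * (Q ^ h * ?c ?m) + e) + 63 * w) / w"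
    using w by (intro divide_right_mono) linarith+
   also have "\<dots> = real (63 * (Q ^ h * ?c ?m) + e) / w + of_int 63" using w by (simp add: add_divide_distrib)
   finally have "v \<le> \<lfloor>real (63 * (Q ^ h * ?c ?m) + e) / w + of_int 63\<rfloor>" unfolding i(2) by (rule floor_mono)
   then have "v \<le> ?b ?m + 63" by (simp only: floor_add_int[symmetric])
   then have "v = ?b ?m + int (nat (v - ?b ?m))" "nat (v - ?b ?m) < 64" using lo by linarith+
   then show "v \<in> (\<lambda>(m, t). ?b m + int t) ` (?M \<times> {..<64::nat})"
    using i(1) by (intro image_eqI[of _ _ "(?m, nat (v - ?b ?m))"]) auto
  qed
  have fin: "finite (?M \<times> {..<64::nat})" using M[of e] by simp
  have "card (?F e) \<le> card (?M \<times> {..<64::nat})" by (rule surj_card_le[OF fin sub])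
  also have "\<dots> \<le> 64 * ((Q + 3) * B ^ (k - h))" using M[of e] by (simp add: card_cartesian_product)
  finally show ?thesis using finite_subset[OF sub] fin by blast
 qed
 let ?S = "{\<lfloor>real m / w\<rfloor> |m. m \<in> near_set p q \<and> \<bar>real m - x\<bar> \<le> r}"
 have S: "?S = (\<Union>e\<in>{..65}. ?F e)" unfolding near_set_def G_def by blast
 show "finite ?S" unfolding S using I by simp
 have "card ?S \<le> (\<Sum>e\<in>{..65}. card (?F e))" unfolding S by (rule card_UN_le) simp
 also have "\<dots> \<le> (\<Sum>e\<in>{..65::nat}. 64 * ((Q + 3) * B ^ (k - h)))" using I by (intro sum_mono) blast
 also have "\<dots> = 4224 * (Q + 3) * B ^ (k - h)" by simp
 finally have c: "real (card ?S) \<le> 4224 * (real Q + 3) * real B ^ (k - h)"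
  by (simp only: of_nat_le_iff[symmetric, where 'a = real] of_nat_add of_nat_mult of_nat_power of_nat_numeral)
 \<comment> \<open>Rounding to levels loses one factor \<open>Q\<close> here, which becomes a factor
   \<open>B = 2 ^ p\<close> after taking the power \<open>p / q\<close>.\<close>
 have "real Q ^ (k - h) \<le> real Q * (r / w)"
 proof -
  have "real Q ^ (k - h) * w \<le> real Q ^ (k - h) * real Q ^ Suc h" using h(2) Q1 by (intro mult_left_mono) simp_all
  also have "\<dots> = real Q * real Q ^ k" using \<open>h \<le> k\<close> by (simp flip: power_add)
  also have "\<dots> \<le> real Q * r" using k(1) by (intro mult_left_mono) simp_all
  finally show ?thesis using w by (simp add: field_simps)
 qed
 then have "(real Q ^ (k - h)) powr (real p / real q) \<le> (real Q * (r / w)) powr (real p / real q)"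
  using Q1 by (intro powr_mono2) simp_all
 moreover have pw: "(real Q ^ n) powr (real p / real q) = real B ^ n" for n
 proof -
  have "real Q ^ n = 2 powr (real (q * n))"
   by (simp add: Q_def powr_realpow[of 2 "q * n"] power_mult del: of_nat_mult)
  then have "(real Q ^ n) powr (real p / real q) = 2 powr (real (p * n))" using p by (simp add: powr_powr mult.commute)
  also have "\<dots> = real B ^ n" by (simp add: B_def powr_realpow[of 2 "p * n"] power_mult del: of_nat_mult)
  finally show ?thesis .
 qed
 moreover have "(real Q * (r / w)) powr (real p / real q) = real B * (r / w) powr (real p / real q)"
  using pw[of 1] w powr_mult[of "real Q" "r / w" "real p / real q"] by (simp del: times_divide_eq_right)
 ultimately have "real B ^ (k - h) \<le> real B * (r / w) powr (real p / real q)" by simp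
 then have "4224 * (real Q + 3) * real B ^ (k - h) \<le> 4224 * (real Q + 3) * (real B * (r / w) powr (real p / real q))"
  by (intro mult_left_mono) simp_all
 then show "real (card ?S) \<le> 4224 * (2 ^ q + 3) * 2 ^ p * (r / w) powr (real p / real q)"
  using c by (simp add: Q_def B_def mult.assoc)
qed

text \<open>Net points are mapped injectively to squares of side \<open>w\<close>. One coordinate of
  such a square is restricted by \<open>cantor_count\<close> with exponent \<open>p / q\<close>, the
  other is arbitrary and contributes exponent 1. The constant does not depend on the point set, as
  \<open>growth_bound\<close> requires.\<close>

theorem growth_fam:
 assumes p: "0 < p" "p < q"
 shows "growth_bound (fam p q) (1 + real p / real q)"
proof -
 define C where "C = 4224 * (2 ^ q + 3) * (2::real) ^ p"
 define s where "s = real p / real q"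
 have C0: "0 \<le> C" by (simp add: C_def)
 have s0: "0 \<le> s" by (simp add: s_def)
 have "real (card (N \<inter> cball x r)) \<le> 8 * C * 2 powr (1 + s) * (r / \<rho>) powr (1 + s)"
  if P: "P \<in> fam p q" and rho: "0 < \<rho>" "2 * \<rho> \<le> r" and N: "is_net \<rho> N P" for P \<rho> r N and x :: "real \<times> real"
 proof -
  \<comment> \<open>Two points in a square of side \<rho> / 2 are closer than \<rho>, so a net has
    at most one point there. For \<rho> \<le> 2 the side is 1, and squares separate the points
    because their coordinates are integers.\<close>
  define w where "w = max (\<rho> / 2) 1"
  \<comment> \<open>A ball smaller than the squares is replaced by one of radius \<open>w\<close>,
    so that \<open>w \<le> R\<close> holds as \<open>cantor_count\<close> demands; this costs
    nothing, as then \<open>R / w = 1\<close> and \<open>r / \<rho>\<close> is at least 2.\<close>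
  define R where "R = max r w"
  have w: "1 \<le> w" "w \<le> R" "0 < w" by (auto simp: w_def R_def)
  define \<phi> where "\<phi> z = (\<lfloor>fst z / w\<rfloor>, \<lfloor>snd z / w\<rfloor>)" for z :: "real \<times> real"
  have NP: "z \<in> N \<Longrightarrow> \<exists>m n. z = (real m, real n) \<and> (m \<in> near_set p q \<or> n \<in> near_set p q)" for z
   using N P unfolding is_net_def fam_def by blast
  have inj: "inj_on \<phi> N"
  proof (rule inj_onI, rule ccontr)
   fix z z' assume z: "z \<in> N" "z' \<in> N" "\<phi> z = \<phi> z'" "z \<noteq> z'"
   have d: "\<rho> < dist z z'" using N z unfolding is_net_def by blast
   show False
   proof (cases "\<rho> \<le> 2")
    case True
    then have "w = 1" by (simp add: w_def)
    obtain m n m' n' where "z = (real m, real n)" "z' = (real m', real n')" using NP z by metis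
    then show False using z(3,4) \<open>w = 1\<close> by (simp add: \<phi>_def)
   next
    case False
    then have wr: "w = \<rho> / 2" by (simp add: w_def)
    have fl: "\<bar>a - b\<bar> < w" if "\<lfloor>a / w\<rfloor> = \<lfloor>b / w\<rfloor>" for a b
    proof -
     have "\<bar>a / w - b / w\<bar> < 1" using that by linarith
     then show ?thesis using w by (simp add: field_simps flip: diff_divide_distrib)
    qed
    have "\<bar>fst z - fst z'\<bar> < w" "\<bar>snd z - snd z'\<bar> < w" using z(3) fl by (auto simp: \<phi>_def)
    moreover have "dist z z' \<le> \<bar>fst z - fst z'\<bar> + \<bar>snd z - snd z'\<bar>"
     unfolding dist_prod_def dist_real_def by (metis sqrt_sum_squares_le_sum_abs power2_abs abs_abs)
    ultimately show False using d wr by linarith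
   qed
  qed
  define I where "I t = {\<lfloor>real m / w\<rfloor> |m. m \<in> near_set p q \<and> \<bar>real m - t\<bar> \<le> R}" for t
  define J where "J t = floor ` {(t - R) / w..(t - R) / w + 2 * R / w}" for t :: real
  have Ic: "finite (I t) \<and> real (card (I t)) \<le> C * (R / w) powr s" for t
   using cantor_count[OF p w(1,2), of t] unfolding I_def C_def s_def by blast
  have Jc: "finite (J t) \<and> real (card (J t)) \<le> 4 * (R / w)" for t
  proof -
   have "1 \<le> R / w" using w by simp
   then show ?thesis using card_floor[of "{(t - R) / w..(t - R) / w + 2 * R / w}" "(t - R) / w" "2 * R / w"] unfolding J_def by auto
  qed
  have J: "\<lfloor>v / w\<rfloor> \<in> J t" if "\<bar>v - t\<bar> \<le> R" for v t
  proof -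
   have "t - R \<le> v" "v \<le> t - R + 2 * R" using that by linarith+
   then have "(t - R) / w \<le> v / w" "v / w \<le> (t - R + 2 * R) / w" using w by (auto intro: divide_right_mono)
   then show ?thesis unfolding J_def by (intro imageI) (simp only: add_divide_distrib[of "t - R"] atLeastAtMost_iff)
  qed
  have sub: "\<phi> ` (N \<inter> cball x r) \<subseteq> (I (fst x) \<times> J (snd x)) \<union> (J (fst x) \<times> I (snd x))"
  proof
   fix v assume "v \<in> \<phi> ` (N \<inter> cball x r)"
   then obtain z where z: "z \<in> N" "dist x z \<le> r" "v = \<phi> z" by auto
   obtain m n where mn: "z = (real m, real n)" "m \<in> near_set p q \<or> n \<in> near_set p q" using NP z by blast
   have "\<bar>fst z - fst x\<bar> \<le> R" "\<bar>snd z - snd x\<bar> \<le> R"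
    using z(2) dist_fst_le[of x z] dist_snd_le[of x z] by (auto simp: dist_real_def R_def)
   then have d: "\<bar>real m - fst x\<bar> \<le> R" "\<bar>real n - snd x\<bar> \<le> R" by (simp_all add: mn)
   have "v = (\<lfloor>real m / w\<rfloor>, \<lfloor>real n / w\<rfloor>)" by (simp add: z mn \<phi>_def)
   then show "v \<in> (I (fst x) \<times> J (snd x)) \<union> (J (fst x) \<times> I (snd x))"
    using mn(2) J[OF d(1)] J[OF d(2)] d unfolding I_def by blast
  qed
  have fin: "finite ((I (fst x) \<times> J (snd x)) \<union> (J (fst x) \<times> I (snd x)))" using Ic Jc by simp
  have "card (N \<inter> cball x r) = card (\<phi> ` (N \<inter> cball x r))"
   using inj by (intro card_image[symmetric]) (auto intro: inj_on_subset)
  also have "\<dots> \<le> card ((I (fst x) \<times> J (snd x)) \<union> (J (fst x) \<times> I (snd x)))" by (rule card_mono[OF fin sub])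
  also have "\<dots> \<le> card (I (fst x) \<times> J (snd x)) + card (J (fst x) \<times> I (snd x))" by (rule card_Un_le)
  also have "\<dots> = card (I (fst x)) * card (J (snd x)) + card (J (fst x)) * card (I (snd x))"
   by (simp only: card_cartesian_product)
  finally have "real (card (N \<inter> cball x r)) \<le> real (card (I (fst x))) * real (card (J (snd x))) + real (card (J (fst x))) * real (card (I (snd x)))"
   by (simp only: of_nat_le_iff[symmetric, where 'a = real] of_nat_add of_nat_mult)
  also have "\<dots> \<le> (C * (R / w) powr s) * (4 * (R / w)) + (4 * (R / w)) * (C * (R / w) powr s)"
   using Ic Jc C0 w by (intro add_mono mult_mono) (simp_all)
  also have "\<dots> = 8 * C * (R / w) powr (1 + s)" using w by (simp add: powr_add)
  also have "\<dots> \<le> 8 * C * (2 * (r / \<rho>)) powr (1 + s)"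
  proof -
   have "R / w \<le> 2 * (r / \<rho>)"
   proof (cases "r \<le> w")
    case True
    then have "R / w = 1" using w by (simp add: R_def)
    then show ?thesis using rho by (simp add: field_simps)
   next
    case False
    then have "R / w = r / w" by (simp add: R_def)
    also have "\<dots> \<le> r / (\<rho> / 2)" using rho False w by (intro divide_left_mono) (auto simp: w_def)
    finally show ?thesis by (simp add: mult.commute)
   qed
   then show ?thesis using C0 w s0 by (intro mult_left_mono powr_mono2) simp_all
  qed
  also have "\<dots> = 8 * C * 2 powr (1 + s) * (r / \<rho>) powr (1 + s)" using powr_mult[of 2 "r / \<rho>" "1 + s"] rho by (simp del: times_divide_eq_right)
  finally show ?thesis .
 qed
 then show ?thesis unfolding growth_bound_def s_def by blast
qed

lemma fam_dim: "0 < p \<Longrightarrow> p < q \<Longrightarrow> fractal_dim (fam p q) \<le> ereal (1 + real p / real q)"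
 unfolding fractal_dim_def using growth_fam by (intro INF_lower) simp

context cgrid begin

lemma V_fam: "rpt ` V \<in> fam p q"
proof -
 have "\<exists>m n. rpt x = (real m, real n) \<and> (m \<in> near_set p q \<or> n \<in> near_set p q)" if "x \<in> V" for x
  using V_near(1)[OF that] unfolding rpt_def near_set_def by blast
 then show ?thesis using card_V(1) unfolding fam_def by blast
qed

end

section \<open>Polynomial-time programs\<close>

text \<open>The summand 2 keeps the base at least 2, so constants and sums are absorbed into the
  exponent and one parameter describes a polynomial bound.\<close>

definition pbd :: "('a \<Rightarrow> nat) \<Rightarrow> ('a \<Rightarrow> nat) \<Rightarrow> bool" where
 "pbd f g \<longleftrightarrow> (\<exists>d. \<forall>x. f x \<le> (g x + 2) ^ d)"

lemma pbdI: "(\<And>x. f x \<le> (g x + 2) ^ d) \<Longrightarrow> pbd f g"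
 unfolding pbd_def by blast

lemma pbd_le: "(\<And>x. f x \<le> f' x) \<Longrightarrow> pbd f' g \<Longrightarrow> pbd f g"
 unfolding pbd_def by (meson le_trans)

lemma pbd_refl [intro, simp]: "pbd g g" by (rule pbdI[of _ _ 1]) simp

lemma pbd_const [intro, simp]: "pbd (\<lambda>_. c) g"
proof (rule pbdI[of _ _ c])
 fix x
 have "c \<le> 2 ^ c" using less_exp[of c] by (rule less_imp_le)
 also have "\<dots> \<le> (g x + 2) ^ c" by (intro power_mono) simp_all
 finally show "c \<le> (g x + 2) ^ c" .
qed

lemma pbd_mult: "pbd f g \<Longrightarrow> pbd f' g \<Longrightarrow> pbd (\<lambda>x. f x * f' x) g"
proof -
 assume "pbd f g" "pbd f' g"
 then obtain d e where "\<And>x. f x \<le> (g x + 2) ^ d" "\<And>x. f' x \<le> (g x + 2) ^ e" unfolding pbd_def by blast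
 then show ?thesis by (intro pbdI[of _ _ "d + e"]) (simp add: power_add mult_mono)
qed

lemma pbd_add: "pbd f g \<Longrightarrow> pbd f' g \<Longrightarrow> pbd (\<lambda>x. f x + f' x) g"
proof (rule pbd_le[of _ "\<lambda>x. 2 * ((f x + 1) * (f' x + 1))"])
 assume "pbd f g" "pbd f' g"
 then obtain d e where de: "\<And>x. f x \<le> (g x + 2) ^ d" "\<And>x. f' x \<le> (g x + 2) ^ e" unfolding pbd_def by blast
 have s: "h + 1 \<le> (n + 2) ^ Suc d" if "h \<le> (n + 2) ^ d" for h n d :: nat
 proof -
  have "1 \<le> (n + 2) ^ d" by simp
  moreover have "(n + 2) ^ Suc d \<ge> 2 * (n + 2) ^ d" by simp
  ultimately show ?thesis using that by linarith
 qed
 have "pbd (\<lambda>x. f x + 1) g" "pbd (\<lambda>x. f' x + 1) g"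
  by (rule pbdI, rule s, rule de)+
 then show "pbd (\<lambda>x. 2 * ((f x + 1) * (f' x + 1))) g" by (intro pbd_mult pbd_const)
qed (simp add: algebra_simps)

lemma pbd_trans: "pbd f g \<Longrightarrow> pbd g h \<Longrightarrow> pbd f h"
proof -
 assume "pbd f g" "pbd g h"
 then obtain d e where de: "\<And>x. f x \<le> (g x + 2) ^ d" "\<And>x. g x \<le> (h x + 2) ^ e" unfolding pbd_def by blast
 show ?thesis
 proof (rule pbdI[of _ _ "(e + 2) * d"])
  fix x
  have "1 \<le> (h x + 2) ^ e" by simp
  moreover have "(h x + 2) ^ (e + 2) \<ge> (h x + 2) ^ e * 4"
   unfolding power_add by (intro mult_left_mono) (auto simp: power2_eq_square)
  ultimately have "g x + 2 \<le> (h x + 2) ^ (e + 2)" using de(2)[of x] by linarith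
  then have "(g x + 2) ^ d \<le> ((h x + 2) ^ (e + 2)) ^ d" by (intro power_mono) simp_all
  then show "f x \<le> (h x + 2) ^ ((e + 2) * d)" using de(1)[of x] unfolding power_mult by linarith
 qed
qed

lemma pbd_comp: "pbd f g \<Longrightarrow> pbd (\<lambda>x. f (u x)) (\<lambda>x. g (u x))"
 unfolding pbd_def by blast

section \<open>Programs that compute a function in place\<close>

definition runs :: "com \<Rightarrow> store \<Rightarrow> nat \<Rightarrow> tree \<Rightarrow> nat \<Rightarrow> bool" where
 "runs c s k v T \<longleftrightarrow> (\<exists>t s'. exec c s t s' \<and> t \<le> T \<and> s' k = v \<and> (\<forall>j<k. s' j = s j))"

lemma runsE:
 assumes "runs c s k v T"
 obtains t s' where "exec c s t s'" "t \<le> T" "s' k = v" "\<And>j. j < k \<Longrightarrow> s' j = s j"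
 using assms unfolding runs_def by blast

text \<open>\<open>pt a b f\<close>: with inputs encoded by \<open>a\<close> and outputs by \<open>b\<close>, a program computes \<open>f\<close> in any
 given variable in polynomial time, leaving all lower-numbered variables untouched.\<close>

definition pt :: "('a \<Rightarrow> tree) \<Rightarrow> ('b \<Rightarrow> tree) \<Rightarrow> ('a \<Rightarrow> 'b) \<Rightarrow> bool" where
 "pt a b f \<longleftrightarrow> pbd (\<lambda>x. size (b (f x))) (\<lambda>x. size (a x)) \<and>
   (\<exists>T. pbd T (\<lambda>x. size (a x)) \<and> (\<forall>k. \<exists>c. \<forall>s x. s k = a x \<longrightarrow> runs c s k (b (f x)) (T x)))"

lemma pt_size: "pt a b f \<Longrightarrow> pbd (\<lambda>x. size (b (f x))) (\<lambda>x. size (a x))"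
 unfolding pt_def by blast

lemma ptE:
 assumes "pt a b f"
 obtains T C where "pbd T (\<lambda>x. size (a x))" "\<And>k s x. s k = a x \<Longrightarrow> runs (C k) s k (b (f x)) (T x)"
proof -
 obtain T where T: "pbd T (\<lambda>x. size (a x))" "\<forall>k. \<exists>c. \<forall>s x. s k = a x \<longrightarrow> runs c s k (b (f x)) (T x)"
  using assms unfolding pt_def by blast
 obtain C where "\<forall>k s x. s k = a x \<longrightarrow> runs (C k) s k (b (f x)) (T x)" using T(2) by metis
 then show thesis using that T(1) by blast
qed

lemma ptI:
 assumes "pbd (\<lambda>x. size (b (f x))) (\<lambda>x. size (a x))" "pbd T (\<lambda>x. size (a x))"
  and "\<And>k s x. s k = a x \<Longrightarrow> runs (C k) s k (b (f x)) (T x)"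
 shows "pt a b f"
 unfolding pt_def using assms by blast

definition pr :: "('a \<Rightarrow> tree) \<Rightarrow> ('b \<Rightarrow> tree) \<Rightarrow> 'a \<times> 'b \<Rightarrow> tree" where
 "pr a b p = Node (a (fst p)) (b (snd p))"
lemmas [simp] = pr_def
abbreviation "ls \<equiv> enc_list"
abbreviation "bl \<equiv> enc_bool"

lemma runs_assign: "eval_expr e s = v \<Longrightarrow> runs (Assign k e) s k v 1"
 unfolding runs_def by (intro exI conjI, rule Assign) auto

lemma pt_assign:
 assumes "pbd (\<lambda>x. size (b (f x))) (\<lambda>x. size (a x))" "\<And>k s x. s k = a x \<Longrightarrow> eval_expr (e k) s = b (f x)"
 shows "pt a b f"
 by (rule ptI[of _ _ _ "\<lambda>_. 1" "\<lambda>k. Assign k (e k)"], rule assms(1), rule pbd_const, rule runs_assign, rule assms(2))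

lemma pt_id: "pt a a (\<lambda>x. x)"
 by (rule pt_assign[of _ _ _ Var]) auto

fun texpr :: "tree \<Rightarrow> expr" where
 "texpr Leaf = LeafE" | "texpr (Node a b) = NodeE (texpr a) (texpr b)"

lemma eval_texpr [simp]: "eval_expr (texpr t) s = t" by (induction t) auto

lemma pt_const: "pt a b (\<lambda>x. c)"
 by (rule pt_assign[of _ _ _ "\<lambda>_. texpr (b c)"]) auto

text \<open>Different types may share an encoding: a pair of a head and a tail is a list, a list of
  units is a unary number. Changing the view costs no computation.\<close>

lemma pt_recode: "pt a b f \<Longrightarrow> (\<And>x. b (f x) = c (g x)) \<Longrightarrow> pt a c g"
 unfolding pt_def by simp

lemma pt_comp:
 assumes "pt b c g" "pt a b f"
 shows "pt a c (\<lambda>x. g (f x))"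
proof -
 obtain T C where g: "pbd T (\<lambda>x. size (b x))" "\<And>k s x. s k = b x \<Longrightarrow> runs (C k) s k (c (g x)) (T x)"
  by (rule ptE[OF assms(1)]) (rule that)
 obtain U D where f: "pbd U (\<lambda>x. size (a x))" "\<And>k s x. s k = a x \<Longrightarrow> runs (D k) s k (b (f x)) (U x)"
  by (rule ptE[OF assms(2)]) (rule that)
 show ?thesis
 proof (rule ptI[of _ _ _ "\<lambda>x. U x + T (f x)" "\<lambda>k. Seq (D k) (C k)"])
  show "pbd (\<lambda>x. size (c (g (f x)))) (\<lambda>x. size (a x))"
   using pbd_trans[OF pbd_comp[OF pt_size[OF assms(1)]] pt_size[OF assms(2)]] .
  show "pbd (\<lambda>x. U x + T (f x)) (\<lambda>x. size (a x))"
   using pbd_add[OF f(1) pbd_trans[OF pbd_comp[OF g(1)] pt_size[OF assms(2)]]] .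
  fix k :: nat and s :: store and x assume "s k = a x"
  from f(2)[of s k x, OF this] obtain t s' where 1: "exec (D k) s t s'" "t \<le> U x" "s' k = b (f x)" "\<And>j. j < k \<Longrightarrow> s' j = s j"
   by (rule runsE) (rule that)
  from g(2)[of s' k "f x", OF 1(3)] obtain u s'' where 2: "exec (C k) s' u s''" "u \<le> T (f x)" "s'' k = c (g (f x))" "\<And>j. j < k \<Longrightarrow> s'' j = s' j"
   by (rule runsE) (rule that)
  show "runs (Seq (D k) (C k)) s k (c (g (f x))) (U x + T (f x))"
   unfolding runs_def using exec.Seq[OF 1(1) 2(1)] 1(2,4) 2(2-) by (intro exI[of _ "t + u"] exI[of _ s'']) auto
 qed
qed

lemma pt_pair:
 assumes "pt a b f" "pt a c g"
 shows "pt a (pr b c) (\<lambda>x. (f x, g x))"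
proof -
 obtain T C where f: "pbd T (\<lambda>x. size (a x))" "\<And>k s x. s k = a x \<Longrightarrow> runs (C k) s k (b (f x)) (T x)"
  by (rule ptE[OF assms(1)]) (rule that)
 obtain U D where g: "pbd U (\<lambda>x. size (a x))" "\<And>k s x. s k = a x \<Longrightarrow> runs (D k) s k (c (g x)) (U x)"
  by (rule ptE[OF assms(2)]) (rule that)
 let ?P = "\<lambda>k. Seq (Assign (k + 1) (Var k)) (Seq (C (k + 1)) (Seq (Assign (k + 2) (Var k)) (Seq (D (k + 2)) (Assign k (NodeE (Var (k + 1)) (Var (k + 2)))))))"
 show ?thesis
 proof (rule ptI[of _ _ _ "\<lambda>x. T x + U x + 3" ?P])
  show "pbd (\<lambda>x. size ((pr b c) (f x, g x))) (\<lambda>x. size (a x))"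
   using pbd_add[OF pbd_add[OF pt_size[OF assms(1)] pt_size[OF assms(2)]] pbd_const[of 1]] by simp
  show "pbd (\<lambda>x. T x + U x + 3) (\<lambda>x. size (a x))" using f(1) g(1) by (intro pbd_add) auto
  fix k :: nat and s :: store and x assume k: "s k = a x"
  let ?s1 = "s(k + 1 := s k)"
  have e1: "exec (Assign (k + 1) (Var k)) s 1 ?s1" using exec.Assign[of "k + 1" "Var k" s] by simp
  from f(2)[of ?s1 "k + 1" x] k obtain t s2 where e2: "exec (C (k + 1)) ?s1 t s2" "t \<le> T x" "s2 (k + 1) = b (f x)" "\<And>j. j < k + 1 \<Longrightarrow> s2 j = ?s1 j"
   by (metis fun_upd_same runsE)
  let ?s3 = "s2(k + 2 := s2 k)"
  have e3: "exec (Assign (k + 2) (Var k)) s2 1 ?s3" using exec.Assign[of "k + 2" "Var k" s2] by simp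
  have "?s3 (k + 2) = a x" using e2(4)[of k] k by simp
  from g(2)[of ?s3 "k + 2" x, OF this] obtain u s4 where e4: "exec (D (k + 2)) ?s3 u s4" "u \<le> U x" "s4 (k + 2) = c (g x)" "\<And>j. j < k + 2 \<Longrightarrow> s4 j = ?s3 j"
   by (rule runsE) (rule that)
  let ?s5 = "s4(k := Node (s4 (k + 1)) (s4 (k + 2)))"
  have e5: "exec (Assign k (NodeE (Var (k + 1)) (Var (k + 2)))) s4 1 ?s5"
   using exec.Assign[of k "NodeE (Var (k + 1)) (Var (k + 2))" s4] by simp
  have "exec (?P k) s (1 + (t + (1 + (u + 1)))) ?s5"
   by (intro exec.Seq) (rule e1 e2(1) e3 e4(1) e5)+
  moreover have "?s5 k = (pr b c) (f x, g x)" using e4(3) e4(4)[of "k + 1"] e2(3) by simp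
  moreover have "?s5 j = s j" if "j < k" for j using that e4(4)[of j] e2(4)[of j] by simp
  ultimately show "runs (?P k) s k ((pr b c) (f x, g x)) (T x + U x + 3)"
   unfolding runs_def using e2(2) e4(2) by (intro exI[of _ "1 + (t + (1 + (u + 1)))"] exI[of _ ?s5]) auto
 qed
qed

lemma pt_fst: "pt a (pr b c) f \<Longrightarrow> pt a b (\<lambda>x. fst (f x))"
proof (erule pt_comp[rotated], rule pt_assign[of _ _ _ "\<lambda>k. Left (Var k)"])
 show "pbd (\<lambda>x. size (b (fst x))) (\<lambda>x. size ((pr b c) x))"
  by (rule pbdI[of _ _ 1]) (simp add: split_beta)
qed (simp add: split_beta)

lemma pt_snd: "pt a (pr b c) f \<Longrightarrow> pt a c (\<lambda>x. snd (f x))"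
proof (erule pt_comp[rotated], rule pt_assign[of _ _ _ "\<lambda>k. Right (Var k)"])
 show "pbd (\<lambda>x. size (c (snd x))) (\<lambda>x. size ((pr b c) x))"
  by (rule pbdI[of _ _ 1]) (simp add: split_beta)
qed (simp add: split_beta)

lemma pt_cons:
 assumes "pt a b f" "pt a (ls b) g" shows "pt a (ls b) (\<lambda>x. f x # g x)"
 by (rule pt_recode[OF pt_pair[OF assms]]) (simp add: enc_list_def)

lemma pt_if:
 assumes "pt a bl P" "pt a b f" "pt a b g"
 shows "pt a b (\<lambda>x. if P x then f x else g x)"
proof -
 obtain T C where P: "pbd T (\<lambda>x. size (a x))" "\<And>k s x. s k = a x \<Longrightarrow> runs (C k) s k (bl (P x)) (T x)"
  by (rule ptE[OF assms(1)]) (rule that)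
 obtain U D where f: "pbd U (\<lambda>x. size (a x))" "\<And>k s x. s k = a x \<Longrightarrow> runs (D k) s k (b (f x)) (U x)"
  by (rule ptE[OF assms(2)]) (rule that)
 obtain W E where g: "pbd W (\<lambda>x. size (a x))" "\<And>k s x. s k = a x \<Longrightarrow> runs (E k) s k (b (g x)) (W x)"
  by (rule ptE[OF assms(3)]) (rule that)
 let ?Q = "\<lambda>k. Seq (Assign (k + 1) (Var k)) (Seq (C (k + 1)) (IfNode (Var (k + 1)) (D k) (E k)))"
 show ?thesis
 proof (rule ptI[of _ _ _ "\<lambda>x. T x + (U x + W x) + 2" ?Q])
  show "pbd (\<lambda>x. size (b (if P x then f x else g x))) (\<lambda>x. size (a x))"
   by (rule pbd_le[OF _ pbd_add[OF pt_size[OF assms(2)] pt_size[OF assms(3)]]]) simp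
  show "pbd (\<lambda>x. T x + (U x + W x) + 2) (\<lambda>x. size (a x))" using P(1) f(1) g(1) by (intro pbd_add) auto
  fix k :: nat and s :: store and x assume k: "s k = a x"
  let ?s1 = "s(k + 1 := s k)"
  have e1: "exec (Assign (k + 1) (Var k)) s 1 ?s1" using exec.Assign[of "k + 1" "Var k" s] by simp
  have "?s1 (k + 1) = a x" using k by simp
  from P(2)[of ?s1 "k + 1" x, OF this] obtain t s2 where e2: "exec (C (k + 1)) ?s1 t s2" "t \<le> T x" "s2 (k + 1) = bl (P x)" "\<And>j. j < k + 1 \<Longrightarrow> s2 j = ?s1 j"
   by (rule runsE) (rule that)
  have k2: "s2 k = a x" using e2(4)[of k] k by simp
  show "runs (?Q k) s k (b (if P x then f x else g x)) (T x + (U x + W x) + 2)"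
  proof (cases "P x")
   case True
   from f(2)[of s2 k x, OF k2] obtain u s3 where e3: "exec (D k) s2 u s3" "u \<le> U x" "s3 k = b (f x)" "\<And>j. j < k \<Longrightarrow> s3 j = s2 j"
    by (rule runsE) (rule that)
   have "exec (IfNode (Var (k + 1)) (D k) (E k)) s2 (1 + u) s3"
    using True e2(3) by (intro exec.IfTrue e3(1)) (simp add: enc_bool_def)
   then have "exec (?Q k) s (1 + (t + (1 + u))) s3" by (intro exec.Seq) (rule e1 e2(1) | assumption)+
   then show ?thesis unfolding runs_def using e2(2) e3(2-) e2(4) True
    by (intro exI[of _ "1 + (t + (1 + u))"] exI[of _ s3]) auto
  next
   case False
   from g(2)[of s2 k x, OF k2] obtain u s3 where e3: "exec (E k) s2 u s3" "u \<le> W x" "s3 k = b (g x)" "\<And>j. j < k \<Longrightarrow> s3 j = s2 j"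
    by (rule runsE) (rule that)
   have "exec (IfNode (Var (k + 1)) (D k) (E k)) s2 (1 + u) s3"
    using False e2(3) by (intro exec.IfFalse e3(1)) (simp add: enc_bool_def)
   then have "exec (?Q k) s (1 + (t + (1 + u))) s3" by (intro exec.Seq) (rule e1 e2(1) | assumption)+
   then show ?thesis unfolding runs_def using e2(2) e3(2-) e2(4) False
    by (intro exI[of _ "1 + (t + (1 + u))"] exI[of _ s3]) auto
  qed
 qed
qed

lemma enc_list_simps [simp]: "ls b [] = Leaf" "ls b (x # xs) = Node (b x) (ls b xs)"
 by (simp_all add: enc_list_def)

lemma size_ls: "size (ls b xs) = sum_list (map (\<lambda>x. size (b x)) xs) + length xs"
 by (induction xs) auto

lemma pt_null: "pt a (ls b) f \<Longrightarrow> pt a bl (\<lambda>x. f x = [])"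
proof -
 assume f: "pt a (ls b) f"
 have n: "pt (ls b) bl (\<lambda>xs. xs = [])"
 proof (rule ptI[of _ _ _ "\<lambda>_. 2" "\<lambda>k. IfNode (Var k) (Assign k LeafE) (Assign k (NodeE LeafE LeafE))"])
  show "pbd (\<lambda>x. size (bl (x = []))) (\<lambda>x. size (ls b x))"
   by (rule pbd_le[OF _ pbd_const[of 1]]) (simp add: enc_bool_def)
  fix k and s :: store and xs assume k: "s k = ls b xs"
  show "runs (IfNode (Var k) (Assign k LeafE) (Assign k (NodeE LeafE LeafE))) s k (bl (xs = [])) 2"
  proof (cases xs)
   case Nil
   then have "exec (IfNode (Var k) (Assign k LeafE) (Assign k (NodeE LeafE LeafE))) s (1 + 1) (s(k := Node Leaf Leaf))"
    using k exec.IfFalse[OF _ exec.Assign[of k "NodeE LeafE LeafE" s]] by simp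
   then show ?thesis unfolding runs_def using Nil by (intro exI[of _ "1 + 1"] exI) (auto simp: enc_bool_def)
  next
   case Cons
   then have "exec (IfNode (Var k) (Assign k LeafE) (Assign k (NodeE LeafE LeafE))) s (1 + 1) (s(k := Leaf))"
    using k exec.IfTrue[OF _ exec.Assign[of k LeafE s]] by simp
   then show ?thesis unfolding runs_def using Cons by (intro exI[of _ "1 + 1"] exI) (auto simp: enc_bool_def)
  qed
 qed simp
 show ?thesis by (rule pt_comp[OF n f])
qed

lemma pbd_power: "pbd S g \<Longrightarrow> pbd (\<lambda>x. (S x + 2) ^ d) g"
 by (rule pbd_trans[OF pbdI[of _ S d]]) simp_all

text \<open>The tree of a nonempty list is already the pair of its head and tail, so the branch for
  nonempty lists receives its argument by a single pairing with the input.\<close>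

lemma pt_case:
 assumes "pt a (ls b) f" "pt a c g"
  and "pt (pr a (pr b (ls b))) c (\<lambda>p. h (fst p) (fst (snd p)) (snd (snd p)))"
 shows "pt a c (\<lambda>x. case f x of [] \<Rightarrow> g x | y # ys \<Rightarrow> h x y ys)"
proof -
 let ?e = "pr a (pr b (ls b))" and ?h = "\<lambda>p. h (fst p) (fst (snd p)) (snd (snd p))"
 obtain T C where f: "pbd T (\<lambda>x. size (a x))" "\<And>k s x. s k = a x \<Longrightarrow> runs (C k) s k (ls b (f x)) (T x)"
  by (rule ptE[OF assms(1)]) (rule that)
 obtain U D where g: "pbd U (\<lambda>x. size (a x))" "\<And>k s x. s k = a x \<Longrightarrow> runs (D k) s k (c (g x)) (U x)"
  by (rule ptE[OF assms(2)]) (rule that)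
 obtain W E where h: "pbd W (\<lambda>p. size (?e p))" "\<And>k s p. s k = ?e p \<Longrightarrow> runs (E k) s k (c (?h p)) (W p)"
  by (rule ptE[OF assms(3)]) (rule that)
 obtain d where d: "\<And>p. W p \<le> (size (?e p) + 2) ^ d" using h(1) unfolding pbd_def by blast
 obtain d' where d': "\<And>p. size (c (?h p)) \<le> (size (?e p) + 2) ^ d'" using pt_size[OF assms(3)] unfolding pbd_def by blast
 define S where "S x = size (a x) + size (ls b (f x)) + 1" for x
 have S: "pbd S (\<lambda>x. size (a x))" unfolding S_def by (intro pbd_add pt_size[OF assms(1)]) simp_all
 have se: "size (?e (x, y, ys)) = S x" if "f x = y # ys" for x y ys using that by (simp add: S_def)
 let ?Q = "\<lambda>k. Seq (Assign (k + 1) (Var k)) (Seq (C (k + 1)) (IfNode (Var (k + 1))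
   (Seq (Assign k (NodeE (Var k) (Var (k + 1)))) (E k)) (D k)))"
 show ?thesis
 proof (rule ptI[of _ _ _ "\<lambda>x. T x + (U x + (S x + 2) ^ d) + 3" ?Q])
  show "pbd (\<lambda>x. size (c (case f x of [] \<Rightarrow> g x | y # ys \<Rightarrow> h x y ys))) (\<lambda>x. size (a x))"
  proof (rule pbd_le[OF _ pbd_add[OF pt_size[OF assms(2)] pbd_power[OF S]]])
   show "size (c (case f x of [] \<Rightarrow> g x | y # ys \<Rightarrow> h x y ys)) \<le> size (c (g x)) + (S x + 2) ^ d'" for x
    using d'[of "(x, hd (f x), tl (f x))"] se[of x "hd (f x)" "tl (f x)"] by (cases "f x") auto
  qed
  show "pbd (\<lambda>x. T x + (U x + (S x + 2) ^ d) + 3) (\<lambda>x. size (a x))"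
   using f(1) g(1) S by (intro pbd_add pbd_power) auto
  fix k :: nat and s :: store and x assume k: "s k = a x"
  let ?s1 = "s(k + 1 := s k)"
  have e1: "exec (Assign (k + 1) (Var k)) s 1 ?s1" using exec.Assign[of "k + 1" "Var k" s] by simp
  have "?s1 (k + 1) = a x" using k by simp
  from f(2)[of ?s1 "k + 1" x, OF this] obtain t s2 where e2: "exec (C (k + 1)) ?s1 t s2" "t \<le> T x" "s2 (k + 1) = ls b (f x)" "\<And>j. j < k + 1 \<Longrightarrow> s2 j = ?s1 j"
   by (rule runsE) (rule that)
  have k2: "s2 k = a x" using e2(4)[of k] k by simp
  show "runs (?Q k) s k (c (case f x of [] \<Rightarrow> g x | y # ys \<Rightarrow> h x y ys)) (T x + (U x + (S x + 2) ^ d) + 3)"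
  proof (cases "f x")
   case Nil
   from g(2)[of s2 k x, OF k2] obtain u s3 where e3: "exec (D k) s2 u s3" "u \<le> U x" "s3 k = c (g x)" "\<And>j. j < k \<Longrightarrow> s3 j = s2 j"
    by (rule runsE) (rule that)
   have "exec (IfNode (Var (k + 1)) (Seq (Assign k (NodeE (Var k) (Var (k + 1)))) (E k)) (D k)) s2 (1 + u) s3"
    using Nil e2(3) by (intro exec.IfFalse e3(1)) simp
   then have "exec (?Q k) s (1 + (t + (1 + u))) s3" by (intro exec.Seq) (rule e1 e2(1) | assumption)+
   then show ?thesis unfolding runs_def using e2(2) e3(2-) e2(4) Nil
    by (intro exI[of _ "1 + (t + (1 + u))"] exI[of _ s3]) auto
  next
   case (Cons y ys)
   let ?s3 = "s2(k := Node (s2 k) (s2 (k + 1)))"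
   have e0: "exec (Assign k (NodeE (Var k) (Var (k + 1)))) s2 1 ?s3"
    using exec.Assign[of k "NodeE (Var k) (Var (k + 1))" s2] by simp
   have "?s3 k = ?e (x, y, ys)" using k2 e2(3) Cons by simp
   from h(2)[of ?s3 k "(x, y, ys)", OF this] obtain u s4 where e3: "exec (E k) ?s3 u s4" "u \<le> W (x, y, ys)" "s4 k = c (?h (x, y, ys))" "\<And>j. j < k \<Longrightarrow> s4 j = ?s3 j"
    by (rule runsE) (rule that)
   have "exec (IfNode (Var (k + 1)) (Seq (Assign k (NodeE (Var k) (Var (k + 1)))) (E k)) (D k)) s2 (1 + (1 + u)) s4"
    using Cons e2(3) by (intro exec.IfTrue exec.Seq[OF e0 e3(1)]) simp
   then have "exec (?Q k) s (1 + (t + (1 + (1 + u)))) s4" by (intro exec.Seq) (rule e1 e2(1) | assumption)+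
   moreover have "u \<le> (S x + 2) ^ d" using e3(2) d[of "(x, y, ys)"] se[OF Cons] by simp
   moreover have "s4 j = s j" if "j < k" for j using e3(4)[OF that] e2(4)[of j] that by simp
   ultimately show ?thesis unfolding runs_def using e2(2) e3(3) Cons
    by (intro exI[of _ "1 + (t + (1 + (1 + u)))"] exI[of _ s4]) auto
  qed
 qed
qed

lemma size_ls_elem: "y \<in> set xs \<Longrightarrow> size (b y) \<le> size (ls b xs)"
 by (induction xs) auto

lemma length_ls: "length xs \<le> size (ls b xs)"
 by (simp add: size_ls)

text \<open>Variable \<open>k\<close> holds the input, \<open>k + 1\<close> the rest of the list,
  \<open>k + 2\<close> the accumulator; \<open>k + 3\<close> is where the step function is
  evaluated.\<close>

definition fold_body :: "nat \<Rightarrow> com \<Rightarrow> com" where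
 "fold_body k E = Seq (Assign (k + 3) (NodeE (Var k) (NodeE (Left (Var (k + 1))) (Var (k + 2)))))
   (Seq E (Seq (Assign (k + 2) (Var (k + 3))) (Assign (k + 1) (Right (Var (k + 1))))))"

lemma fold_loop:
 assumes step: "\<And>s y z. s (k + 3) = (pr a (pr b c)) (x, y, z) \<Longrightarrow> runs E s (k + 3) (c (h y z)) (W y z)"
 shows "\<lbrakk>s k = a x; s (k + 1) = ls b ys; s (k + 2) = c z;
  \<And>n. n < length ys \<Longrightarrow> W (ys ! n) (fold h (take n ys) z) \<le> Tm\<rbrakk> \<Longrightarrow>
  \<exists>t s'. exec (WhileNode (Var (k + 1)) (fold_body k E)) s t s' \<and>
   t \<le> length ys * (Tm + 4) + 1 \<and> s' (k + 2) = c (fold h ys z) \<and> (\<forall>j\<le>k. s' j = s j)"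
proof (induction ys arbitrary: s z)
 case Nil
 then have "exec (WhileNode (Var (k + 1)) (fold_body k E)) s 1 s" by (intro exec.WhileFalse) simp
 then show ?case using Nil by (intro exI[of _ 1] exI[of _ s]) simp
next
 case (Cons y ys)
 let ?s1 = "s(k + 3 := Node (s k) (Node (b y) (s (k + 2))))"
 have e1: "exec (Assign (k + 3) (NodeE (Var k) (NodeE (Left (Var (k + 1))) (Var (k + 2))))) s 1 ?s1"
  using exec.Assign[of "k + 3" "NodeE (Var k) (NodeE (Left (Var (k + 1))) (Var (k + 2)))" s] Cons.prems(2) by simp
 have "?s1 (k + 3) = (pr a (pr b c)) (x, y, z)" using Cons.prems by simp
 from step[of ?s1, OF this] obtain t s2 where e2: "exec E ?s1 t s2" "t \<le> W y z" "s2 (k + 3) = c (h y z)" "\<And>j. j < k + 3 \<Longrightarrow> s2 j = ?s1 j"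
  by (rule runsE) (rule that)
 let ?s3 = "s2(k + 2 := s2 (k + 3))"
 have e3: "exec (Assign (k + 2) (Var (k + 3))) s2 1 ?s3" using exec.Assign[of "k + 2" "Var (k + 3)" s2] by simp
 let ?s4 = "?s3(k + 1 := right (?s3 (k + 1)))"
 have e4: "exec (Assign (k + 1) (Right (Var (k + 1)))) ?s3 1 ?s4"
  using exec.Assign[of "k + 1" "Right (Var (k + 1))" ?s3] by simp
 have b: "exec (fold_body k E) s (1 + (t + (1 + 1))) ?s4" unfolding fold_body_def by (intro exec.Seq) (rule e1 e2(1) e3 e4)+
 have "?s4 k = a x" "?s4 (k + 1) = ls b ys" "?s4 (k + 2) = c (h y z)"
  using e2(4)[of k] e2(4)[of "k + 1"] e2(3) Cons.prems by simp_all
 moreover have "W (ys ! n) (fold h (take n ys) (h y z)) \<le> Tm" if "n < length ys" for n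
  using Cons.prems(4)[of "Suc n"] that by simp
 ultimately obtain u s' where u: "exec (WhileNode (Var (k + 1)) (fold_body k E)) ?s4 u s'" "u \<le> length ys * (Tm + 4) + 1"
  "s' (k + 2) = c (fold h ys (h y z))" "\<forall>j\<le>k. s' j = ?s4 j" using Cons.IH[of ?s4 "h y z"] by blast
 have "exec (WhileNode (Var (k + 1)) (fold_body k E)) s (1 + (1 + (t + (1 + 1))) + u) s'"
  using Cons.prems(2) by (intro exec.WhileTrue[OF _ b u(1)]) simp
 moreover have "t \<le> Tm" using e2(2) Cons.prems(4)[of 0] by simp
 moreover have "s' j = s j" if "j \<le> k" for j using u(4) that e2(4)[of j] by simp
 ultimately show ?case using u(2,3) by (intro exI[of _ "1 + (1 + (t + (1 + 1))) + u"] exI[of _ s']) simp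
qed

text \<open>A polynomial-time step does not make the loop polynomial, since the accumulator could
  double in each round. Hence the bound \<open>Z\<close>, which has to cover the accumulator after
  every prefix of the list.\<close>

lemma pt_fold:
 assumes l: "pt a (ls b) l" and i: "pt a c i"
  and h: "pt (pr a (pr b c)) c (\<lambda>p. h (fst p) (fst (snd p)) (snd (snd p)))"
  and Z: "pbd Z (\<lambda>x. size (a x))" "\<And>x n. size (c (fold (h x) (take n (l x)) (i x))) \<le> Z x"
 shows "pt a c (\<lambda>x. fold (h x) (l x) (i x))"
proof -
 let ?e = "pr a (pr b c)" and ?h = "\<lambda>p. h (fst p) (fst (snd p)) (snd (snd p))"
 obtain T C where f: "pbd T (\<lambda>x. size (a x))" "\<And>k s x. s k = a x \<Longrightarrow> runs (C k) s k (ls b (l x)) (T x)"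
  by (rule ptE[OF l]) (rule that)
 obtain U D where g: "pbd U (\<lambda>x. size (a x))" "\<And>k s x. s k = a x \<Longrightarrow> runs (D k) s k (c (i x)) (U x)"
  by (rule ptE[OF i]) (rule that)
 obtain W E where hh: "pbd W (\<lambda>p. size (?e p))" "\<And>k s p. s k = ?e p \<Longrightarrow> runs (E k) s k (c (?h p)) (W p)"
  by (rule ptE[OF h]) (rule that)
 obtain d where d: "\<And>p. W p \<le> (size (?e p) + 2) ^ d" using hh(1) unfolding pbd_def by blast
 define S where "S x = size (a x) + size (ls b (l x)) + Z x + 2" for x
 define Tm where "Tm x = (S x + 2) ^ d" for x
 have S: "pbd S (\<lambda>x. size (a x))" unfolding S_def by (intro pbd_add pt_size[OF l] Z(1)) simp_all
 let ?Q = "\<lambda>k. Seq (Assign (k + 1) (Var k)) (Seq (C (k + 1)) (Seq (Assign (k + 2) (Var k)) (Seq (D (k + 2))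
  (Seq (WhileNode (Var (k + 1)) (fold_body k (E (k + 3))))
   (Assign k (Var (k + 2)))))))"
 let ?T = "\<lambda>x. T x + U x + size (ls b (l x)) * (Tm x + 4) + 4"
 show ?thesis
 proof (rule ptI[of _ _ _ ?T ?Q])
  show "pbd (\<lambda>x. size (c (fold (h x) (l x) (i x)))) (\<lambda>x. size (a x))"
  proof (rule pbd_le[OF _ Z(1)])
   show "size (c (fold (h x) (l x) (i x))) \<le> Z x" for x using Z(2)[of x "length (l x)"] by simp
  qed
  show "pbd ?T (\<lambda>x. size (a x))"
   unfolding Tm_def by (intro pbd_add pbd_mult pbd_power S f(1) g(1) pt_size[OF l]) simp_all
  fix k :: nat and s :: store and x assume k: "s k = a x"
  let ?s1 = "s(k + 1 := s k)"
  have e1: "exec (Assign (k + 1) (Var k)) s 1 ?s1" using exec.Assign[of "k + 1" "Var k" s] by simp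
  have "?s1 (k + 1) = a x" using k by simp
  from f(2)[of ?s1 "k + 1" x, OF this] obtain t s2 where e2: "exec (C (k + 1)) ?s1 t s2" "t \<le> T x" "s2 (k + 1) = ls b (l x)" "\<And>j. j < k + 1 \<Longrightarrow> s2 j = ?s1 j"
   by (rule runsE) (rule that)
  let ?s3 = "s2(k + 2 := s2 k)"
  have e3: "exec (Assign (k + 2) (Var k)) s2 1 ?s3" using exec.Assign[of "k + 2" "Var k" s2] by simp
  have "?s3 (k + 2) = a x" using e2(4)[of k] k by simp
  from g(2)[of ?s3 "k + 2" x, OF this] obtain u s4 where e4: "exec (D (k + 2)) ?s3 u s4" "u \<le> U x" "s4 (k + 2) = c (i x)" "\<And>j. j < k + 2 \<Longrightarrow> s4 j = ?s3 j"
   by (rule runsE) (rule that)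
  have s4: "s4 k = a x" "s4 (k + 1) = ls b (l x)" using e4(4)[of k] e4(4)[of "k + 1"] e2(3) e2(4)[of k] k by simp_all
  have step: "runs (E (k + 3)) s' (k + 3) (c (h x y z)) (W (x, y, z))" if "s' (k + 3) = ?e (x, y, z)" for s' y z
   using hh(2)[of s' "k + 3" "(x, y, z)", OF that] by simp
  have bound: "W (x, l x ! n, fold (h x) (take n (l x)) (i x)) \<le> Tm x" if "n < length (l x)" for n
  proof -
   let ?p = "(x, l x ! n, fold (h x) (take n (l x)) (i x))"
   have "size (?e ?p) \<le> S x"
    using size_ls_elem[of "l x ! n" "l x" b] that Z(2)[of x n] by (simp add: S_def)
   then have "(size (?e ?p) + 2) ^ d \<le> Tm x" unfolding Tm_def by (intro power_mono) simp_all
   then show ?thesis using d[of ?p] by linarith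
  qed
  obtain v s5 where e5: "exec (WhileNode (Var (k + 1)) (fold_body k (E (k + 3)))) s4 v s5"
    "v \<le> length (l x) * (Tm x + 4) + 1" "s5 (k + 2) = c (fold (h x) (l x) (i x))" "\<And>j. j \<le> k \<Longrightarrow> s5 j = s4 j"
   using fold_loop[of k a b c x "E (k + 3)" "h x" "\<lambda>y z. W (x, y, z)" s4 "l x" "i x" "Tm x", OF step s4 e4(3) bound] by blast
  let ?s6 = "s5(k := s5 (k + 2))"
  have e6: "exec (Assign k (Var (k + 2))) s5 1 ?s6" using exec.Assign[of k "Var (k + 2)" s5] by simp
  have "exec (?Q k) s (1 + (t + (1 + (u + (v + 1))))) ?s6"
   by (intro exec.Seq) (rule e1 e2(1) e3 e4(1) e5(1) e6)+
  moreover have "v \<le> size (ls b (l x)) * (Tm x + 4) + 1"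
   using e5(2) mult_right_mono[OF length_ls[of "l x" b], of "Tm x + 4"] by linarith
  moreover have "?s6 j = s j" if "j < k" for j using e5(4)[of j] e4(4)[of j] e2(4)[of j] that by simp
  ultimately show "runs (?Q k) s k (c (fold (h x) (l x) (i x))) (?T x)"
   unfolding runs_def using e2(2) e4(2) e5(3) by (intro exI[of _ "1 + (t + (1 + (u + (v + 1))))"] exI[of _ ?s6]) auto
 qed
qed

section \<open>Rules for Boolean and list functions\<close>

named_theorems pt_intros

lemmas [pt_intros] = pt_id pt_fst pt_snd pt_pair pt_cons pt_if pt_null

lemma pt_True [pt_intros]: "pt a b (\<lambda>x. True)" by (rule pt_const)
lemma pt_False [pt_intros]: "pt a b (\<lambda>x. False)" by (rule pt_const)
lemma pt_Nil [pt_intros]: "pt a b (\<lambda>x. [])" by (rule pt_const)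
lemma pt_zero [pt_intros]: "pt a b (\<lambda>x. 0)" by (rule pt_const)
lemma pt_one [pt_intros]: "pt a b (\<lambda>x. 1)" by (rule pt_const)
lemma pt_numeral [pt_intros]: "pt a b (\<lambda>x. numeral n)" by (rule pt_const)
lemma pt_unit [pt_intros]: "pt a b (\<lambda>x. ())" by (rule pt_const)

lemma pt_not [pt_intros]: "pt a bl P \<Longrightarrow> pt a bl (\<lambda>x. \<not> P x)"
 by (drule pt_if[OF _ pt_False[of a bl] pt_True]) (simp add: if_bool_eq_disj)

lemma pt_conj [pt_intros]: "pt a bl P \<Longrightarrow> pt a bl Q \<Longrightarrow> pt a bl (\<lambda>x. P x \<and> Q x)"
 by (drule (1) pt_if[OF _ _ pt_False]) (simp add: if_bool_eq_disj)

lemma pt_disj [pt_intros]: "pt a bl P \<Longrightarrow> pt a bl Q \<Longrightarrow> pt a bl (\<lambda>x. P x \<or> Q x)"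
 using pt_not[OF pt_conj[OF pt_not pt_not], of a P Q] by simp

lemma size_bl: "size (bl b) \<le> 1" by (simp add: enc_bool_def)

lemma size_ls_append: "size (ls b (xs @ ys)) = size (ls b xs) + size (ls b ys)"
 by (induction xs) auto

lemma size_ls_take: "size (ls b (take n xs)) \<le> size (ls b xs)"
 using size_ls_append[of b "take n xs" "drop n xs"] by simp

lemma size_ls_rev: "size (ls b (rev xs)) = size (ls b xs)"
 by (induction xs) (auto simp: size_ls_append)

lemma size_ls_filter: "size (ls b (filter P xs)) \<le> size (ls b xs)"
 by (induction xs) auto

lemma size_ls_concat: "size (ls b (concat xs)) \<le> size (ls (ls b) xs)"
 by (induction xs) (auto simp: size_ls_append)

lemma size_ls_bound: "(\<And>y. y \<in> set ys \<Longrightarrow> size (b y) \<le> K) \<Longrightarrow> size (ls b ys) \<le> length ys * (K + 1)"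
proof (induction ys)
 case (Cons y ys)
 then have "size (ls b ys) \<le> length ys * (K + 1)" "size (b y) \<le> K" by simp_all
 then show ?case by simp
qed simp

lemma pt_rev [pt_intros]: "pt a (ls b) f \<Longrightarrow> pt a (ls b) (\<lambda>x. rev (f x))"
proof -
 assume f: "pt a (ls b) f"
 have "pt (ls b) (ls b) (\<lambda>xs. fold (\<lambda>y z. y # z) xs [])"
 proof (rule pt_fold[of "ls b" b _ "ls b" _ _ "\<lambda>xs. size (ls b xs)"])
  show "size (ls b (fold (\<lambda>y z. y # z) (take n x) [])) \<le> size (ls b x)" for x n
   using size_ls_take[of b n x] by (simp add: fold_Cons_rev size_ls_rev)
 qed (rule pt_intros pbd_refl)+
 then have "pt (ls b) (ls b) rev" by (simp add: fold_Cons_rev)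
 from pt_comp[OF this f] show ?thesis .
qed

lemma rev_map_fold: "fold (\<lambda>y z. g y # z) xs acc = rev (map g xs) @ acc"
 by (induction xs arbitrary: acc) auto

lemma pt_map [pt_intros]:
 assumes f: "pt a (ls b) f" and g: "pt (pr a b) c (\<lambda>p. g (fst p) (snd p))"
 shows "pt a (ls c) (\<lambda>x. map (g x) (f x))"
proof -
 obtain d where d: "\<And>p. size (c (g (fst p) (snd p))) \<le> (size ((pr a b) p) + 2) ^ d"
  using pt_size[OF g] unfolding pbd_def by blast
 define S where "S x = size (a x) + size (ls b (f x)) + 1" for x
 have S: "pbd S (\<lambda>x. size (a x))" unfolding S_def by (intro pbd_add pt_size[OF f]) simp_all
 have el: "size (c (g x y)) \<le> (S x + 2) ^ d" if "y \<in> set (f x)" for x y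
 proof -
  have "size ((pr a b) (x, y)) \<le> S x" using size_ls_elem[OF that, of b] by (simp add: S_def)
  then have "(size ((pr a b) (x, y)) + 2) ^ d \<le> (S x + 2) ^ d" by (intro power_mono) simp_all
  then show ?thesis using d[of "(x, y)"] by simp
 qed
 have "pt a (ls c) (\<lambda>x. fold (\<lambda>y z. g x y # z) (f x) [])"
 proof (rule pt_fold[OF f, of _ _ _ "\<lambda>x. length (f x) * ((S x + 2) ^ d + 1)"])
  show "pt a (ls c) (\<lambda>x. [])" by (rule pt_const)
  have "pt (pr a (pr b (ls c))) (pr a b) (\<lambda>p. (fst p, fst (snd p)))" by (rule pt_intros)+
  from pt_comp[OF g this] have g': "pt (pr a (pr b (ls c))) c (\<lambda>p. g (fst p) (fst (snd p)))" by simp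
  show "pt (pr a (pr b (ls c))) (ls c) (\<lambda>p. g (fst p) (fst (snd p)) # snd (snd p))"
   by (rule pt_intros g')+
  show "pbd (\<lambda>x. length (f x) * ((S x + 2) ^ d + 1)) (\<lambda>x. size (a x))"
   by (rule pbd_le[OF _ pbd_mult[OF pt_size[OF f] pbd_add[OF pbd_power[OF S, of d] pbd_const[of 1]]]])
    (rule mult_right_mono[OF length_ls], simp)
  fix x n
  have "size (ls c (fold (\<lambda>y z. g x y # z) (take n (f x)) [])) = size (ls c (map (g x) (take n (f x))))"
   by (simp add: rev_map_fold size_ls_rev)
  also have "\<dots> \<le> size (ls c (map (g x) (f x)))" unfolding take_map[symmetric] by (rule size_ls_take)
  also have "\<dots> \<le> length (map (g x) (f x)) * ((S x + 2) ^ d + 1)"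
   by (rule size_ls_bound) (use el in auto)
  finally show "size (ls c (fold (\<lambda>y z. g x y # z) (take n (f x)) [])) \<le> length (f x) * ((S x + 2) ^ d + 1)" by simp
 qed
 then have "pt a (ls c) (\<lambda>x. rev (map (g x) (f x)))" by (simp add: rev_map_fold)
 from pt_rev[OF this] show ?thesis by simp
qed

lemma rev_filter_fold: "fold (\<lambda>y z. if P y then y # z else z) xs acc = rev (filter P xs) @ acc"
 by (induction xs arbitrary: acc) auto

lemma pt_filter [pt_intros]:
 assumes f: "pt a (ls b) f" and P: "pt (pr a b) bl (\<lambda>p. P (fst p) (snd p))"
 shows "pt a (ls b) (\<lambda>x. filter (P x) (f x))"
proof -
 have "pt a (ls b) (\<lambda>x. fold (\<lambda>y z. if P x y then y # z else z) (f x) [])"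
 proof (rule pt_fold[OF f, of _ _ _ "\<lambda>x. size (ls b (f x))"])
  show "pt a (ls b) (\<lambda>x. [])" by (rule pt_const)
  have "pt (pr a (pr b (ls b))) (pr a b) (\<lambda>p. (fst p, fst (snd p)))" by (rule pt_intros)+
  from pt_comp[OF P this] have g': "pt (pr a (pr b (ls b))) bl (\<lambda>p. P (fst p) (fst (snd p)))" by simp
  show "pt (pr a (pr b (ls b))) (ls b)
    (\<lambda>p. if P (fst p) (fst (snd p)) then fst (snd p) # snd (snd p) else snd (snd p))"
   by (rule pt_intros g')+
  fix x n
  have "size (ls b (fold (\<lambda>y z. if P x y then y # z else z) (take n (f x)) [])) = size (ls b (filter (P x) (take n (f x))))"
   by (simp add: rev_filter_fold size_ls_rev)
  also have "\<dots> \<le> size (ls b (f x))" using size_ls_filter size_ls_take le_trans by blast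
  finally show "size (ls b (fold (\<lambda>y z. if P x y then y # z else z) (take n (f x)) [])) \<le> size (ls b (f x))" .
 qed (rule pt_size[OF f])
 then have "pt a (ls b) (\<lambda>x. rev (filter (P x) (f x)))" by (simp add: rev_filter_fold)
 from pt_rev[OF this] show ?thesis by simp
qed

lemma pt_append [pt_intros]:
 assumes "pt a (ls b) f" "pt a (ls b) g" shows "pt a (ls b) (\<lambda>x. f x @ g x)"
proof -
 have "pt a (ls b) (\<lambda>x. fold (\<lambda>y z. y # z) (rev (f x)) (g x))"
 proof (rule pt_fold[OF pt_rev[OF assms(1)] assms(2), of _ "\<lambda>x. size (ls b (f x)) + size (ls b (g x))"])
  show "size (ls b (fold (\<lambda>y z. y # z) (take n (rev (f x))) (g x))) \<le> size (ls b (f x)) + size (ls b (g x))" for x n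
   using size_ls_take[of b n "rev (f x)"] by (simp add: size_ls_rev size_ls_append fold_Cons_rev)
 qed (rule pt_intros pbd_add pt_size assms)+
 then show ?thesis by (simp add: fold_Cons_rev)
qed

lemma pt_concat [pt_intros]:
 assumes f: "pt a (ls (ls b)) f" shows "pt a (ls b) (\<lambda>x. concat (f x))"
proof -
 have e: "fold (\<lambda>y z. z @ y) xs acc = acc @ concat xs" for xs :: "'b list list" and acc
  by (induction xs arbitrary: acc) auto
 have "pt a (ls b) (\<lambda>x. fold (\<lambda>y z. z @ y) (f x) [])"
 proof (rule pt_fold[OF f, of _ _ _ "\<lambda>x. size (ls (ls b) (f x))"])
  show "size (ls b (fold (\<lambda>y z. z @ y) (take n (f x)) [])) \<le> size (ls (ls b) (f x))" for x n
   using size_ls_take[of "ls b" n "f x"] size_ls_concat[of b "take n (f x)"] by (simp add: e)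
 qed (rule pt_intros pt_size f)+
 then show ?thesis by (simp add: e)
qed

lemma pt_ex [pt_intros]:
 assumes f: "pt a (ls b) f" and P: "pt (pr a b) bl (\<lambda>p. P (fst p) (snd p))"
 shows "pt a bl (\<lambda>x. \<exists>y\<in>set (f x). P x y)"
proof -
 have "pt a bl (\<lambda>x. filter (P x) (f x) \<noteq> [])" by (rule pt_not[OF pt_null[OF pt_filter[OF f P]]])
 then show ?thesis by (simp add: filter_empty_conv)
qed

lemma pt_all [pt_intros]:
 assumes f: "pt a (ls b) f" and P: "pt (pr a b) bl (\<lambda>p. P (fst p) (snd p))"
 shows "pt a bl (\<lambda>x. \<forall>y\<in>set (f x). P x y)"
 using pt_not[OF pt_ex[OF f pt_not[OF P]]] by simp

text \<open>Coordinates and indices are polynomially bounded, so arithmetic can be carried out in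
  unary. Binary numerals are produced only for the points that are handed to the solver.\<close>

definition un :: "nat \<Rightarrow> tree" where "un n = ls (\<lambda>_::unit. Leaf) (replicate n ())"

lemma un_simps [simp]: "un 0 = Leaf" "un (Suc n) = Node Leaf (un n)"
 by (simp_all add: un_def)

lemma size_un [simp]: "size (un n) = n" by (induction n) auto

lemma inj_un: "inj un" by (rule injI) (metis size_un)

lemma pt_replicate: "pt a un f \<Longrightarrow> pt a (ls (\<lambda>_. Leaf)) (\<lambda>x. replicate (f x) ())"
 by (erule pt_recode) (simp add: un_def)

lemma pt_Suc [pt_intros]: "pt a un f \<Longrightarrow> pt a un (\<lambda>x. Suc (f x))"
 by (rule pt_recode[OF pt_cons[OF pt_unit pt_replicate]]) (simp_all add: un_def)

lemma pt_length [pt_intros]: "pt a (ls b) f \<Longrightarrow> pt a un (\<lambda>x. length (f x))"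
proof -
 assume f: "pt a (ls b) f"
 have e: "map (\<lambda>_. ()) xs = replicate (length xs) ()" for xs :: "'b list" by (rule map_replicate_const)
 have "pt a (ls (\<lambda>_::unit. Leaf)) (\<lambda>x. map (\<lambda>_. ()) (f x))" by (intro pt_map[OF f] pt_const)
 then show ?thesis by (rule pt_recode) (simp add: un_def map_replicate_const)
qed

lemma pt_funpow:
 assumes n: "pt a un n" and i: "pt a c i" and g: "pt (pr a c) c (\<lambda>p. g (fst p) (snd p))"
  and Z: "pbd Z (\<lambda>x. size (a x))" "\<And>x m. m \<le> n x \<Longrightarrow> size (c ((g x ^^ m) (i x))) \<le> Z x"
 shows "pt a c (\<lambda>x. (g x ^^ n x) (i x))"
proof -
 have e: "fold (\<lambda>_. h) (replicate m ()) z = (h ^^ m) z" for h :: "'b \<Rightarrow> 'b" and m z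
  by (induction m arbitrary: z) (auto simp: funpow_swap1)
 have "pt a c (\<lambda>x. fold (\<lambda>_. g x) (replicate (n x) ()) (i x))"
 proof (rule pt_fold[OF pt_replicate[OF n] i _ Z(1)])
  have "pt (pr a (pr (\<lambda>_::unit. Leaf) c)) (pr a c) (\<lambda>p. (fst p, snd (snd p)))" by (rule pt_intros)+
  from pt_comp[OF g this] show "pt (pr a (pr (\<lambda>_::unit. Leaf) c)) c (\<lambda>p. g (fst p) (snd (snd p)))" by simp
  show "size (c (fold (\<lambda>_. g x) (take m (replicate (n x) ())) (i x))) \<le> Z x" for x m
   using Z(2)[of "min (n x) m" x] by (simp add: e min.commute)
 qed
 then show ?thesis by (simp add: e)
qed

lemma pt_plus [pt_intros]: "pt a un f \<Longrightarrow> pt a un g \<Longrightarrow> pt a un (\<lambda>x. f x + g x)"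
proof (rule pt_recode[OF pt_append[OF pt_replicate pt_replicate]])
 show "ls (\<lambda>_. Leaf) (replicate (f x) () @ replicate (g x) ()) = un (f x + g x)" for x
  unfolding un_def replicate_add ..
qed

lemma pt_pred: "pt a un f \<Longrightarrow> pt a un (\<lambda>x. f x - 1)"
proof -
 assume f: "pt a un f"
 have "pt a (ls (\<lambda>_. Leaf)) (\<lambda>x. case replicate (f x) () of [] \<Rightarrow> [] | y # ys \<Rightarrow> ys)"
  by (rule pt_case[OF pt_replicate[OF f]]) (rule pt_intros)+
 then show ?thesis by (rule pt_recode) (simp add: un_def, case_tac "f x", simp_all)
qed

lemma pt_minus [pt_intros]: "pt a un f \<Longrightarrow> pt a un g \<Longrightarrow> pt a un (\<lambda>x. f x - g x)"
proof -
 assume f: "pt a un f" and g: "pt a un g"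
 have e: "((\<lambda>k. k - 1) ^^ m) n = n - m" for m n :: nat
  by (induction m) auto
 have "pt a un (\<lambda>x. ((\<lambda>k. k - 1) ^^ g x) (f x))"
 proof (rule pt_funpow[OF g f _ pt_size[OF f]])
  show "pt (pr a un) un (\<lambda>p. snd p - 1)" by (rule pt_pred pt_intros)+
  show "size (un (((\<lambda>k. k - 1) ^^ m) (f x))) \<le> size (un (f x))" for x m unfolding e by simp
 qed
 then show ?thesis unfolding e .
qed

lemma pt_le [pt_intros]: "pt a un f \<Longrightarrow> pt a un g \<Longrightarrow> pt a bl (\<lambda>x. f x \<le> g x)"
proof -
 assume "pt a un f" "pt a un g"
 then have "pt a bl (\<lambda>x. replicate (f x - g x) () = [])"
  by (intro pt_null[OF pt_replicate] pt_minus)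
 then show ?thesis by simp
qed

lemma pt_less [pt_intros]: "pt a un f \<Longrightarrow> pt a un g \<Longrightarrow> pt a bl (\<lambda>x. f x < g x)"
 using pt_le[OF pt_Suc, of a f g] by (simp add: Suc_le_eq)

lemma pt_times [pt_intros]: "pt a un f \<Longrightarrow> pt a un g \<Longrightarrow> pt a un (\<lambda>x. f x * g x)"
proof -
 assume f: "pt a un f" and g: "pt a un g"
 have e: "((+) n ^^ m) 0 = m * n" for m n :: nat by (induction m) auto
 have "pt a un (\<lambda>x. ((+) (g x) ^^ f x) 0)"
 proof (rule pt_funpow[OF f _ _ pbd_mult[OF pt_size[OF f] pt_size[OF g]]])
  have g': "pt (pr a un) un (\<lambda>p. g (fst p))" by (rule pt_comp[OF g]) (rule pt_intros)+
  show "pt (pr a un) un (\<lambda>p. g (fst p) + snd p)" by (rule pt_intros g')+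
  show "size (un (((+) (g x) ^^ m) 0)) \<le> size (un (f x)) * size (un (g x))" if "m \<le> f x" for x m
   using that by (simp add: e)
 qed (rule pt_const)
 then show ?thesis by (simp add: e)
qed

lemma enumerate_fold:
 "fold (\<lambda>y z. (Suc (fst z), (fst z, y) # snd z)) xs (n, acc) = (n + length xs, rev (List.enumerate n xs) @ acc)"
 by (induction xs arbitrary: n acc) auto

lemma pt_enumerate [pt_intros]:
 assumes f: "pt a (ls b) f" shows "pt a (ls (pr un b)) (\<lambda>x. List.enumerate 0 (f x))"
proof -
 let ?Z = "\<lambda>x. size (ls b (f x)) + size (ls b (f x)) * (size (ls b (f x)) + size (ls b (f x)) + 2) + 1"
 have "pt a (pr un (ls (pr un b))) (\<lambda>x. fold (\<lambda>y z. (Suc (fst z), (fst z, y) # snd z)) (f x) (0, []))"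
 proof (rule pt_fold[OF f, of _ _ _ ?Z])
  show "pbd ?Z (\<lambda>x. size (a x))" by (intro pbd_add pbd_mult pt_size f pbd_const)
  fix x n
  let ?t = "take n (f x)"
  have "size (ls (pr un b) (List.enumerate 0 ?t)) \<le> length (List.enumerate 0 ?t) * (size (ls b (f x)) + size (ls b (f x)) + 1 + 1)"
  proof (rule size_ls_bound)
   fix y assume "y \<in> set (List.enumerate 0 ?t)"
   then obtain m z where y: "y = (m, z)" "m < length ?t" "z \<in> set ?t"
    by (auto simp: in_set_enumerate_eq) (metis nth_mem prod.collapse length_take min_less_iff_conj nth_take)
   have "m \<le> size (ls b (f x))" using y(2) length_ls[of "f x" b] by simp
   moreover have "size (b z) \<le> size (ls b (f x))" using size_ls_elem[of z "f x" b] y(3) by (blast dest: in_set_takeD)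
   ultimately show "size ((pr un b) y) \<le> size (ls b (f x)) + size (ls b (f x)) + 1" by (simp add: y)
  qed
  also have "\<dots> \<le> size (ls b (f x)) * (size (ls b (f x)) + size (ls b (f x)) + 1 + 1)"
   using length_ls[of "f x" b] by (intro mult_right_mono) simp_all
  finally show "size ((pr un (ls (pr un b))) (fold (\<lambda>y z. (Suc (fst z), (fst z, y) # snd z)) ?t (0, []))) \<le> ?Z x"
   using length_ls[of "f x" b] by (simp add: enumerate_fold size_ls_rev)
 qed (rule pt_intros)+
 from pt_rev[OF pt_snd[OF this]] show ?thesis by (simp add: enumerate_fold)
qed

lemma pt_upt [pt_intros]: "pt a un f \<Longrightarrow> pt a (ls un) (\<lambda>x. [0..<f x])"
proof -
 assume f: "pt a un f"
 have "pt a (ls un) (\<lambda>x. map fst (List.enumerate 0 (replicate (f x) ())))" by (rule pt_intros pt_replicate f)+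
 then show ?thesis by (simp add: enumerate_eq_zip)
qed

lemma pt_take [pt_intros]:
 assumes n: "pt a un n" and f: "pt a (ls b) f" shows "pt a (ls b) (\<lambda>x. take (n x) (f x))"
proof -
 have e: "map snd (filter (\<lambda>p. fst p < m) (List.enumerate k xs)) = take (m - k) xs" for m k and xs :: "'b list"
  by (induction xs arbitrary: k) (auto simp: take_Cons' Suc_diff_Suc)
 have n': "pt (pr a (pr un b)) un (\<lambda>p. n (fst p))" by (rule pt_comp[OF n]) (rule pt_intros)+
 have "pt a (ls b) (\<lambda>x. map snd (filter (\<lambda>p. fst p < n x) (List.enumerate 0 (f x))))" by (rule pt_intros f n')+
 then show ?thesis by (simp add: e)
qed

text \<open>Indexing with a default value: a program yields an output on every input, and this
  version of indexing is specified outside the list as well.\<close>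

definition nthd :: "'a \<Rightarrow> 'a list \<Rightarrow> nat \<Rightarrow> 'a" where
 "nthd d xs i = (case drop i xs of [] \<Rightarrow> d | y # ys \<Rightarrow> y)"

lemma nthd: "i < length xs \<Longrightarrow> nthd d xs i = xs ! i"
 by (simp add: nthd_def Cons_nth_drop_Suc[symmetric])

lemma pt_nthd [pt_intros]:
 assumes d: "pt a b d" and f: "pt a (ls b) f" and n: "pt a un n"
 shows "pt a b (\<lambda>x. nthd (d x) (f x) (n x))"
proof -
 have e: "((\<lambda>xs. case xs of [] \<Rightarrow> [] | y # ys \<Rightarrow> ys) ^^ m) xs = drop m xs" for m and xs :: "'b list"
  by (induction m arbitrary: xs) (auto simp: funpow_swap1 drop_Suc split: list.split simp del: funpow.simps(2) simp: funpow_Suc_right)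
 have "pt a (ls b) (\<lambda>x. ((\<lambda>xs. case xs of [] \<Rightarrow> [] | y # ys \<Rightarrow> ys) ^^ n x) (f x))"
 proof (rule pt_funpow[OF n f _ pt_size[OF f]])
  show "pt (pr a (ls b)) (ls b) (\<lambda>p. case snd p of [] \<Rightarrow> [] | y # ys \<Rightarrow> ys)"
   by (rule pt_case) (rule pt_intros)+
  show "size (ls b (((\<lambda>xs. case xs of [] \<Rightarrow> [] | y # ys \<Rightarrow> ys) ^^ m) (f x))) \<le> size (ls b (f x))" for x m
   unfolding e using size_ls_append[of b "take m (f x)" "drop m (f x)"] by simp
 qed
 then have "pt a (ls b) (\<lambda>x. drop (n x) (f x))" unfolding e .
 then show ?thesis unfolding nthd_def by (rule pt_case[OF _ d]) (rule pt_intros)+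
qed

text \<open>The language has no recursion, so two trees are compared through a worklist of pairs of
  subtrees in variable \<open>k + 1\<close>; variable \<open>k\<close> holds the verdict. A mismatch
  empties the worklist and thereby ends the loop.\<close>

definition treq_body :: "nat \<Rightarrow> com" where
 "treq_body k = (let v = Var (k + 2) in Seq (Assign (k + 2) (Left (Var (k + 1))))
  (Seq (Assign (k + 1) (Right (Var (k + 1))))
  (IfNode (Left v)
   (IfNode (Right v)
    (Assign (k + 1) (NodeE (NodeE (Left (Left v)) (Left (Right v))) (NodeE (NodeE (Right (Left v)) (Right (Right v))) (Var (k + 1)))))
    (Seq (Assign k LeafE) (Assign (k + 1) LeafE)))
   (IfNode (Right v)
    (Seq (Assign k LeafE) (Assign (k + 1) LeafE))
    (Assign k (Var k))))))"

text \<open>The factor 2 in the measure pays for splitting a pair of nodes with left subtrees of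
  sizes summing up as usual: \<open>2 * (a + b + 1) + 1\<close> exceeds the sum of
  \<open>2 * a + 1\<close> and \<open>2 * b + 1\<close> by one. Each round costs at most 6 steps for
  the body and one for the test.\<close>

lemma treq_loop:
 "s k = bl True \<Longrightarrow> s (k + 1) = ls (pr (\<lambda>t. t) (\<lambda>t. t)) ps \<Longrightarrow>
  \<exists>t s'. exec (WhileNode (Var (k + 1)) (treq_body k)) s t s' \<and> t \<le> 7 * (\<Sum>p\<leftarrow>ps. 2 * size (fst p) + 1) + 1 \<and>
   s' k = bl (\<forall>p\<in>set ps. fst p = snd p) \<and> (\<forall>j<k. s' j = s j)"
proof (induction "\<Sum>p\<leftarrow>ps. 2 * size (fst p) + 1" arbitrary: ps s rule: less_induct)
 case less
 let ?W = "WhileNode (Var (k + 1)) (treq_body k)" and ?e = "pr (\<lambda>t. t) (\<lambda>t. t)"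
 show ?case
 proof (cases ps)
  case Nil
  then have "exec ?W s 1 s" using less.prems by (intro exec.WhileFalse) simp
  then show ?thesis using Nil less.prems by (intro exI[of _ 1] exI[of _ s]) simp
 next
  case (Cons pq qs)
  obtain p q where pq: "pq = (p, q)" by (cases pq)
  let ?s1 = "s(k + 2 := Node p q)"
  have e1: "exec (Assign (k + 2) (Left (Var (k + 1)))) s 1 ?s1"
   using exec.Assign[of "k + 2" "Left (Var (k + 1))" s] less.prems(2) by (simp add: Cons pq)
  let ?s2 = "?s1(k + 1 := ls ?e qs)"
  have e2: "exec (Assign (k + 1) (Right (Var (k + 1)))) ?s1 1 ?s2"
   using exec.Assign[of "k + 1" "Right (Var (k + 1))" ?s1] less.prems(2) by (simp add: Cons pq)
  have n: "eval_expr (Var (k + 1)) s \<noteq> Leaf" using less.prems(2) by (simp add: Cons)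
  have fail: ?thesis if "p \<noteq> q" and ex: "exec (treq_body k) s (1 + (1 + (1 + (1 + (1 + 1))))) (?s2(k := Leaf, k + 1 := Leaf))"
  proof -
   let ?s3 = "?s2(k := Leaf, k + 1 := Leaf)"
   have "exec ?W ?s3 1 ?s3" by (intro exec.WhileFalse) simp
   note w = exec.WhileTrue[OF n ex this]
   show ?thesis
   proof (intro exI conjI, rule w)
    show "1 + (1 + (1 + (1 + (1 + (1 + 1))))) + 1 \<le> 7 * (\<Sum>p\<leftarrow>ps. 2 * size (fst p) + 1) + 1" by (simp add: Cons)
   qed (use that(1) in \<open>auto simp: Cons pq enc_bool_def\<close>)
  qed
  have go: ?thesis if ex: "exec (treq_body k) s u s3" "u \<le> 6" "s3 k = bl True" "s3 (k + 1) = ls ?e rs"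
   "(\<Sum>p\<leftarrow>rs. 2 * size (fst p) + 1) < (\<Sum>p\<leftarrow>ps. 2 * size (fst p) + 1)"
   "(\<forall>p\<in>set rs. fst p = snd p) \<longleftrightarrow> (\<forall>p\<in>set ps. fst p = snd p)" "\<forall>j<k. s3 j = s j" for s3 u rs
  proof -
   obtain t s' where ih: "exec ?W s3 t s'" "t \<le> 7 * (\<Sum>p\<leftarrow>rs. 2 * size (fst p) + 1) + 1"
    "s' k = bl (\<forall>p\<in>set rs. fst p = snd p)" "\<forall>j<k. s' j = s3 j"
    using less.hyps[OF ex(5,3,4)] by blast
   have "exec ?W s (1 + u + t) s'" by (rule exec.WhileTrue[OF n ex(1) ih(1)])
   moreover have "1 + u + t \<le> 7 * (\<Sum>p\<leftarrow>ps. 2 * size (fst p) + 1) + 1" using ex(2,5) ih(2) by linarith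
   ultimately show ?thesis using ih(3,4) ex(6,7) by (intro exI[of _ "1 + u + t"] exI[of _ s']) simp
  qed
  have bf: "exec (Seq (Assign k LeafE) (Assign (k + 1) LeafE)) ?s2 (1 + 1) (?s2(k := Leaf, k + 1 := Leaf))"
   using exec.Seq[OF exec.Assign[of k LeafE ?s2] exec.Assign[of "k + 1" LeafE]] by simp
  have body: "exec (treq_body k) s (1 + (1 + u)) s3"
   if "exec (IfNode (Left (Var (k + 2)))
   (IfNode (Right (Var (k + 2)))
    (Assign (k + 1) (NodeE (NodeE (Left (Left (Var (k + 2)))) (Left (Right (Var (k + 2))))) (NodeE (NodeE (Right (Left (Var (k + 2)))) (Right (Right (Var (k + 2))))) (Var (k + 1)))))
    (Seq (Assign k LeafE) (Assign (k + 1) LeafE)))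
   (IfNode (Right (Var (k + 2)))
    (Seq (Assign k LeafE) (Assign (k + 1) LeafE))
    (Assign k (Var k)))) ?s2 u s3" for u s3
   unfolding treq_body_def Let_def by (rule exec.Seq[OF e1 exec.Seq[OF e2 that]])
  show ?thesis
  proof (cases p)
   case Leaf
   show ?thesis
   proof (cases q)
    case Leaf
    have "exec (Assign k (Var k)) ?s2 1 ?s2" using exec.Assign[of k "Var k" ?s2] by (simp only: eval_expr.simps fun_upd_triv)
    from body[OF exec.IfFalse[OF _ exec.IfFalse[OF _ this]]]
    have ex: "exec (treq_body k) s (1 + (1 + (1 + (1 + 1)))) ?s2" using Leaf \<open>p = Leaf\<close> by simp
    show ?thesis
     by (rule go[OF ex, of qs]) (use less.prems in \<open>simp_all add: Cons pq Leaf \<open>p = Leaf\<close>\<close>)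
   next
    case (Node q1 q2)
    from body[OF exec.IfFalse[OF _ exec.IfTrue[OF _ bf]]] show ?thesis
     using Node \<open>p = Leaf\<close> by (intro fail) simp_all
   qed
  next
   case (Node p1 p2)
   show ?thesis
   proof (cases q)
    case Leaf
    from body[OF exec.IfTrue[OF _ exec.IfFalse[OF _ bf]]] show ?thesis
     using Leaf Node by (intro fail) simp_all
   next
    case (Node q1 q2)
    let ?s3 = "?s2(k + 1 := ls ?e ((p1, q1) # (p2, q2) # qs))"
    have "exec (Assign (k + 1) (NodeE (NodeE (Left (Left (Var (k + 2)))) (Left (Right (Var (k + 2))))) (NodeE (NodeE (Right (Left (Var (k + 2)))) (Right (Right (Var (k + 2))))) (Var (k + 1))))) ?s2 1 ?s3"
     using exec.Assign[of "k + 1" "NodeE (NodeE (Left (Left (Var (k + 2)))) (Left (Right (Var (k + 2))))) (NodeE (NodeE (Right (Left (Var (k + 2)))) (Right (Right (Var (k + 2))))) (Var (k + 1)))" ?s2]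
     by (simp add: Node \<open>p = Node p1 p2\<close>)
    from body[OF exec.IfTrue[OF _ exec.IfTrue[OF _ this]]]
    have ex: "exec (treq_body k) s (1 + (1 + (1 + (1 + 1)))) ?s3" using Node \<open>p = Node p1 p2\<close> by simp
    show ?thesis
     by (rule go[OF ex, of "(p1, q1) # (p2, q2) # qs"])
      (use less.prems in \<open>auto simp: Cons pq Node \<open>p = Node p1 p2\<close>\<close>)
   qed
  qed
 qed
qed

lemma pt_tree_eq: "pt (pr (\<lambda>t. t) (\<lambda>t. t)) bl (\<lambda>p. fst p = snd p)"
proof (rule ptI[of _ _ _ "\<lambda>p. 7 * (2 * size (fst p) + 1) + 3"
  "\<lambda>k. Seq (Assign (k + 1) (NodeE (Var k) LeafE)) (Seq (Assign k (texpr (bl True))) (WhileNode (Var (k + 1)) (treq_body k)))"])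
 let ?e = "pr (\<lambda>t. t) (\<lambda>t. t)"
 show "pbd (\<lambda>x. size (bl (fst x = snd x))) (\<lambda>x. size (?e x))"
  by (rule pbd_le[OF size_bl pbd_const])
 have "pbd (\<lambda>x. 2 * size (?e x) + 2) (\<lambda>x. size (?e x))" by (intro pbd_add pbd_mult) simp_all
 then have "pbd (\<lambda>p. 7 * (2 * size (?e p) + 2) + 3) (\<lambda>x. size (?e x))" by (intro pbd_add pbd_mult) simp_all
 then show "pbd (\<lambda>p. 7 * (2 * size (fst p) + 1) + 3) (\<lambda>x. size (?e x))" by (rule pbd_le[rotated]) simp
 fix k :: nat and s :: store and x assume k: "s k = ?e x"
 let ?s1 = "s(k + 1 := ls ?e [x])"
 have e1: "exec (Assign (k + 1) (NodeE (Var k) LeafE)) s 1 ?s1"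
  using exec.Assign[of "k + 1" "NodeE (Var k) LeafE" s] k by simp
 let ?s2 = "?s1(k := bl True)"
 have e2: "exec (Assign k (texpr (bl True))) ?s1 1 ?s2" using exec.Assign[of k "texpr (bl True)" ?s1] by simp
 obtain t s' where e3: "exec (WhileNode (Var (k + 1)) (treq_body k)) ?s2 t s'" "t \<le> 7 * (\<Sum>p\<leftarrow>[x]. 2 * size (fst p) + 1) + 1"
  "s' k = bl (\<forall>p\<in>set [x]. fst p = snd p)" "\<forall>j<k. s' j = ?s2 j"
  using treq_loop[of ?s2 k "[x]"] by auto
 show "runs (Seq (Assign (k + 1) (NodeE (Var k) LeafE)) (Seq (Assign k (texpr (bl True))) (WhileNode (Var (k + 1)) (treq_body k))))
   s k (bl (fst x = snd x)) (7 * (2 * size (fst x) + 1) + 3)"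
  unfolding runs_def using exec.Seq[OF e1 exec.Seq[OF e2 e3(1)]] e3(2-)
  by (intro exI[of _ "1 + (1 + t)"] exI[of _ s']) simp
qed

lemma pt_eq_enc:
 assumes "pt a b f" "pt a c g" shows "pt a bl (\<lambda>x. b (f x) = c (g x))"
proof -
 have "pt a (\<lambda>t. t) (\<lambda>x. b (f x))" "pt a (\<lambda>t. t) (\<lambda>x. c (g x))"
  by (rule pt_recode[OF assms(1)], simp) (rule pt_recode[OF assms(2)], simp)
 from pt_comp[OF pt_tree_eq pt_pair[OF this]] show ?thesis by simp
qed

lemma pt_eq: "inj b \<Longrightarrow> pt a b f \<Longrightarrow> pt a b g \<Longrightarrow> pt a bl (\<lambda>x. f x = g x)"
 using pt_eq_enc[of a b f b g] by (simp add: inj_eq)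

lemma pt_eq_nat [pt_intros]: "pt a un f \<Longrightarrow> pt a un g \<Longrightarrow> pt a bl (\<lambda>x. f x = g x)"
 by (rule pt_eq[OF inj_un])

lemma pt_mem [pt_intros]:
 assumes "pt a un f" "pt a (ls un) g" shows "pt a bl (\<lambda>x. f x \<in> set (g x))"
proof -
 have f': "pt (pr a un) un (\<lambda>p. f (fst p))" by (rule pt_comp[OF assms(1)]) (rule pt_intros)+
 have "pt a bl (\<lambda>x. \<exists>y\<in>set (g x). f x = y)" by (rule pt_intros f' assms)+
 then show ?thesis by simp
qed

section \<open>Binary numerals and points\<close>

fun binc :: "bool list \<Rightarrow> bool list" where
 "binc [] = [True]" | "binc (False # bs) = True # bs" | "binc (True # bs) = False # binc bs"

lemma bits_Suc: "bits (Suc n) = binc (bits n)"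
proof (induction n rule: less_induct)
 case (less n)
 show ?case
 proof (cases "n = 0")
  case True
  then show ?thesis by (simp add: bits.simps)
 next
  case False
  have b: "bits n = odd n # bits (n div 2)" "bits (Suc n) = odd (Suc n) # bits (Suc n div 2)"
   using False by (subst bits.simps, simp)+
  show ?thesis
  proof (cases "odd n")
   case True
   then have "Suc n div 2 = Suc (n div 2)" by simp
   then show ?thesis using b True less[of "n div 2"] False by simp
  next
   case even: False
   then have "Suc n div 2 = n div 2" by simp
   then show ?thesis using b even by simp
  qed
 qed
qed

lemma bits_funpow: "bits n = (binc ^^ n) []"
 by (induction n) (simp_all add: bits_Suc, simp add: bits.simps)

lemma length_binc: "length (binc bs) \<le> Suc (length bs)"
 by (induction bs rule: binc.induct) auto

lemma length_bits: "length (bits n) \<le> n"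
proof (induction n)
 case (Suc n)
 then show ?case using length_binc[of "bits n"] by (simp add: bits_Suc)
qed (simp add: bits.simps)

lemma size_ls_bl: "size (ls bl bs) \<le> 2 * length bs"
 using size_ls_bound[of bs bl 1] size_bl by auto

text \<open>Increment as a fold: the flag is the carry, and the digits are collected in reverse
  order.\<close>

definition binc_step :: "bool \<Rightarrow> bool \<times> bool list \<Rightarrow> bool \<times> bool list" where
 "binc_step b z = (if fst z then (if b then (True, False # snd z) else (False, True # snd z)) else (False, b # snd z))"

lemma binc_fold: "fold binc_step bs (False, acc) = (False, rev bs @ acc)"
 "(let r = fold binc_step bs (True, acc) in rev (if fst r then True # snd r else snd r)) = rev acc @ binc bs"
proof -
 show f: "fold binc_step bs (False, acc) = (False, rev bs @ acc)" for bs acc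
  by (induction bs arbitrary: acc) (auto simp: binc_step_def)
 show "(let r = fold binc_step bs (True, acc) in rev (if fst r then True # snd r else snd r)) = rev acc @ binc bs"
  by (induction bs arbitrary: acc rule: binc.induct) (auto simp: binc_step_def f Let_def)
qed

lemma length_binc_fold: "length (snd (fold binc_step bs z)) = length bs + length (snd z)"
 by (induction bs arbitrary: z) (auto simp: binc_step_def)

lemma pt_binc: "pt (ls bl) (ls bl) binc"
proof -
 have "pt (ls bl) (pr bl (ls bl)) (\<lambda>bs. fold binc_step bs (True, []))"
 proof (rule pt_fold[OF pt_id, where Z = "\<lambda>bs. 2 * size (ls bl bs) + 2"])
  show "pt (ls bl) (pr bl (ls bl)) (\<lambda>x. (True, []))" by (rule pt_const)
  show "pt (pr (ls bl) (pr bl (pr bl (ls bl)))) (pr bl (ls bl)) (\<lambda>p. binc_step (fst (snd p)) (snd (snd p)))"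
   unfolding binc_step_def by (rule pt_intros)+
  show "pbd (\<lambda>bs. 2 * size (ls bl bs) + 2) (\<lambda>x. size (ls bl x))" by (intro pbd_add pbd_mult) simp_all
  fix bs n
  let ?r = "fold binc_step (take n bs) (True, [])"
  have "size (ls bl (snd ?r)) \<le> 2 * length (snd ?r)" by (rule size_ls_bl)
  also have "\<dots> \<le> 2 * size (ls bl bs)" using length_ls[of bs bl] by (simp add: length_binc_fold)
  finally show "size (pr bl (ls bl) ?r) \<le> 2 * size (ls bl bs) + 2" using size_bl[of "fst ?r"] by simp
 qed
 note r = this
 have "pt (ls bl) (ls bl) (\<lambda>bs. rev (if fst (fold binc_step bs (True, [])) then True # snd (fold binc_step bs (True, [])) else snd (fold binc_step bs (True, []))))"
  by (rule pt_intros r)+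
 then show ?thesis using binc_fold(2)[of _ "[]"] by (simp add: Let_def)
qed

text \<open>A unary number is converted by counting up from the empty numeral; this is polynomial
  because the number of increments is the size of the unary input.\<close>

lemma pt_bits:
 assumes f: "pt a un f" shows "pt a (ls bl) (\<lambda>x. bits (f x))"
proof -
 have "pt a (ls bl) (\<lambda>x. (binc ^^ f x) [])"
 proof (rule pt_funpow[OF f, of _ _ _ "\<lambda>x. 2 * f x"])
  show "pt (pr a (ls bl)) (ls bl) (\<lambda>p. binc (snd p))" by (rule pt_comp[OF pt_binc]) (rule pt_intros)+
  show "pbd (\<lambda>x. 2 * f x) (\<lambda>x. size (a x))" using pbd_mult[OF pbd_const[of 2] pt_size[OF f]] by simp
  show "size (ls bl ((binc ^^ m) [])) \<le> 2 * f x" if "m \<le> f x" for x m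
   using size_ls_bl[of "bits m"] length_bits[of m] that unfolding bits_funpow[symmetric] by linarith
 qed (rule pt_const)
 then show ?thesis by (simp add: bits_funpow)
qed

lemma enc_rat_nat: "enc_rat (of_nat n) = pr (pr bl (ls bl)) (pr bl (ls bl)) ((False, bits n), (False, bits 1))"
proof -
 have "quotient_of (of_nat n) = (int n, 1)" using quotient_of_int[of "int n"] by (simp add: Rat.of_int_def)
 then show ?thesis by (simp add: enc_rat_def enc_int_def enc_nat_def)
qed

abbreviation ptenc :: "rat \<times> rat \<Rightarrow> tree" where "ptenc \<equiv> \<lambda>(x, y). Node (enc_rat x) (enc_rat y)"

lemma pt_point:
 assumes "pt a un f" "pt a un g" shows "pt a ptenc (\<lambda>x. (of_nat (f x), of_nat (g x)))"
proof -
 have "pt a (pr (pr bl (ls bl)) (pr bl (ls bl))) (\<lambda>x. ((False, bits (h x)), (False, bits 1)))" if "pt a un h" for h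
  by (intro pt_pair pt_const pt_bits that)
 from pt_pair[OF this[OF assms(1)] this[OF assms(2)]] show ?thesis
  by (rule pt_recode) (simp add: enc_rat_nat)
qed

text \<open>Running a program with all its variables renumbered upwards by \<open>m\<close>.\<close>

fun shift_expr :: "nat \<Rightarrow> expr \<Rightarrow> expr" where
 "shift_expr m (Var x) = Var (x + m)"
| "shift_expr m LeafE = LeafE"
| "shift_expr m (NodeE a b) = NodeE (shift_expr m a) (shift_expr m b)"
| "shift_expr m (Left a) = Left (shift_expr m a)"
| "shift_expr m (Right a) = Right (shift_expr m a)"

fun shift :: "nat \<Rightarrow> com \<Rightarrow> com" where
 "shift m (Assign x e) = Assign (x + m) (shift_expr m e)"
| "shift m (Seq c d) = Seq (shift m c) (shift m d)"
| "shift m (IfNode e c d) = IfNode (shift_expr m e) (shift m c) (shift m d)"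
| "shift m (WhileNode e c) = WhileNode (shift_expr m e) (shift m c)"

fun vmax_expr :: "expr \<Rightarrow> nat" where
 "vmax_expr (Var x) = Suc x"
| "vmax_expr LeafE = 0"
| "vmax_expr (NodeE a b) = max (vmax_expr a) (vmax_expr b)"
| "vmax_expr (Left a) = vmax_expr a"
| "vmax_expr (Right a) = vmax_expr a"

fun vmax :: "com \<Rightarrow> nat" where
 "vmax (Assign x e) = max (Suc x) (vmax_expr e)"
| "vmax (Seq c d) = max (vmax c) (vmax d)"
| "vmax (IfNode e c d) = max (vmax_expr e) (max (vmax c) (vmax d))"
| "vmax (WhileNode e c) = max (vmax_expr e) (vmax c)"

lemma eval_shift: "vmax_expr e \<le> n \<Longrightarrow> \<forall>i<n. S (i + m) = s i \<Longrightarrow> eval_expr (shift_expr m e) S = eval_expr e s"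
 by (induction e) auto

lemma exec_shift:
 "exec c s t s' \<Longrightarrow> vmax c \<le> n \<Longrightarrow> \<forall>i<n. S (i + m) = s i \<Longrightarrow>
  \<exists>S'. exec (shift m c) S t S' \<and> (\<forall>i<n. S' (i + m) = s' i) \<and> (\<forall>j<m. S' j = S j)"
proof (induction arbitrary: S rule: exec.induct)
 case (Assign x e s)
 have a: "exec (shift m (Assign x e)) S 1 (S(x + m := eval_expr e s))"
  using exec.Assign[of "x + m" "shift_expr m e" S] eval_shift[of e n S m s] Assign by simp
 show ?case
  by (intro exI conjI, rule a) (use Assign in auto)
next
 case (Seq c1 s1 t1 s2 c2 t2 s3)
 obtain S2 where 2: "exec (shift m c1) S t1 S2" "\<forall>i<n. S2 (i + m) = s2 i" "\<forall>j<m. S2 j = S j"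
  using Seq.IH(1)[of S] Seq.prems by auto
 obtain S3 where 3: "exec (shift m c2) S2 t2 S3" "\<forall>i<n. S3 (i + m) = s3 i" "\<forall>j<m. S3 j = S2 j"
  using Seq.IH(2)[of S2] Seq.prems 2 by auto
 then show ?case using exec.Seq[OF 2(1) 3(1)] 2(3) by (intro exI[of _ S3]) simp
next
 case (IfTrue e s c1 t s' c2)
 obtain S2 where 2: "exec (shift m c1) S t S2" "\<forall>i<n. S2 (i + m) = s' i" "\<forall>j<m. S2 j = S j"
  using IfTrue.IH[of S] IfTrue.prems by auto
 have "eval_expr (shift_expr m e) S \<noteq> Leaf" using eval_shift[of e n S m s] IfTrue by simp
 from exec.IfTrue[OF this 2(1)] 2(2,3) show ?case by (intro exI[of _ S2]) simp
next
 case (IfFalse e s c2 t s' c1)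
 obtain S2 where 2: "exec (shift m c2) S t S2" "\<forall>i<n. S2 (i + m) = s' i" "\<forall>j<m. S2 j = S j"
  using IfFalse.IH[of S] IfFalse.prems by auto
 have "eval_expr (shift_expr m e) S = Leaf" using eval_shift[of e n S m s] IfFalse by simp
 from exec.IfFalse[OF this 2(1)] 2(2,3) show ?case by (intro exI[of _ S2]) simp
next
 case (WhileFalse e s c)
 have "eval_expr (shift_expr m e) S = Leaf" using eval_shift[of e n S m s] WhileFalse by simp
 from exec.WhileFalse[OF this] WhileFalse.prems show ?case by (intro exI[of _ S]) simp
next
 case (WhileTrue e s1 c t1 s2 t2 s3)
 obtain S2 where 2: "exec (shift m c) S t1 S2" "\<forall>i<n. S2 (i + m) = s2 i" "\<forall>j<m. S2 j = S j"
  using WhileTrue.IH(1)[of S] WhileTrue.prems by auto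
 obtain S3 where 3: "exec (shift m (WhileNode e c)) S2 t2 S3" "\<forall>i<n. S3 (i + m) = s3 i" "\<forall>j<m. S3 j = S2 j"
  using WhileTrue.IH(2)[of S2] WhileTrue.prems 2 by auto
 have "eval_expr (shift_expr m e) S \<noteq> Leaf" using eval_shift[of e n S m s1] WhileTrue by simp
 from exec.WhileTrue[OF this 2(1)] 3 2(3) show ?case by (intro exI[of _ S3]) simp
qed

fun clear :: "nat \<Rightarrow> nat \<Rightarrow> com" where
 "clear m 0 = Assign m LeafE"
| "clear m (Suc n) = Seq (clear m n) (Assign (m + Suc n) LeafE)"

lemma exec_clear: "exec (clear m n) s (Suc n) (\<lambda>j. if m \<le> j \<and> j \<le> m + n then Leaf else s j)"
proof (induction n)
 case 0
 have "s(m := Leaf) = (\<lambda>j. if m \<le> j \<and> j \<le> m + 0 then Leaf else s j)" by auto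
 then show ?case using exec.Assign[of m LeafE s] by simp
next
 case (Suc n)
 let ?s = "\<lambda>j. if m \<le> j \<and> j \<le> m + n then Leaf else s j"
 have "?s(m + Suc n := Leaf) = (\<lambda>j. if m \<le> j \<and> j \<le> m + Suc n then Leaf else s j)" by auto
 then show ?case using exec.Seq[OF Suc exec.Assign[of "m + Suc n" LeafE ?s]] by simp
qed

text \<open>The called program is specified for stores in which everything but the input is a leaf.
  The variables that it can mention are therefore cleared first.\<close>

definition call :: "nat \<Rightarrow> com \<Rightarrow> com" where
 "call k c = Seq (clear (k + 1) (vmax c)) (shift k c)"

lemma call:
 assumes "outputs_within c x T y" "s k = x"
 obtains t s' where "exec (call k c) s t s'" "real t \<le> T + real (vmax c) + 1" "s' k = y" "\<And>j. j < k \<Longrightarrow> s' j = s j"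
proof -
 obtain t s1 where c: "exec c ((\<lambda>_. Leaf)(0 := x)) t s1" "s1 0 = y" "real t \<le> T"
  using assms(1) unfolding outputs_within_def by blast
 let ?s = "\<lambda>j. if k + 1 \<le> j \<and> j \<le> k + 1 + vmax c then Leaf else s j"
 have "\<forall>i<Suc (vmax c). ?s (i + k) = ((\<lambda>_. Leaf)(0 := x)) i" using assms(2) by auto
 from exec_shift[OF c(1) _ this] obtain S where S: "exec (shift k c) ?s t S" "\<forall>i<Suc (vmax c). S (i + k) = s1 i" "\<forall>j<k. S j = ?s j"
  by auto
 have "exec (call k c) s (Suc (vmax c) + t) S" unfolding call_def by (rule exec.Seq[OF exec_clear S(1)])
 moreover have "S k = y" using S(2)[rule_format, of 0] c(2) by simp
 ultimately show thesis using that[of "Suc (vmax c) + t" S] c(3) S(3) by simp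
qed

section \<open>Sparsification\<close>

text \<open>Literals are treated as independent symbols, so formulas are monotone.\<close>

definition evl :: "(nat \<Rightarrow> bool) \<Rightarrow> nat list list \<Rightarrow> bool" where
 "evl \<tau> F \<longleftrightarrow> (\<forall>C\<in>set F. \<exists>l\<in>set C. \<tau> l)"

text \<open>Insertion with subsumption: a clause implied by a present one is dropped, and present
  clauses that it implies are removed. This preserves equivalence and keeps the formula an
  antichain.\<close>

definition ins :: "nat list \<Rightarrow> nat list list \<Rightarrow> nat list list" where
 "ins C F = (if \<exists>D\<in>set F. \<forall>l\<in>set D. l \<in> set C then F
   else C # filter (\<lambda>D. \<not> (\<forall>l\<in>set C. l \<in> set D)) F)"

definition antich :: "nat list list \<Rightarrow> bool" where
 "antich F \<longleftrightarrow> distinct F \<and> (\<forall>C\<in>set F. \<forall>D\<in>set F. set C \<subseteq> set D \<longrightarrow> C = D)"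

definition okcl :: "nat \<Rightarrow> nat list \<Rightarrow> bool" where
 "okcl n C \<longleftrightarrow> distinct C \<and> length C \<le> 3 \<and> set C \<subseteq> {..<2 * n}"

definition okf :: "nat \<Rightarrow> nat list list \<Rightarrow> bool" where
 "okf n F \<longleftrightarrow> antich F \<and> (\<forall>C\<in>set F. okcl n C)"

lemma evl_ins: "evl \<tau> (ins C F) \<longleftrightarrow> evl \<tau> F \<and> (\<exists>l\<in>set C. \<tau> l)"
proof (cases "\<exists>D\<in>set F. \<forall>l\<in>set D. l \<in> set C")
 case True
 then obtain D where "D \<in> set F" "set D \<subseteq> set C" by blast
 then have "evl \<tau> F \<Longrightarrow> \<exists>l\<in>set C. \<tau> l" unfolding evl_def by blast
 then show ?thesis using True unfolding ins_def by auto
next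
 case False
 then have s: "set (ins C F) = insert C {D \<in> set F. \<not> set C \<subseteq> set D}" unfolding ins_def by auto
 have "\<exists>l\<in>set D. \<tau> l" if "D \<in> set F" "\<exists>l\<in>set C. \<tau> l" "evl \<tau> (ins C F)" for D
  using that unfolding evl_def s by (cases "set C \<subseteq> set D") (blast, simp)
 moreover have "evl \<tau> (ins C F)" if "evl \<tau> F" "\<exists>l\<in>set C. \<tau> l"
  using that unfolding evl_def s by simp
 moreover have "\<exists>l\<in>set C. \<tau> l" if "evl \<tau> (ins C F)" using that unfolding evl_def s by simp
 ultimately show ?thesis unfolding evl_def[of \<tau> F] by metis
qed

lemma evl_fold_ins: "evl \<tau> (fold ins Ps F) \<longleftrightarrow> evl \<tau> F \<and> evl \<tau> Ps"
 by (induction Ps arbitrary: F) (simp_all add: evl_ins, simp_all add: evl_def conj_commute)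

lemma ins_ok: "okf n F \<Longrightarrow> okcl n C \<Longrightarrow> okf n (ins C F)"
proof (cases "\<exists>D\<in>set F. \<forall>l\<in>set D. l \<in> set C")
 case True
 then show "okf n F \<Longrightarrow> okf n (ins C F)" unfolding ins_def by simp
next
 case False
 assume a: "okf n F" "okcl n C"
 have s: "set (ins C F) = insert C {D \<in> set F. \<not> set C \<subseteq> set D}" using False unfolding ins_def by auto
 have "distinct (ins C F)" using False a(1) unfolding ins_def okf_def antich_def by auto
 moreover have "\<not> set D \<subseteq> set C" if "D \<in> set F" for D using False that by blast
 ultimately show "okf n (ins C F)" using a unfolding okf_def antich_def s by blast
qed

lemma fold_ins_ok: "okf n F \<Longrightarrow> \<forall>C\<in>set Ps. okcl n C \<Longrightarrow> okf n (fold ins Ps F)"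
 by (induction Ps arbitrary: F) (auto simp: ins_ok)

lemma set_fold_ins:
 assumes "distinct Ps" "\<forall>P\<in>set Ps. \<forall>D\<in>set F. \<not> set D \<subseteq> set P"
  "\<forall>P\<in>set Ps. \<forall>P'\<in>set Ps. set P \<subseteq> set P' \<longrightarrow> P = P'"
 shows "set (fold ins Ps F) = set Ps \<union> {D \<in> set F. \<forall>P\<in>set Ps. \<not> set P \<subseteq> set D}"
 using assms
proof (induction Ps arbitrary: F)
 case (Cons P Ps)
 have i: "set (ins P F) = insert P {D \<in> set F. \<not> set P \<subseteq> set D}"
  using Cons.prems(2) unfolding ins_def by auto
 have "\<forall>P'\<in>set Ps. \<not> set P \<subseteq> set P'" using Cons.prems(1,3) by auto
 then have "\<forall>P'\<in>set Ps. \<forall>D\<in>set (ins P F). \<not> set D \<subseteq> set P'" using Cons.prems(2) i by auto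
 then have "set (fold ins Ps (ins P F)) = set Ps \<union> {D \<in> set (ins P F). \<forall>P\<in>set Ps. \<not> set P \<subseteq> set D}"
  using Cons.IH[of "ins P F"] Cons.prems by auto
 moreover have "\<forall>P'\<in>set Ps. \<not> set P' \<subseteq> set P" using Cons.prems(1,3) by auto
 ultimately show ?case unfolding i by auto
qed simp

section \<open>Clauses by length and the measure of progress\<close>

definition cls :: "nat \<Rightarrow> nat list list \<Rightarrow> nat list set" where
 "cls k F = {C \<in> set F. length C = k}"

definition deg :: "nat \<Rightarrow> nat list list \<Rightarrow> nat \<Rightarrow> nat" where
 "deg k F l = card {C \<in> cls k F. l \<in> set C}"

text \<open>The number of 2-clauses alone may drop, because a new unit removes those that contain
  it. As long as no symbol lies in more than 2\<theta> of them, the loss per unit is at most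
  2\<theta>, and the second summand refunds it. If some symbol is more frequent the value is the
  least possible one, so that no gain is claimed before frequent symbols have been branched
  on.\<close>

definition bnd :: "nat \<Rightarrow> nat list list \<Rightarrow> nat" where
 "bnd \<theta> F = (if \<exists>l. 2 * \<theta> < deg 2 F l then 0 else card (cls 2 F) + 2 * \<theta> * card (cls 1 F))"

lemma finite_cls [simp]: "finite (cls k F)" by (simp add: cls_def)

lemma card_cls_deg:
 assumes "okf n F" "0 < k" shows "card (cls k F) \<le> (\<Sum>l<2 * n. deg k F l)"
proof -
 have "cls k F \<subseteq> (\<Union>l\<in>{..<2 * n}. {C \<in> cls k F. l \<in> set C})"
 proof
  fix C assume C: "C \<in> cls k F"
  then have "set C \<subseteq> {..<2 * n}" "C \<noteq> []" using assms by (auto simp: cls_def okf_def okcl_def)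
  then obtain l where "l \<in> set C" "l < 2 * n" by (cases C) auto
  then show "C \<in> (\<Union>l\<in>{..<2 * n}. {C \<in> cls k F. l \<in> set C})" using C by blast
 qed
 then have "card (cls k F) \<le> card (\<Union>l\<in>{..<2 * n}. {C \<in> cls k F. l \<in> set C})" by (intro card_mono) auto
 also have "\<dots> \<le> (\<Sum>l<2 * n. deg k F l)" unfolding deg_def by (rule card_UN_le) simp
 finally show ?thesis .
qed

lemma card_units: "okf n F \<Longrightarrow> card (cls 1 F) \<le> 2 * n"
proof -
 assume ok: "okf n F"
 have "deg 1 F l \<le> 1" for l
 proof -
  have "{C \<in> cls 1 F. l \<in> set C} \<subseteq> {[l]}" by (auto simp: cls_def length_Suc_conv)
  then show ?thesis unfolding deg_def using card_mono[of "{[l]}"] by simp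
 qed
 then have "(\<Sum>l<2 * n. deg 1 F l) \<le> (\<Sum>l<2 * n. 1)" by (intro sum_mono)
 then show ?thesis using card_cls_deg[OF ok, of 1] by simp
qed

lemma bnd_le: "okf n F \<Longrightarrow> bnd \<theta> F \<le> 8 * \<theta> * n"
proof -
 assume ok: "okf n F"
 show ?thesis
 proof (cases "\<exists>l. 2 * \<theta> < deg 2 F l")
  case False
  then have "(\<Sum>l<2 * n. deg 2 F l) \<le> (\<Sum>l<2 * n. 2 * \<theta>)" by (intro sum_mono) (simp add: not_less)
  then have "card (cls 2 F) \<le> 4 * \<theta> * n" using card_cls_deg[OF ok, of 2] by (simp add: algebra_simps)
  moreover have "2 * \<theta> * card (cls 1 F) \<le> 2 * \<theta> * (2 * n)" using card_units[OF ok] by (intro mult_left_mono) simp_all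
  ultimately have "card (cls 2 F) + 2 * \<theta> * card (cls 1 F) \<le> 4 * \<theta> * n + 2 * \<theta> * (2 * n)" by linarith
  also have "\<dots> = 8 * \<theta> * n" by simp
  finally show ?thesis using False by (simp only: bnd_def if_False)
 qed (simp add: bnd_def)
qed

context
 fixes n :: nat and F Ps :: "nat list list"
 assumes ok: "okf n F" and Ps: "distinct Ps" "\<forall>P\<in>set Ps. okcl n P"
  and below: "\<forall>P\<in>set Ps. \<exists>C\<in>set F. set P \<subset> set C"
  and anti: "\<forall>P\<in>set Ps. \<forall>P'\<in>set Ps. set P \<subseteq> set P' \<longrightarrow> P = P'"
begin

lemma not_subsumed: "\<forall>P\<in>set Ps. \<forall>D\<in>set F. \<not> set D \<subseteq> set P"
proof (intro ballI notI)
 fix P D assume a: "P \<in> set Ps" "D \<in> set F" "set D \<subseteq> set P"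
 then obtain C where "C \<in> set F" "set P \<subset> set C" using below by blast
 then show False using a ok unfolding okf_def antich_def by blast
qed

lemma child_set: "set (fold ins Ps F) = set Ps \<union> {D \<in> set F. \<forall>P\<in>set Ps. \<not> set P \<subseteq> set D}"
 by (rule set_fold_ins[OF Ps(1) not_subsumed anti])

lemma child_len: "P \<in> set Ps \<Longrightarrow> D \<in> set F \<Longrightarrow> set P \<subseteq> set D \<Longrightarrow> length P < length D"
proof -
 assume a: "P \<in> set Ps" "D \<in> set F" "set P \<subseteq> set D"
 then have "set P \<subset> set D" using not_subsumed by blast
 then have "card (set P) < card (set D)" by (intro psubset_card_mono) auto
 then show ?thesis using a(1,2) Ps(2) ok by (simp add: okf_def okcl_def distinct_card)
qed

lemma child_disj: "set Ps \<inter> set F = {}"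
 using not_subsumed by blast

text \<open>An inserted clause is strictly shorter than whatever it removes, so units inserted
  earlier survive; every new unit removes at most 2\<theta> clauses of length 2.\<close>

lemma child1:
 assumes "\<forall>P\<in>set Ps. length P = 1"
 shows "card (cls 1 (fold ins Ps F)) = card (cls 1 F) + length Ps" "bnd \<theta> F \<le> bnd \<theta> (fold ins Ps F)"
proof -
 let ?G = "fold ins Ps F"
 have c1: "cls 1 ?G = set Ps \<union> cls 1 F"
  unfolding cls_def child_set using assms child_len by fastforce
 show u: "card (cls 1 ?G) = card (cls 1 F) + length Ps"
  unfolding c1 using child_disj Ps(1) by (subst card_Un_disjoint) (auto simp: cls_def distinct_card)
 have c2: "cls 2 ?G = {D \<in> cls 2 F. \<forall>P\<in>set Ps. \<not> set P \<subseteq> set D}"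
  unfolding cls_def child_set using assms by auto
 have d: "deg 2 ?G l \<le> deg 2 F l" for l
  unfolding deg_def c2 by (intro card_mono) auto
 show "bnd \<theta> F \<le> bnd \<theta> ?G"
 proof (cases "\<exists>l. 2 * \<theta> < deg 2 F l")
  case False
  then have big: "\<not> (\<exists>l. 2 * \<theta> < deg 2 ?G l)" using d by (meson le_less_trans not_less)
  have "cls 2 F \<subseteq> cls 2 ?G \<union> (\<Union>P\<in>set Ps. {D \<in> cls 2 F. hd P \<in> set D})"
  proof
   fix D assume D: "D \<in> cls 2 F"
   show "D \<in> cls 2 ?G \<union> (\<Union>P\<in>set Ps. {D \<in> cls 2 F. hd P \<in> set D})"
   proof (cases "\<forall>P\<in>set Ps. \<not> set P \<subseteq> set D")
    case True then show ?thesis using D c2 by blast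
   next
    case False
    then obtain P where P: "P \<in> set Ps" "set P \<subseteq> set D" by blast
    then have "P \<noteq> []" using assms by fastforce
    then have "hd P \<in> set D" using P(2) hd_in_set by blast
    then show ?thesis using P(1) D by blast
   qed
  qed
  then have "card (cls 2 F) \<le> card (cls 2 ?G \<union> (\<Union>P\<in>set Ps. {D \<in> cls 2 F. hd P \<in> set D}))"
   by (intro card_mono) auto
  also have "\<dots> \<le> card (cls 2 ?G) + card (\<Union>P\<in>set Ps. {D \<in> cls 2 F. hd P \<in> set D})" by (rule card_Un_le)
  also have "card (\<Union>P\<in>set Ps. {D \<in> cls 2 F. hd P \<in> set D}) \<le> (\<Sum>P\<in>set Ps. deg 2 F (hd P))"
   unfolding deg_def by (rule card_UN_le) simp
  also have "\<dots> \<le> (\<Sum>P\<in>set Ps. 2 * \<theta>)" using False by (intro sum_mono) (simp add: not_less)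
  also have "\<dots> = 2 * \<theta> * length Ps" using Ps(1) by (simp add: distinct_card)
  finally have "card (cls 2 F) \<le> card (cls 2 ?G) + 2 * \<theta> * length Ps" by simp
  then show ?thesis using False big u unfolding bnd_def by (simp add: algebra_simps)
 qed (simp add: bnd_def)
qed

text \<open>Old and new 2-clauses contribute at most \<theta> each to the degree of a symbol. The
  cutoff in \<open>bnd\<close> is twice the branching threshold in order that it is not reached
  here.\<close>

lemma child2:
 assumes "\<forall>P\<in>set Ps. length P = 2" "\<And>l. deg 2 F l \<le> \<theta>" "\<And>l. card {P \<in> set Ps. l \<in> set P} \<le> \<theta>"
 shows "card (cls 1 (fold ins Ps F)) = card (cls 1 F)" "bnd \<theta> (fold ins Ps F) = bnd \<theta> F + length Ps"
proof -
 let ?G = "fold ins Ps F"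
 have c1: "cls 1 ?G = cls 1 F"
  unfolding cls_def child_set using assms(1) child_len by fastforce
 then show u: "card (cls 1 ?G) = card (cls 1 F)" by simp
 have c2: "cls 2 ?G = set Ps \<union> cls 2 F"
  unfolding cls_def child_set using assms(1) child_len by fastforce
 have u2: "card (cls 2 ?G) = card (cls 2 F) + length Ps"
  unfolding c2 using child_disj Ps(1) by (subst card_Un_disjoint) (auto simp: cls_def distinct_card)
 have "deg 2 ?G l \<le> 2 * \<theta>" for l
 proof -
  have "{C \<in> cls 2 ?G. l \<in> set C} = {P \<in> set Ps. l \<in> set P} \<union> {C \<in> cls 2 F. l \<in> set C}" unfolding c2 by blast
  then have "deg 2 ?G l \<le> card {P \<in> set Ps. l \<in> set P} + deg 2 F l" unfolding deg_def by (simp add: card_Un_le)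
  then show ?thesis using assms(2)[of l] assms(3)[of l] by linarith
 qed
 then have "\<not> (\<exists>l. 2 * \<theta> < deg 2 ?G l)" by (simp add: not_less)
 moreover have "\<not> (\<exists>l. 2 * \<theta> < deg 2 F l)" using assms(2) by (metis le_trans mult_2 le_add1 not_less)
 ultimately show "bnd \<theta> ?G = bnd \<theta> F + length Ps" using u u2 by (simp add: bnd_def)
qed

end

section \<open>Branching on a heart and its petals\<close>

definition pets :: "nat list \<Rightarrow> nat \<Rightarrow> nat list list \<Rightarrow> nat list list" where
 "pets h m F = filter (\<lambda>C. length C = length h + m \<and> (\<forall>l\<in>set h. l \<in> set C)) F"

definition petal :: "nat list \<Rightarrow> nat list \<Rightarrow> nat list" where
 "petal h C = filter (\<lambda>l. l \<notin> set h) C"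

text \<open>Candidates consist of a heart, the length of its petals and the number of petals
  required. The order matters: a candidate is taken only if all earlier kinds fail, and their
  failure supplies the degree bounds under which \<open>child2\<close> applies.\<close>

definition cands :: "nat \<Rightarrow> nat \<Rightarrow> nat list list \<Rightarrow> (nat list \<times> nat \<times> nat) list" where
 "cands \<theta>1 \<theta>2 F = map (\<lambda>l. ([l], 1, \<theta>1)) (concat F)
   @ concat (map (\<lambda>a. map (\<lambda>b. ([a, b], 1, \<theta>1)) (filter (\<lambda>b. b \<noteq> a) (concat F))) (concat F))
   @ map (\<lambda>l. ([l], 2, \<theta>2)) (concat F)"

definition good :: "nat list list \<Rightarrow> nat list \<times> nat \<times> nat \<Rightarrow> bool" where
 "good F c \<longleftrightarrow> snd (snd c) \<le> length (pets (fst c) (fst (snd c)) F)"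

text \<open>Either the heart contains a true symbol, or each clause containing the heart is
  satisfied outside it. The first child receives the heart as a clause, the second all petals. No
  children means that no symbol or pair is frequent.\<close>

definition branch :: "nat \<Rightarrow> nat \<Rightarrow> nat list list \<Rightarrow> nat list list list" where
 "branch \<theta>1 \<theta>2 F = (case filter (good F) (cands \<theta>1 \<theta>2 F) of [] \<Rightarrow> []
   | c # _ \<Rightarrow> [ins (fst c) F, fold ins (map (petal (fst c)) (pets (fst c) (fst (snd c)) F)) F])"

lemma heart_branch:
 assumes ok: "okf n F" and h: "distinct h" and ne: "pets h m F \<noteq> []" and m: "0 < m"
 defines "Ps \<equiv> map (petal h) (pets h m F)"
 shows "evl \<tau> F \<longleftrightarrow> evl \<tau> (ins h F) \<or> evl \<tau> (fold ins Ps F)"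
  and "distinct Ps" "\<forall>P\<in>set Ps. okcl n P \<and> length P = m" "\<forall>P\<in>set Ps. \<forall>P'\<in>set Ps. set P \<subseteq> set P' \<longrightarrow> P = P'"
  and "h \<noteq> [] \<Longrightarrow> \<forall>P\<in>set Ps. \<exists>C\<in>set F. set P \<subset> set C" "\<exists>C\<in>set F. set h \<subset> set C" "okcl n h"
proof -
 have pe: "C \<in> set F \<and> length C = length h + m \<and> set h \<subseteq> set C \<and> okcl n C" if "C \<in> set (pets h m F)" for C
  using that ok by (auto simp: pets_def okf_def)
 have sp: "set (petal h C) = set C - set h" for C by (auto simp: petal_def)
 have inj: "C = C'" if "C \<in> set (pets h m F)" "C' \<in> set (pets h m F)" "set (petal h C) \<subseteq> set (petal h C')" for C C'
 proof -
  have "set C \<subseteq> set C'" using that(3) pe[OF that(1)] pe[OF that(2)] unfolding sp by blast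
  then show ?thesis using pe[OF that(1)] pe[OF that(2)] ok unfolding okf_def antich_def by blast
 qed
 have "inj_on (petal h) (set (pets h m F))" using inj by (intro inj_onI) auto
 then show "distinct Ps" using ok by (simp add: Ps_def distinct_map pets_def okf_def antich_def)
 show anti: "\<forall>P\<in>set Ps. \<forall>P'\<in>set Ps. set P \<subseteq> set P' \<longrightarrow> P = P'" using inj by (auto simp: Ps_def)
 show "\<forall>P\<in>set Ps. okcl n P \<and> length P = m"
 proof
  fix P assume "P \<in> set Ps"
  then obtain C where C: "C \<in> set (pets h m F)" "P = petal h C" by (auto simp: Ps_def)
  have d: "distinct P" "set P = set C - set h" using pe[OF C(1)] C(2) sp by (auto simp: petal_def okcl_def)
  then have "length P = card (set C - set h)" by (simp flip: distinct_card)
  also have "\<dots> = card (set C) - card (set h)" using pe[OF C(1)] by (intro card_Diff_subset) auto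
  also have "\<dots> = m" using pe[OF C(1)] h by (simp add: distinct_card okcl_def)
  finally show "okcl n P \<and> length P = m" using d pe[OF C(1)] by (auto simp: okcl_def)
 qed
 show "\<forall>P\<in>set Ps. \<exists>C\<in>set F. set P \<subset> set C" if "h \<noteq> []"
 proof
  fix P assume "P \<in> set Ps"
  then obtain C where C: "C \<in> set (pets h m F)" "P = petal h C" by (auto simp: Ps_def)
  have "hd h \<in> set C" "hd h \<notin> set P" using that pe[OF C(1)] C(2) sp by auto
  then show "\<exists>C\<in>set F. set P \<subset> set C" using pe[OF C(1)] C(2) sp by blast
 qed
 obtain C where C: "C \<in> set (pets h m F)" using ne by (meson hd_in_set)
 have "card (set h) < card (set C)" using pe[OF C] h m by (simp add: distinct_card okcl_def)
 then have "set h \<noteq> set C" by auto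
 then show "\<exists>C\<in>set F. set h \<subset> set C" using pe[OF C] by blast
 show "okcl n h" using pe[OF C] h by (auto simp: okcl_def)
 show "evl \<tau> F \<longleftrightarrow> evl \<tau> (ins h F) \<or> evl \<tau> (fold ins Ps F)"
 proof -
  have "evl \<tau> Ps" if e: "evl \<tau> F" "\<not> (\<exists>l\<in>set h. \<tau> l)"
   unfolding evl_def
  proof
   fix P assume "P \<in> set Ps"
   then obtain C where C: "C \<in> set (pets h m F)" "P = petal h C" by (auto simp: Ps_def)
   then obtain l where "l \<in> set C" "\<tau> l" using e(1) pe[OF C(1)] unfolding evl_def by blast
   then show "\<exists>l\<in>set P. \<tau> l" using e(2) C(2) sp by blast
  qed
  then show ?thesis unfolding evl_fold_ins evl_ins by blast
 qed
qed

lemma cands_good: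
 assumes "filter (good F) (cands \<theta>1 \<theta>2 F) = c # cs" "0 < \<theta>1" "0 < \<theta>2"
 obtains (single) l where "c = ([l], 1, \<theta>1)" "\<theta>1 \<le> length (pets [l] 1 F)"
 | (pair) a b where "c = ([a, b], 1, \<theta>1)" "a \<noteq> b" "\<theta>1 \<le> length (pets [a, b] 1 F)"
   "\<And>l. l \<in> set (concat F) \<Longrightarrow> length (pets [l] 1 F) < \<theta>1"
 | (triple) l where "c = ([l], 2, \<theta>2)" "\<theta>2 \<le> length (pets [l] 2 F)"
   "\<And>l. l \<in> set (concat F) \<Longrightarrow> length (pets [l] 1 F) < \<theta>1"
   "\<And>a b. a \<in> set (concat F) \<Longrightarrow> b \<in> set (concat F) \<Longrightarrow> a \<noteq> b \<Longrightarrow> length (pets [a, b] 1 F) < \<theta>1"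
proof -
 let ?A = "map (\<lambda>l. ([l], 1::nat, \<theta>1)) (concat F)"
 let ?B = "concat (map (\<lambda>a. map (\<lambda>b. ([a, b], 1::nat, \<theta>1)) (filter (\<lambda>b. b \<noteq> a) (concat F))) (concat F))"
 let ?C = "map (\<lambda>l. ([l], 2::nat, \<theta>2)) (concat F)"
 have f: "filter (good F) ?A @ filter (good F) ?B @ filter (good F) ?C = c # cs"
  using assms(1) unfolding cands_def filter_append .
 have gA: "length (pets [l] 1 F) < \<theta>1" if "filter (good F) ?A = []" "l \<in> set (concat F)" for l
 proof -
  have "([l], 1, \<theta>1) \<in> set ?A" using that(2) by simp
  then have "\<not> good F ([l], 1, \<theta>1)" using that(1) unfolding filter_empty_conv by blast
  then show ?thesis by (simp add: good_def)
 qed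
 have gB: "length (pets [a, b] 1 F) < \<theta>1" if "filter (good F) ?B = []" "a \<in> set (concat F)" "b \<in> set (concat F)" "a \<noteq> b" for a b
 proof -
  have "([a, b], 1, \<theta>1) \<in> set ?B" using that(2-4) by auto
  then have "\<not> good F ([a, b], 1, \<theta>1)" using that(1) unfolding filter_empty_conv by blast
  then show ?thesis by (simp add: good_def)
 qed
 show thesis
 proof (cases "filter (good F) ?A")
  case (Cons x xs)
  then have "c \<in> set (filter (good F) ?A)" using f by simp
  then have cA: "c \<in> set ?A" "good F c" by (simp_all only: set_filter mem_Collect_eq)
  from cA(1) obtain l where l: "c = ([l], 1, \<theta>1)" by auto
  then show thesis using single cA(2) by (simp add: good_def)
 next
  case A: Nil
  show thesis
  proof (cases "filter (good F) ?B")
   case (Cons x xs)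
   then have "c \<in> set (filter (good F) ?B)" using f A by simp
   then have cB: "c \<in> set ?B" "good F c" by (simp_all only: set_filter mem_Collect_eq)
   from cB(1) obtain a b where l: "c = ([a, b], 1, \<theta>1)" "a \<noteq> b" by auto
   then show thesis using pair[OF l] cB(2) gA[OF A] by (simp add: good_def)
  next
   case B: Nil
   have "c \<in> set (filter (good F) ?C)" using f A B by simp
   then have cC: "c \<in> set ?C" "good F c" by (simp_all only: set_filter mem_Collect_eq)
   from cC(1) obtain l where l: "c = ([l], 2, \<theta>2)" by auto
   show thesis using triple[OF l _ gA[OF A] gB[OF B]] l cC(2) by (simp add: good_def)
  qed
 qed
qed

lemma okf_set: "okf n F \<Longrightarrow> distinct F" by (simp add: okf_def antich_def)

lemma deg_eq:
 assumes "okf n F" shows "length (pets [l] k F) = deg (Suc k) F l"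
proof -
 have "length (pets [l] k F) = card (set (pets [l] k F))"
  using distinct_card[of "pets [l] k F"] okf_set[OF assms] by (simp add: pets_def)
 also have "set (pets [l] k F) = {C \<in> cls (Suc k) F. l \<in> set C}" by (auto simp: pets_def cls_def)
 finally show ?thesis unfolding deg_def .
qed

lemma deg_0: "l \<notin> set (concat F) \<Longrightarrow> deg k F l = 0"
 unfolding deg_def cls_def by (auto simp: card_eq_0_iff)

text \<open>A potential on formulas: the room left for unit clauses and for \<open>bnd\<close>,
  measured against their maximal values \<open>2 * n\<close> and \<open>8 * \<theta> * n\<close>. It
  decreases in both children of a branching.\<close>

definition pot :: "real \<Rightarrow> real \<Rightarrow> nat \<Rightarrow> nat \<Rightarrow> nat list list \<Rightarrow> real" where
 "pot \<alpha> \<beta> \<theta> n F = \<alpha> * (2 * real n - real (card (cls 1 F))) + \<beta> * (8 * real \<theta> * real n - real (bnd \<theta> F))"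

lemma pot_nonneg: "okf n F \<Longrightarrow> 0 \<le> \<alpha> \<Longrightarrow> 0 \<le> \<beta> \<Longrightarrow> 0 \<le> pot \<alpha> \<beta> \<theta> n F"
proof -
 assume a: "okf n F" "0 \<le> \<alpha>" "0 \<le> \<beta>"
 have "real (card (cls 1 F)) \<le> real (2 * n)" using card_units[OF a(1)] by (rule of_nat_mono)
 moreover have "real (bnd \<theta> F) \<le> real (8 * \<theta> * n)" using bnd_le[OF a(1)] by (rule of_nat_mono)
 ultimately show ?thesis unfolding pot_def using a by (intro add_nonneg_nonneg mult_nonneg_nonneg) simp_all
qed

lemma pot_le: "0 \<le> \<alpha> \<Longrightarrow> 0 \<le> \<beta> \<Longrightarrow> pot \<alpha> \<beta> \<theta> n F \<le> (2 * \<alpha> + 8 * \<beta> * real \<theta>) * real n"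
 by (simp add: pot_def algebra_simps)

text \<open>The three conditions belong to the three kinds of hearts: one unit against \<theta>1
  units, one 2-clause against \<theta>1 units, and one unit against \<theta>2 clauses of length 2.
  Each says that the sum of \<open>2 powr pot\<close> over the children is at most the value at the
  parent.\<close>

locale sparse =
 fixes \<alpha> \<beta> :: real and \<theta>1 \<theta>2 :: nat
 assumes pos: "0 < \<alpha>" "0 < \<beta>" "0 < \<theta>1" "0 < \<theta>2"
  and wa: "2 powr (-\<alpha>) + 2 powr (- (\<alpha> * real \<theta>1)) \<le> 1"
  and wb: "2 powr (-\<beta>) + 2 powr (- (\<alpha> * real \<theta>1)) \<le> 1"
  and wc: "2 powr (-\<alpha>) + 2 powr (- (\<beta> * real \<theta>2)) \<le> 1"
begin

abbreviation "\<Phi> \<equiv> pot \<alpha> \<beta> \<theta>1"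

lemma drop1:
 assumes "okf n F" "distinct Ps" "\<forall>P\<in>set Ps. okcl n P \<and> length P = 1"
  "\<forall>P\<in>set Ps. \<exists>C\<in>set F. set P \<subset> set C" "\<forall>P\<in>set Ps. \<forall>P'\<in>set Ps. set P \<subseteq> set P' \<longrightarrow> P = P'" "t \<le> length Ps"
 shows "\<Phi> n (fold ins Ps F) \<le> \<Phi> n F - \<alpha> * real t"
proof -
 have P: "\<forall>P\<in>set Ps. okcl n P" "\<forall>P\<in>set Ps. length P = 1" using assms(3) by blast+
 note c = child1[OF assms(1,2) P(1) assms(4,5) P(2)]
 have "real (bnd \<theta>1 F) \<le> real (bnd \<theta>1 (fold ins Ps F))" using c(2) by (rule of_nat_mono)
 then have "\<beta> * real (bnd \<theta>1 F) \<le> \<beta> * real (bnd \<theta>1 (fold ins Ps F))" using pos by (intro mult_left_mono) auto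
 moreover have "\<alpha> * real t \<le> \<alpha> * real (length Ps)" using assms(6) pos by (intro mult_left_mono) auto
 ultimately show ?thesis unfolding pot_def c(1) by (simp add: algebra_simps)
qed

lemma drop2:
 assumes "okf n F" "distinct Ps" "\<forall>P\<in>set Ps. okcl n P \<and> length P = 2"
  "\<forall>P\<in>set Ps. \<exists>C\<in>set F. set P \<subset> set C" "\<forall>P\<in>set Ps. \<forall>P'\<in>set Ps. set P \<subseteq> set P' \<longrightarrow> P = P'" "t \<le> length Ps"
  "\<And>l. deg 2 F l \<le> \<theta>1" "\<And>l. card {P \<in> set Ps. l \<in> set P} \<le> \<theta>1"
 shows "\<Phi> n (fold ins Ps F) \<le> \<Phi> n F - \<beta> * real t"
proof -
 have P: "\<forall>P\<in>set Ps. okcl n P" "\<forall>P\<in>set Ps. length P = 2" using assms(3) by blast+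
 note c = child2[OF assms(1,2) P(1) assms(4,5) P(2) assms(7,8)]
 have "\<beta> * real t \<le> \<beta> * real (length Ps)" using assms(6) pos by (intro mult_left_mono) auto
 then show ?thesis unfolding pot_def c by (simp add: algebra_simps)
qed

lemma weight_split:
 assumes "\<Phi>1 \<le> \<Phi>0 - x" "\<Phi>2 \<le> \<Phi>0 - y" "2 powr (-x) + 2 powr (-y) \<le> (1::real)"
 shows "2 powr \<Phi>1 + 2 powr \<Phi>2 \<le> 2 powr \<Phi>0"
proof -
 have "2 powr \<Phi>1 + 2 powr \<Phi>2 \<le> 2 powr (\<Phi>0 + (-x)) + 2 powr (\<Phi>0 + (-y))" using assms(1,2) by (intro add_mono powr_mono) simp_all
 also have "\<dots> = 2 powr \<Phi>0 * (2 powr (-x) + 2 powr (-y))" unfolding powr_add distrib_left ..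
 also have "\<dots> \<le> 2 powr \<Phi>0 * 1" using assms(3) by (intro mult_left_mono) simp_all
 finally show ?thesis by simp
qed

theorem branch:
 assumes ok: "okf n F" and b: "branch \<theta>1 \<theta>2 F = G # Gs"
 obtains G' where "Gs = [G']" "okf n G" "okf n G'" "\<And>\<tau>. evl \<tau> F \<longleftrightarrow> evl \<tau> G \<or> evl \<tau> G'"
  "2 powr \<Phi> n G + 2 powr \<Phi> n G' \<le> 2 powr \<Phi> n F"
proof -
 obtain h m \<theta> cs where f: "filter (good F) (cands \<theta>1 \<theta>2 F) = (h, m, \<theta>) # cs"
  using b unfolding branch_def by (cases "filter (good F) (cands \<theta>1 \<theta>2 F)") auto
 define Ps where "Ps = map (petal h) (pets h m F)"
 have G: "G = ins h F" "Gs = [fold ins Ps F]" using b unfolding branch_def f Ps_def by simp_all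
 have GG: "G = fold ins [h] F" using G by simp
 have c: "distinct h \<and> h \<noteq> [] \<and> 0 < m \<and> pets h m F \<noteq> []"
  by (rule cands_good[OF f pos(3,4)]) (use pos in \<open>auto simp del: concat.simps\<close>)
 then have c': "distinct h" "h \<noteq> []" "0 < m" "pets h m F \<noteq> []" by blast+
 note hb = heart_branch[OF ok c'(1,4,3), folded Ps_def]
 note okh = hb(7)
 have okP: "\<forall>P\<in>set Ps. okcl n P" using hb(3) by blast
 have one: "distinct [h]" "\<forall>P\<in>set [h]. \<exists>C\<in>set F. set P \<subset> set C" "\<forall>P\<in>set [h]. \<forall>P'\<in>set [h]. set P \<subseteq> set P' \<longrightarrow> P = P'"
  using hb(6) by simp_all
 have "2 powr \<Phi> n G + 2 powr \<Phi> n (fold ins Ps F) \<le> 2 powr \<Phi> n F"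
 proof (rule cands_good[OF f pos(3,4)])
  fix l assume l: "(h, m, \<theta>) = ([l], 1, \<theta>1)" "\<theta>1 \<le> length (pets [l] 1 F)"
  have "\<Phi> n G \<le> \<Phi> n F - \<alpha> * real 1" unfolding GG by (rule drop1[OF ok one(1) _ one(2,3)]) (use l okh in auto)
  moreover have "\<Phi> n (fold ins Ps F) \<le> \<Phi> n F - \<alpha> * real \<theta>1"
   by (rule drop1[OF ok hb(2) _ hb(5)[OF c'(2)] hb(4)]) (use hb(3) l in \<open>auto simp: Ps_def\<close>)
  ultimately show ?thesis by (rule weight_split) (use wa in simp)
 next
  fix a b assume l: "(h, m, \<theta>) = ([a, b], 1, \<theta>1)" "a \<noteq> b" "\<theta>1 \<le> length (pets [a, b] 1 F)"
   "\<And>l. l \<in> set (concat F) \<Longrightarrow> length (pets [l] 1 F) < \<theta>1"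
  have d: "deg 2 F l \<le> \<theta>1" for l
   using l(4)[of l] deg_0[of l F 2] deg_eq[OF ok, of l 1] by (cases "l \<in> set (concat F)") (simp_all add: numeral_2_eq_2)
  have "\<Phi> n G \<le> \<Phi> n F - \<beta> * real 1" unfolding GG
  proof (rule drop2[OF ok one(1) _ one(2,3) _ d])
   fix l
   have "card {P \<in> set [h]. l \<in> set P} \<le> card {h}" by (intro card_mono) auto
   then show "card {P \<in> set [h]. l \<in> set P} \<le> \<theta>1" using pos(3) by simp
  qed (use l okh in auto)
  moreover have "\<Phi> n (fold ins Ps F) \<le> \<Phi> n F - \<alpha> * real \<theta>1"
   by (rule drop1[OF ok hb(2) _ hb(5)[OF c'(2)] hb(4)]) (use hb(3) l in \<open>auto simp: Ps_def\<close>)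
  ultimately show ?thesis by (rule weight_split) (use wb in simp)
 next
  fix l assume l: "(h, m, \<theta>) = ([l], 2, \<theta>2)" "\<theta>2 \<le> length (pets [l] 2 F)"
   "\<And>l. l \<in> set (concat F) \<Longrightarrow> length (pets [l] 1 F) < \<theta>1"
   "\<And>a b. a \<in> set (concat F) \<Longrightarrow> b \<in> set (concat F) \<Longrightarrow> a \<noteq> b \<Longrightarrow> length (pets [a, b] 1 F) < \<theta>1"
  have d: "deg 2 F x \<le> \<theta>1" for x
   using l(3)[of x] deg_0[of x F 2] deg_eq[OF ok, of x 1] by (cases "x \<in> set (concat F)") (simp_all add: numeral_2_eq_2)
  have "\<Phi> n G \<le> \<Phi> n F - \<alpha> * real 1" unfolding GG by (rule drop1[OF ok one(1) _ one(2,3)]) (use l okh in auto)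
  moreover have "\<Phi> n (fold ins Ps F) \<le> \<Phi> n F - \<beta> * real \<theta>2"
  proof (rule drop2[OF ok hb(2) _ hb(5)[OF c'(2)] hb(4) _ d])
   fix x
   show "card {P \<in> set Ps. x \<in> set P} \<le> \<theta>1"
   proof (cases "x = l \<or> x \<notin> set (concat F)")
    case True
    then have "{P \<in> set Ps. x \<in> set P} = {}" using l(1) by (auto simp: Ps_def petal_def pets_def)
    then show ?thesis by (simp only: card.empty le0)
   next
    case False
    have "l \<in> set (concat F)"
    proof -
     obtain C where "C \<in> set (pets h m F)" using c'(4) by (meson hd_in_set)
     then show ?thesis using l(1) by (auto simp: pets_def)
    qed
    \<comment> \<open>A symbol in \<theta>1 petals of \<open>l\<close> would form with
      \<open>l\<close> a frequent pair, but pairs were tried before and none was frequent.\<close>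
    then have lt: "length (pets [l, x] 1 F) < \<theta>1" using l(4)[of l x] False by simp
    have "{P \<in> set Ps. x \<in> set P} \<subseteq> petal h ` set (pets [l, x] 1 F)"
     using l(1) by (auto simp: Ps_def petal_def pets_def)
    then have "card {P \<in> set Ps. x \<in> set P} \<le> card (petal h ` set (pets [l, x] 1 F))" by (intro card_mono) auto
    also have "\<dots> \<le> card (set (pets [l, x] 1 F))" by (rule card_image_le) simp
    also have "\<dots> \<le> length (pets [l, x] 1 F)" by (rule card_length)
    finally show ?thesis using lt by simp
   qed
  qed (use hb(3) l in \<open>auto simp: Ps_def\<close>)
  ultimately show ?thesis by (rule weight_split) (use wc in simp)
 qed
 moreover have "okf n G" unfolding G by (rule ins_ok[OF ok okh])
 moreover have "okf n (fold ins Ps F)" by (rule fold_ins_ok[OF ok okP])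
 ultimately show thesis using that[OF G(2)] hb(1) unfolding G by blast
qed

theorem leaf_length:
 assumes ok: "okf n F" and b: "branch \<theta>1 \<theta>2 F = []"
 shows "length F \<le> 1 + 2 * n * (1 + \<theta>1 + \<theta>2)"
proof -
 have ng: "\<not> good F c" if "c \<in> set (cands \<theta>1 \<theta>2 F)" for c
 proof -
  have "filter (good F) (cands \<theta>1 \<theta>2 F) = []" using b unfolding branch_def by (auto split: list.splits)
  then show ?thesis using that unfolding filter_empty_conv by blast
 qed
 have 2: "deg 2 F l \<le> \<theta>1" for l
 proof (cases "l \<in> set (concat F)")
  case True
  then have "([l], 1, \<theta>1) \<in> set (cands \<theta>1 \<theta>2 F)" unfolding cands_def by simp
  from ng[OF this] show ?thesis unfolding good_def using deg_eq[OF ok, of l 1] by (simp add: numeral_2_eq_2)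
 qed (simp add: deg_0)
 have 3: "deg 3 F l \<le> \<theta>2" for l
 proof (cases "l \<in> set (concat F)")
  case True
  then have "([l], 2, \<theta>2) \<in> set (cands \<theta>1 \<theta>2 F)" unfolding cands_def by simp
  from ng[OF this] show ?thesis unfolding good_def using deg_eq[OF ok, of l 2] by (simp add: numeral_3_eq_3 numeral_2_eq_2)
 qed (simp add: deg_0)
 have s: "set F \<subseteq> {[]} \<union> cls 1 F \<union> cls 2 F \<union> cls 3 F"
 proof
  fix C assume "C \<in> set F"
  then have "C \<in> set F" "length C \<le> 3" using ok by (auto simp: okf_def okcl_def)
  then have "length C = 0 \<or> length C = 1 \<or> length C = 2 \<or> length C = 3" by linarith
  then show "C \<in> {[]} \<union> cls 1 F \<union> cls 2 F \<union> cls 3 F" using \<open>C \<in> set F\<close> by (auto simp: cls_def)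
 qed
 have "length F = card (set F)" using okf_set[OF ok] by (simp add: distinct_card)
 also have "\<dots> \<le> card ({[]} \<union> cls 1 F \<union> cls 2 F \<union> cls 3 F)" by (rule card_mono[OF _ s]) simp
 also have "\<dots> \<le> card ({[]} :: nat list set) + card (cls 1 F) + card (cls 2 F) + card (cls 3 F)"
  using card_Un_le[of "{[]} \<union> cls 1 F \<union> cls 2 F" "cls 3 F"] card_Un_le[of "{[]} \<union> cls 1 F" "cls 2 F"]
   card_Un_le[of "{[]}" "cls 1 F"] by linarith
 \<comment> \<open>The summand 1 is for the empty clause; the others bound the clauses of lengths 1,
   2 and 3 by summing degrees over the symbols.\<close>
 also have "\<dots> \<le> 1 + 2 * n + 2 * n * \<theta>1 + 2 * n * \<theta>2"
 proof -
  have "card (cls 2 F) \<le> 2 * n * \<theta>1"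
   using card_cls_deg[OF ok, of 2] sum_mono[of "{..<2 * n}" "deg 2 F" "\<lambda>_. \<theta>1"] 2 by simp
  moreover have "card (cls 3 F) \<le> 2 * n * \<theta>2"
   using card_cls_deg[OF ok, of 3] sum_mono[of "{..<2 * n}" "deg 3 F" "\<lambda>_. \<theta>2"] 3 by simp
  ultimately show ?thesis using card_units[OF ok] by simp
 qed
 finally show ?thesis by (simp add: algebra_simps)
qed

end

text \<open>With \<open>\<beta> = \<alpha> / (8 * \<theta>1)\<close> the total exponent is
  \<open>3 * \<alpha> = \<epsilon>\<close>. This \<beta> is of order \<open>1 / \<theta>1\<close>,
  and so is the deficit of \<open>2 powr (-\<beta>)\<close> below 1, whereas
  \<open>2 powr (- (\<alpha> * \<theta>1))\<close> decays exponentially; so a large \<theta>1 works.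
  Only then, with \<beta> fixed, is \<theta>2 chosen.\<close>

lemma sparse_exists:
 fixes \<epsilon> :: real
 assumes "0 < \<epsilon>"
 obtains \<alpha> \<beta> \<theta>1 \<theta>2 where "sparse \<alpha> \<beta> \<theta>1 \<theta>2" "2 * \<alpha> + 8 * \<beta> * real \<theta>1 \<le> \<epsilon>"
proof -
 define \<alpha> where "\<alpha> = \<epsilon> / 3"
 have a: "0 < \<alpha>" using assms by (simp add: \<alpha>_def)
 have "((\<lambda>t::real. 2 powr (-\<alpha>) + 2 powr (- (\<alpha> * t))) \<longlongrightarrow> 2 powr (-\<alpha>)) at_top"
  using a by real_asymp
 moreover have "2 powr (-\<alpha>) < 1" using a by (simp add: powr_less_one)
 ultimately have e1: "\<forall>\<^sub>F t in at_top. 2 powr (-\<alpha>) + 2 powr (- (\<alpha> * t)) < 1"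
  by (rule order_tendstoD(2))
 have e2: "\<forall>\<^sub>F t::real in at_top. 2 powr (- (\<alpha> / (8 * t))) + 2 powr (- (\<alpha> * t)) < 1"
  using a by real_asymp
 have "\<forall>\<^sub>F t::nat in at_top. 2 powr (-\<alpha>) + 2 powr (- (\<alpha> * real t)) < 1 \<and>
   2 powr (- (\<alpha> / (8 * real t))) + 2 powr (- (\<alpha> * real t)) < 1 \<and> 0 < t"
  using eventually_compose_filterlim[OF e1 filterlim_real_sequentially] eventually_compose_filterlim[OF e2 filterlim_real_sequentially]
   eventually_gt_at_top[of 0] by eventually_elim simp
 then obtain \<theta>1 :: nat where t1: "2 powr (-\<alpha>) + 2 powr (- (\<alpha> * real \<theta>1)) < 1"
  "2 powr (- (\<alpha> / (8 * real \<theta>1))) + 2 powr (- (\<alpha> * real \<theta>1)) < 1" "0 < \<theta>1"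
  using eventually_happens'[OF sequentially_bot] by blast
 define \<beta> where "\<beta> = \<alpha> / (8 * real \<theta>1)"
 have b: "0 < \<beta>" using a t1(3) by (simp add: \<beta>_def)
 have "((\<lambda>t::real. 2 powr (-\<alpha>) + 2 powr (- (\<beta> * t))) \<longlongrightarrow> 2 powr (-\<alpha>)) at_top"
  using b by real_asymp
 then have e3: "\<forall>\<^sub>F t in at_top. 2 powr (-\<alpha>) + 2 powr (- (\<beta> * t)) < 1"
  by (rule order_tendstoD(2)) (use a in \<open>simp add: powr_less_one\<close>)
 have "\<forall>\<^sub>F t::nat in at_top. 2 powr (-\<alpha>) + 2 powr (- (\<beta> * real t)) < 1 \<and> 0 < t"
  using eventually_compose_filterlim[OF e3 filterlim_real_sequentially] eventually_gt_at_top[of 0] by eventually_elim simp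
 then obtain \<theta>2 :: nat where t2: "2 powr (-\<alpha>) + 2 powr (- (\<beta> * real \<theta>2)) < 1" "0 < \<theta>2"
  using eventually_happens'[OF sequentially_bot] by blast
 have "sparse \<alpha> \<beta> \<theta>1 \<theta>2" using a b t1 t2 unfolding sparse_def by (simp add: \<beta>_def)
 moreover have "2 * \<alpha> + 8 * \<beta> * real \<theta>1 \<le> \<epsilon>" using t1(3) by (simp add: \<beta>_def \<alpha>_def)
 ultimately show thesis by (rule that)
qed

section \<open>Computing the instance\<close>

text \<open>A coarse bound in the natural numbers that controls the sizes of unary numbers in
  programs; the exponent that enters the running time comes from \<open>can_upper\<close>.\<close>

lemma can_le_power: "0 < p \<Longrightarrow> p \<le> q \<Longrightarrow> can p q j \<le> j ^ q"
proof (induction j rule: less_induct)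
 case (less j)
 let ?m = "j div 2 ^ p" and ?r = "j mod 2 ^ p"
 have q: "0 < q" using less.prems by simp
 have B: "2 \<le> (2::nat) ^ p" using power_increasing[of 1 p "2::nat"] less.prems by simp
 show ?case
 proof (cases "?m = 0")
  case True
  then have "can p q j = ?r" using can_rec[OF less.prems(1), of q j] by simp
  also have "\<dots> \<le> j" by simp
  also have "\<dots> \<le> j ^ q" using q self_le_power[of j q] by (cases "j = 0") simp_all
  finally show ?thesis .
 next
  case False
  then have "j \<noteq> 0" by (metis div_0)
  then have "?m < j" using B by simp
  then have "can p q ?m \<le> ?m ^ q" using less.IH less.prems by blast
  then have "can p q j \<le> 2 ^ q * ?m ^ q + ?r" using can_rec[OF less.prems(1), of q j] by simp
  also have "\<dots> = (2 * ?m) ^ q + ?r" by (simp add: power_mult_distrib)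
  also have "\<dots> \<le> (2 * ?m + ?r) ^ q"
  proof -
   obtain s where s: "q = Suc s" using q by (cases q) auto
   have "(2 * ?m) ^ q + ?r \<le> (2 * ?m) ^ s * (2 * ?m + ?r)" using False by (simp add: s algebra_simps)
   also have "\<dots> \<le> (2 * ?m + ?r) ^ s * (2 * ?m + ?r)" by (intro mult_right_mono power_mono) simp_all
   finally show ?thesis by (simp add: s mult.commute)
  qed
  also have "\<dots> \<le> j ^ q"
  proof (intro power_mono)
   have "2 * ?m \<le> 2 ^ p * ?m" using B by (intro mult_right_mono) simp_all
   moreover have "2 ^ p * ?m + ?r = j" by (simp add: mult.commute)
   ultimately show "2 * ?m + ?r \<le> j" by linarith
  qed simp
  finally show ?thesis .
 qed
qed

text \<open>Appends every possible last digit to each listed number. Applied to the values of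
  \<open>can\<close> at the first \<open>m\<close> indices, it gives those at the first
  \<open>m * 2 ^ p\<close>.\<close>

definition cstep :: "nat \<Rightarrow> nat \<Rightarrow> nat list \<Rightarrow> nat list" where
 "cstep p q A = concat (map (\<lambda>x. map (\<lambda>d. 2 ^ q * x + d) [0..<2 ^ p]) A)"

lemma cstep: "0 < p \<Longrightarrow> cstep p q (map (can p q) [0..<m]) = map (can p q) [0..<m * 2 ^ p]"
proof (induction m)
 case (Suc m)
 have "map (\<lambda>d. 2 ^ q * can p q m + d) [0..<2 ^ p] = map (can p q) [m * 2 ^ p..<Suc m * 2 ^ p]"
 proof (rule nth_equalityI)
  fix i assume "i < length (map (\<lambda>d. 2 ^ q * can p q m + d) [0..<2 ^ p])"
  then have i: "i < 2 ^ p" by simp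
  then have "(m * 2 ^ p + i) div 2 ^ p = m" "(m * 2 ^ p + i) mod 2 ^ p = i" by simp_all
  then have "can p q (m * 2 ^ p + i) = 2 ^ q * can p q m + i" using can_rec[OF Suc.prems, of q "m * 2 ^ p + i"] by simp
  then show "map (\<lambda>d. 2 ^ q * can p q m + d) [0..<2 ^ p] ! i = map (can p q) [m * 2 ^ p..<Suc m * 2 ^ p] ! i"
   using i by simp
 qed simp
 moreover have "[0..<Suc m * 2 ^ p] = [0..<m * 2 ^ p] @ [m * 2 ^ p..<Suc m * 2 ^ p]"
  using upt_add_eq_append[of 0 "m * 2 ^ p" "2 ^ p"] by (simp add: add.commute)
 ultimately show ?case using Suc by (simp add: cstep_def)
qed (simp add: cstep_def)

text \<open>Each round at least doubles the list until it has \<open>K\<close> entries, so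
  \<open>K\<close> rounds are ample. Truncation after every round keeps the intermediate lists
  polynomial.\<close>

definition canl :: "nat \<Rightarrow> nat \<Rightarrow> nat \<Rightarrow> nat list" where
 "canl p q K = ((\<lambda>A. take K (cstep p q A)) ^^ K) [0]"

lemma canl_iter:
 assumes "0 < p" "0 < K"
 shows "((\<lambda>A. take K (cstep p q A)) ^^ h) [0] = map (can p q) [0..<min K (2 ^ (p * h))]"
proof (induction h)
 case 0 then show ?case using assms by simp
next
 case (Suc h)
 have m: "min K (min K (2 ^ (p * h)) * 2 ^ p) = min K (2 ^ (p * Suc h))"
 proof (cases "K \<le> 2 ^ (p * h)")
  case True
  have "K * 1 \<le> K * 2 ^ p" by (intro mult_left_mono) simp_all
  moreover have "2 ^ (p * h) \<le> (2::nat) ^ (p * Suc h)" by (intro power_increasing) simp_all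
  ultimately have "K \<le> 2 ^ (p * Suc h)" "K \<le> K * 2 ^ p" using True by linarith+
  then show ?thesis using True by (simp only: min_absorb1)
 next
  case False
  then show ?thesis by (simp add: power_add mult.commute)
 qed
 have tk: "take K (map f [0..<k]) = map f [0..<min K k]" for f :: "nat \<Rightarrow> nat" and k
  by (cases "K \<le> k") (simp_all add: take_map min_def)
 show ?case using Suc by (simp add: cstep[OF assms(1)] tk m del: mult_Suc_right)
qed

lemma canl: "0 < p \<Longrightarrow> canl p q K = (if K = 0 then [0] else map (can p q) [0..<K])"
proof (cases "K = 0")
 case False
 assume p: "0 < p"
 have "K < 2 ^ K" by (rule less_exp)
 also have "\<dots> \<le> 2 ^ (p * K)" using p by (intro power_increasing) simp_all
 finally show ?thesis using canl_iter[OF p, where K = K and q = q and h = K] False by (simp add: canl_def min_def)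
qed (simp add: canl_def)

text \<open>Coordinate, kind and block index of a column or row. The copy number of a gap column or
  gap row is forgotten, as the shape of a cell does not depend on it.\<close>

type_synonym desc = "nat \<times> nat \<times> nat"

definition xdesc :: "nat list \<Rightarrow> nat \<Rightarrow> desc list" where
 "xdesc A M = [(0, 2, 0), (1, 3, 0)] @ concat (map (\<lambda>j.
   map (\<lambda>k. (21 * nthd 0 A j + (k + 2), k + 4, j)) [0..<8] @
   (if Suc j < M then [(21 * nthd 0 A j + 10, 12, j), (1 + 21 * nthd 0 A (Suc j), 14, j)] @
     map (\<lambda>g. (11 + 21 * nthd 0 A j + g, 13, j)) [0..<21 * (nthd 0 A (Suc j) - nthd 0 A j) - 10]
    else [])) [0..<M])"

definition ydesc :: "nat list \<Rightarrow> nat \<Rightarrow> desc list" where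
 "ydesc A L = [(0, 2, 0)] @ concat (map (\<lambda>i.
   map (\<lambda>k. (21 * nthd 0 A i + (k + 1), k + 3, i)) [0..<19] @ [(21 * nthd 0 A i + 20, 22, Suc i)] @
   (if Suc i < L then map (\<lambda>g. (21 + 21 * nthd 0 A i + g, 23, Suc i)) [0..<21 * (nthd 0 A (Suc i) - nthd 0 A i) - 20]
    else [(21 + 21 * nthd 0 A i, 24, Suc i)])) [0..<L])"

text \<open>The first \<open>n\<close> columns are the consistency clauses, with only negative
  occurrences, and the clauses of \<open>F\<close> follow with only positive ones. This is the order
  that \<open>neg_first\<close> demands.\<close>

definition occ_pos :: "nat \<Rightarrow> nat list list \<Rightarrow> nat \<Rightarrow> nat \<Rightarrow> bool" where
 "occ_pos n F i j \<longleftrightarrow> n \<le> j \<and> i \<in> set (nthd [] F (j - n))"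

definition occ_neg :: "nat \<Rightarrow> nat \<Rightarrow> nat \<Rightarrow> bool" where
 "occ_neg n i j \<longleftrightarrow> j < n \<and> (i = 2 * j \<or> i = Suc (2 * j))"

definition rsd :: "nat \<Rightarrow> nat list list \<Rightarrow> desc \<Rightarrow> desc \<Rightarrow> nat" where
 "rsd n F X Y = (let s = nthd 0 (nthd [] shtab (fst (snd Y))) (fst (snd X)) in
   if s = 7 then (if occ_pos n F (snd (snd Y)) (snd (snd X)) then 9 else 2)
   else if s = 8 then (if occ_neg n (snd (snd Y)) (snd (snd X)) then 9 else 2) else s)"

text \<open>Points together with a flag for thick cells. The list \<open>A\<close> is long enough
  for both axes, whose indices reach \<open>n + length F\<close> and \<open>2 * n\<close>.\<close>

definition plist :: "nat \<Rightarrow> nat \<Rightarrow> nat \<Rightarrow> nat list list \<Rightarrow> ((nat \<times> nat) \<times> bool) list" where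
 "plist p q n F = (let M = n + length F; A = canl p q (2 * n + length F + 1) in
   concat (map (\<lambda>X. concat (map (\<lambda>Y. map (\<lambda>u. ((3 * fst X + fst u, 3 * fst Y + snd u), rsd n F X Y = 9)) (offs (rsd n F X Y)))
    (ydesc A (2 * n)))) (xdesc A M)))"

context cgrid begin

lemma set_xdesc:
 assumes "\<And>j. j \<le> M \<Longrightarrow> nthd 0 A j = ca j"
 shows "set (xdesc A M) = {(fx \<alpha>, fst \<alpha>, fst (snd \<alpha>)) |\<alpha>. vx \<alpha>}"
proof
 show "set (xdesc A M) \<subseteq> {(fx \<alpha>, fst \<alpha>, fst (snd \<alpha>)) |\<alpha>. vx \<alpha>}"
 proof
  fix X assume "X \<in> set (xdesc A M)"
  then consider "X = (0, 2, 0)" | "X = (1, 3, 0)"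
   | j k where "j < M" "k < 8" "X = (21 * ca j + (k + 2), k + 4, j)"
   | j where "Suc j < M" "X = (21 * ca j + 10, 12, j)" | j where "Suc j < M" "X = (1 + 21 * ca (Suc j), 14, j)"
   | j g where "Suc j < M" "g < gapx j" "X = (11 + 21 * ca j + g, 13, j)"
   unfolding xdesc_def gapx_def by (auto simp: assms split: if_splits)
  then show "X \<in> {(fx \<alpha>, fst \<alpha>, fst (snd \<alpha>)) |\<alpha>. vx \<alpha>}"
  proof cases
   case 1 then have "X = (fx (2, 0, 0), 2, 0)" by (simp add: fx_def)
   then show ?thesis by force
  next
   case 2 then have "X = (fx (3, 0, 0), 3, 0)" by (simp add: fx_def)
   then show ?thesis by force
  next
   case (3 j k)
   then have "X = (fx (k + 4, j, 0), k + 4, j)" "vx (k + 4, j, 0)" by (auto simp add: fx_def)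
   then show ?thesis by force
  next
   case (4 j)
   then have "X = (fx (12, j, 0), 12, j)" "vx (12, j, 0)" by (auto simp add: fx_def)
   then show ?thesis by force
  next
   case (5 j)
   then have "X = (fx (14, j, 0), 14, j)" "vx (14, j, 0)" by (auto simp add: fx_def)
   then show ?thesis by force
  next
   case (6 j g)
   then have "X = (fx (13, j, g), 13, j)" "vx (13, j, g)" by (auto simp add: fx_def)
   then show ?thesis by force
  qed
 qed
 show "{(fx \<alpha>, fst \<alpha>, fst (snd \<alpha>)) |\<alpha>. vx \<alpha>} \<subseteq> set (xdesc A M)"
 proof
  fix X assume "X \<in> {(fx \<alpha>, fst \<alpha>, fst (snd \<alpha>)) |\<alpha>. vx \<alpha>}"
  then obtain k j g where v: "vx (k, j, g)" "X = (fx (k, j, g), k, j)" by force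
  from v(1) consider "k = 2" "j = 0" | "k = 3" "j = 0" | "4 \<le> k \<and> k \<le> 11" "j < M"
   | "k = 12" "Suc j < M" | "k = 14" "Suc j < M" | "k = 13" "Suc j < M" "g < gapx j" by force
  then show "X \<in> set (xdesc A M)"
  proof cases
   case 1 then show ?thesis using v(2) by (simp add: xdesc_def fx_def)
  next
   case 2 then show ?thesis using v(2) by (simp add: xdesc_def fx_def)
  next
   case 3
   then have "X = (21 * nthd 0 A j + ((k - 4) + 2), (k - 4) + 4, j)" "k - 4 \<in> set [0..<8]" using v(2) by (auto simp add: fx_def assms)
   then have "X \<in> set (map (\<lambda>k. (21 * nthd 0 A j + (k + 2), k + 4, j)) [0..<8])" unfolding set_map by blast
   then show ?thesis unfolding xdesc_def using 3(2) by force
  next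
   case 4
   then have "X = (21 * nthd 0 A j + 10, 12, j)" using v(2) by (simp add: fx_def assms)
   then show ?thesis unfolding xdesc_def using 4(2) by force
  next
   case 5
   then have "X = (1 + 21 * nthd 0 A (Suc j), 14, j)" using v(2) by (simp add: fx_def assms)
   then show ?thesis unfolding xdesc_def using 5(2) by force
  next
   case 6
   then have "X = (11 + 21 * nthd 0 A j + g, 13, j)" "g \<in> set [0..<21 * (nthd 0 A (Suc j) - nthd 0 A j) - 10]"
    using v(2) by (simp_all add: fx_def assms gapx_def)
   then have "X \<in> set (map (\<lambda>g. (11 + 21 * nthd 0 A j + g, 13, j)) [0..<21 * (nthd 0 A (Suc j) - nthd 0 A j) - 10])"
    unfolding set_map by blast
   then show ?thesis unfolding xdesc_def using 6(2) by force
  qed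
 qed
qed

lemma set_ydesc:
 assumes "\<And>j. j \<le> L \<Longrightarrow> nthd 0 A j = ca j"
 shows "set (ydesc A L) = {(fy \<alpha>, fst \<alpha>, fst (snd \<alpha>)) |\<alpha>. vy \<alpha>}"
proof
 show "set (ydesc A L) \<subseteq> {(fy \<alpha>, fst \<alpha>, fst (snd \<alpha>)) |\<alpha>. vy \<alpha>}"
 proof
  fix X assume "X \<in> set (ydesc A L)"
  then consider "X = (0, 2, 0)"
   | j k where "j < L" "k < 19" "X = (21 * ca j + (k + 1), k + 3, j)"
   | j where "j < L" "X = (21 * ca j + 20, 22, Suc j)" | j where "j < L" "\<not> Suc j < L" "X = (21 + 21 * ca j, 24, Suc j)"
   | j g where "Suc j < L" "g < gapy (Suc j)" "X = (21 + 21 * ca j + g, 23, Suc j)"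
   unfolding ydesc_def gapy_def by (auto simp: assms split: if_splits)
  then show "X \<in> {(fy \<alpha>, fst \<alpha>, fst (snd \<alpha>)) |\<alpha>. vy \<alpha>}"
  proof cases
   case 1 then have "X = (fy (2, 0, 0), 2, 0)" by (simp add: fy_def)
   then show ?thesis by force
  next
   case (2 j k)
   then have "X = (fy (k + 3, j, 0), k + 3, j)" "vy (k + 3, j, 0)" by (auto simp add: fy_def)
   then show ?thesis by force
  next
   case (3 j)
   then have "X = (fy (22, Suc j, 0), 22, Suc j)" "vy (22, Suc j, 0)" by (auto simp add: fy_def)
   then show ?thesis by force
  next
   case (4 j)
   then have "X = (fy (24, Suc j, 0), 24, Suc j)" "vy (24, Suc j, 0)" by (auto simp add: fy_def)
   then show ?thesis by force
  next
   case (5 j g)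
   then have "X = (fy (23, Suc j, g), 23, Suc j)" "vy (23, Suc j, g)" by (auto simp add: fy_def)
   then show ?thesis by force
  qed
 qed
 show "{(fy \<alpha>, fst \<alpha>, fst (snd \<alpha>)) |\<alpha>. vy \<alpha>} \<subseteq> set (ydesc A L)"
 proof
  fix X assume "X \<in> {(fy \<alpha>, fst \<alpha>, fst (snd \<alpha>)) |\<alpha>. vy \<alpha>}"
  then obtain k j g where v: "vy (k, j, g)" "X = (fy (k, j, g), k, j)" by force
  from v(1) consider "k = 2" "j = 0" | "3 \<le> k \<and> k \<le> 21" "j < L"
   | i where "k = 22" "j = Suc i" "i < L" | i where "k = 24" "j = Suc i" "i < L" "\<not> Suc i < L"
   | i where "k = 23" "j = Suc i" "Suc i < L" "g < gapy (Suc i)" using L0 by (cases j) force+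
  then show "X \<in> set (ydesc A L)"
  proof cases
   case 1 then show ?thesis using v(2) by (simp add: ydesc_def fy_def)
  next
   case 2
   then have "X = (21 * nthd 0 A j + ((k - 3) + 1), (k - 3) + 3, j)" "k - 3 \<in> set [0..<19]" using v(2) by (auto simp add: fy_def assms)
   then have "X \<in> set (map (\<lambda>k. (21 * nthd 0 A j + (k + 1), k + 3, j)) [0..<19])" unfolding set_map by blast
   then show ?thesis unfolding ydesc_def using 2(2) by force
  next
   case (3 i)
   then have "X = (21 * nthd 0 A i + 20, 22, Suc i)" using v(2) by (simp add: fy_def assms)
   then show ?thesis unfolding ydesc_def using 3(3) by force
  next
   case (4 i)
   then have "X = (21 + 21 * nthd 0 A i, 24, Suc i)" using v(2) by (simp add: fy_def assms)
   then show ?thesis unfolding ydesc_def using 4(3,4) by force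
  next
   case (5 i)
   then have "X = (21 + 21 * nthd 0 A i + g, 23, Suc i)" "g \<in> set [0..<21 * (nthd 0 A (Suc i) - nthd 0 A i) - 20]"
    using v(2) by (simp_all add: fy_def assms gapy_def)
   then have "X \<in> set (map (\<lambda>g. (21 + 21 * nthd 0 A i + g, 23, Suc i)) [0..<21 * (nthd 0 A (Suc i) - nthd 0 A i) - 20])"
    unfolding set_map by blast
   then show ?thesis unfolding ydesc_def using 5(3) by force
  qed
 qed
qed

end

definition dedup :: "'a list \<Rightarrow> 'a list" where
 "dedup xs = fold (\<lambda>y z. if y \<in> set z then z else y # z) xs []"

lemma dedup: "set (dedup xs) = set xs" "distinct (dedup xs)"
proof -
 have "set (fold (\<lambda>y z. if y \<in> set z then z else y # z) xs acc) = set xs \<union> set acc \<and>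
  (distinct acc \<longrightarrow> distinct (fold (\<lambda>y z. if y \<in> set z then z else y # z) xs acc))" for acc
  by (induction xs arbitrary: acc) auto
 from this[of "[]"] show "set (dedup xs) = set xs" "distinct (dedup xs)" unfolding dedup_def by simp_all
qed

lemma mem_concat_map: "y \<in> set (concat (map f xs)) \<longleftrightarrow> (\<exists>x\<in>set xs. y \<in> set (f x))"
 by auto

definition ratp :: "nat \<times> nat \<Rightarrow> rat \<times> rat" where
 "ratp P = (of_nat (fst P), of_nat (snd P))"

definition inst :: "nat \<Rightarrow> nat \<Rightarrow> nat \<Rightarrow> nat list list \<Rightarrow> (rat \<times> rat) list" where
 "inst p q n F = map ratp (dedup (map fst (plist p q n F)))"

definition cpairs :: "(rat \<times> rat) list \<Rightarrow> ((rat \<times> rat) \<times> rat \<times> rat) list" where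
 "cpairs qs = map (\<lambda>i. (nthd (0, 0) qs i, nthd (0, 0) qs (if Suc i = length qs then 0 else Suc i))) [0..<length qs]"

definition tangd :: "(nat \<times> nat) \<times> bool \<Rightarrow> (nat \<times> nat) \<times> bool \<Rightarrow> bool" where
 "tangd P Q = (let w = 1 + (if snd P then 1 else 0) + (if snd Q then 1 else 0);
   a = fst (fst P); b = snd (fst P); c = fst (fst Q); d = snd (fst Q) in
  (b = d \<and> (c = a + w \<or> a = c + w)) \<or> (a = c \<and> (d = b + w \<or> b = d + w)))"

text \<open>The tour is compared with the grid points through their encodings, since equality of
  trees is what a program can test; the encoding is injective on grid points.\<close>

definition check :: "nat \<Rightarrow> nat \<Rightarrow> nat \<Rightarrow> nat list list \<Rightarrow> (rat \<times> rat) list \<Rightarrow> bool" where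
 "check p q n F qs \<longleftrightarrow> (\<forall>r\<in>set (cpairs qs). \<exists>P\<in>set (plist p q n F). \<exists>Q\<in>set (plist p q n F).
   tangd P Q \<and> ptenc (ratp (fst P)) = ptenc (fst r) \<and> ptenc (ratp (fst Q)) = ptenc (snd r))"

lemma bits_inj: "bits m = bits n \<Longrightarrow> m = n"
proof (induction m arbitrary: n rule: less_induct)
 case (less m)
 show ?case
 proof (cases "m = 0 \<or> n = 0")
  case True
  then show ?thesis using less.prems bits.simps[of m] bits.simps[of n] by (auto split: if_splits)
 next
  case False
  then have "odd m # bits (m div 2) = odd n # bits (n div 2)" using less.prems bits.simps[of m] bits.simps[of n] by simp
  then have "odd m = odd n" "m div 2 = n div 2" using less.IH[of "m div 2" "n div 2"] False by auto
  then show ?thesis by (metis bit_eq_rec)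
 qed
qed

lemma enc_bits_inj: "ls bl xs = ls bl ys \<Longrightarrow> xs = ys"
proof (induction xs arbitrary: ys)
 case Nil then show ?case by (cases ys) auto
next
 case (Cons x xs) then show ?case by (cases ys) (auto simp: enc_bool_def split: if_splits)
qed

lemma ptenc_inj: "ptenc (ratp P) = ptenc (ratp Q) \<Longrightarrow> P = Q"
 unfolding ratp_def by (auto simp: enc_rat_nat prod_eq_iff dest!: enc_bits_inj bits_inj)

lemma ratp_inj: "ratp P = ratp Q \<Longrightarrow> P = Q" by (rule ptenc_inj) simp

lemma cpairs_nth:
 assumes "i < length qs"
 shows "cpairs qs ! i = (qs ! i, qs ! (Suc i mod length qs))" "length (cpairs qs) = length qs"
proof -
 have e: "(if Suc i = length qs then 0 else Suc i) = Suc i mod length qs" using assms by auto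
 have "cpairs qs ! i = (nthd (0, 0) qs i, nthd (0, 0) qs (Suc i mod length qs))"
  unfolding e[symmetric] using assms by (simp add: cpairs_def)
 moreover have "Suc i mod length qs < length qs" using assms by (intro mod_less_divisor) linarith
 ultimately show "cpairs qs ! i = (qs ! i, qs ! (Suc i mod length qs))" using assms by (simp add: nthd)
qed (simp add: cpairs_def)

section \<open>Correctness of the computed instance\<close>

context
 fixes p q n :: nat and F :: "nat list list"
 assumes pq: "0 < p" "p < q" and n: "0 < n" and ok: "okf n F"
begin

interpretation cgrid p q "2 * n" "n + length F" "occ_pos n F" "occ_neg n"
 using pq n by unfold_locales auto

lemma rsd_eq:
 assumes "vx (k, j, g)" "vy (l, i, h)"
 shows "rsd n F (x, k, j) (y, l, i) = rs ((k, j, g), (l, i, h))"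
proof -
 have "k < 15" "l < 25" using vx_le[OF assms(1)] vy_le[OF assms(2)] .
 then have "l < length shtab" "k < length (shtab ! l)" using shtab_len by simp_all
 then have "nthd 0 (nthd [] shtab l) k = sh k l" by (simp add: nthd sh_def)
 then show ?thesis by (simp add: rsd_def rs_def Let_def)
qed

lemma set_plist: "set (plist p q n F) = (\<lambda>v. (pos v, rs (fst v) = 9)) ` V"
proof -
 let ?A = "canl p q (2 * n + length F + 1)"
 have A: "nthd 0 ?A j = ca j" if "j \<le> 2 * n + length F" for j
  using that canl[OF p, of q "2 * n + length F + 1"] by (simp add: nthd del: upt_Suc)
 have X: "set (xdesc ?A (n + length F)) = {(fx \<alpha>, fst \<alpha>, fst (snd \<alpha>)) |\<alpha>. vx \<alpha>}"
  by (rule set_xdesc) (rule A, simp)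
 have Y: "set (ydesc ?A (2 * n)) = {(fy \<alpha>, fst \<alpha>, fst (snd \<alpha>)) |\<alpha>. vy \<alpha>}"
  by (rule set_ydesc) (rule A, simp)
 have mem: "P \<in> set (plist p q n F) \<longleftrightarrow> (\<exists>X\<in>set (xdesc ?A (n + length F)). \<exists>Y\<in>set (ydesc ?A (2 * n)). \<exists>u\<in>set (offs (rsd n F X Y)).
   P = ((3 * fst X + fst u, 3 * fst Y + snd u), rsd n F X Y = 9))" for P
  unfolding plist_def Let_def mem_concat_map set_map image_iff ..
 show ?thesis
 proof
  show "set (plist p q n F) \<subseteq> (\<lambda>v. (pos v, rs (fst v) = 9)) ` V"
  proof
   fix P assume "P \<in> set (plist p q n F)"
   then obtain X Y u where u: "X \<in> set (xdesc ?A (n + length F))" "Y \<in> set (ydesc ?A (2 * n))" "u \<in> set (offs (rsd n F X Y))"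
    "P = ((3 * fst X + fst u, 3 * fst Y + snd u), rsd n F X Y = 9)" unfolding mem by blast
   obtain k j g where x: "vx (k, j, g)" "X = (fx (k, j, g), k, j)" using u(1) unfolding X by force
   obtain l i h where y: "vy (l, i, h)" "Y = (fy (l, i, h), l, i)" using u(2) unfolding Y by force
   let ?c = "((k, j, g), (l, i, h))"
   have r: "rsd n F X Y = rs ?c" unfolding x(2) y(2) by (rule rsd_eq[OF x(1) y(1)])
   have "set (offs 0) = {}" by (simp add: offs_def)
   then have "rs ?c \<noteq> 0" using u(3) unfolding r by (metis empty_iff)
   then have c: "cell ?c" using x y by (simp add: cell_def)
   have "pos (?c, u) = (3 * fst X + fst u, 3 * fst Y + snd u)"
    using cx_eq[OF c] cy_eq[OF c] unfolding x(2) y(2) pos_def by (cases u) simp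
   moreover have "(?c, u) \<in> V" using c u(3) unfolding V_def r by simp
   ultimately show "P \<in> (\<lambda>v. (pos v, rs (fst v) = 9)) ` V" unfolding u(4) r by (intro image_eqI[of _ _ "(?c, u)"]) simp_all
  qed
  show "(\<lambda>v. (pos v, rs (fst v) = 9)) ` V \<subseteq> set (plist p q n F)"
  proof
   fix P assume "P \<in> (\<lambda>v. (pos v, rs (fst v) = 9)) ` V"
   then obtain v where v: "v \<in> V" "P = (pos v, rs (fst v) = 9)" by blast
   obtain k j g l i h u where vv: "v = (((k, j, g), (l, i, h)), u)" by (metis prod_cases3 prod.exhaust)
   let ?c = "((k, j, g), (l, i, h))"
   have c: "cell ?c" "u \<in> set (offs (rs ?c))" using v(1) unfolding vv V_def by simp_all
   have vxy: "vx (k, j, g)" "vy (l, i, h)" using c(1) by (simp_all add: cell_def)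
   let ?X = "(fx (k, j, g), k, j)" and ?Y = "(fy (l, i, h), l, i)"
   have "?X \<in> set (xdesc ?A (n + length F))" unfolding X using vxy(1) by force
   moreover have "?Y \<in> set (ydesc ?A (2 * n))" unfolding Y using vxy(2) by force
   moreover have r: "rsd n F ?X ?Y = rs ?c" by (rule rsd_eq[OF vxy])
   moreover have "P = ((3 * fst ?X + fst u, 3 * fst ?Y + snd u), rsd n F ?X ?Y = 9)"
    using cx_eq[OF c(1)] cy_eq[OF c(1)] unfolding v(2) vv r pos_def by (cases u) simp
   moreover have "u \<in> set (offs (rsd n F ?X ?Y))" unfolding r by (rule c(2))
   ultimately show "P \<in> set (plist p q n F)" unfolding mem by blast
  qed
 qed
qed

lemma set_inst: "set (inst p q n F) = ratp ` pos ` V" "distinct (inst p q n F)"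
proof -
 show "set (inst p q n F) = ratp ` pos ` V"
  unfolding inst_def set_map dedup(1) set_plist image_image by simp
 show "distinct (inst p q n F)" unfolding inst_def distinct_map
  using dedup(2) ratp_inj by (auto simp: inj_on_def)
qed

lemma real_ratp: "real_point (ratp (pos v)) = rpt v"
 by (simp add: real_point_def ratp_def rpt_def)

lemma real_inst: "real_point ` set (inst p q n F) = rpt ` V"
 unfolding set_inst image_image real_ratp ..

lemma inst_fam: "real_point ` set (inst p q n F) \<in> fam p q"
 unfolding real_inst by (rule V_fam)

lemma length_inst: "length (inst p q n F) \<le> 66 * (n + length F) * (63 * can p q (2 * n) + 66) + 66 * (2 * n) * (63 * can p q (n + length F) + 66)"
proof -
 have "length (inst p q n F) = card (ratp ` pos ` V)" using set_inst distinct_card by metis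
 also have "\<dots> \<le> card (pos ` V)" using card_V(1) by (intro card_image_le) simp
 also have "\<dots> \<le> card V" using card_V(1) by (intro card_image_le)
 finally show ?thesis using card_V(2) by linarith
qed

lemma layout_sat:
 "(\<exists>\<tau>. \<forall>j<n + length F. \<exists>i<2 * n. (occ_pos n F i j \<and> \<tau> i) \<or> (occ_neg n i j \<and> \<not> \<tau> i))
  \<longleftrightarrow> (\<exists>\<tau>. (\<forall>v<n. \<not> (\<tau> (2 * v) \<and> \<tau> (Suc (2 * v)))) \<and> evl \<tau> F)"
proof (rule ex_cong1)
 fix \<tau> :: "nat \<Rightarrow> bool"
 have "(\<forall>j<n + length F. \<exists>i<2 * n. (occ_pos n F i j \<and> \<tau> i) \<or> (occ_neg n i j \<and> \<not> \<tau> i))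
  \<longleftrightarrow> (\<forall>j<n. \<exists>i<2 * n. occ_neg n i j \<and> \<not> \<tau> i) \<and> (\<forall>j<length F. \<exists>i<2 * n. occ_pos n F i (n + j) \<and> \<tau> i)"
  (is "?l \<longleftrightarrow> ?r")
 proof
  assume l: ?l
  have "\<exists>i<2 * n. occ_neg n i j \<and> \<not> \<tau> i" if "j < n" for j using l[rule_format, of j] that by (auto simp: occ_pos_def)
  moreover have "\<exists>i<2 * n. occ_pos n F i (n + j) \<and> \<tau> i" if "j < length F" for j
   using l[rule_format, of "n + j"] that by (auto simp: occ_neg_def)
  ultimately show ?r by blast
 next
  assume r: ?r
  show ?l
  proof (intro allI impI)
   fix j assume j: "j < n + length F"
   show "\<exists>i<2 * n. (occ_pos n F i j \<and> \<tau> i) \<or> (occ_neg n i j \<and> \<not> \<tau> i)"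
   proof (cases "j < n")
    case True then show ?thesis using r by blast
   next
    case False
    then obtain k where "j = n + k" using le_Suc_ex by (metis not_less)
    then show ?thesis using r j by (metis add_less_cancel_left)
   qed
  qed
 qed
 also have "(\<forall>j<n. \<exists>i<2 * n. occ_neg n i j \<and> \<not> \<tau> i) \<longleftrightarrow> (\<forall>v<n. \<not> (\<tau> (2 * v) \<and> \<tau> (Suc (2 * v))))"
 proof (intro all_cong1 imp_cong refl)
  fix j assume j: "j < n"
  have "2 * j < 2 * n" "Suc (2 * j) < 2 * n" using j by linarith+
  then show "(\<exists>i<2 * n. occ_neg n i j \<and> \<not> \<tau> i) \<longleftrightarrow> \<not> (\<tau> (2 * j) \<and> \<tau> (Suc (2 * j)))"
   using j unfolding occ_neg_def by blast
 qed
 also have "(\<forall>j<length F. \<exists>i<2 * n. occ_pos n F i (n + j) \<and> \<tau> i) \<longleftrightarrow> evl \<tau> F"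
 proof -
  have "(\<exists>i<2 * n. occ_pos n F i (n + j) \<and> \<tau> i) \<longleftrightarrow> (\<exists>l\<in>set (F ! j). \<tau> l)" if j: "j < length F" for j
  proof -
   have "set (F ! j) \<subseteq> {..<2 * n}" using ok j unfolding okf_def okcl_def by simp
   then show ?thesis unfolding occ_pos_def using j by (auto simp: nthd)
  qed
  then show ?thesis unfolding evl_def all_set_conv_all_nth by simp
 qed
 finally show "(\<forall>j<n + length F. \<exists>i<2 * n. (occ_pos n F i j \<and> \<tau> i) \<or> (occ_neg n i j \<and> \<not> \<tau> i))
  \<longleftrightarrow> (\<forall>v<n. \<not> (\<tau> (2 * v) \<and> \<tau> (Suc (2 * v)))) \<and> evl \<tau> F" .
qed

text \<open>Every point of the tour is pulled back to the unique vertex at that position. The test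
  then says that consecutive vertices are tangent, and \<open>optimal_tour_sat\<close>
  applies.\<close>

theorem check_correct:
 assumes opt: "optimal_tour (real_point ` set (inst p q n F)) (map real_point qs)"
 shows "check p q n F qs \<longleftrightarrow> (\<exists>\<tau>. (\<forall>v<n. \<not> (\<tau> (2 * v) \<and> \<tau> (Suc (2 * v)))) \<and> evl \<tau> F)"
proof -
 have rinj: "inj real_point" by (auto simp: inj_def real_point_def)
 have "real_point ` set qs = real_point ` set (inst p q n F)" using opt by (auto simp: optimal_tour_def is_tour_def)
 then have sq: "set qs = ratp ` pos ` V" using rinj set_inst(1) by (simp add: inj_image_eq_iff)
 have "\<forall>x\<in>set qs. \<exists>v\<in>V. x = ratp (pos v)" unfolding sq by blast
 then obtain f where f: "\<And>x. x \<in> set qs \<Longrightarrow> f x \<in> V \<and> x = ratp (pos (f x))" by metis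
 define ws where "ws = map f qs"
 have wsV: "set ws \<subseteq> V" using f by (auto simp: ws_def)
 have len: "length ws = length qs" by (simp add: ws_def)
 have qw: "qs ! i = ratp (pos (ws ! i)) \<and> ws ! i \<in> V" if "i < length qs" for i
  using f[of "qs ! i"] that by (simp add: ws_def)
 have "map real_point qs = map rpt ws" unfolding ws_def map_map o_def
  using f by (intro map_cong refl) (metis real_ratp)
 then have opt': "optimal_tour (rpt ` V) (map rpt ws)" using opt real_inst by simp
 have td: "tangd (pos v, rs (fst v) = 9) (pos w, rs (fst w) = 9) \<longleftrightarrow> tang v w" for v w
  unfolding tangd_def tang_def apart_def wt_def th_def Let_def fst_conv snd_conv by simp
 have "check p q n F qs \<longleftrightarrow> (\<forall>i<length qs. tang (ws ! i) (ws ! (Suc i mod length ws)))"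
 proof -
  have "(\<exists>P\<in>set (plist p q n F). \<exists>Q\<in>set (plist p q n F). tangd P Q \<and> ptenc (ratp (fst P)) = ptenc (fst (cpairs qs ! i)) \<and> ptenc (ratp (fst Q)) = ptenc (snd (cpairs qs ! i)))
   \<longleftrightarrow> tang (ws ! i) (ws ! (Suc i mod length ws))" if i: "i < length qs" for i
  proof -
   let ?v = "ws ! i" and ?w = "ws ! (Suc i mod length ws)"
   have s: "Suc i mod length qs < length qs" using i by (intro mod_less_divisor) linarith
   have c: "cpairs qs ! i = (ratp (pos ?v), ratp (pos ?w))"
    using cpairs_nth(1)[OF i] qw[OF i] qw[OF s] len by simp
   have V: "?v \<in> V" "?w \<in> V" using qw[OF i] qw[OF s] len by simp_all
   have e: "ptenc (ratp (pos v)) = ptenc (ratp (pos w)) \<longleftrightarrow> v = w" if "v \<in> V" "w \<in> V" for v w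
    using ptenc_inj inj_onD[OF pos_inj] that by metis
   show ?thesis unfolding set_plist c using e V by (auto simp: td simp del: ratp_def)
  qed
  then show ?thesis unfolding check_def all_set_conv_all_nth
   by (cases qs) (simp add: cpairs_def, simp add: cpairs_def)
 qed
 also have "\<dots> \<longleftrightarrow> (\<exists>\<tau>. \<forall>j<n + length F. \<exists>i<2 * n. (occ_pos n F i j \<and> \<tau> i) \<or> (occ_neg n i j \<and> \<not> \<tau> i))"
  unfolding len[symmetric]
  by (rule optimal_tour_sat[OF _ opt' wsV, symmetric]) (auto simp: occ_pos_def occ_neg_def)
 finally show ?thesis unfolding layout_sat .
qed

end

section \<open>Polynomial time for the instance, the test and the branching\<close>

lemma pt_cstep: "pt (ls un) (ls un) (cstep p q)"
 unfolding cstep_def by (rule pt_intros pt_const)+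

lemma pt_canl:
 assumes "0 < p" "p \<le> q" shows "pt un (ls un) (canl p q)"
 unfolding canl_def
proof (rule pt_funpow[OF pt_id])
 show "pt un (ls un) (\<lambda>x. [0])" by (rule pt_const)
 have c: "pt (pr un (ls un)) (ls un) (\<lambda>x. cstep p q (snd x))" by (rule pt_comp[OF pt_cstep]) (rule pt_intros)+
 show "pt (pr un (ls un)) (ls un) (\<lambda>x. take (fst x) (cstep p q (snd x)))" by (rule pt_intros c)+
 show "pbd (\<lambda>K. K * ((K + 2) ^ q + 1) + 1) (\<lambda>x. size (un x))"
  by (intro pbd_add pbd_mult pbd_power) simp_all
 fix K m :: nat assume m: "m \<le> K"
 let ?A = "((\<lambda>A. take K (cstep p q A)) ^^ m) [0]"
 show "size (ls un ?A) \<le> K * ((K + 2) ^ q + 1) + 1"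
 proof (cases "K = 0")
  case True then show ?thesis using m by simp
 next
  case False
  then have e: "?A = map (can p q) [0..<min K (2 ^ (p * m))]" using canl_iter[OF assms(1)] by simp
  have "size (ls un ?A) \<le> length ?A * (((K + 2) ^ q) + 1)"
  proof (rule size_ls_bound)
   fix y assume "y \<in> set ?A"
   then obtain j where "j < K" "y = can p q j" unfolding e by auto
   then have "y \<le> j ^ q" using can_le_power[OF assms] by simp
   also have "\<dots> \<le> (K + 2) ^ q" using \<open>j < K\<close> by (intro power_mono) simp_all
   finally show "size (un y) \<le> (K + 2) ^ q" by simp
  qed
  also have "\<dots> \<le> K * ((K + 2) ^ q + 1)" unfolding e by (intro mult_right_mono) simp_all
  finally show ?thesis by simp
 qed
qed

abbreviation "ed \<equiv> pr un (pr un un)"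

lemma pt_xdesc: "pt (pr (ls un) un) (ls ed) (\<lambda>x. xdesc (fst x) (snd x))"
 unfolding xdesc_def by (rule pt_intros)+

lemma pt_ydesc: "pt (pr (ls un) un) (ls ed) (\<lambda>x. ydesc (fst x) (snd x))"
 unfolding ydesc_def by (rule pt_intros)+

abbreviation "ef \<equiv> ls (ls un)"
abbreviation "es \<equiv> pr un ef"

lemma pt_occ_pos: "pt (pr es (pr un un)) bl (\<lambda>x. occ_pos (fst (fst x)) (snd (fst x)) (fst (snd x)) (snd (snd x)))"
 unfolding occ_pos_def by (rule pt_intros)+

lemma pt_occ_neg: "pt (pr es (pr un un)) bl (\<lambda>x. occ_neg (fst (fst x)) (fst (snd x)) (snd (snd x)))"
 unfolding occ_neg_def by (rule pt_intros)+

lemma pt_rsd: "pt (pr es (pr ed ed)) un (\<lambda>x. rsd (fst (fst x)) (snd (fst x)) (fst (snd x)) (snd (snd x)))"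
proof -
 have o: "pt (pr es (pr ed ed)) (pr es (pr un un)) (\<lambda>x. (fst x, snd (snd (snd (snd x))), snd (snd (fst (snd x)))))"
  by (rule pt_intros)+
 note P = pt_comp[OF pt_occ_pos o, simplified fst_conv snd_conv] and N = pt_comp[OF pt_occ_neg o, simplified fst_conv snd_conv]
 show ?thesis unfolding rsd_def Let_def by (rule P N pt_intros pt_const)+
qed

lemma pt_offs: "pt un (ls (pr un un)) offs"
 unfolding offs_def op_simps by (rule pt_intros)+

abbreviation "ep \<equiv> pr (pr un un) bl"

lemma pt_plist:
 assumes "0 < p" "p \<le> q" shows "pt es (ls ep) (\<lambda>x. plist p q (fst x) (snd x))"
proof -
 have A: "pt es (ls un) (\<lambda>x. canl p q (2 * fst x + length (snd x) + 1))"
  by (rule pt_comp[OF pt_canl[OF assms]]) (rule pt_intros)+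
 have "pt es (pr (ls un) un) (\<lambda>x. (canl p q (2 * fst x + length (snd x) + 1), fst x + length (snd x)))"
  by (rule A pt_intros)+
 note X = pt_comp[OF pt_xdesc this, simplified fst_conv snd_conv]
 have "pt es (pr (ls un) un) (\<lambda>x. (canl p q (2 * fst x + length (snd x) + 1), 2 * fst x))"
  by (rule A pt_intros)+
 note Y = pt_comp[OF pt_ydesc this, simplified fst_conv snd_conv]
 have Y': "pt (pr es ed) (ls ed) (\<lambda>x. ydesc (canl p q (2 * fst (fst x) + length (snd (fst x)) + 1)) (2 * fst (fst x)))"
  by (rule pt_comp[OF Y]) (rule pt_intros)+
 have "pt (pr (pr es ed) ed) (pr es (pr ed ed)) (\<lambda>x. (fst (fst x), (snd (fst x), snd x)))" by (rule pt_intros)+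
 note R = pt_comp[OF pt_rsd this, simplified fst_conv snd_conv]
 note O = pt_comp[OF pt_offs R]
 have R': "pt (pr (pr (pr es ed) ed) (pr un un)) un (\<lambda>x. rsd (fst (fst (fst (fst x)))) (snd (fst (fst (fst x)))) (snd (fst (fst x))) (snd (fst x)))"
  by (rule pt_comp[OF R]) (rule pt_intros)+
 show ?thesis unfolding plist_def Let_def by (rule X Y' O R' pt_intros)+
qed

lemma pt_mem_inj:
 assumes "inj b" "pt a b f" "pt a (ls b) g" shows "pt a bl (\<lambda>x. f x \<in> set (g x))"
proof -
 have f': "pt (pr a b) b (\<lambda>p. f (fst p))" by (rule pt_comp[OF assms(2)]) (rule pt_intros)+
 have "pt a bl (\<lambda>x. \<exists>y\<in>set (g x). f x = y)" by (rule pt_intros f' assms pt_eq[OF assms(1)])+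
 then show ?thesis by simp
qed

lemma pt_dedup:
 assumes "inj b" "pt a (ls b) f" shows "pt a (ls b) (\<lambda>x. dedup (f x))"
proof (rule pt_comp[OF _ assms(2)])
 let ?S = "\<lambda>xs. size (ls b xs) * (size (ls b xs) + 1)"
 show "pt (ls b) (ls b) dedup" unfolding dedup_def
 proof (rule pt_fold[OF pt_id, where Z = ?S])
  show "pt (ls b) (ls b) (\<lambda>x. [])" by (rule pt_const)
  show "pt (pr (ls b) (pr b (ls b))) (ls b) (\<lambda>p. if fst (snd p) \<in> set (snd (snd p)) then snd (snd p) else fst (snd p) # snd (snd p))"
   by (rule pt_mem_inj[OF assms(1)] pt_intros)+
  show "pbd ?S (\<lambda>x. size (ls b x))" by (intro pbd_mult pbd_add) simp_all
  fix xs :: "'a list" and n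
  let ?d = "fold (\<lambda>y z. if y \<in> set z then z else y # z) (take n xs) []"
  have d: "?d = dedup (take n xs)" by (simp add: dedup_def)
  have "size (ls b ?d) \<le> length ?d * (size (ls b xs) + 1)"
   by (rule size_ls_bound) (auto simp: d dedup(1) dest!: in_set_takeD intro: size_ls_elem)
  also have "\<dots> \<le> ?S xs"
  proof (rule mult_right_mono)
   have "length ?d = card (set (take n xs))" unfolding d using dedup[of "take n xs"] distinct_card by metis
   also have "\<dots> \<le> length xs" using card_length[of "take n xs"] by simp
   finally show "length ?d \<le> size (ls b xs)" using length_ls[of xs b] by linarith
  qed simp
  finally show "size (ls b ?d) \<le> ?S xs" .
 qed
qed

lemma inj_pr: "inj a \<Longrightarrow> inj b \<Longrightarrow> inj (pr a b)"
 by (auto simp: inj_def prod_eq_iff)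

lemma pt_inst:
 assumes "0 < p" "p \<le> q" shows "pt es (ls ptenc) (\<lambda>x. inst p q (fst x) (snd x))"
 unfolding inst_def ratp_def
 by (rule pt_intros pt_point pt_dedup[OF inj_pr[OF inj_un inj_un]] pt_plist[OF assms])+

lemma pt_cpairs: "pt (ls ptenc) (ls (pr ptenc ptenc)) cpairs"
 unfolding cpairs_def by (rule pt_nthd[OF pt_const[where b = ptenc]] pt_intros)+

lemma pt_tangd: "pt (pr ep ep) bl (\<lambda>x. tangd (fst x) (snd x))"
 unfolding tangd_def Let_def by (rule pt_intros)+

lemma pt_check:
 assumes "0 < p" "p \<le> q" shows "pt (pr es (ls ptenc)) bl (\<lambda>x. check p q (fst (fst x)) (snd (fst x)) (snd x))"
proof -
 let ?a = "pr es (ls ptenc)" and ?r = "pr ptenc ptenc"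
 have C: "pt ?a (ls ?r) (\<lambda>x. cpairs (snd x))" by (rule pt_comp[OF pt_cpairs]) (rule pt_intros)+
 have L1: "pt (pr ?a ?r) (ls ep) (\<lambda>x. plist p q (fst (fst (fst x))) (snd (fst (fst x))))"
  by (rule pt_comp[OF pt_plist[OF assms]]) (rule pt_intros)+
 have L2: "pt (pr (pr ?a ?r) ep) (ls ep) (\<lambda>x. plist p q (fst (fst (fst (fst x)))) (snd (fst (fst (fst x)))))"
  by (rule pt_comp[OF L1]) (rule pt_intros)+
 have "pt (pr (pr (pr ?a ?r) ep) ep) (pr ep ep) (\<lambda>x. (snd (fst x), snd x))" by (rule pt_intros)+
 note T = pt_comp[OF pt_tangd this, simplified fst_conv snd_conv]
 have R: "pt a ptenc (\<lambda>x. ratp (f x))" if "pt a (pr un un) f" for a and f :: "'x \<Rightarrow> nat \<times> nat"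
  unfolding ratp_def by (intro pt_point pt_fst[OF that] pt_snd[OF that])
 have E1: "pt (pr (pr (pr ?a ?r) ep) ep) bl (\<lambda>x. ptenc (ratp (fst (snd (fst x)))) = ptenc (fst (snd (fst (fst x)))))"
  by (rule pt_eq_enc R pt_intros)+
 have E2: "pt (pr (pr (pr ?a ?r) ep) ep) bl (\<lambda>x. ptenc (ratp (fst (snd x))) = ptenc (snd (snd (fst (fst x)))))"
  by (rule pt_eq_enc R pt_intros)+
 show ?thesis unfolding check_def by (rule C L1 L2 T E1 E2 pt_intros)+
qed

lemma size_ins: "size (ls b (ins C F)) \<le> size (b C) + size (ls b F) + 1"
 using size_ls_filter[of b _ F] by (auto simp: ins_def)

lemma pt_ins: "pt (pr (ls un) ef) ef (\<lambda>x. ins (fst x) (snd x))"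
 unfolding ins_def by (rule pt_intros)+

lemma pt_fold_ins: "pt a ef f \<Longrightarrow> pt a ef g \<Longrightarrow> pt a ef (\<lambda>x. fold ins (f x) (g x))"
proof (rule pt_fold, assumption, assumption)
 assume f: "pt a ef f" and g: "pt a ef g"
 show "pt (pr a (pr (ls un) ef)) ef (\<lambda>p. ins (fst (snd p)) (snd (snd p)))"
  using pt_comp[OF pt_ins pt_snd[OF pt_id]] .
 show "pbd (\<lambda>x. size (ef (f x)) + size (ef (g x))) (\<lambda>x. size (a x))"
  by (intro pbd_add pt_size f g)
 fix x n
 have "size (ef (fold ins Ps F)) \<le> size (ef Ps) + size (ef F)" for Ps F
 proof (induction Ps arbitrary: F)
  case (Cons P Ps)
  have "size (ef (fold ins (P # Ps) F)) \<le> size (ef Ps) + size (ef (ins P F))" using Cons.IH[of "ins P F"] by simp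
  then show ?case using size_ins[of "ls un" P F] by simp
 qed simp
 from this[of "take n (f x)" "g x"] show "size (ef (fold ins (take n (f x)) (g x))) \<le> size (ef (f x)) + size (ef (g x))"
  using size_ls_take[of "ls un" n "f x"] by linarith
qed

lemma pt_pets: "pt (pr (ls un) (pr un ef)) ef (\<lambda>x. pets (fst x) (fst (snd x)) (snd (snd x)))"
 unfolding pets_def by (rule pt_intros)+

lemma pt_petal: "pt (pr (ls un) (ls un)) (ls un) (\<lambda>x. petal (fst x) (snd x))"
 unfolding petal_def by (rule pt_intros)+

abbreviation "ec \<equiv> pr (ls un) (pr un un)"

lemma pt_cands: "pt ef (ls ec) (cands \<theta>1 \<theta>2)"
 unfolding cands_def by (rule pt_intros pt_const)+

lemma pt_good: "pt (pr ef ec) bl (\<lambda>x. good (fst x) (snd x))"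
proof -
 have "pt (pr ef ec) (pr (ls un) (pr un ef)) (\<lambda>x. (fst (snd x), (fst (snd (snd x)), fst x)))" by (rule pt_intros)+
 note P = pt_comp[OF pt_pets this, simplified fst_conv snd_conv]
 show ?thesis unfolding good_def by (rule P pt_intros)+
qed

lemma pt_branch: "pt ef (ls ef) (branch \<theta>1 \<theta>2)"
proof -
 let ?a = "pr ef (pr ec (ls ec))"
 have "pt ?a (pr (ls un) (pr un ef)) (\<lambda>x. (fst (fst (snd x)), (fst (snd (fst (snd x))), fst x)))" by (rule pt_intros)+
 note P = pt_comp[OF pt_pets this, simplified fst_conv snd_conv]
 have "pt (pr ?a (ls un)) (pr (ls un) (ls un)) (\<lambda>x. (fst (fst (snd (fst x))), snd x))" by (rule pt_intros)+
 note Q = pt_comp[OF pt_petal this, simplified fst_conv snd_conv]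
 have "pt ?a (pr (ls un) ef) (\<lambda>x. (fst (fst (snd x)), fst x))" by (rule pt_intros)+
 note I = pt_comp[OF pt_ins this, simplified fst_conv snd_conv]
 show ?thesis unfolding branch_def
 proof (rule pt_case)
  show "pt ef (ls ec) (\<lambda>F. filter (good F) (cands \<theta>1 \<theta>2 F))"
   by (rule pt_filter[OF pt_cands pt_good])
  show "pt ef (ls ef) (\<lambda>x. [])" by (rule pt_const)
  show "pt ?a (ls ef) (\<lambda>x. [ins (fst (fst (snd x))) (fst x), fold ins (map (petal (fst (fst (snd x)))) (pets (fst (fst (snd x))) (fst (snd (fst (snd x)))) (fst x))) (fst x)])"
   by (rule I pt_fold_ins pt_map[OF P Q] pt_intros)+
 qed
qed

section \<open>From 3-CNF formulas to clauses of symbols\<close>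

abbreviation elit :: "literal \<Rightarrow> tree" where "elit \<equiv> pr enc_nat bl"

lemma enc_3sat_eq: "enc_3sat N \<phi> = pr enc_nat (ls (ls elit)) (N, \<phi>)"
proof -
 have "(\<lambda>(v, b). Node (enc_nat v) (enc_bool b)) = elit" by (auto simp: fun_eq_iff)
 then show ?thesis by (simp add: enc_3sat_def)
qed

lemma inj_enc_nat: "inj enc_nat"
 unfolding inj_def enc_nat_def using enc_bits_inj bits_inj by blast

text \<open>Variables arrive as binary numbers, and writing such a number in unary can take time
  exponential in its length. The position of a variable among those that occur is bounded by the
  size of the input and can be written in unary.\<close>

definition vars :: "cnf \<Rightarrow> nat list" where
 "vars \<phi> = dedup (map fst (concat \<phi>))"

definition vidx :: "nat list \<Rightarrow> nat \<Rightarrow> nat" where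
 "vidx vs v = nthd 0 (map fst (filter (\<lambda>p. snd p = v) (List.enumerate 0 vs))) 0"

definition lit :: "nat list \<Rightarrow> literal \<Rightarrow> nat" where
 "lit vs l = 2 * vidx vs (fst l) + (if snd l then 1 else 0)"

text \<open>\<open>Suc\<close> adds a spare variable, so that the drawing has a row and a column
  even if no variable occurs. Its consistency clause is satisfied by making its symbols
  false.\<close>

definition prep :: "cnf \<Rightarrow> nat \<times> nat list list" where
 "prep \<phi> = (Suc (length (vars \<phi>)), fold ins (map (\<lambda>C. dedup (map (lit (vars \<phi>)) C)) \<phi>) [])"

lemma vidx:
 assumes "v \<in> set vs" "distinct vs"
 shows "vidx vs v < length vs" "vs ! vidx vs v = v"
proof -
 let ?l = "filter (\<lambda>p. snd p = v) (List.enumerate 0 vs)"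
 obtain i where i: "i < length vs" "vs ! i = v" using assms(1) by (auto simp: in_set_conv_nth)
 then have "(i, v) \<in> set ?l" by (auto simp: in_set_enumerate_eq)
 then have ne: "?l \<noteq> []" by (metis empty_iff empty_set)
 then obtain p ps where p: "?l = p # ps" by (cases ?l) auto
 then have "p \<in> set ?l" by simp
 then have "snd p = v" "fst p < length vs" "vs ! fst p = snd p" by (auto simp: in_set_enumerate_eq)
 moreover have "vidx vs v = fst p" using p by (simp add: vidx_def nthd_def)
 ultimately show "vidx vs v < length vs" "vs ! vidx vs v = v" by simp_all
qed

lemma vars: "distinct (vars \<phi>)" "C \<in> set \<phi> \<Longrightarrow> l \<in> set C \<Longrightarrow> fst l \<in> set (vars \<phi>)"
 unfolding vars_def by (auto simp: dedup)

lemma length_vars: "is_3cnf N \<phi> \<Longrightarrow> length (vars \<phi>) \<le> N"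
proof -
 assume "is_3cnf N \<phi>"
 then have "set (vars \<phi>) \<subseteq> {..<N}" unfolding vars_def dedup is_3cnf_def by fastforce
 then have "card (set (vars \<phi>)) \<le> card {..<N}" by (intro card_mono) auto
 then show ?thesis using vars(1) by (simp add: distinct_card)
qed

lemma prep_ok:
 assumes "is_3cnf N \<phi>" shows "okf (fst (prep \<phi>)) (snd (prep \<phi>))"
proof -
 let ?n = "Suc (length (vars \<phi>))"
 have "okcl ?n (dedup (map (lit (vars \<phi>)) C))" if C: "C \<in> set \<phi>" for C
 proof -
  have "length (dedup (map (lit (vars \<phi>)) C)) = card (lit (vars \<phi>) ` set C)"
   using dedup[of "map (lit (vars \<phi>)) C"] distinct_card by (metis set_map)
  also have "\<dots> \<le> length C" using card_image_le[of "set C" "lit (vars \<phi>)"] card_length[of C] by (meson List.finite_set le_trans)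
  also have "\<dots> \<le> 3" using assms C by (auto simp: is_3cnf_def)
  finally have "length (dedup (map (lit (vars \<phi>)) C)) \<le> 3" .
  moreover have "lit (vars \<phi>) l < 2 * ?n" if "l \<in> set C" for l
   using vidx(1)[OF vars(2)[OF C that] vars(1)] by (simp add: lit_def)
  ultimately show ?thesis unfolding okcl_def by (auto simp: dedup)
 qed
 moreover have "okf ?n []" by (simp add: okf_def antich_def)
 ultimately show ?thesis unfolding prep_def fst_conv snd_conv by (intro fold_ins_ok) auto
qed

lemma prep_sat:
 "satisfiable \<phi> \<longleftrightarrow> (\<exists>\<tau>. (\<forall>v<fst (prep \<phi>). \<not> (\<tau> (2 * v) \<and> \<tau> (Suc (2 * v)))) \<and> evl \<tau> (snd (prep \<phi>)))"
proof -
 let ?n = "Suc (length (vars \<phi>))"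
 have e: "evl \<tau> (snd (prep \<phi>)) \<longleftrightarrow> (\<forall>C\<in>set \<phi>. \<exists>l\<in>set C. \<tau> (lit (vars \<phi>) l))" for \<tau>
  unfolding prep_def snd_conv evl_fold_ins by (simp add: evl_def dedup)
 show ?thesis
 proof
  assume "satisfiable \<phi>"
  then obtain \<alpha> where a: "\<And>C. C \<in> set \<phi> \<Longrightarrow> \<exists>(v, b)\<in>set C. \<alpha> v = b" unfolding satisfiable_def by blast
  define \<tau> where "\<tau> i \<longleftrightarrow> (\<alpha> (vars \<phi> ! (i div 2)) = odd i)" for i
  have "\<exists>l\<in>set C. \<tau> (lit (vars \<phi>) l)" if C: "C \<in> set \<phi>" for C
  proof -
   obtain v b where l: "(v, b) \<in> set C" "\<alpha> v = b" using a[OF C] by blast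
   have "vars \<phi> ! vidx (vars \<phi>) v = v" using vidx(2)[OF vars(2)[OF C l(1)] vars(1)] by simp
   then have "\<tau> (lit (vars \<phi>) (v, b))" using l(2) by (simp add: \<tau>_def lit_def)
   then show ?thesis using l(1) by blast
  qed
  moreover have "\<not> (\<tau> (2 * v) \<and> \<tau> (Suc (2 * v)))" for v by (simp add: \<tau>_def)
  ultimately show "\<exists>\<tau>. (\<forall>v<fst (prep \<phi>). \<not> (\<tau> (2 * v) \<and> \<tau> (Suc (2 * v)))) \<and> evl \<tau> (snd (prep \<phi>))"
   unfolding e by blast
 next
  assume "\<exists>\<tau>. (\<forall>v<fst (prep \<phi>). \<not> (\<tau> (2 * v) \<and> \<tau> (Suc (2 * v)))) \<and> evl \<tau> (snd (prep \<phi>))"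
  then obtain \<tau> where t: "\<And>v. v < ?n \<Longrightarrow> \<not> (\<tau> (2 * v) \<and> \<tau> (Suc (2 * v)))" "\<And>C. C \<in> set \<phi> \<Longrightarrow> \<exists>l\<in>set C. \<tau> (lit (vars \<phi>) l)"
   unfolding e by (auto simp: prep_def)
  \<comment> \<open>A model of the symbols may make both literals of a variable false, so the
    assignment follows the positive symbol; if the negative symbol is true, consistency makes the
    positive one false.\<close>
  define \<alpha> where "\<alpha> v = \<tau> (Suc (2 * vidx (vars \<phi>) v))" for v
  have "\<exists>(v, b)\<in>set C. \<alpha> v = b" if C: "C \<in> set \<phi>" for C
  proof -
   obtain l where l: "l \<in> set C" "\<tau> (lit (vars \<phi>) l)" using t(2)[OF C] by blast
   have "vidx (vars \<phi>) (fst l) < ?n" using vidx(1)[OF vars(2)[OF C l(1)] vars(1)] by simp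
   then have "\<alpha> (fst l) = snd l" using l(2) t(1) by (cases "snd l") (auto simp: \<alpha>_def lit_def)
   then show ?thesis using l(1) by (intro bexI[of _ l]) (simp_all add: split_beta)
  qed
  then show "satisfiable \<phi>" unfolding satisfiable_def by blast
 qed
qed

lemma pt_vars: "pt (ls (ls elit)) (ls enc_nat) vars"
 unfolding vars_def by (rule pt_dedup[OF inj_enc_nat] pt_intros)+

lemma pt_lit: "pt (pr (ls enc_nat) elit) un (\<lambda>x. lit (fst x) (snd x))"
 unfolding lit_def vidx_def by (rule pt_intros pt_eq[OF inj_enc_nat])+

lemma pt_prep: "pt (pr enc_nat (ls (ls elit))) es (\<lambda>x. prep (snd x))"
proof -
 let ?a = "pr enc_nat (ls (ls elit))"
 have V: "pt ?a (ls enc_nat) (\<lambda>x. vars (snd x))" by (rule pt_comp[OF pt_vars]) (rule pt_intros)+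
 have "pt (pr (pr ?a (ls elit)) elit) (pr (ls enc_nat) elit) (\<lambda>x. (vars (snd (fst (fst x))), snd x))"
  by (rule pt_comp[OF V] pt_intros)+
 note L = pt_comp[OF pt_lit this, simplified fst_conv snd_conv]
 have D: "pt (pr ?a (ls elit)) (ls un) (\<lambda>x. dedup (map (lit (vars (snd (fst x)))) (snd x)))"
  by (rule pt_dedup[OF inj_un] pt_map[OF _ L] pt_intros)+
 show ?thesis unfolding prep_def
  by (rule V pt_fold_ins pt_map[OF _ D] pt_intros)+
qed

lemma enc_nat_size: "size (enc_nat n) \<le> 2 * n"
 using size_ls_bl[of "bits n"] length_bits[of n] by (simp add: enc_nat_def)

text \<open>Clauses are distinct lists of at most three symbols, so the size of a formula is bounded in
 terms of the number of symbols.\<close>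

lemma size_clauses:
 assumes d: "distinct F" and len: "\<And>C. C \<in> set F \<Longrightarrow> length C \<le> 3 \<and> set C \<subseteq> A"
  and A: "finite A" "card A \<le> 2 * N" and s: "\<And>l. l \<in> A \<Longrightarrow> size (b l) \<le> 2 * N + 2"
 shows "2 * N + size (ls (ls b) F) + 1 \<le> (N + 2) ^ 12"
proof -
 have cl: "size (ls b C) \<le> 3 * (2 * N + 2 + 1)" if "C \<in> set F" for C
 proof -
  have "size (ls b C) \<le> length C * (2 * N + 2 + 1)" by (rule size_ls_bound) (use s len[OF that] in blast)
  also have "\<dots> \<le> 3 * (2 * N + 2 + 1)" using len[OF that] by (intro mult_right_mono) auto
  finally show ?thesis .
 qed
 have fin: "finite {xs. set xs \<subseteq> A \<and> length xs \<le> 3}" by (rule finite_lists_length_le) (rule A)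
 have sub: "set F \<subseteq> {xs. set xs \<subseteq> A \<and> length xs \<le> 3}" using len by blast
 have "length F = card (set F)" using d by (simp add: distinct_card)
 also have "\<dots> \<le> card {xs. set xs \<subseteq> A \<and> length xs \<le> 3}" by (rule card_mono[OF fin sub])
 also have "\<dots> = (\<Sum>i\<le>3. card A ^ i)" by (rule card_lists_length_le) (rule A)
 also have "\<dots> \<le> (\<Sum>i\<le>3. (2 * N) ^ i)" by (intro sum_mono power_mono A) simp
 also have "\<dots> = 1 + 2 * N + (2 * N) ^ 2 + (2 * N) ^ 3"
  by (simp add: numeral_3_eq_3 numeral_2_eq_2)
 finally have ln: "length F \<le> 1 + 2 * N + (2 * N) ^ 2 + (2 * N) ^ 3" .
 have "size (ls (ls b) F) \<le> length F * (3 * (2 * N + 2 + 1) + 1)" by (rule size_ls_bound) (rule cl)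
 also have "\<dots> \<le> (1 + 2 * N + (2 * N) ^ 2 + (2 * N) ^ 3) * (3 * (2 * N + 2 + 1) + 1)"
  using ln by (intro mult_right_mono) simp_all
 also have "\<dots> \<le> (8 * (N + 2) ^ 3) * (6 * (N + 2))"
 proof (rule mult_mono)
  show "1 + 2 * N + (2 * N) ^ 2 + (2 * N) ^ 3 \<le> 8 * (N + 2) ^ 3" by (simp add: power2_eq_square power3_eq_cube algebra_simps)
 qed simp_all
 also have "\<dots> = 48 * (N + 2) ^ 4"
 proof -
  have "(8 * m ^ 3) * (6 * m) = 48 * m ^ 4" for m :: nat by (simp add: power3_eq_cube power4_eq_xxxx)
  then show ?thesis .
 qed
 finally have "2 * N + size (ls (ls b) F) + 1 \<le> 48 * (N + 2) ^ 4 + 2 * (N + 2) ^ 4"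
  using self_le_power[of "N + 2" 4] by linarith
 also have "\<dots> \<le> 2 ^ 8 * (N + 2) ^ 4" by simp
 also have "\<dots> \<le> (N + 2) ^ 8 * (N + 2) ^ 4" by (intro mult_right_mono power_mono) simp_all
 also have "\<dots> = (N + 2) ^ 12" by (simp flip: power_add)
 finally show ?thesis .
qed

lemma enc_3sat_size:
 assumes "is_3cnf N \<phi>"
 shows "size (enc_3sat N \<phi>) \<le> (N + 2) ^ 12"
proof -
 have "2 * N + size (ls (ls elit) \<phi>) + 1 \<le> (N + 2) ^ 12"
 proof (rule size_clauses[where A = "{..<N} \<times> UNIV"])
  show "length C \<le> 3 \<and> set C \<subseteq> {..<N} \<times> UNIV" if "C \<in> set \<phi>" for C using assms that by (auto simp: is_3cnf_def)
  show "size (elit l) \<le> 2 * N + 2" if "l \<in> {..<N} \<times> UNIV" for l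
   using that enc_nat_size[of "fst l"] size_bl[of "snd l"] by auto
 qed (use assms in \<open>auto simp: is_3cnf_def card_cartesian_product\<close>)
 then show ?thesis using enc_nat_size[of N] by (simp add: enc_3sat_eq)
qed

lemma es_size: "okf n F \<Longrightarrow> size (es (n, F)) \<le> (n + 2) ^ 12"
proof -
 assume ok: "okf n F"
 have "2 * n + size (ef F) + 1 \<le> (n + 2) ^ 12"
  by (rule size_clauses[where A = "{..<2 * n}"]) (use ok in \<open>auto simp: okf_def okcl_def antich_def\<close>)
 then show ?thesis by simp
qed

section \<open>The reduction\<close>

lemma size_ls_distinct: "distinct xs \<Longrightarrow> distinct ys \<Longrightarrow> set xs = set ys \<Longrightarrow> size (ls b xs) = size (ls b ys)"
 unfolding size_ls by (metis distinct_card sum_list_distinct_conv_sum_set)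

section \<open>Searching the branching tree with a TSP solver\<close>

locale tsp_oracle = sparse \<alpha> \<beta> \<theta>1 \<theta>2 for \<alpha> \<beta> :: real and \<theta>1 \<theta>2 :: nat +
 fixes p q :: nat and c :: com and T :: "nat \<Rightarrow> nat \<Rightarrow> real"
 assumes p: "0 < p" "p < q" and c: "solves_TSP c (fam p q) T"
begin

definition satn :: "nat \<Rightarrow> nat list list \<Rightarrow> bool" where
 "satn n F \<longleftrightarrow> (\<exists>\<tau>. (\<forall>v<n. \<not> (\<tau> (2 * v) \<and> \<tau> (Suc (2 * v)))) \<and> evl \<tau> F)"

lemma satn_branch:
 assumes "okf n F" "\<And>\<tau>. evl \<tau> F \<longleftrightarrow> evl \<tau> G \<or> evl \<tau> G'"
 shows "satn n F \<longleftrightarrow> satn n G \<or> satn n G'"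
 unfolding satn_def assms(2) by blast

text \<open>The returned tour is a permutation of the instance, so its encoding has the same size;
  this bounds the time of the test that is run on it.\<close>

lemma oracle_tour:
 assumes "0 < n" "okf n F"
 obtains qs where "outputs_within c (ls ptenc (inst p q n F)) (T (length (inst p q n F)) (size (ls ptenc (inst p q n F)))) (ls ptenc qs)"
  "check p q n F qs \<longleftrightarrow> satn n F" "size (ls ptenc qs) = size (ls ptenc (inst p q n F))"
proof -
 let ?ps = "inst p q n F"
 have d: "distinct ?ps" "real_point ` set ?ps \<in> fam p q"
  using set_inst(2)[OF p assms] inst_fam[OF p assms] by blast+
 then obtain qs where qs: "optimal_tour (real_point ` set ?ps) (map real_point qs)"
  "outputs_within c (enc_points ?ps) (T (length ?ps) (size (enc_points ?ps))) (enc_points qs)"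
  using c unfolding solves_TSP_def by blast
 have inj: "inj real_point" by (auto simp: inj_def real_point_def)
 have "distinct qs" "real_point ` set qs = real_point ` set ?ps"
  using qs(1) by (auto simp: optimal_tour_def is_tour_def distinct_map)
 then have "size (ls ptenc qs) = size (ls ptenc ?ps)"
  using d(1) inj by (intro size_ls_distinct) (simp_all add: inj_image_eq_iff)
 then show thesis using that[of qs] qs(2) check_correct[OF p assms qs(1)] unfolding enc_points_def satn_def by blast
qed

definition orac :: "nat \<Rightarrow> nat list list \<Rightarrow> real" where
 "orac n F = T (length (inst p q n F)) (size (ls ptenc (inst p q n F)))"

lemma body:
 obtains B D where "\<And>n F W r s. 0 < n \<Longrightarrow> okf n F \<Longrightarrow> s 0 = un n \<Longrightarrow> s 1 = ls ef (F # W) \<Longrightarrow> s 2 = bl r \<Longrightarrow>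
  \<exists>t s'. exec B s t s' \<and> s' 0 = un n \<and> s' 1 = ls ef (branch \<theta>1 \<theta>2 F @ W) \<and>
   s' 2 = bl (r \<or> branch \<theta>1 \<theta>2 F = [] \<and> satn n F) \<and>
   real t \<le> real ((n + 2) ^ D) + (if branch \<theta>1 \<theta>2 F = [] then orac n F else 0)"
proof -
 have pq: "p \<le> q" using p by simp
 obtain Tb Cb where b: "pbd Tb (\<lambda>x. size (ef x))" "\<And>k s x. s k = ef x \<Longrightarrow> runs (Cb k) s k (ls ef (branch \<theta>1 \<theta>2 x)) (Tb x)"
  by (rule ptE[OF pt_branch]) (rule that)
 obtain Ti Ci where i: "pbd Ti (\<lambda>x. size (es x))" "\<And>k s x. s k = es x \<Longrightarrow> runs (Ci k) s k (ls ptenc (inst p q (fst x) (snd x))) (Ti x)"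
  by (rule ptE[OF pt_inst[OF p(1) pq]]) (rule that)
 obtain Th Ch where h: "pbd Th (\<lambda>x. size (pr es (ls ptenc) x))"
  "\<And>k s x. s k = pr es (ls ptenc) x \<Longrightarrow> runs (Ch k) s k (bl (check p q (fst (fst x)) (snd (fst x)) (snd x))) (Th x)"
  by (rule ptE[OF pt_check[OF p(1) pq]]) (rule that)
 obtain db where db: "\<And>x. Tb x \<le> (size (ef x) + 2) ^ db" using b(1) unfolding pbd_def by blast
 obtain di where di: "\<And>x. Ti x \<le> (size (es x) + 2) ^ di" using i(1) unfolding pbd_def by blast
 obtain dh where dh: "\<And>x. Th x \<le> (size (pr es (ls ptenc) x) + 2) ^ dh" using h(1) unfolding pbd_def by blast
 obtain dp where dp: "\<And>x. size (ls ptenc (inst p q (fst x) (snd x))) \<le> (size (es x) + 2) ^ dp"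
  using pt_size[OF pt_inst[OF p(1) pq]] unfolding pbd_def by blast
 \<comment> \<open>\<open>S n\<close> bounds the size of every formula on \<open>n\<close>
   variables, and \<open>K n\<close> everything except the solver itself. The summand with
   \<open>vmax c\<close> pays for clearing variables before the call and for single steps.\<close>
 define S where "S n = (n + 2) ^ 12 + 2" for n :: nat
 define K where "K n = S n ^ db + S n ^ di + (S n + S n ^ dp + 1) ^ dh + (vmax c + 12)" for n
 have "pbd (\<lambda>n. (n + 2) ^ 12) (\<lambda>n. n)" by (rule pbdI[where d = 12]) simp
 then have pS: "pbd S (\<lambda>n. n)" unfolding S_def by (intro pbd_add pbd_const)
 have pw: "pbd (\<lambda>n. f n ^ d) (\<lambda>n. n)" if "pbd f (\<lambda>n. n)" for f :: "nat \<Rightarrow> nat" and d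
  by (rule pbd_le[OF _ pbd_power[OF that, of d]]) (simp add: power_mono)
 have "pbd K (\<lambda>n. n)" unfolding K_def by (intro pbd_add pw pS pbd_const)
 then obtain D where D: "\<And>n. K n \<le> (n + 2) ^ D" unfolding pbd_def by blast
 let ?leaf = "Seq (Assign 4 (NodeE (Var 0) (Var 3))) (Seq (Assign 5 (Var 4)) (Seq (Ci 5) (Seq (call 5 c)
  (Seq (Assign 4 (NodeE (Var 4) (Var 5))) (Seq (Ch 4) (IfNode (Var 4) (Assign 2 (texpr (bl True))) (Assign 2 (Var 2))))))))"
 let ?B = "Seq (Assign 3 (Left (Var 1))) (Seq (Assign 1 (Right (Var 1))) (Seq (Assign 4 (Var 3)) (Seq (Cb 4)
  (IfNode (Var 4) (Assign 1 (NodeE (Left (Var 4)) (NodeE (Left (Right (Var 4))) (Var 1)))) ?leaf))))"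
 show thesis
 proof (rule that[of ?B D])
  fix n F W r and s :: store
  assume n: "0 < n" and ok: "okf n F" and s: "s 0 = un n" "s 1 = ls ef (F # W)" "s 2 = bl r"
  have se: "size (es (n, F)) + 2 \<le> S n" using es_size[OF ok] by (simp add: S_def)
  let ?s1 = "s(3 := ef F)"
  have e1: "exec (Assign 3 (Left (Var 1))) s 1 ?s1" using exec.Assign[of 3 "Left (Var 1)" s] s(2) by simp
  let ?s2 = "?s1(1 := ls ef W)"
  have e2: "exec (Assign 1 (Right (Var 1))) ?s1 1 ?s2" using exec.Assign[of 1 "Right (Var 1)" ?s1] s(2) by simp
  let ?s3 = "?s2(4 := ef F)"
  have e3: "exec (Assign 4 (Var 3)) ?s2 1 ?s3" using exec.Assign[of 4 "Var 3" ?s2] by simp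
  have "?s3 4 = ef F" by simp
  from b(2)[of ?s3 4 F, OF this] obtain t4 s4 where e4: "exec (Cb 4) ?s3 t4 s4" "t4 \<le> Tb F" "s4 4 = ls ef (branch \<theta>1 \<theta>2 F)" "\<And>j. j < 4 \<Longrightarrow> s4 j = ?s3 j"
   by (rule runsE) (rule that)
  have s4: "s4 0 = un n" "s4 1 = ls ef W" "s4 2 = bl r" "s4 3 = ef F" using e4(4)[of 0] e4(4)[of 1] e4(4)[of 2] e4(4)[of 3] s by simp_all
  have "size (ef F) + 2 \<le> S n" using se by simp
  then have "(size (ef F) + 2) ^ db \<le> S n ^ db" by (rule power_mono) simp
  then have t4: "t4 \<le> S n ^ db" using e4(2) db[of F] by linarith
  have whole: "exec ?B s (1 + (1 + (1 + (t4 + u)))) s'"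
   if "exec (IfNode (Var 4) (Assign 1 (NodeE (Left (Var 4)) (NodeE (Left (Right (Var 4))) (Var 1)))) ?leaf) s4 u s'" for u s'
   by (rule exec.Seq[OF e1 exec.Seq[OF e2 exec.Seq[OF e3 exec.Seq[OF e4(1) that]]]])
  show "\<exists>t s'. exec ?B s t s' \<and> s' 0 = un n \<and> s' 1 = ls ef (branch \<theta>1 \<theta>2 F @ W) \<and>
   s' 2 = bl (r \<or> branch \<theta>1 \<theta>2 F = [] \<and> satn n F) \<and>
   real t \<le> real ((n + 2) ^ D) + (if branch \<theta>1 \<theta>2 F = [] then orac n F else 0)"
  proof (cases "branch \<theta>1 \<theta>2 F")
   case (Cons G Gs)
   obtain G' where G': "Gs = [G']" using branch[OF ok Cons] by blast
   let ?s5 = "s4(1 := ls ef (G # G' # W))"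
   have "exec (Assign 1 (NodeE (Left (Var 4)) (NodeE (Left (Right (Var 4))) (Var 1)))) s4 1 ?s5"
    using exec.Assign[of 1 "NodeE (Left (Var 4)) (NodeE (Left (Right (Var 4))) (Var 1))" s4] s4 e4(3) Cons G' by simp
   from whole[OF exec.IfTrue[OF _ this]] e4(3) Cons
   have ex: "exec ?B s (1 + (1 + (1 + (t4 + (1 + 1))))) ?s5" by simp
   have "1 + (1 + (1 + (t4 + (1 + 1)))) \<le> (n + 2) ^ D" using t4 D[of n] unfolding K_def by linarith
   then have "real (1 + (1 + (1 + (t4 + (1 + 1))))) \<le> real ((n + 2) ^ D)" by (rule of_nat_mono)
   then show ?thesis using ex s4 Cons G' by (intro exI[of _ "1 + (1 + (1 + (t4 + (1 + 1))))"] exI[of _ ?s5]) simp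
  next
   case Nil
   let ?l5 = "s4(4 := es (n, F))"
   have l1: "exec (Assign 4 (NodeE (Var 0) (Var 3))) s4 1 ?l5" using exec.Assign[of 4 "NodeE (Var 0) (Var 3)" s4] s4 by simp
   let ?l6 = "?l5(5 := es (n, F))"
   have l2: "exec (Assign 5 (Var 4)) ?l5 1 ?l6" using exec.Assign[of 5 "Var 4" ?l5] by simp
   have "?l6 5 = es (n, F)" by simp
   from i(2)[of ?l6 5 "(n, F)", OF this, unfolded fst_conv snd_conv] obtain t7 s7 where l3: "exec (Ci 5) ?l6 t7 s7" "t7 \<le> Ti (n, F)"
    "s7 5 = ls ptenc (inst p q n F)" "\<And>j. j < 5 \<Longrightarrow> s7 j = ?l6 j"
    by (rule runsE) (rule that)
   obtain qs where qs: "outputs_within c (ls ptenc (inst p q n F)) (orac n F) (ls ptenc qs)"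
    "check p q n F qs \<longleftrightarrow> satn n F" "size (ls ptenc qs) = size (ls ptenc (inst p q n F))"
    using oracle_tour[OF n ok] unfolding orac_def by blast
   obtain t8 s8 where l4: "exec (call 5 c) s7 t8 s8" "real t8 \<le> orac n F + real (vmax c) + 1" "s8 5 = ls ptenc qs" "\<And>j. j < 5 \<Longrightarrow> s8 j = s7 j"
    by (rule call[where k = 5 and s = s7, OF qs(1) l3(3)]) (rule that)
   let ?x = "((n, F), qs)"
   have s8: "s8 4 = es (n, F)" "s8 0 = un n" "s8 1 = ls ef W" "s8 2 = bl r"
    using l4(4)[of 4] l3(4)[of 4] l4(4)[of 0] l3(4)[of 0] l4(4)[of 1] l3(4)[of 1] l4(4)[of 2] l3(4)[of 2] s4 by simp_all
   let ?l9 = "s8(4 := pr es (ls ptenc) ?x)"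
   have l5: "exec (Assign 4 (NodeE (Var 4) (Var 5))) s8 1 ?l9"
    using exec.Assign[of 4 "NodeE (Var 4) (Var 5)" s8] s8 l4(3) by simp
   have "?l9 4 = pr es (ls ptenc) ?x" by simp
   from h(2)[of ?l9 4 ?x, OF this, unfolded fst_conv snd_conv] obtain t10 s10 where l6: "exec (Ch 4) ?l9 t10 s10" "t10 \<le> Th ?x"
    "s10 4 = bl (check p q n F qs)" "\<And>j. j < 4 \<Longrightarrow> s10 j = ?l9 j"
    by (rule runsE) (rule that)
   have s10: "s10 0 = un n" "s10 1 = ls ef W" "s10 2 = bl r"
    using l6(4)[of 0] l6(4)[of 1] l6(4)[of 2] s8 by simp_all
   let ?s' = "s10(2 := bl (r \<or> check p q n F qs))"
   have l7: "exec (IfNode (Var 4) (Assign 2 (texpr (bl True))) (Assign 2 (Var 2))) s10 (1 + 1) ?s'"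
   proof (cases "check p q n F qs")
    case True
    have "exec (Assign 2 (texpr (bl True))) s10 1 ?s'" using exec.Assign[of 2 "texpr (bl True)" s10] True by simp
    then show ?thesis using True l6(3) by (intro exec.IfTrue) (simp_all add: enc_bool_def)
   next
    case False
    have "exec (Assign 2 (Var 2)) s10 1 ?s'" using exec.Assign[of 2 "Var 2" s10] False s10 by simp
    then show ?thesis using False l6(3) by (intro exec.IfFalse) (simp_all add: enc_bool_def)
   qed
   let ?u = "1 + (1 + (t7 + (t8 + (1 + (t10 + (1 + 1))))))"
   have "exec ?leaf s4 ?u ?s'"
    by (rule exec.Seq[OF l1 exec.Seq[OF l2 exec.Seq[OF l3(1) exec.Seq[OF l4(1) exec.Seq[OF l5 exec.Seq[OF l6(1) l7]]]]]])
   from whole[OF exec.IfFalse[OF _ this]] e4(3) Nil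
   have ex: "exec ?B s (1 + (1 + (1 + (t4 + (1 + ?u))))) ?s'" by simp
   have "(size (es (n, F)) + 2) ^ di \<le> S n ^ di" using se by (rule power_mono) simp
   then have t7: "t7 \<le> S n ^ di" using l3(2) di[of "(n, F)"] by linarith
   have "(size (es (n, F)) + 2) ^ dp \<le> S n ^ dp" using se by (rule power_mono) simp
   then have "size (ls ptenc qs) \<le> S n ^ dp" using dp[of "(n, F)"] qs(3) by simp
   then have "size (pr es (ls ptenc) ?x) + 2 \<le> S n + S n ^ dp + 1" using se by simp
   then have "(size (pr es (ls ptenc) ?x) + 2) ^ dh \<le> (S n + S n ^ dp + 1) ^ dh" by (rule power_mono) simp
   then have t10: "t10 \<le> (S n + S n ^ dp + 1) ^ dh" using l6(2) dh[of ?x] by linarith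
   have "t4 + t7 + t10 + vmax c + 12 \<le> (n + 2) ^ D" using t4 t7 t10 D[of n] unfolding K_def by linarith
   then have "real (t4 + t7 + t10 + vmax c + 12) \<le> real ((n + 2) ^ D)" by (rule of_nat_mono)
   then have "real (1 + (1 + (1 + (t4 + (1 + ?u))))) \<le> real ((n + 2) ^ D) + orac n F" using l4(2) by simp
   then show ?thesis using ex s10 Nil qs(2)
    by (intro exI[of _ "1 + (1 + (1 + (t4 + (1 + ?u))))"] exI[of _ ?s']) simp
  qed
 qed
qed

text \<open>A binary tree with \<open>l\<close> leaves has \<open>2 * l - 1\<close> nodes, and
  \<open>2 powr\<close> of the potential bounds the number of leaves below a formula. So
  \<open>wgt\<close> bounds the number of rounds that the formula causes.\<close>

definition wgt :: "nat \<Rightarrow> nat list list \<Rightarrow> real" where "wgt n F = 2 * 2 powr \<Phi> n F - 1"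

lemma wgt_ge_1: "okf n F \<Longrightarrow> 1 \<le> wgt n F"
 using pot_nonneg[of n F \<alpha> \<beta> \<theta>1] pos ge_one_powr_ge_zero[of 2 "\<Phi> n F"] unfolding wgt_def by simp

text \<open>Replacing a formula by its children lowers the total weight of the list by at least 1,
  since the weights of the two children sum to at most the weight of the parent minus 1, and a leaf
  has weight at least 1. Hence \<open>m\<close> bounds the number of rounds.\<close>

lemma loop:
 assumes B: "\<And>F W r s. okf n F \<Longrightarrow> s 0 = un n \<Longrightarrow> s 1 = ls ef (F # W) \<Longrightarrow> s 2 = bl r \<Longrightarrow>
  \<exists>t s'. exec B s t s' \<and> s' 0 = un n \<and> s' 1 = ls ef (branch \<theta>1 \<theta>2 F @ W) \<and>
   s' 2 = bl (r \<or> branch \<theta>1 \<theta>2 F = [] \<and> satn n F) \<and> real t \<le> X"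
 shows "\<forall>F\<in>set W. okf n F \<Longrightarrow> s 0 = un n \<Longrightarrow> s 1 = ls ef W \<Longrightarrow> s 2 = bl r \<Longrightarrow> (\<Sum>F\<leftarrow>W. wgt n F) \<le> real m \<Longrightarrow>
  \<exists>t s'. exec (WhileNode (Var 1) B) s t s' \<and> s' 2 = bl (r \<or> (\<exists>F\<in>set W. satn n F)) \<and> real t \<le> (X + 1) * real m + 1"
proof (induction m arbitrary: W s r)
 case 0
 have "W = []"
 proof (cases W)
  case (Cons F W')
  have "0 \<le> (\<Sum>F\<leftarrow>W'. wgt n F)" using 0(1) wgt_ge_1 unfolding Cons by (intro sum_list_nonneg) force
  moreover have "1 \<le> wgt n F" using 0(1) wgt_ge_1 Cons by simp
  ultimately show ?thesis using 0(5) Cons by simp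
 qed
 moreover from this have "exec (WhileNode (Var 1) B) s 1 s" using 0(3) by (intro exec.WhileFalse) simp
 ultimately show ?case using 0(4) by (intro exI[of _ 1] exI[of _ s]) simp
next
 case (Suc m)
 show ?case
 proof (cases W)
  case Nil
  \<comment> \<open>A running time is nonnegative: the assumed bound is applied to the formula
    without clauses.\<close>
  have "0 \<le> X"
  proof -
   have ok: "okf n []" by (simp add: okf_def antich_def)
   let ?s = "((\<lambda>_. Leaf)(0 := un n, 1 := ls ef [[]], 2 := bl False)) :: store"
   have "?s 0 = un n" "?s 1 = ls ef ([] # [])" "?s 2 = bl False" by simp_all
   from B[OF ok this] obtain t where "real t \<le> X" by blast
   then show ?thesis using of_nat_0_le_iff[of t] by linarith
  qed
  then have "(1::real) \<le> (X + 1) * real (Suc m) + 1" by simp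
  moreover have "exec (WhileNode (Var 1) B) s 1 s" using Suc.prems(3) Nil by (intro exec.WhileFalse) simp
  ultimately show ?thesis using Suc.prems(4) Nil by (intro exI[of _ 1] exI[of _ s]) simp
 next
  case (Cons F W')
  have ok: "okf n F" using Suc.prems(1) Cons by simp
  obtain t s1 where 1: "exec B s t s1" "s1 0 = un n" "s1 1 = ls ef (branch \<theta>1 \<theta>2 F @ W')"
   "s1 2 = bl (r \<or> branch \<theta>1 \<theta>2 F = [] \<and> satn n F)" "real t \<le> X"
   using B[OF ok Suc.prems(2) _ Suc.prems(4)] Suc.prems(3) Cons by blast
  have ch: "(\<forall>G\<in>set (branch \<theta>1 \<theta>2 F). okf n G) \<and> (\<Sum>G\<leftarrow>branch \<theta>1 \<theta>2 F. wgt n G) \<le> wgt n F - 1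
   \<and> (satn n F \<longleftrightarrow> branch \<theta>1 \<theta>2 F = [] \<and> satn n F \<or> (\<exists>G\<in>set (branch \<theta>1 \<theta>2 F). satn n G))"
  proof (cases "branch \<theta>1 \<theta>2 F")
   case Nil
   then show ?thesis using wgt_ge_1[OF ok] by simp
  next
   case (Cons G Gs)
   obtain G' where G: "Gs = [G']" "okf n G" "okf n G'" "\<And>\<tau>. evl \<tau> F \<longleftrightarrow> evl \<tau> G \<or> evl \<tau> G'"
    "2 powr \<Phi> n G + 2 powr \<Phi> n G' \<le> 2 powr \<Phi> n F" using branch[OF ok Cons] by blast
   then show ?thesis using Cons satn_branch[OF ok G(4)] by (simp add: wgt_def)
  qed
  have "\<exists>t s'. exec (WhileNode (Var 1) B) s1 t s' \<and>
    s' 2 = bl ((r \<or> branch \<theta>1 \<theta>2 F = [] \<and> satn n F) \<or> (\<exists>F\<in>set (branch \<theta>1 \<theta>2 F @ W'). satn n F)) \<and> real t \<le> (X + 1) * real m + 1"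
   by (rule Suc.IH[OF _ 1(2-4)]) (use ch Suc.prems Cons in auto)
  then obtain u s' where 2: "exec (WhileNode (Var 1) B) s1 u s'"
   "s' 2 = bl ((r \<or> branch \<theta>1 \<theta>2 F = [] \<and> satn n F) \<or> (\<exists>F\<in>set (branch \<theta>1 \<theta>2 F @ W'). satn n F))" "real u \<le> (X + 1) * real m + 1" by blast
  have w: "exec (WhileNode (Var 1) B) s (1 + t + u) s'"
   by (rule exec.WhileTrue[OF _ 1(1) 2(1)]) (use Suc.prems(3) Cons in simp)
  have r: "real (1 + t + u) \<le> (X + 1) * real (Suc m) + 1" using 1(5) 2(3) by (simp add: algebra_simps)
  have e: "(r \<or> branch \<theta>1 \<theta>2 F = [] \<and> satn n F) \<or> (\<exists>F\<in>set (branch \<theta>1 \<theta>2 F @ W'). satn n F) \<longleftrightarrow> r \<or> (\<exists>F\<in>set W. satn n F)"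
   using ch unfolding Cons by auto
  show ?thesis
   by (rule exI[of _ "1 + t + u"], rule exI[of _ s']) (use w r 2(2)[unfolded e] in blast)
 qed
qed

theorem solve_3sat:
 assumes X: "\<And>n F. 0 < n \<Longrightarrow> okf n F \<Longrightarrow> branch \<theta>1 \<theta>2 F = [] \<Longrightarrow> orac n F \<le> X n"
  and X0: "\<And>n. 0 \<le> X n" and mono: "\<And>m n. m \<le> n \<Longrightarrow> X m \<le> X n"
  and eps: "2 * \<alpha> + 8 * \<beta> * real \<theta>1 \<le> \<epsilon>"
 obtains d D where "solves_3SAT d (\<lambda>N. real ((N + 2) ^ D) + (real ((N + 3) ^ D) + X (N + 1) + 1) * (2 * 2 powr (\<epsilon> * real (N + 1)) + 1))"
proof -
 obtain B D where B: "\<And>n F W r s. 0 < n \<Longrightarrow> okf n F \<Longrightarrow> s 0 = un n \<Longrightarrow> s 1 = ls ef (F # W) \<Longrightarrow> s 2 = bl r \<Longrightarrow>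
  \<exists>t s'. exec B s t s' \<and> s' 0 = un n \<and> s' 1 = ls ef (branch \<theta>1 \<theta>2 F @ W) \<and>
   s' 2 = bl (r \<or> branch \<theta>1 \<theta>2 F = [] \<and> satn n F) \<and>
   real t \<le> real ((n + 2) ^ D) + (if branch \<theta>1 \<theta>2 F = [] then orac n F else 0)" by (rule body) blast
 obtain Tp Cp where pp: "pbd Tp (\<lambda>x. size (pr enc_nat (ls (ls elit)) x))"
  "\<And>k s x. s k = pr enc_nat (ls (ls elit)) x \<Longrightarrow> runs (Cp k) s k (es (prep (snd x))) (Tp x)"
  by (rule ptE[OF pt_prep]) (rule that)
 obtain dp where dp: "\<And>x. Tp x \<le> (size (pr enc_nat (ls (ls elit)) x) + 2) ^ dp" using pp(1) unfolding pbd_def by blast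
 define K where "K N = ((N + 2) ^ 12 + 2) ^ dp + 6" for N :: nat
 have "pbd (\<lambda>n. (n + 2) ^ 12) (\<lambda>n. n)" by (rule pbdI[where d = 12]) simp
 from pbd_add[OF pbd_power[OF this] pbd_const] have "pbd K (\<lambda>n. n)" unfolding K_def .
 then obtain D' where D': "\<And>n. K n \<le> (n + 2) ^ D'" unfolding pbd_def by blast
 let ?E = "max D D'"
 let ?C = "Seq (Cp 0) (Seq (Assign 1 (NodeE (Right (Var 0)) LeafE)) (Seq (Assign 0 (Left (Var 0))) (Seq (Assign 2 LeafE)
   (Seq (WhileNode (Var 1) B) (Assign 0 (Var 2))))))"
 show thesis
 proof (rule that[of ?C ?E], unfold solves_3SAT_def, intro allI impI)
  fix N \<phi> assume cnf: "is_3cnf N \<phi>"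
  define n F where nF: "n = fst (prep \<phi>)" "F = snd (prep \<phi>)"
  have n: "0 < n" "n \<le> N + 1" using length_vars[OF cnf] by (simp_all add: nF prep_def)
  have ok: "okf n F" using prep_ok[OF cnf] by (simp add: nF)
  let ?s0 = "(\<lambda>_. Leaf)(0 := enc_3sat N \<phi>) :: store"
  have "?s0 0 = pr enc_nat (ls (ls elit)) (N, \<phi>)" by (simp add: enc_3sat_eq)
  from pp(2)[of ?s0 0 "(N, \<phi>)", OF this, unfolded snd_conv] obtain t1 s1 where 1: "exec (Cp 0) ?s0 t1 s1" "t1 \<le> Tp (N, \<phi>)" "s1 0 = es (prep \<phi>)"
   by (rule runsE) (rule that)
  have s10: "s1 0 = es (n, F)" using 1(3) by (simp add: nF)
  let ?s2 = "s1(1 := ls ef [F])"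
  have 2: "exec (Assign 1 (NodeE (Right (Var 0)) LeafE)) s1 1 ?s2" using exec.Assign[of 1 "NodeE (Right (Var 0)) LeafE" s1] s10 by simp
  let ?s3 = "?s2(0 := un n)"
  have 3: "exec (Assign 0 (Left (Var 0))) ?s2 1 ?s3" using exec.Assign[of 0 "Left (Var 0)" ?s2] s10 by simp
  let ?s4 = "?s3(2 := bl False)"
  have 4: "exec (Assign 2 LeafE) ?s3 1 ?s4" using exec.Assign[of 2 LeafE ?s3] by (simp add: enc_bool_def)
  define Y where "Y = real ((n + 2) ^ D) + X n"
  have body: "\<exists>t s'. exec B s t s' \<and> s' 0 = un n \<and> s' 1 = ls ef (branch \<theta>1 \<theta>2 F @ W) \<and>
   s' 2 = bl (r \<or> branch \<theta>1 \<theta>2 F = [] \<and> satn n F) \<and> real t \<le> Y"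
   if ok: "okf n F" and s: "s 0 = un n" "s 1 = ls ef (F # W)" "s 2 = bl r" for F W r s
  proof -
   have "(if branch \<theta>1 \<theta>2 F = [] then orac n F else 0) \<le> X n" using X[OF n(1) ok] X0 by simp
   then show ?thesis using B[OF n(1) ok s] unfolding Y_def by (smt (verit, best))
  qed
  define m where "m = nat \<lceil>wgt n F\<rceil>"
  have m: "wgt n F \<le> real m" "real m \<le> wgt n F + 1" using wgt_ge_1[OF ok] unfolding m_def by linarith+
  have "\<exists>t s'. exec (WhileNode (Var 1) B) ?s4 t s' \<and> s' 2 = bl (False \<or> (\<exists>F\<in>set [F]. satn n F)) \<and> real t \<le> (Y + 1) * real m + 1"
   by (rule loop[OF body]) (use ok m in \<open>simp_all\<close>)
  then obtain t5 s5 where 5: "exec (WhileNode (Var 1) B) ?s4 t5 s5" "s5 2 = bl (False \<or> (\<exists>F\<in>set [F]. satn n F))" "real t5 \<le> (Y + 1) * real m + 1"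
   by blast
  let ?s6 = "s5(0 := s5 2)"
  have 6: "exec (Assign 0 (Var 2)) s5 1 ?s6" using exec.Assign[of 0 "Var 2" s5] by simp
  let ?t = "t1 + (1 + (1 + (1 + (t5 + 1))))"
  have ex: "exec ?C ?s0 ?t ?s6"
   by (rule exec.Seq[OF 1(1) exec.Seq[OF 2 exec.Seq[OF 3 exec.Seq[OF 4 exec.Seq[OF 5(1) 6]]]]])
  have out: "?s6 0 = enc_bool (satisfiable \<phi>)" using 5(2) prep_sat[of \<phi>] by (simp add: satn_def nF)
  have "real ?t \<le> real ((N + 2) ^ ?E) + (real ((N + 3) ^ ?E) + X (N + 1) + 1) * (2 * 2 powr (\<epsilon> * real (N + 1)) + 1)"
  proof -
   have "(size (pr enc_nat (ls (ls elit)) (N, \<phi>)) + 2) ^ dp \<le> ((N + 2) ^ 12 + 2) ^ dp"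
    using enc_3sat_size[OF cnf] unfolding enc_3sat_eq by (intro power_mono) simp_all
   then have "t1 + 6 \<le> K N" using 1(2) dp[of "(N, \<phi>)"] unfolding K_def by linarith
   also have "\<dots> \<le> (N + 2) ^ D'" by (rule D')
   also have "\<dots> \<le> (N + 2) ^ ?E" by (intro power_increasing) simp_all
   finally have a: "real (t1 + 6) \<le> real ((N + 2) ^ ?E)" by (rule of_nat_mono)
   have "(n + 2) ^ D \<le> (N + 3) ^ D" using n(2) by (intro power_mono) simp_all
   also have "\<dots> \<le> (N + 3) ^ ?E" by (intro power_increasing) simp_all
   finally have "real ((n + 2) ^ D) \<le> real ((N + 3) ^ ?E)" by (rule of_nat_mono)
   then have Y: "Y \<le> real ((N + 3) ^ ?E) + X (N + 1)" unfolding Y_def using mono[OF n(2)] by linarith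
   have Y0: "0 \<le> Y" unfolding Y_def using X0[of n] by simp
   have "0 \<le> 2 * \<alpha> + 8 * \<beta> * real \<theta>1" using pos by (intro add_nonneg_nonneg mult_nonneg_nonneg) simp_all
   then have eps0: "0 \<le> \<epsilon>" using eps by linarith
   have "\<Phi> n F \<le> (2 * \<alpha> + 8 * \<beta> * real \<theta>1) * real n" using pos by (intro pot_le) auto
   also have "\<dots> \<le> \<epsilon> * real (N + 1)" using eps n(2) eps0 by (intro mult_mono) auto
   finally have "wgt n F + 1 \<le> 2 * 2 powr (\<epsilon> * real (N + 1))" unfolding wgt_def by simp
   then have mm: "real m \<le> 2 * 2 powr (\<epsilon> * real (N + 1))" using m(2) by linarith
   have "(Y + 1) * real m \<le> (real ((N + 3) ^ ?E) + X (N + 1) + 1) * (2 * 2 powr (\<epsilon> * real (N + 1)))"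
    using Y Y0 mm by (intro mult_mono) auto
   also have "\<dots> \<le> (real ((N + 3) ^ ?E) + X (N + 1) + 1) * (2 * 2 powr (\<epsilon> * real (N + 1)) + 1)"
    using Y Y0 by (intro mult_left_mono) auto
   finally show ?thesis using a 5(3) by simp
  qed
  then show "outputs_within ?C (enc_3sat N \<phi>) (real ((N + 2) ^ ?E) + (real ((N + 3) ^ ?E) + X (N + 1) + 1) * (2 * 2 powr (\<epsilon> * real (N + 1)) + 1)) (enc_bool (satisfiable \<phi>))"
   unfolding outputs_within_def using ex out by blast
 qed
qed

end

section \<open>Asymptotics and the conclusion\<close>

text \<open>The Landau bound holds only eventually, but instances may be small. The finitely many
  exceptions are summed into the additive constant.\<close>

lemma bigo_bound:
 assumes "g \<in> O(\<lambda>n. real n powr e)"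
 obtains C C0 where "0 < C" "0 \<le> C0" "\<And>n::nat. g n \<le> C * real n powr e + C0"
proof -
 obtain C where C: "0 < C" "\<forall>\<^sub>F n in sequentially. norm (g n) \<le> C * norm (real n powr e)"
  using assms by (rule landau_o.bigE)
 then obtain m where m: "\<And>n. m \<le> n \<Longrightarrow> \<bar>g n\<bar> \<le> C * real n powr e" unfolding eventually_sequentially by auto
 have "g n \<le> C * real n powr e + (\<Sum>i<m. \<bar>g i\<bar>)" for n
 proof (cases "m \<le> n")
  case True
  have "0 \<le> (\<Sum>i<m. \<bar>g i\<bar>)" by (intro sum_nonneg) simp
  then show ?thesis using m[OF True] by linarith
 next
  case False
  then have "\<bar>g n\<bar> \<le> (\<Sum>i<m. \<bar>g i\<bar>)" by (intro member_le_sum) auto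
  moreover have "0 \<le> C * real n powr e" using C(1) by simp
  ultimately show ?thesis by linarith
 qed
 then show thesis using that[of C "\<Sum>i<m. \<bar>g i\<bar>"] C(1) by (simp add: sum_nonneg)
qed

text \<open>Since \<eta> < 1, the solver's time and every polynomial are below
  \<open>2 powr (\<sigma> / 8 * N)\<close> up to constants. Two such factors and the factor for the
  branching with rate \<sigma> / 2 leave a quarter of the rate to spare.\<close>

lemma time_bigo:
 fixes \<sigma> \<eta> C1 C0 :: real and D d k :: nat
 assumes s: "0 < \<sigma>" and eta: "0 < \<eta>" "\<eta> < 1" and C1: "0 < C1"
 shows "(\<lambda>N. real ((N + 2) ^ D) + (real ((N + 3) ^ D) + 2 powr (C1 * real (N + 1) powr \<eta> + C0) * (real ((N + 1 + 2) ^ d) + 1) ^ k + 1)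
   * (2 * 2 powr (\<sigma> / 2 * real (N + 1)) + 1)) \<in> O(\<lambda>N. 2 powr (\<sigma> * real N))"
proof -
 let ?E = "\<lambda>a N. 2 powr (a * real N) :: real"
 have mult: "(\<lambda>N. f N * h N) \<in> O(?E (a + b))" if "f \<in> O(?E a)" "h \<in> O(?E b)" for f h a b
  using landau_o.big.mult[OF that] by (simp add: distrib_right powr_add)
 have mono: "f \<in> O(?E b)" if "f \<in> O(?E a)" "a \<le> b" for f a b
 proof -
  have "?E a \<in> O(?E b)"
   using that(2) by (intro bigoI[of _ 1] always_eventually allI) (simp add: mult_right_mono)
  then show ?thesis using landau_o.big_trans that(1) by blast
 qed
 define \<rho> where "\<rho> = \<sigma> / 8"
 have r: "0 < \<rho>" using s by (simp add: \<rho>_def)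
 have 1: "(\<lambda>N. real ((N + 2) ^ D)) \<in> O(?E \<rho>)" using r by real_asymp
 have 2: "(\<lambda>N. real ((N + 3) ^ D)) \<in> O(?E \<rho>)" using r by real_asymp
 have 3: "(\<lambda>N. 2 powr (C1 * real (N + 1) powr \<eta> + C0)) \<in> O(?E \<rho>)" using r eta C1 by real_asymp
 have 4: "(\<lambda>N. (real ((N + 1 + 2) ^ d) + 1) ^ k) \<in> O(?E \<rho>)"
 proof (cases "d = 0 \<or> k = 0")
  case True
  then have "(\<lambda>N. (real ((N + 1 + 2) ^ d) + 1) ^ k) = (\<lambda>N. 2 ^ k) \<or> (\<lambda>N. (real ((N + 1 + 2) ^ d) + 1) ^ k) = (\<lambda>N. 1)" by auto
  moreover have "(\<lambda>N::nat. 2 ^ k :: real) \<in> O(?E \<rho>)" "(\<lambda>N::nat. 1 :: real) \<in> O(?E \<rho>)" using r by real_asymp+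
  ultimately show ?thesis by metis
 next
  case False
  then have "0 < d" "0 < k" by simp_all
  then show ?thesis using r by real_asymp
 qed
 have 5: "(\<lambda>N. 2 * 2 powr (\<sigma> / 2 * real (N + 1)) + 1) \<in> O(?E (\<sigma> / 2))" using s by real_asymp
 have 6: "(\<lambda>N::nat. 1 :: real) \<in> O(?E (\<rho> + \<rho>))" using r by real_asymp
 have "(\<lambda>N. real ((N + 3) ^ D) + 2 powr (C1 * real (N + 1) powr \<eta> + C0) * (real ((N + 1 + 2) ^ d) + 1) ^ k + 1) \<in> O(?E (\<rho> + \<rho>))"
  using mono[OF 2, of "\<rho> + \<rho>"] mult[OF 3 4] 6 r by (intro sum_in_bigo) simp_all
 from mult[OF this 5] have "(\<lambda>N. (real ((N + 3) ^ D) + 2 powr (C1 * real (N + 1) powr \<eta> + C0) * (real ((N + 1 + 2) ^ d) + 1) ^ k + 1)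
   * (2 * 2 powr (\<sigma> / 2 * real (N + 1)) + 1)) \<in> O(?E (\<rho> + \<rho> + \<sigma> / 2))" .
 then show ?thesis using mono[OF 1, of \<sigma>] mono[of _ "\<rho> + \<rho> + \<sigma> / 2" \<sigma>] s by (intro sum_in_bigo) (simp_all add: \<rho>_def)
qed

theorem theorem4p1:
  fixes \<delta> \<delta>' :: real
  assumes "1 < \<delta>" and "\<delta> < 2" and "0 < \<delta>'" and "\<delta>' < \<delta>"
    and "\<And>F :: (real \<times> real) set set.
           (\<forall>P\<in>F. finite P) \<Longrightarrow> fractal_dim F \<le> ereal \<delta> \<Longrightarrow>
           \<exists>c g k. g \<in> O(\<lambda>n. real n powr (1 - 1 / \<delta>')) \<and>
             solves_TSP c F (\<lambda>n L. 2 powr g n * (1 + real L) ^ k)"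
  shows "\<not> ETH"
proof -
 \<comment> \<open>The maximum keeps the rational number positive, hence \<open>p\<close> positive,
   also when \<delta>' \<le> 1.\<close>
 have "max 0 (\<delta>' - 1) < \<delta> - 1" using assms by simp
 then obtain r where r: "r \<in> \<rat>" "max 0 (\<delta>' - 1) < r" "r < \<delta> - 1" using Rats_dense_in_real by blast
 obtain p q :: nat where pq0: "q \<noteq> 0" "\<bar>r\<bar> = real p / real q" using Rats_abs_nat_div_natE[OF r(1)] by metis
 have rpq: "r = real p / real q" "0 < r" using pq0 r(2) by simp_all
 have "0 < p" using rpq pq0 by (cases "p = 0") auto
 moreover have "r < 1" using r(3) assms by simp
 then have "p < q" using rpq(1) pq0(1) by (simp add: divide_less_eq)
 ultimately have p: "0 < p" "p < q" by blast+
 have pq: "p \<le> q" using p by simp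
 have "fractal_dim (fam p q) \<le> ereal (1 + real p / real q)" by (rule fam_dim[OF p])
 also have "\<dots> \<le> ereal \<delta>" using r(3) rpq(1) by simp
 finally have dim: "fractal_dim (fam p q) \<le> ereal \<delta>" .
 have "\<forall>P\<in>fam p q. finite P" by (simp add: fam_def)
 from assms(5)[OF this dim] obtain c g k where g: "g \<in> O(\<lambda>n. real n powr (1 - 1 / \<delta>'))"
  and c: "solves_TSP c (fam p q) (\<lambda>n L. 2 powr g n * (1 + real L) ^ k)" by blast
 define e where "e = 1 - 1 / \<delta>'"
 obtain C C0 where C: "0 < C" "0 \<le> C0" "\<And>n::nat. g n \<le> C * real n powr e + C0"
  by (rule bigo_bound[OF g[folded e_def]]) (rule that)
 define s where "s = 1 + real q / real p"
 have s: "1 < s" using p by (simp add: s_def)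
 have es: "s * e < 1"
 proof -
  have "\<delta>' < 1 + real p / real q" using r(2) rpq(1) by simp
  also have "1 + real p / real q = (real q + real p) / real q" using p by (simp add: field_simps)
  finally have "real q / (real q + real p) < 1 / \<delta>'" using assms(3) p by (simp add: field_simps)
  then have "e < real p / (real q + real p)" using p unfolding e_def by (simp add: field_simps)
  then have "s * e < s * (real p / (real q + real p))" using s by (intro mult_strict_left_mono) simp_all
  also have "\<dots> = 1"
  proof -
   have "s = (real q + real p) / real p" using p by (simp add: s_def field_simps)
   then show ?thesis using p by simp
  qed
  finally show ?thesis .
 qed
 \<comment> \<open>For \<delta>' \<le> 1 the exponent \<open>e\<close> is not positive. Any positive
   exponent with product below 1 with \<open>s\<close> can replace it, so that powers become
   monotone in the number of points.\<close>
 define e' where "e' = max e (1 / (2 * s))"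
 have e': "0 < e'" "e \<le> e'" "s * e' < 1"
 proof -
  have h: "0 < 1 / (2 * s)" "s * (1 / (2 * s)) < 1" using s by simp_all
  show "0 < e'" unfolding e'_def using h(1) by (rule less_le_trans[OF _ max.cobounded2])
  show "e \<le> e'" unfolding e'_def by (rule max.cobounded1)
  have "e' = e \<or> e' = 1 / (2 * s)" by (simp add: e'_def max_def)
  then show "s * e' < 1" using es h(2) by blast
 qed
 have "\<exists>c T. T \<in> O(\<lambda>N. 2 powr (\<sigma> * real N)) \<and> solves_3SAT c T" if sig: "0 < \<sigma>" for \<sigma> :: real
 proof -
  obtain \<alpha> \<beta> \<theta>1 \<theta>2 where sp: "sparse \<alpha> \<beta> \<theta>1 \<theta>2" "2 * \<alpha> + 8 * \<beta> * real \<theta>1 \<le> \<sigma> / 2"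
   by (rule sparse_exists[OF half_gt_zero[OF sig]]) (rule that)
  interpret tsp_oracle \<alpha> \<beta> \<theta>1 \<theta>2 p q c "\<lambda>n L. 2 powr g n * (1 + real L) ^ k"
   using sp(1) p c by (simp add: tsp_oracle_def tsp_oracle_axioms_def)
  \<comment> \<open>At a leaf there are at most
    \<open>1 + 2 * n * (1 + \<theta>1 + \<theta>2)\<close> clauses besides the \<open>n\<close>
    consistency clauses. With \<open>1 \<le> n\<close> this totals at most
    \<open>\<kappa> * n\<close> columns.\<close>
  define \<kappa> where "\<kappa> = 4 + 2 * \<theta>1 + 2 * \<theta>2"
  define A where "A = 132 * (63 * 2 ^ q + 66 :: real)"
  define C1 where "C1 = C * (A * real \<kappa> powr s) powr e'"
  have A1: "1 \<le> A" by (simp add: A_def)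
  have k1: "1 \<le> real \<kappa>" by (simp add: \<kappa>_def)
  have len: "real (length (inst p q n F)) \<le> A * (real \<kappa> * real n) powr s"
   if n: "0 < n" and ok: "okf n F" and lf: "branch \<theta>1 \<theta>2 F = []" for n F
  proof -
   let ?m = "\<kappa> * n"
   have "length F \<le> 1 + 2 * n * (1 + \<theta>1 + \<theta>2)" by (rule leaf_length[OF ok lf])
   then have "n + length F \<le> n + (n + 2 * n * (1 + \<theta>1 + \<theta>2))" using n by linarith
   also have "\<dots> = ?m" by (simp add: \<kappa>_def algebra_simps)
   finally have m: "n + length F \<le> ?m" .
   have m2: "2 * n \<le> ?m" by (simp add: \<kappa>_def)
   have cm: "can p q (2 * n) \<le> can p q ?m" "can p q (n + length F) \<le> can p q ?m"
    using can_mono[OF p(1) pq] m m2 by blast+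
   have "length (inst p q n F) \<le> 66 * (n + length F) * (63 * can p q (2 * n) + 66) + 66 * (2 * n) * (63 * can p q (n + length F) + 66)"
    by (rule length_inst[OF p n ok])
   also have "\<dots> \<le> 66 * ?m * (63 * can p q ?m + 66) + 66 * ?m * (63 * can p q ?m + 66)"
    using m m2 cm n by (intro add_mono mult_mono) simp_all
   also have "\<dots> = 132 * (?m * (63 * can p q ?m + 66))" by simp
   finally have "real (length (inst p q n F)) \<le> real (132 * (?m * (63 * can p q ?m + 66)))" by (rule of_nat_mono)
   also have "\<dots> = 132 * (real ?m * (63 * real (can p q ?m) + 66))" by simp
   also have "\<dots> \<le> 132 * (real ?m * ((63 * 2 ^ q + 66) * real ?m powr (real q / real p)))"
   proof (intro mult_left_mono)
    have "real (1::nat) \<le> real ?m" using n by (intro of_nat_mono) (simp add: \<kappa>_def)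
    then have "1 \<le> real ?m powr (real q / real p)" by (intro ge_one_powr_ge_zero) simp_all
    then show "63 * real (can p q ?m) + 66 \<le> (63 * 2 ^ q + 66) * real ?m powr (real q / real p)"
     using can_upper[OF p(1) pq, of ?m] by (simp add: distrib_right)
   qed simp_all
   also have "\<dots> = A * (real \<kappa> * real n) powr s"
    using n k1 by (simp add: A_def s_def powr_add)
   finally show ?thesis .
  qed
  have gl: "g (length (inst p q n F)) \<le> C1 * real n powr (s * e') + C0"
   if n: "0 < n" and ok: "okf n F" and lf: "branch \<theta>1 \<theta>2 F = []" for n F
  proof -
   let ?l = "length (inst p q n F)"
   have "real ?l powr e \<le> (A * (real \<kappa> * real n) powr s) powr e'"
   proof (cases "?l = 0")
    case False
    then have l1: "1 \<le> real ?l" by (cases ?l) simp_all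
    have "real ?l powr e \<le> real ?l powr e'" using l1 e'(2) by (intro powr_mono)
    also have "\<dots> \<le> (A * (real \<kappa> * real n) powr s) powr e'" using len[OF that] e'(1) by (intro powr_mono2) simp_all
    finally show ?thesis .
   qed simp
   also have "\<dots> = (A * real \<kappa> powr s) powr e' * real n powr (s * e')"
    using A1 by (simp add: powr_mult powr_powr mult.assoc)
   finally have "C * real ?l powr e \<le> C1 * real n powr (s * e')"
    using C(1) unfolding C1_def mult.assoc by (intro mult_left_mono) simp_all
   then show ?thesis using C(3)[of ?l] by linarith
  qed
  obtain dp where dp: "\<And>x. size (ls ptenc (inst p q (fst x) (snd x))) \<le> (size (es x) + 2) ^ dp"
   using pt_size[OF pt_inst[OF p(1) pq]] unfolding pbd_def by blast
  have "pbd (\<lambda>n. (n + 2) ^ 12) (\<lambda>n. n)" by (rule pbdI[where d = 12]) simp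
  then have "pbd (\<lambda>n. ((n + 2) ^ 12 + 2) ^ dp) (\<lambda>n. n)" by (rule pbd_power)
  then obtain d where d: "\<And>n::nat. ((n + 2) ^ 12 + 2) ^ dp \<le> (n + 2) ^ d" unfolding pbd_def by blast
  have sz: "size (ls ptenc (inst p q n F)) \<le> (n + 2) ^ d" if "okf n F" for n F
  proof -
   have "(size (es (n, F)) + 2) ^ dp \<le> ((n + 2) ^ 12 + 2) ^ dp" using es_size[OF that] by (intro power_mono) simp_all
   then show ?thesis using dp[of "(n, F)"] d[of n] by simp
  qed
  \<comment> \<open>Number of points and size of the encoding are both replaced by bounds in
    \<open>n\<close>, which makes the solver's time at all leaves uniform and monotone in
    \<open>n\<close>.\<close>
  define X where "X n = 2 powr (C1 * real n powr (s * e') + C0) * (real ((n + 2) ^ d) + 1) ^ k" for n :: nat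
  have C1: "0 < C1" using C(1) A1 k1 by (simp add: C1_def)
  have Xo: "orac n F \<le> X n" if "0 < n" "okf n F" "branch \<theta>1 \<theta>2 F = []" for n F
   unfolding orac_def X_def
  proof (intro mult_mono powr_mono power_mono)
   show "g (length (inst p q n F)) \<le> C1 * real n powr (s * e') + C0" by (rule gl[OF that])
   show "1 + real (size (ls ptenc (inst p q n F))) \<le> real ((n + 2) ^ d) + 1"
    using of_nat_mono[OF sz[OF that(2)], where 'a = real] by simp
  qed simp_all
  have X0: "0 \<le> X n" for n by (simp add: X_def)
  have Xm: "X m \<le> X n" if "m \<le> n" for m n
  proof -
   have "real m powr (s * e') \<le> real n powr (s * e')" using that s e'(1) by (intro powr_mono2) simp_all
   then have "C1 * real m powr (s * e') + C0 \<le> C1 * real n powr (s * e') + C0" using C1 by simp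
   moreover have "real ((m + 2) ^ d) \<le> real ((n + 2) ^ d)" using that by (intro of_nat_mono power_mono) simp_all
   ultimately show ?thesis unfolding X_def by (intro mult_mono powr_mono power_mono) simp_all
  qed
  obtain d' D where dD: "solves_3SAT d' (\<lambda>N. real ((N + 2) ^ D) + (real ((N + 3) ^ D) + X (N + 1) + 1) * (2 * 2 powr (\<sigma> / 2 * real (N + 1)) + 1))"
   by (rule solve_3sat[OF Xo X0 Xm sp(2)]) (assumption | rule that)+
  moreover have "(\<lambda>N. real ((N + 2) ^ D) + (real ((N + 3) ^ D) + X (N + 1) + 1) * (2 * 2 powr (\<sigma> / 2 * real (N + 1)) + 1)) \<in> O(\<lambda>N. 2 powr (\<sigma> * real N))"
   unfolding X_def by (rule time_bigo[OF sig _ e'(3) C1]) (use s e' in simp)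
  ultimately show ?thesis by blast
 qed
 then show ?thesis unfolding ETH_def by blast
qed

end
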